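(* Let $F$ be a non-archimedean local field of characteristic zero, $n\ge1$, and let $\delta\in\widetilde{\mathrm{GL}}(2n,F)$ be very regular semisimple. Suppose $(V_1,q_1)$ and $(V_2,q_2)$ are $F$-quadratic spaces of dimension $2n$ such that for each $i=1,2$: (i) $\mathrm{SO}(V_i,q_i)$ is quasisplit; (ii) there exists a very regular $\gamma_i\in\mathrm{SO}(V_i,q_i)(F)$ such that $\gamma_i\leftrightarrow\delta$ via twisted endoscopy. Then there is an isomorphism $\varphi:\mathrm{SO}(V_1,q_1)\simeq\mathrm{SO}(V_2,q_2)$ of $F$-groups such that $\varphi(\gamma_1)$ and $\gamma_2$ are stably conjugate up to $\mathrm O(V_2,q_2)$. In particular, the corresponding endoscopic data of $\widetilde{\mathrm{GL}}(2n)$ are equivalent.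
   Context: $\widetilde{\mathrm{GL}}(2n)$ is the space of non-degenerate bilinear forms on $F^{2n}$, with $\mathrm{GL}(2n)$ acting by conjugation $(x\delta x^{-1})(v|v')=\delta(x^{-1}v|x^{-1}v')$. Let $\mathrm{Ad}_\delta$ be the automorphism of $\mathrm{GL}(2n)$ with $\delta x=\mathrm{Ad}_\delta(x)\delta$ for the bitorsor structure $(x\delta y)(v|v')=\delta(x^{-1}v|yv')$. An element $\delta$ is strongly regular semisimple if $\mathrm{Ad}_\delta$ fixes a Borel pair over $\bar F$, the identity component of its stabilizer is a torus and the stabilizer is abelian. Parametrization of twisted classes: a strongly regular semisimple $\delta$ is parametrized by $(L,L_\pm,x)$, where $L$ is an étale $F$-algebra of dimension $2n$, $L_\pm$ is the fixed subalgebra of an involution $\tau\in\mathrm{Aut}_F(L)$ ($L$ being étale of rank $2$ over $L_\pm$), $x\in L^\times$ generates $L$ over $F$, and $\delta$ is equivalent to the form $(v,v')\mapsto\mathrm{Tr}_{L/F}(\tau(v)v'x)$ on $L\simeq F^{2n}$. The stable conjugacy class (conjugacy over $\bar F$) depends only on $x$ modulo $L_\pm^\times$. $\delta$ is very regular if moreover $\frac{x}{\tau(x)}\pm1\in L^\times$. Parametrization in even orthogonal groups: a semisimple $\gamma\in\mathrm{SO}(V,q)(F)$, $\dim V=2n$, is very regular if it is regular and has no eigenvalue $\pm1$ on $V$. Such $\gamma$ is parametrized, up to $\mathrm O(V,q)(F)$-conjugacy, by $(L,L_\pm,y,c)$, where $L$ is an étale $F$-algebra of dimension $2n$, $L_\pm$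 is the fixed subalgebra of an involution $\tau\in\mathrm{Aut}_F(L)$ ($L$ being étale of rank $2$ over $L_\pm$), $y\in L^\times$ generates $L$ over $F$ with $y\tau(y)=1$, $c\in L_\pm^\times$, and $(V,q,\gamma)\simeq(L,q_c,\text{multiplication by }y)$ with $q_c(v|v')=\mathrm{Tr}_{L/F}(\tau(v)v'c)$. Forgetting $c$ gives the parametrization $(L,L_\pm,y)$ of stable conjugacy classes up to $\mathrm O(V,q)$ (i.e. conjugacy under $\mathrm O(V,q)(\bar F)$). Correspondence: $\gamma\leftrightarrow\delta$ if, $\delta$ being parametrized by $(L,L_\pm,x)$ and $\gamma$ by $(L',L'_\pm,y')$, there is an isomorphism of pairs of $F$-algebras $\varphi:(L',L'_\pm)\to(L,L_\pm)$ with $\frac{x}{\tau(x)}=-\varphi(y')$. Endoscopic data: a quasisplit $\mathrm{SO}(V,q)$ with $\dim V=2n$ and $(V,q)$ not isotropic of dimension two is regarded as the endoscopic group of the simple endoscopic datum $(2n,0,\chi)$ of $\widetilde{\mathrm{GL}}(2n)$, where $\chi:\Gamma_F\to\{\pm1\}$ is the character attached by class field theory to $F[\sqrt{d_\pm(q)}]/F$, $d_\pm(q)=(-1)^n\det q$. Such data are equivalent exactly when the characters $\chi$ coincide. *)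

theory Defs
  imports
    "HOL-Analysis.Abstract_Topology_2"
    "HOL-Algebra.Solvable_Groups"
    "HOL-Algebra.Algebraic_Closure_Type"
    "Jordan_Normal_Form.Char_Poly"
begin

section \<open>Non-archimedean local fields\<close>

text \<open>The absolute value is discrete, non-trivial and complete, with finite residue field.
  The last clause of discreteness says that the value group is generated by \<open>v \<pi>\<close>.\<close>

locale nonarch_local_field =
  fixes v :: "'f::field \<Rightarrow> real"
  assumes nonneg: "0 \<le> v x"
    and zero_iff: "v x = 0 \<longleftrightarrow> x = 0"
    and mult: "v (x * y) = v x * v y"
    and ultrametric: "v (x + y) \<le> max (v x) (v y)"
    and discrete: "\<exists>\<pi>. 0 < v \<pi> \<and> v \<pi> < 1 \<and> (\<forall>x. x \<noteq> 0 \<longrightarrow> (\<exists>k::int. v x = v \<pi> powi k))"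
    and complete: "(\<And>r. r > 0 \<Longrightarrow> \<exists>M. \<forall>i\<ge>M. \<forall>j\<ge>M. v (u i - u j) < r)
          \<Longrightarrow> \<exists>l. (\<lambda>i. v (u i - l)) \<longlonglongrightarrow> 0"
    and finite_residue_field:
      "finite ({x. v x \<le> 1} // {(x, y). v x \<le> 1 \<and> v y \<le> 1 \<and> v (x - y) < 1})"


section \<open>Linear algebraic groups\<close>

text \<open>The algebraic closure of \<open>F\<close> is \<^typ>\<open>'f alg_closure\<close>. A linear algebraic group over it is
  identified with its group of points, a subset of \<open>GL N\<close>; a field of definition is given by the
  subset \<open>K\<close> of admissible coefficients. In characteristic zero a closed subset is
  defined over \<open>F\<close> as soon as it is the zero set of functions with coefficients in \<open>F\<close>.\<close>

definition GL :: "nat \<Rightarrow> 'k::field mat monoid" where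
  "GL N = \<lparr>carrier = {A \<in> carrier_mat N N. det A \<noteq> 0}, monoid.mult = (*), one = 1\<^sub>m N\<rparr>"

text \<open>The functions in \<open>K[x\<^sub>i\<^sub>j, det\<inverse>]\<close>.\<close>

inductive_set regular_functions :: "'k::field set \<Rightarrow> nat \<Rightarrow> ('k mat \<Rightarrow> 'k) set"
  for K N where
  const: "c \<in> K \<Longrightarrow> (\<lambda>A. c) \<in> regular_functions K N"
| entry: "i < N \<Longrightarrow> j < N \<Longrightarrow> (\<lambda>A. A $$ (i, j)) \<in> regular_functions K N"
| inv_det: "(\<lambda>A. inverse (det A)) \<in> regular_functions K N"
| add: "f \<in> regular_functions K N \<Longrightarrow> g \<in> regular_functions K N \<Longrightarrow>
    (\<lambda>A. f A + g A) \<in> regular_functions K N"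
| mult: "f \<in> regular_functions K N \<Longrightarrow> g \<in> regular_functions K N \<Longrightarrow>
    (\<lambda>A. f A * g A) \<in> regular_functions K N"

text \<open>The topology on \<open>GL N\<close> whose closed sets are the zero sets of elements of
  \<open>regular_functions K N\<close>.\<close>

definition zariski :: "'k::field set \<Rightarrow> nat \<Rightarrow> 'k mat topology" where
  "zariski K N =
    topology_generated_by ((\<lambda>f. {A \<in> carrier (GL N). f A \<noteq> 0}) ` regular_functions K N)"

definition closed_subgroup :: "'k::field set \<Rightarrow> nat \<Rightarrow> 'k mat set \<Rightarrow> bool" where
  "closed_subgroup K N H \<longleftrightarrow> subgroup H (GL N) \<and> closedin (zariski K N) H"

definition identity_component :: "nat \<Rightarrow> 'k::field mat set \<Rightarrow> 'k mat set" where
  "identity_component N H = connected_component_of_set (subtopology (zariski UNIV N) H) (1\<^sub>m N)"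

definition regular_map :: "'k::field set \<Rightarrow> nat \<Rightarrow> 'k mat set \<Rightarrow> nat \<Rightarrow> ('k mat \<Rightarrow> 'k mat) \<Rightarrow> bool" where
  "regular_map K N H M f \<longleftrightarrow>
    (\<forall>i<M. \<forall>j<M. \<exists>r \<in> regular_functions K N. \<forall>g\<in>H. f g $$ (i, j) = r g)"

text \<open>Isomorphisms over \<open>K\<close> from \<open>H \<subseteq> GL N\<close> onto \<open>H' \<subseteq> GL M\<close>.\<close>

definition alg_group_iso ::
  "'k::field set \<Rightarrow> nat \<Rightarrow> 'k mat set \<Rightarrow> nat \<Rightarrow> 'k mat set \<Rightarrow> ('k mat \<Rightarrow> 'k mat) \<Rightarrow> bool" where
  "alg_group_iso K N H M H' f \<longleftrightarrow>
    f \<in> iso ((GL N)\<lparr>carrier := H\<rparr>) ((GL M)\<lparr>carrier := H'\<rparr>) \<and>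
    regular_map K N H M f \<and> regular_map K M H' N (inv_into H f)"

definition diagonal_torus :: "nat \<Rightarrow> 'k::field mat set" where
  "diagonal_torus r = {A \<in> carrier (GL r). diagonal_mat A}"

definition torus :: "nat \<Rightarrow> 'k::alg_closed_field mat set \<Rightarrow> bool" where
  "torus N T \<longleftrightarrow> closed_subgroup UNIV N T \<and>
    (\<exists>r f. alg_group_iso UNIV N T r (diagonal_torus r) f)"

definition maximal_torus :: "nat \<Rightarrow> 'k::alg_closed_field mat set \<Rightarrow> 'k mat set \<Rightarrow> bool" where
  "maximal_torus N G T \<longleftrightarrow> torus N T \<and> T \<subseteq> G \<and>
    (\<forall>T'. torus N T' \<and> T' \<subseteq> G \<and> T \<subseteq> T' \<longrightarrow> T' = T)"

definition connected_solvable :: "nat \<Rightarrow> 'k::alg_closed_field mat set \<Rightarrow> bool" where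
  "connected_solvable N B \<longleftrightarrow> closed_subgroup UNIV N B \<and> connectedin (zariski UNIV N) B \<and>
    solvable ((GL N)\<lparr>carrier := B\<rparr>)"

definition borel_subgroup :: "nat \<Rightarrow> 'k::alg_closed_field mat set \<Rightarrow> 'k mat set \<Rightarrow> bool" where
  "borel_subgroup N G B \<longleftrightarrow> connected_solvable N B \<and> B \<subseteq> G \<and>
    (\<forall>B'. connected_solvable N B' \<and> B' \<subseteq> G \<and> B \<subseteq> B' \<longrightarrow> B' = B)"

definition borel_pair :: "nat \<Rightarrow> 'k::alg_closed_field mat set \<Rightarrow> 'k mat set \<Rightarrow> 'k mat set \<Rightarrow> bool" where
  "borel_pair N G B T \<longleftrightarrow> borel_subgroup N G B \<and> maximal_torus N G T \<and> T \<subseteq> B"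

text \<open>Base change of matrices and the copy of \<open>F\<close> in its algebraic closure.\<close>

abbreviation bc :: "'f::field mat \<Rightarrow> 'f alg_closure mat" where
  "bc \<equiv> map_mat to_ac"

abbreviation base_field :: "'f::field alg_closure set" where
  "base_field \<equiv> range to_ac"


section \<open>Bilinear forms, orthogonal groups and the twisted general linear group\<close>

text \<open>A bilinear form on \<open>F\<^sup>N\<close> is recorded by its Gram matrix; similarly an \<open>N\<close>-dimensional
  quadratic space is \<open>F\<^sup>N\<close> with a symmetric Gram matrix.\<close>

definition form :: "'k::field mat \<Rightarrow> 'k vec \<Rightarrow> 'k vec \<Rightarrow> 'k" where
  "form D v w = v \<bullet> (D *\<^sub>v w)"

definition nondegenerate_form :: "nat \<Rightarrow> 'k::field mat \<Rightarrow> bool" where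
  "nondegenerate_form N D \<longleftrightarrow> D \<in> carrier_mat N N \<and> det D \<noteq> 0"

definition quadratic_space :: "nat \<Rightarrow> 'k::field mat \<Rightarrow> bool" where
  "quadratic_space N Q \<longleftrightarrow> nondegenerate_form N Q \<and> Q\<^sup>T = Q"

definition isotropic :: "nat \<Rightarrow> 'k::field mat \<Rightarrow> bool" where
  "isotropic N Q \<longleftrightarrow> (\<exists>v \<in> carrier_vec N. v \<noteq> 0\<^sub>v N \<and> form Q v v = 0)"

definition Ortho :: "nat \<Rightarrow> 'k::field mat \<Rightarrow> 'k mat set" where
  "Ortho N Q = {g \<in> carrier (GL N).
    \<forall>v \<in> carrier_vec N. \<forall>w \<in> carrier_vec N. form Q (g *\<^sub>v v) (g *\<^sub>v w) = form Q v w}"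

definition SO :: "nat \<Rightarrow> 'k::field mat \<Rightarrow> 'k mat set" where
  "SO N Q = {g \<in> Ortho N Q. det g = 1}"

definition quasisplit_SO :: "nat \<Rightarrow> 'f::field_char_0 mat \<Rightarrow> bool" where
  "quasisplit_SO N Q \<longleftrightarrow>
    (\<exists>B. borel_subgroup N (SO N (bc Q)) B \<and> closed_subgroup base_field N B)"

definition SO_iso_over_base ::
  "nat \<Rightarrow> 'f::field_char_0 mat \<Rightarrow> 'f mat \<Rightarrow> ('f alg_closure mat \<Rightarrow> 'f alg_closure mat) \<Rightarrow> bool" where
  "SO_iso_over_base N Q Q' \<phi> \<longleftrightarrow>
    alg_group_iso base_field N (SO N (bc Q)) N (SO N (bc Q')) \<phi>"

definition conjugate_in :: "nat \<Rightarrow> 'k::field mat set \<Rightarrow> 'k mat \<Rightarrow> 'k mat \<Rightarrow> bool" where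
  "conjugate_in N H a b \<longleftrightarrow> (\<exists>g\<in>H. g * a * inv\<^bsub>GL N\<^esub> g = b)"

text \<open>The Gram matrix of \<open>(x \<delta> y)(v|w) = \<delta>(x\<inverse>v | yw)\<close>, where \<open>D\<close> is that of \<open>\<delta>\<close>.\<close>

definition bitorsor :: "nat \<Rightarrow> 'k::field mat \<Rightarrow> 'k mat \<Rightarrow> 'k mat \<Rightarrow> 'k mat" where
  "bitorsor N x D y = (inv\<^bsub>GL N\<^esub> x)\<^sup>T * D * y"

definition Ad :: "nat \<Rightarrow> 'k::field mat \<Rightarrow> 'k mat \<Rightarrow> 'k mat" where
  "Ad N D x = (THE y. y \<in> carrier (GL N) \<and> bitorsor N (1\<^sub>m N) D x = bitorsor N y D (1\<^sub>m N))"

definition form_stabilizer :: "nat \<Rightarrow> 'k::field mat \<Rightarrow> 'k mat set" where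
  "form_stabilizer N D = {x \<in> carrier (GL N). bitorsor N x D (inv\<^bsub>GL N\<^esub> x) = D}"

definition strongly_regular_semisimple_form :: "nat \<Rightarrow> 'f::field_char_0 mat \<Rightarrow> bool" where
  "strongly_regular_semisimple_form N D \<longleftrightarrow> nondegenerate_form N D \<and>
    (\<exists>B T. borel_pair N (carrier (GL N)) B T \<and> Ad N (bc D) ` B = B \<and> Ad N (bc D) ` T = T) \<and>
    torus N (identity_component N (form_stabilizer N (bc D))) \<and>
    (\<forall>g \<in> form_stabilizer N (bc D). \<forall>h \<in> form_stabilizer N (bc D). g * h = h * g)"

text \<open>Regularity: the identity component of the centralizer is a torus.\<close>

definition very_regular_SO :: "nat \<Rightarrow> 'f::field_char_0 mat \<Rightarrow> 'f mat \<Rightarrow> bool" where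
  "very_regular_SO N Q \<gamma> \<longleftrightarrow> \<gamma> \<in> SO N Q \<and>
    (\<exists>E. diagonal_mat E \<and> similar_mat (bc \<gamma>) E) \<and>
    torus N (identity_component N {g \<in> SO N (bc Q). g * bc \<gamma> = bc \<gamma> * g}) \<and>
    \<not> eigenvalue \<gamma> 1 \<and> \<not> eigenvalue \<gamma> (-1)"


section \<open>Etale algebras\<close>

abbreviation F_algebra :: "('f::field, 'l) module \<Rightarrow> bool" where
  "F_algebra L \<equiv> Module.algebra (ring_of_type_algebra :: 'f ring) L"

definition alg_hom :: "('f, 'l) module \<Rightarrow> ('f, 'm) module \<Rightarrow> ('l \<Rightarrow> 'm) set" where
  "alg_hom L K = {h \<in> Ring.ring_hom L K.
    \<forall>c. \<forall>a \<in> carrier L. h (c \<odot>\<^bsub>L\<^esub> a) = c \<odot>\<^bsub>K\<^esub> h a}"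

text \<open>Linear isomorphisms \<open>F\<^sup>d \<rightarrow> L\<close>.\<close>

definition lin_iso :: "nat \<Rightarrow> ('f::field, 'l) module \<Rightarrow> ('f vec \<Rightarrow> 'l) \<Rightarrow> bool" where
  "lin_iso d L e \<longleftrightarrow> bij_betw e (carrier_vec d) (carrier L) \<and>
    (\<forall>v \<in> carrier_vec d. \<forall>w \<in> carrier_vec d. e (v + w) = e v \<oplus>\<^bsub>L\<^esub> e w) \<and>
    (\<forall>c. \<forall>v \<in> carrier_vec d. e (c \<cdot>\<^sub>v v) = c \<odot>\<^bsub>L\<^esub> e v)"

text \<open>The trace of multiplication by \<open>a\<close>, computed in the basis of \<open>L\<close> given by \<open>e\<close>; it does
  not depend on \<open>e\<close>.\<close>

definition alg_trace :: "nat \<Rightarrow> ('f::field, 'l) module \<Rightarrow> ('f vec \<Rightarrow> 'l) \<Rightarrow> 'l \<Rightarrow> 'f" where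
  "alg_trace d L e a =
    (\<Sum>i<d. the_inv_into (carrier_vec d) e (a \<otimes>\<^bsub>L\<^esub> e (unit_vec d i)) $ i)"

definition eval_poly_alg :: "('f::field, 'l) module \<Rightarrow> 'f poly \<Rightarrow> 'l \<Rightarrow> 'l" where
  "eval_poly_alg L p a = (\<Oplus>\<^bsub>L\<^esub>i\<in>{..degree p}. coeff p i \<odot>\<^bsub>L\<^esub> (a [^]\<^bsub>L\<^esub> i))"

definition generates :: "('f::field, 'l) module \<Rightarrow> 'l \<Rightarrow> bool" where
  "generates L a \<longleftrightarrow> a \<in> carrier L \<and> (\<forall>b \<in> carrier L. \<exists>p. b = eval_poly_alg L p a)"

definition finite_separable_extension :: "('f::field, 'l) module \<Rightarrow> bool" where
  "finite_separable_extension K \<longleftrightarrow> F_algebra K \<and> Ring.field K \<and> (\<exists>d e. lin_iso d K e) \<and>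
    (\<forall>a \<in> carrier K. \<exists>p. coprime p (pderiv p) \<and> eval_poly_alg K p a = \<zero>\<^bsub>K\<^esub>)"

text \<open>A finite product of finite separable extensions, the \<open>\<pi> i\<close> being the projections. Each
  factor is isomorphic to a subspace of \<open>L\<close>, so it can be given a carrier in the same type.\<close>

definition etale_algebra :: "('f::field, 'l) module \<Rightarrow> bool" where
  "etale_algebra L \<longleftrightarrow> F_algebra L \<and>
    (\<exists>m (K :: nat \<Rightarrow> ('f, 'l) module) \<pi>.
      (\<forall>i<m. finite_separable_extension (K i) \<and> \<pi> i \<in> alg_hom L (K i)) \<and>
      bij_betw (\<lambda>a. \<lambda>i\<in>{..<m}. \<pi> i a) (carrier L) (\<Pi>\<^sub>E i\<in>{..<m}. carrier (K i)))"

definition fixed_subalgebra :: "('f, 'l) module \<Rightarrow> ('l \<Rightarrow> 'l) \<Rightarrow> 'l set" where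
  "fixed_subalgebra L \<tau> = {a \<in> carrier L. \<tau> a = a}"

text \<open>\<open>L\<close> is etale of rank two over the fixed algebra of \<open>\<tau>\<close>: it is free with a basis \<open>b, b'\<close>
  whose discriminant is invertible. The trace of \<open>L\<close> over the fixed algebra is
  \<open>a \<mapsto> a + \<tau> a\<close>, hence that discriminant is the square of \<open>b \<tau>(b') - \<tau>(b) b'\<close>.\<close>

definition etale_rank_two_over_fixed :: "('f, 'l) module \<Rightarrow> ('l \<Rightarrow> 'l) \<Rightarrow> bool" where
  "etale_rank_two_over_fixed L \<tau> \<longleftrightarrow>
    (\<exists>b \<in> carrier L. \<exists>b' \<in> carrier L.
      (\<forall>a \<in> carrier L. \<exists>!st. st \<in> fixed_subalgebra L \<tau> \<times> fixed_subalgebra L \<tau> \<and>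
        a = fst st \<otimes>\<^bsub>L\<^esub> b \<oplus>\<^bsub>L\<^esub> snd st \<otimes>\<^bsub>L\<^esub> b') \<and>
      b \<otimes>\<^bsub>L\<^esub> \<tau> b' \<ominus>\<^bsub>L\<^esub> \<tau> b \<otimes>\<^bsub>L\<^esub> b' \<in> Units L)"

definition etale_with_involution :: "nat \<Rightarrow> ('f::field, 'l) module \<Rightarrow> ('l \<Rightarrow> 'l) \<Rightarrow> bool" where
  "etale_with_involution d L \<tau> \<longleftrightarrow> etale_algebra L \<and> (\<exists>e. lin_iso d L e) \<and>
    \<tau> \<in> alg_hom L L \<and> (\<forall>a \<in> carrier L. \<tau> (\<tau> a) = a) \<and> etale_rank_two_over_fixed L \<tau>"


section \<open>Parametrizations and the correspondence\<close>

definition form_param ::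
  "nat \<Rightarrow> 'f::field mat \<Rightarrow> ('f, 'l) module \<Rightarrow> ('l \<Rightarrow> 'l) \<Rightarrow> 'l \<Rightarrow> bool" where
  "form_param N D L \<tau> x \<longleftrightarrow>
    etale_with_involution N L \<tau> \<and> x \<in> Units L \<and> generates L x \<and>
    (\<exists>e. lin_iso N L e \<and>
      (\<forall>v \<in> carrier_vec N. \<forall>w \<in> carrier_vec N.
        form D v w = alg_trace N L e (\<tau> (e v) \<otimes>\<^bsub>L\<^esub> e w \<otimes>\<^bsub>L\<^esub> x)))"

definition SO_param ::
  "nat \<Rightarrow> 'f::field mat \<Rightarrow> 'f mat \<Rightarrow> ('f, 'l) module \<Rightarrow> ('l \<Rightarrow> 'l) \<Rightarrow> 'l \<Rightarrow> 'l \<Rightarrow> bool" where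
  "SO_param N Q \<gamma> L \<tau> y c \<longleftrightarrow>
    etale_with_involution N L \<tau> \<and> y \<in> Units L \<and> generates L y \<and> y \<otimes>\<^bsub>L\<^esub> \<tau> y = \<one>\<^bsub>L\<^esub> \<and>
    c \<in> Units L \<and> c \<in> fixed_subalgebra L \<tau> \<and>
    (\<exists>e. lin_iso N L e \<and>
      (\<forall>v \<in> carrier_vec N. \<forall>w \<in> carrier_vec N.
        form Q v w = alg_trace N L e (\<tau> (e v) \<otimes>\<^bsub>L\<^esub> e w \<otimes>\<^bsub>L\<^esub> c)) \<and>
      (\<forall>v \<in> carrier_vec N. e (\<gamma> *\<^sub>v v) = y \<otimes>\<^bsub>L\<^esub> e v))"

text \<open>Every \<open>N\<close>-dimensional algebra is isomorphic to one with carrier \<open>F\<^sup>N\<close>, so quantifying below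
  over algebras with carrier in \<^typ>\<open>'f vec\<close> loses nothing.\<close>

definition very_regular_form :: "nat \<Rightarrow> 'f::field_char_0 mat \<Rightarrow> bool" where
  "very_regular_form N D \<longleftrightarrow> strongly_regular_semisimple_form N D \<and>
    (\<exists>(L :: ('f, 'f vec) module) \<tau> x. form_param N D L \<tau> x \<and>
      (x \<otimes>\<^bsub>L\<^esub> inv\<^bsub>L\<^esub> (\<tau> x)) \<oplus>\<^bsub>L\<^esub> \<one>\<^bsub>L\<^esub> \<in> Units L \<and>
      (x \<otimes>\<^bsub>L\<^esub> inv\<^bsub>L\<^esub> (\<tau> x)) \<ominus>\<^bsub>L\<^esub> \<one>\<^bsub>L\<^esub> \<in> Units L)"

definition corresponds :: "nat \<Rightarrow> 'f::field_char_0 mat \<Rightarrow> 'f mat \<Rightarrow> 'f mat \<Rightarrow> bool" where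
  "corresponds N Q \<gamma> D \<longleftrightarrow>
    (\<exists>(L :: ('f, 'f vec) module) \<tau> x (L' :: ('f, 'f vec) module) \<tau>' y c \<phi>.
      form_param N D L \<tau> x \<and> SO_param N Q \<gamma> L' \<tau>' y c \<and>
      \<phi> \<in> alg_hom L' L \<and> bij_betw \<phi> (carrier L') (carrier L) \<and>
      \<phi> ` fixed_subalgebra L' \<tau>' = fixed_subalgebra L \<tau> \<and>
      x \<otimes>\<^bsub>L\<^esub> inv\<^bsub>L\<^esub> (\<tau> x) = \<ominus>\<^bsub>L\<^esub> (\<phi> y))"


section \<open>Simple endoscopic data\<close>

definition absolute_galois :: "('f::field_char_0 alg_closure \<Rightarrow> 'f alg_closure) set" where
  "absolute_galois = {\<sigma>. bij \<sigma> \<and> (\<forall>a b. \<sigma> (a + b) = \<sigma> a + \<sigma> b) \<and>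
    (\<forall>a b. \<sigma> (a * b) = \<sigma> a * \<sigma> b) \<and> (\<forall>c. \<sigma> (to_ac c) = to_ac c)}"

text \<open>The character of the Galois group whose kernel is the stabilizer of the square roots of
  \<open>d\<close>; it is the one attached to \<open>F[\<surd>d]/F\<close> by class field theory.\<close>

definition quadratic_character ::
  "'f::field_char_0 \<Rightarrow> ('f alg_closure \<Rightarrow> 'f alg_closure) \<Rightarrow> int" where
  "quadratic_character d =
    (\<lambda>\<sigma>\<in>absolute_galois. if \<forall>s. s ^ 2 = to_ac d \<longrightarrow> \<sigma> s = s then 1 else -1)"

definition disc_pm :: "nat \<Rightarrow> 'f::field mat \<Rightarrow> 'f" where
  "disc_pm n Q = (-1) ^ n * det Q"

text \<open>Simple endoscopic data of the twisted general linear group of rank \<open>2n\<close>, recorded as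
  triples \<open>(2n, 0, \<chi>)\<close>. Two of them are equivalent exactly when the characters coincide.\<close>

type_synonym 'f endo_datum = "nat \<times> nat \<times> (('f alg_closure \<Rightarrow> 'f alg_closure) \<Rightarrow> int)"

definition is_endo_datum_of :: "nat \<Rightarrow> 'f::field_char_0 mat \<Rightarrow> 'f endo_datum \<Rightarrow> bool" where
  "is_endo_datum_of n Q \<D> \<longleftrightarrow> quadratic_space (2 * n) Q \<and> quasisplit_SO (2 * n) Q \<and>
    \<not> (n = 1 \<and> isotropic (2 * n) Q) \<and>
    \<D> = (2 * n, 0, quadratic_character (disc_pm n Q))"

definition equivalent_endo_data :: "'f endo_datum \<Rightarrow> 'f endo_datum \<Rightarrow> bool" where
  "equivalent_endo_data \<D> \<D>' \<longleftrightarrow>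
    fst \<D> = fst \<D>' \<and> fst (snd \<D>) = fst (snd \<D>') \<and> snd (snd \<D>) = snd (snd \<D>')"

end

theory Submission
  imports Defs
begin

text \<open>Over the algebraic closure \<open>K\<close> of \<open>F\<close>, stable conjugacy is decided by eigenvalues, and the
  correspondence prescribes those of \<open>\<gamma>\<^sub>1\<close> and \<open>\<gamma>\<^sub>2\<close> by the same \<open>\<delta>\<close>. The point is to identify the two
  quadratic spaces up to a scalar: a similitude \<open>h\<close> over \<open>F\<close> conjugates one special orthogonal group
  into the other, and the rest follows from it. Let \<open>N = 2n\<close>.

  The quadratic spaces are determined up to scaling by their discriminants
  (\<open>similar_if_same_disc\<close>). This rests on the fact that a quasisplit \<open>SO(Q)\<close> makes \<open>n - 1\<close> hyperbolic
  planes split off \<open>Q\<close> over \<open>F\<close> (\<open>quasisplit_splits_planes\<close>), which leaves a binary form; a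
  binary form is determined up to scaling by its discriminant, and hyperbolic planes absorb
  scalars. To find the planes, let \<open>B\<close> be a Borel subgroup defined over \<open>F\<close>. The theorem of Lie and
  Kolchin (\<open>lie_kolchin\<close>), applied repeatedly to isotropic lines, shows that \<open>B\<close> stabilizes a
  self-dual flag over \<open>K\<close>, and maximality identifies \<open>B\<close> with the group of all upper triangular
  matrices of the special orthogonal group in a basis adapted to that flag
  (\<open>borel_subgroup_SO\<close>). A Galois automorphism \<open>\<sigma>\<close> preserves \<open>B\<close>, so the matrix comparing the
  flag with its image under \<open>\<sigma>\<close> normalizes the group of upper triangular isometries; such a matrix
  is itself upper triangular in its first \<open>n - 1\<close> columns (\<open>std_borel_normalizer\<close>). Thus the isotropic
  flag is Galois-stable up to dimension \<open>n - 1\<close>, hence rational (\<open>splits_planes_if_stable_flag\<close>,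
  resting on \<open>fixed_by_absolute_galois\<close>).

  The discriminants agree modulo squares. Invariance of the trace under \<open>\<tau>\<close> shows that
  \<open>x/\<tau>(x)\<close> acts as the operator \<open>(D\<^sup>T)\<inverse> D\<close>, where \<open>D\<close> is the Gram matrix of \<open>\<delta>\<close>
  (\<open>corresponds_asymmetry\<close>). Consequently \<open>\<gamma>\<^sub>1\<close> and \<open>\<gamma>\<^sub>2\<close> are both conjugate over \<open>F\<close> to
  \<open>- (D\<^sup>T)\<inverse> D\<close>. For an isometry \<open>\<gamma>\<close> of \<open>Q\<close> with determinant one, \<open>det Q \<cdot> det (\<gamma>\<^sup>2 - 1)\<close> is the
  determinant of the skew matrix \<open>Q\<gamma> - \<gamma>\<^sup>TQ\<close> and hence a square (\<open>isometry_disc\<close>); as \<open>\<plusminus>1\<close> is not an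
  eigenvalue, \<open>det Q\<^sub>1 \<cdot> det Q\<^sub>2\<close> is a square. This also gives the equality of the characters.

  For stable conjugacy, \<open>h\<gamma>\<^sub>1h\<inverse>\<close> and \<open>\<gamma>\<^sub>2\<close> are isometries of \<open>Q\<^sub>2\<close> that are conjugate in \<open>GL N\<close>. Since
  \<open>y\<close> generates the algebra, the eigenvalues are distinct (\<open>SO_param_distinct_eigenvalues\<close>), and
  over \<open>K\<close> the conjugating matrix can be corrected by a square root of a matrix commuting with
  \<open>h\<gamma>\<^sub>1h\<inverse>\<close> so as to become an isometry (\<open>conjugate_in_Ortho_if_conjugate\<close>).\<close>

no_notation fps_nth (infixl "$" 75)

section \<open>Matrices and bilinear forms\<close>

declare sum.lessThan_Suc [simp del]

lemma det_nonzero_if_kernel_trivial: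
  fixes A :: "'k::field mat"
  assumes "A \<in> carrier_mat n n"
    and "\<And>x. x \<in> carrier_vec n \<Longrightarrow> A *\<^sub>v x = 0\<^sub>v n \<Longrightarrow> x = 0\<^sub>v n"
  shows "det A \<noteq> 0"
  using det_0_iff_vec_prod_zero_field[OF assms(1)] assms(2) by blast

lemma obtain_inverse_mat:
  fixes A :: "'k::field mat"
  assumes "A \<in> carrier_mat n n" "det A \<noteq> 0"
  obtains B where "B \<in> carrier_mat n n" "A * B = 1\<^sub>m n" "B * A = 1\<^sub>m n"
proof -
  from det_non_zero_imp_unit[OF assms, of "()"]
  obtain B where "B \<in> carrier_mat n n" "A * B = 1\<^sub>m n" "B * A = 1\<^sub>m n"
    unfolding Units_def ring_mat_def by auto
  then show ?thesis using that by blast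
qed

lemma det_nonzero_if_left_inverse:
  fixes A :: "'k::field mat"
  assumes "A \<in> carrier_mat n n" "B \<in> carrier_mat n n" "B * A = 1\<^sub>m n"
  shows "det A \<noteq> 0"
  using det_mult[OF assms(2,1)] assms(3) by auto

lemma mult_mat_vec_index_sum:
  "i < dim_row A \<Longrightarrow> dim_vec x = dim_col A \<Longrightarrow> (A *\<^sub>v x) $ i = (\<Sum>j<dim_col A. A $$ (i, j) * x $ j)"
  by (simp add: scalar_prod_def atLeast0LessThan)

lemma mult_mat_index_sum:
  "i < dim_row A \<Longrightarrow> j < dim_col B \<Longrightarrow> dim_row B = dim_col A \<Longrightarrow>
    (A * B) $$ (i, j) = (\<Sum>k<dim_col A. A $$ (i, k) * B $$ (k, j))"
  by (simp add: scalar_prod_def atLeast0LessThan)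

lemma gram_index_sum:
  assumes "P \<in> carrier_mat n m" "G \<in> carrier_mat n n" "i < m" "j < m"
  shows "(P\<^sup>T * G * P) $$ (i, j) = (\<Sum>k<n. \<Sum>l<n. P $$ (k, i) * G $$ (k, l) * P $$ (l, j))"
proof -
  have "(P\<^sup>T * G * P) $$ (i, j) = (\<Sum>l<n. (\<Sum>k<n. P $$ (k, i) * G $$ (k, l)) * P $$ (l, j))"
    using assms by (simp add: mult_mat_index_sum del: index_mult_mat(1) assoc_mult_mat)
  also have "\<dots> = (\<Sum>l<n. \<Sum>k<n. P $$ (k, i) * G $$ (k, l) * P $$ (l, j))"
    by (simp add: sum_distrib_right)
  also have "\<dots> = (\<Sum>k<n. \<Sum>l<n. P $$ (k, i) * G $$ (k, l) * P $$ (l, j))"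
    by (rule sum.swap)
  finally show ?thesis .
qed

lemma gram_mult:
  fixes G :: "'k::comm_ring_1 mat"
  assumes "P \<in> carrier_mat n n" "G \<in> carrier_mat n n" "R \<in> carrier_mat n m"
  shows "(P * R)\<^sup>T * G * (P * R) = R\<^sup>T * (P\<^sup>T * G * P) * R"
proof -
  have 1: "(P * R)\<^sup>T = R\<^sup>T * P\<^sup>T" using assms by (simp add: transpose_mult)
  have c: "P\<^sup>T \<in> carrier_mat n n" "R\<^sup>T \<in> carrier_mat m n" "P\<^sup>T * G \<in> carrier_mat n n"
    using assms by auto
  have "R\<^sup>T * P\<^sup>T * G * (P * R) = R\<^sup>T * (P\<^sup>T * G) * (P * R)"
    using assoc_mult_mat[OF c(2,1) assms(2)] by simp
  also have "\<dots> = R\<^sup>T * ((P\<^sup>T * G) * (P * R))"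
    using assoc_mult_mat[OF c(2,3), of "P * R" m] assms by simp
  also have "(P\<^sup>T * G) * (P * R) = P\<^sup>T * G * P * R"
    using assoc_mult_mat[OF c(3) assms(1,3)] by simp
  also have "R\<^sup>T * (P\<^sup>T * G * P * R) = R\<^sup>T * (P\<^sup>T * G * P) * R"
    using assoc_mult_mat[of "R\<^sup>T" m n "P\<^sup>T * G * P" n R m] assms c by simp
  finally show ?thesis using 1 by simp
qed

lemma det_gram:
  fixes G :: "'k::comm_ring_1 mat"
  assumes "P \<in> carrier_mat n n" "G \<in> carrier_mat n n"
  shows "det (P\<^sup>T * G * P) = (det P)\<^sup>2 * det G"
  using assms by (simp add: det_mult[of _ n] det_transpose[of _ n] power2_eq_square)

lemma sum_lessThan_split_ends:
  fixes f :: "nat \<Rightarrow> 'k::comm_monoid_add"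
  shows "(\<Sum>k<M+2. f k) = f 0 + (\<Sum>k<M. f (Suc k)) + f (Suc M)"
  by (simp add: sum.lessThan_Suc_shift[of _ "Suc M"] sum.lessThan_Suc[of _ M] add.assoc)

text \<open>Exchange: \<open>v\<close> replaces a unit vector \<open>e\<^sub>k\<close> with \<open>v\<^sub>k \<noteq> 0\<close>; the permutation \<open>\<pi>\<close>
  exchanges \<open>0\<close> and \<open>k\<close>.\<close>

lemma complete_to_basis:
  fixes v :: "'k::field vec"
  assumes v: "v \<in> carrier_vec N" "v \<noteq> 0\<^sub>v N"
  obtains P where "P \<in> carrier_mat N N" "det P \<noteq> 0" "col P 0 = v"
proof -
  from v obtain k where k: "k < N" "v $ k \<noteq> 0" by (metis eq_vecI carrier_vecD index_zero_vec)
  define \<pi> where "\<pi> j = (if j = k then 0 else if j = 0 then k else j)" for j :: nat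
  define P where "P = mat N N (\<lambda>(i, j). if j = 0 then v $ i else if i = \<pi> j then 1 else 0)"
  have PC: "P \<in> carrier_mat N N" by (simp add: P_def)
  have Pi: "P $$ (i, j) = (if j = 0 then v $ i else if i = \<pi> j then 1 else 0)"
    if "i < N" "j < N" for i j using that by (simp add: P_def)
  have "det P \<noteq> 0"
  proof (rule det_nonzero_if_kernel_trivial[OF PC])
    fix x assume x: "x \<in> carrier_vec N" "P *\<^sub>v x = 0\<^sub>v N"
    have row: "(\<Sum>j<N. P $$ (i, j) * x $ j) = 0" if "i < N" for i
      using mult_mat_vec_index_sum[of i P x] x PC that by simp
    have "(\<Sum>j<N. P $$ (k, j) * x $ j) = (\<Sum>j<N. if j = 0 then v $ k * x $ 0 else 0)"
      by (rule sum.cong[OF refl]) (use k in \<open>auto simp: Pi \<pi>_def\<close>)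
    with row[OF k(1)] have x0: "x $ 0 = 0" using k by (simp add: sum.delta)
    have "x $ j = 0" if j: "j < N" "j \<noteq> 0" for j
    proof -
      have pj: "\<pi> j < N" using j k by (auto simp: \<pi>_def)
      have "(\<Sum>l<N. P $$ (\<pi> j, l) * x $ l) = (\<Sum>l<N. if l = j then x $ j else 0)"
        by (rule sum.cong[OF refl]) (use k j pj x0 in \<open>auto simp: Pi \<pi>_def split: if_splits\<close>)
      with row[OF pj] show ?thesis using j by simp
    qed
    then show "x = 0\<^sub>v N" using x(1) x0 by (metis carrier_vecD eq_vecI index_zero_vec(1) index_zero_vec(2))
  qed
  moreover have "col P 0 = v" using v k by (intro eq_vecI) (auto simp: P_def)
  ultimately show ?thesis using that PC by blast
qed

text \<open>The two-sided form of basis completion: besides the first basis vector, the kernel of a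
  linear form \<open>f\<close> containing it is prescribed. It becomes the span of all basis vectors but the last
  one, which makes room for the hyperbolic partner of \<open>v\<close> when \<open>f\<close> is the pairing with \<open>v\<close>.\<close>

lemma complete_to_basis_adapted:
  fixes v f :: "'k::field vec"
  assumes v: "v \<in> carrier_vec (M+2)" "v \<noteq> 0\<^sub>v (M+2)"
    and f: "f \<in> carrier_vec (M+2)" "f \<noteq> 0\<^sub>v (M+2)" and fv: "f \<bullet> v = 0"
  obtains P where "P \<in> carrier_mat (M+2) (M+2)" "det P \<noteq> 0" "col P 0 = v"
    "P\<^sup>T *\<^sub>v f = unit_vec (M+2) (Suc M)"
proof -
  let ?N = "M+2"
  obtain P1 where P1: "P1 \<in> carrier_mat ?N ?N" "det P1 \<noteq> 0" "col P1 0 = v"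
    using complete_to_basis[OF v] by blast
  define g where "g = P1\<^sup>T *\<^sub>v f"
  have gC: "g \<in> carrier_vec ?N" using P1 f by (auto simp: g_def)
  have g0: "g $ 0 = 0"
    using P1 f v fv comm_scalar_prod[OF f(1) v(1)] by (simp add: g_def)
  have "g \<noteq> 0\<^sub>v ?N"
    using det_0_iff_vec_prod_zero_field[of "P1\<^sup>T" ?N] P1 f det_transpose[OF P1(1)]
    unfolding g_def by auto
  then obtain l where l: "l < ?N" "g $ l \<noteq> 0" using gC by (metis eq_vecI carrier_vecD index_zero_vec)
  have l0: "l \<noteq> 0" using g0 l by metis
  define \<pi> where "\<pi> j = (if j = l then Suc M else if j = Suc M then l else j)" for j :: nat
  have pp: "\<pi> (\<pi> j) = j" "\<pi> j < ?N \<longleftrightarrow> j < ?N" "\<pi> 0 = 0" "\<pi> j = l \<longleftrightarrow> j = Suc M" for j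
    using l l0 by (auto simp: \<pi>_def)
  define D where "D = mat ?N ?N (\<lambda>(i, j). if i = l then (if \<pi> j = l then 1 / g $ l else - g $ \<pi> j / g $ l)
     else if i = \<pi> j then 1 else 0)"
  have DC: "D \<in> carrier_mat ?N ?N" by (simp add: D_def)
  have Di: "D $$ (i, j) = (if i = l then (if \<pi> j = l then 1 / g $ l else - g $ \<pi> j / g $ l)
     else if i = \<pi> j then 1 else 0)" if "i < ?N" "j < ?N" for i j using that by (simp add: D_def)
  have dD: "det D \<noteq> 0"
  proof (rule det_nonzero_if_kernel_trivial[OF DC])
    fix x assume x: "x \<in> carrier_vec ?N" "D *\<^sub>v x = 0\<^sub>v ?N"
    have row: "(\<Sum>j<?N. D $$ (i, j) * x $ j) = 0" if "i < ?N" for i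
      using mult_mat_vec_index_sum[of i D x] x DC that by simp
    have z: "x $ \<pi> i = 0" if i: "i < ?N" "i \<noteq> l" for i
    proof -
      have "(\<Sum>j<?N. D $$ (i, j) * x $ j) = (\<Sum>j<?N. if j = \<pi> i then x $ \<pi> i else 0)"
        by (rule sum.cong[OF refl]) (use i pp in \<open>auto simp: Di\<close>)
      with row[OF i(1)] show ?thesis using i pp by simp
    qed
    have z': "x $ j = 0" if "j < ?N" "j \<noteq> Suc M" for j
      using z[of "\<pi> j"] that pp by metis
    have "(\<Sum>j<?N. D $$ (l, j) * x $ j) = (\<Sum>j<?N. if j = Suc M then 1 / g $ l * x $ Suc M else 0)"
      by (rule sum.cong[OF refl]) (use l pp z' in \<open>auto simp: Di\<close>)
    then have "x $ Suc M = 0" using row[OF l(1)] l by simp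
    then show "x = 0\<^sub>v ?N" using x(1) z' by (metis carrier_vecD eq_vecI index_zero_vec(1) index_zero_vec(2))
  qed
  have c0: "(P1 * D) $$ (i, 0) = v $ i" if i: "i < ?N" for i
  proof -
    have "(P1 * D) $$ (i, 0) = (\<Sum>k<?N. P1 $$ (i, k) * D $$ (k, 0))"
      using P1 DC i by (subst mult_mat_index_sum) auto
    also have "\<dots> = (\<Sum>k<?N. if k = 0 then P1 $$ (i, 0) else 0)"
      by (rule sum.cong[OF refl]) (use l0 g0 pp in \<open>auto simp: Di\<close>)
    also have "\<dots> = v $ i" using P1(1) i P1(3)[symmetric] by simp
    finally show ?thesis .
  qed
  have last: "((P1 * D)\<^sup>T *\<^sub>v f) $ j = unit_vec ?N (Suc M) $ j" if j: "j < ?N" for j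
  proof -
    have "(P1 * D)\<^sup>T *\<^sub>v f = D\<^sup>T *\<^sub>v g"
      unfolding g_def using P1 DC f by (simp add: transpose_mult[of _ ?N ?N _ ?N] assoc_mult_mat_vec[of _ ?N ?N _ ?N])
    then have "((P1 * D)\<^sup>T *\<^sub>v f) $ j = (\<Sum>k<?N. D $$ (k, j) * g $ k)"
      using DC gC j by (simp add: mult_mat_vec_index_sum del: index_mult_mat_vec)
    also have "\<dots> = D $$ (l, j) * g $ l + (\<Sum>k\<in>{..<?N}-{l}. D $$ (k, j) * g $ k)"
      using l by (subst sum.remove[of _ l]) auto
    also have "(\<Sum>k\<in>{..<?N}-{l}. D $$ (k, j) * g $ k) = (\<Sum>k\<in>{..<?N}-{l}. if k = \<pi> j then g $ \<pi> j else 0)"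
      by (rule sum.cong[OF refl]) (use j in \<open>auto simp: Di\<close>)
    also have "\<dots> = (if \<pi> j = l then 0 else g $ \<pi> j)" using j pp by (auto simp: sum.delta)
    finally show ?thesis using l j pp(4)[of j] by (auto simp: Di unit_vec_def)
  qed
  show ?thesis
  proof (rule that[of "P1 * D"])
    show "col (P1 * D) 0 = v" using c0 P1 DC v by (intro eq_vecI) (auto simp del: index_mult_mat(1) simp: col_def)
    show "(P1 * D)\<^sup>T *\<^sub>v f = unit_vec ?N (Suc M)" using last DC by (intro eq_vecI) auto
  qed (use P1 DC dD in \<open>auto simp: det_mult\<close>)
qed

text \<open>The orthogonal sum of a bilinear space with the plane whose Gram matrix is
  \<open>((0, 1), (\<epsilon>, 0))\<close>, the plane being spanned by the first and the last basis vector.\<close>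

definition add_plane :: "'k::field \<Rightarrow> nat \<Rightarrow> 'k mat \<Rightarrow> 'k mat" where
  "add_plane \<epsilon> M Q = mat (M+2) (M+2) (\<lambda>(i, j).
     if i = 0 then (if j = Suc M then 1 else 0)
     else if i = Suc M then (if j = 0 then \<epsilon> else 0)
     else if j = 0 \<or> j = Suc M then 0 else Q $$ (i - 1, j - 1))"

lemma add_plane_carrier [simp]: "add_plane \<epsilon> M Q \<in> carrier_mat (M+2) (M+2)"
  by (simp add: add_plane_def)

lemma add_plane_dims [simp]: "dim_row (add_plane \<epsilon> M Q) = M+2" "dim_col (add_plane \<epsilon> M Q) = M+2"
  by (simp_all add: add_plane_def)

lemma add_plane_index:
  assumes "i < M+2" "j < M+2"
  shows "add_plane \<epsilon> M Q $$ (i, j) = (if i = 0 then (if j = Suc M then 1 else 0)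
     else if i = Suc M then (if j = 0 then \<epsilon> else 0)
     else if j = 0 \<or> j = Suc M then 0 else Q $$ (i - 1, j - 1))"
  using assms by (simp add: add_plane_def)

lemma det_add_plane:
  fixes Q :: "'k::field mat"
  assumes Q: "Q \<in> carrier_mat M M"
  shows "det (add_plane \<epsilon> M Q) = - \<epsilon> * det Q"
proof -
  let ?A = "add_plane \<epsilon> M Q"
  define B where "B = four_block_mat (mat 1 1 (\<lambda>_. \<epsilon>)) (0\<^sub>m 1 (M+1)) (0\<^sub>m (M+1) 1)
     (four_block_mat Q (0\<^sub>m M 1) (0\<^sub>m 1 M) (1\<^sub>m 1))"
  have "swaprows 0 (Suc M) ?A = B"
    by (rule eq_matI) (use Q in \<open>auto simp: B_def add_plane_index\<close>)
  moreover have "det (swaprows 0 (Suc M) ?A) = - det ?A"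
    by (rule det_swaprows[of _ "M+2"]) auto
  moreover have "det B = det (mat 1 1 (\<lambda>_. \<epsilon>)) * det (four_block_mat Q (0\<^sub>m M 1) (0\<^sub>m 1 M) (1\<^sub>m 1))"
    unfolding B_def by (rule det_four_block_mat_lower_left_zero) (use Q in auto)
  moreover have "det (four_block_mat Q (0\<^sub>m M 1) (0\<^sub>m 1 M) (1\<^sub>m 1)) = det Q * det (1\<^sub>m 1)"
    by (rule det_four_block_mat_lower_left_zero) (use Q in auto)
  moreover have "det (mat 1 1 (\<lambda>_. \<epsilon>)) = \<epsilon>" by (subst det_single) auto
  ultimately have "- det ?A = \<epsilon> * det Q" by simp
  then show ?thesis by (metis minus_minus minus_mult_left)
qed

lemma symmetric_index:
  fixes A :: "'k::field mat"
  assumes "A \<in> carrier_mat n n" "A\<^sup>T = \<epsilon> \<cdot>\<^sub>m A" "i < n" "j < n"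
  shows "A $$ (j, i) = \<epsilon> * A $$ (i, j)"
  using assms by (metis carrier_matD index_smult_mat(1) index_transpose_mat(1))

text \<open>In a basis that starts with \<open>v\<close> and whose vectors except the last one are orthogonal to \<open>v\<close>, the
  first row of the Gram matrix is \<open>(0, \<dots>, 0, 1)\<close>. Subtracting multiples of \<open>v\<close> from the other basis
  vectors makes them orthogonal to the last one.\<close>

lemma split_off_plane:
  fixes A :: "'k::field_char_0 mat"
  assumes A: "A \<in> carrier_mat (M+2) (M+2)" "det A \<noteq> 0" "A\<^sup>T = \<epsilon> \<cdot>\<^sub>m A"
    and eps: "\<epsilon> = 1 \<or> \<epsilon> = -1"
    and v: "v \<in> carrier_vec (M+2)" "v \<noteq> 0\<^sub>v (M+2)" and iso: "form A v v = 0"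
  obtains P A' where "P \<in> carrier_mat (M+2) (M+2)" "det P \<noteq> 0" "col P 0 = v"
    "A' \<in> carrier_mat M M" "det A' \<noteq> 0" "A'\<^sup>T = \<epsilon> \<cdot>\<^sub>m A'" "P\<^sup>T * A * P = add_plane \<epsilon> M A'"
proof -
  let ?N = "M+2"
  define f where "f = A\<^sup>T *\<^sub>v v"
  have fC: "f \<in> carrier_vec ?N" using A(1) v(1) unfolding f_def by (meson mult_mat_vec_carrier transpose_carrier_mat)
  have AT: "A $$ (j, i) = \<epsilon> * A $$ (i, j)" if "i < ?N" "j < ?N" for i j
    using symmetric_index[OF A(1,3)] that by blast
  have fv: "f \<bullet> v = 0"
    using iso transpose_vec_mult_scalar[OF A(1) v(1) v(1)] by (simp add: f_def form_def)
  have "f \<noteq> 0\<^sub>v ?N"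
    using det_0_iff_vec_prod_zero_field[of "A\<^sup>T" ?N] A v det_transpose[OF A(1)] unfolding f_def by auto
  then obtain P where P: "P \<in> carrier_mat ?N ?N" "det P \<noteq> 0" "col P 0 = v"
    "P\<^sup>T *\<^sub>v f = unit_vec ?N (Suc M)"
    using complete_to_basis_adapted[OF v fC _ fv] by blast
  define G where "G = P\<^sup>T * A * P"
  have GC: "G \<in> carrier_mat ?N ?N" using P A by (simp add: G_def)
  have Gsym: "G $$ (j, i) = \<epsilon> * G $$ (i, j)" if "i < ?N" "j < ?N" for i j
  proof -
    have "G $$ (j, i) = (\<Sum>k<?N. \<Sum>l<?N. P $$ (k, j) * A $$ (k, l) * P $$ (l, i))"
      unfolding G_def using gram_index_sum[OF P(1) A(1)] that by simp
    also have "\<dots> = (\<Sum>k<?N. \<Sum>l<?N. \<epsilon> * (P $$ (l, i) * A $$ (l, k) * P $$ (k, j)))"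
      by (intro sum.cong refl) (subst AT, auto simp: mult_ac)
    also have "\<dots> = \<epsilon> * (\<Sum>l<?N. \<Sum>k<?N. (P $$ (l, i) * A $$ (l, k) * P $$ (k, j)))"
      by (subst sum.swap) (simp add: sum_distrib_left)
    also have "\<dots> = \<epsilon> * G $$ (i, j)"
      unfolding G_def using gram_index_sum[OF P(1) A(1)] that by simp
    finally show ?thesis .
  qed
  have G0: "G $$ (0, j) = (if j = Suc M then 1 else 0)" if j: "j < ?N" for j
  proof -
    have vi: "v $ k = P $$ (k, 0)" if "k < ?N" for k using P that by (metis carrier_matD(1) index_col zero_less_Suc add_2_eq_Suc' carrier_matD(2))
    have "G $$ (0, j) = (\<Sum>k<?N. \<Sum>l<?N. v $ k * A $$ (k, l) * P $$ (l, j))"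
      unfolding G_def using gram_index_sum[OF P(1) A(1)] j vi by simp
    also have "\<dots> = (P\<^sup>T *\<^sub>v f) $ j"
      using P(1) fC j A(1) v(1)
      by (subst sum.swap)
         (simp add: mult_mat_vec_index_sum f_def sum_distrib_left mult_ac del: index_mult_mat_vec)
    finally show ?thesis using P(4) j by (simp add: unit_vec_def)
  qed
  have Gi0: "G $$ (i, 0) = (if i = Suc M then \<epsilon> else 0)" if j: "i < ?N" for i
    using Gsym[of 0 i, OF _ j] G0[OF j] by simp
  \<comment> \<open>the multiples of \<open>v\<close> to be added; the last vector is paired with itself, whence the factor \<open>1/2\<close>\<close>
  define e where "e j = (if j = 0 then 0 else if j = Suc M then - G $$ (Suc M, Suc M) / 2 else - G $$ (j, Suc M))" for j
  define E where "E = mat ?N ?N (\<lambda>(i, j). (if i = j then 1 else 0) + (if i = 0 then e j else 0))"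
  have EC: "E \<in> carrier_mat ?N ?N" by (simp add: E_def)
  have Ei: "E $$ (i, j) = (if i = j then 1 else 0) + (if i = 0 then e j else 0)" if "i < ?N" "j < ?N" for i j
    using that by (simp add: E_def)
  have "upper_triangular E" by (auto simp: upper_triangular_def E_def)
  then have "det E = prod_list (diag_mat E)" using det_upper_triangular EC by blast
  also have "diag_mat E = map (\<lambda>i. 1) [0..<?N]" unfolding diag_mat_def
    using EC by (auto simp: Ei e_def)
  also have "prod_list \<dots> = 1" by (simp add: map_replicate_const prod_list_replicate)
  finally have dE: "det E = 1" .
  have left: "(\<Sum>k<?N. E $$ (k, i) * h k) = h i + e i * h 0" if "i < ?N" for i and h :: "nat \<Rightarrow> 'k"
  proof -
    have "(\<Sum>k<?N. E $$ (k, i) * h k) = (\<Sum>k<?N. (if k = i then h i else 0) + (if k = 0 then e i * h 0 else 0))"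
      by (rule sum.cong[OF refl]) (use that in \<open>auto simp: Ei distrib_right\<close>)
    then show ?thesis using that by (simp add: sum.distrib del: sum.lessThan_Suc)
  qed
  define A' where "A' = mat M M (\<lambda>(i, j). G $$ (Suc i, Suc j))"
  have A'C: "A' \<in> carrier_mat M M" by (simp add: A'_def)
  have EGE: "E\<^sup>T * G * E = add_plane \<epsilon> M A'"
  proof (rule eq_matI)
    fix i j assume "i < dim_row (add_plane \<epsilon> M A')" "j < dim_col (add_plane \<epsilon> M A')"
    then have ij: "i < ?N" "j < ?N" by auto
    have "(E\<^sup>T * G * E) $$ (i, j) = (\<Sum>k<?N. E $$ (k, i) * (\<Sum>l<?N. E $$ (l, j) * G $$ (k, l)))"
      using gram_index_sum[OF EC GC] ij by (simp add: sum_distrib_left mult_ac)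
    also have "\<dots> = (G $$ (i, j) + e j * G $$ (i, 0)) + e i * (G $$ (0, j) + e j * G $$ (0, 0))"
      by (simp only: left[OF ij(1)] left[OF ij(2)])
    also have "\<dots> = add_plane \<epsilon> M A' $$ (i, j)"
    proof -
      consider "i = 0" | "i = Suc M" "j = 0" | "i = Suc M" "j = Suc M" | "i = Suc M" "0 < j" "j < Suc M"
        | "0 < i" "i < Suc M" "j = 0" | "0 < i" "i < Suc M" "j = Suc M"
        | "0 < i" "i < Suc M" "0 < j" "j < Suc M" using ij by linarith
      then show ?thesis
      proof cases
        case 3
        have "\<epsilon> = 1 \<or> G $$ (Suc M, Suc M) = 0"
          using eps Gsym[of "Suc M" "Suc M"] by fastforce
        then show ?thesis using 3 by (auto simp: add_plane_index G0 Gi0 e_def)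
      next
        case 4
        then have "G $$ (Suc M, j) = \<epsilon> * G $$ (j, Suc M)" by (intro Gsym) auto
        then show ?thesis using 4 eps by (auto simp: add_plane_index G0 Gi0 e_def)
      qed (insert ij, auto simp: add_plane_index G0 Gi0 e_def A'_def)
    qed
    finally show "(E\<^sup>T * G * E) $$ (i, j) = add_plane \<epsilon> M A' $$ (i, j)" .
  qed (use EC in auto)
  have full: "(P * E)\<^sup>T * A * (P * E) = add_plane \<epsilon> M A'"
    unfolding gram_mult[OF P(1) A(1) EC] G_def[symmetric] by (rule EGE)
  have dPE: "det (P * E) \<noteq> 0" unfolding det_mult[OF P(1) EC] dE using P(2) by simp
  have PEC: "P * E \<in> carrier_mat ?N ?N" using P(1) EC by (rule mult_carrier_mat)
  have "det (add_plane \<epsilon> M A') = (det (P * E))\<^sup>2 * det A"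
    unfolding full[symmetric] by (rule det_gram[OF PEC A(1)])
  then have "det (add_plane \<epsilon> M A') \<noteq> 0"
    using dPE A(2) by simp
  then have dA': "det A' \<noteq> 0" using det_add_plane[OF A'C] by auto
  have sA': "A'\<^sup>T = \<epsilon> \<cdot>\<^sub>m A'"
    by (rule eq_matI) (auto simp: A'_def intro!: Gsym)
  have "col (P * E) 0 = v"
  proof (rule eq_vecI)
    fix i assume "i < dim_vec v"
    then have i: "i < ?N" using v(1) by simp
    have "col (P * E) 0 $ i = (P * E) $$ (i, 0)" using PEC i by (subst index_col) auto
    also have "\<dots> = (\<Sum>k<?N. P $$ (i, k) * E $$ (k, 0))"
      using P(1) EC i by (subst mult_mat_index_sum) auto
    also have "\<dots> = (\<Sum>k<?N. E $$ (k, 0) * P $$ (i, k))" by (simp only: mult.commute)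
    also have "\<dots> = P $$ (i, 0)" using left[of 0 "\<lambda>k. P $$ (i, k)"] by (simp add: e_def)
    also have "\<dots> = col P 0 $ i" using P(1) i by (subst index_col) auto
    finally show "col (P * E) 0 $ i = v $ i" unfolding P(3) .
  qed (use PEC v(1) in auto)
  then show ?thesis
    by (rule that[OF PEC dPE _ A'C dA' sA' full])
qed

lemma eq_uminus_self_imp_zero:
  fixes a :: "'k::field_char_0"
  assumes "a = - a"
  shows "a = 0"
proof -
  have "2 * a = 0" using assms by (metis add.right_inverse mult_2)
  then show ?thesis by simp
qed

lemma form_skew_diagonal:
  fixes A :: "'k::field_char_0 mat"
  assumes A: "A \<in> carrier_mat n n" "A\<^sup>T = (-1) \<cdot>\<^sub>m A" and v: "v \<in> carrier_vec n"
  shows "form A v v = 0"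
proof -
  have AT: "A $$ (j, i) = - (A $$ (i, j))" if "i < n" "j < n" for i j
    using symmetric_index[OF A(1,2) that] by simp
  have f: "form A v v = (\<Sum>i<n. \<Sum>j<n. v $ i * A $$ (i, j) * v $ j)"
    using A v by (simp add: form_def scalar_prod_def sum_distrib_left mult_ac atLeast0LessThan)
  also have "\<dots> = (\<Sum>j<n. \<Sum>i<n. v $ i * A $$ (i, j) * v $ j)" by (rule sum.swap)
  also have "\<dots> = (\<Sum>j<n. \<Sum>i<n. - (v $ j * A $$ (j, i) * v $ i))"
    by (intro sum.cong refl) (subst AT, auto simp: mult_ac)
  also have "\<dots> = - form A v v" by (simp add: f sum_negf)
  finally show ?thesis by (rule eq_uminus_self_imp_zero)
qed

text \<open>Every vector is isotropic for a skew form, so planes with \<open>\<epsilon> = -1\<close> split off, and these have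
  determinant one. The square root is the Pfaffian up to sign.\<close>

lemma det_skew_is_square:
  fixes A :: "'k::field_char_0 mat"
  assumes "A \<in> carrier_mat N N" "A\<^sup>T = (-1) \<cdot>\<^sub>m A"
  shows "\<exists>s. det A = s\<^sup>2"
  using assms
proof (induction N arbitrary: A rule: less_induct)
  case (less N)
  note A = less.prems
  consider "N = 0" | "det A = 0" | "N = 1" "det A \<noteq> 0" | M where "N = M+2" "det A \<noteq> 0"
    by (metis One_nat_def add_2_eq_Suc' not0_implies_Suc)
  then show ?case
  proof cases
    case 1 then show ?thesis using A by (auto intro!: exI[of _ 1])
  next
    case 2 then show ?thesis by (auto intro!: exI[of _ 0])
  next
    case 3
    have "A $$ (0, 0) = 0"
      using symmetric_index[OF A(1,2), of 0 0] 3 by (intro eq_uminus_self_imp_zero) simp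
    then have "det A = 0" using A 3 det_single[of A] by simp
    then show ?thesis using 3 by simp
  next
    case (4 M)
    have u: "unit_vec N 0 \<in> carrier_vec (M+2)" "unit_vec N 0 \<noteq> (0\<^sub>v (M+2) :: 'k vec)"
      using 4 by (auto simp: unit_vec_def vec_eq_iff)
    have "form A (unit_vec N 0) (unit_vec N 0) = 0" by (rule form_skew_diagonal[OF A]) simp
    then obtain P A' where P: "P \<in> carrier_mat N N" "det P \<noteq> 0" "A' \<in> carrier_mat M M"
      "A'\<^sup>T = (-1) \<cdot>\<^sub>m A'" "P\<^sup>T * A * P = add_plane (-1) M A'"
      using split_off_plane[of A M "-1", OF A(1)[unfolded 4(1)] 4(2) A(2) _ u] 4(1) by metis
    obtain s where s: "det A' = s\<^sup>2" using less.IH[of M A'] P 4 by auto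
    have "(det P)\<^sup>2 * det A = s\<^sup>2"
      using det_gram[OF P(1) A(1)] P(5) det_add_plane[OF P(3), of "-1"] s by simp
    then have "det A = (s / det P)\<^sup>2" using P(2) by (simp add: power_divide field_simps)
    then show ?thesis by blast
  qed
qed

text \<open>The direct sum of two scalars and a matrix, arranged to fit \<open>add_plane\<close>.\<close>

definition embed_block :: "nat \<Rightarrow> 'k::field \<Rightarrow> 'k mat \<Rightarrow> 'k \<Rightarrow> 'k mat" where
  "embed_block M a A b = mat (M+2) (M+2) (\<lambda>(i, j).
     if i = 0 then (if j = 0 then a else 0)
     else if i = Suc M then (if j = Suc M then b else 0)
     else if j = 0 \<or> j = Suc M then 0 else A $$ (i - 1, j - 1))"

lemma embed_block_carrier [simp]: "embed_block M a A b \<in> carrier_mat (M+2) (M+2)"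
  by (simp add: embed_block_def)

lemma embed_block_index:
  assumes "i < M+2" "j < M+2"
  shows "embed_block M a A b $$ (i, j) = (if i = 0 then (if j = 0 then a else 0)
     else if i = Suc M then (if j = Suc M then b else 0)
     else if j = 0 \<or> j = Suc M then 0 else A $$ (i - 1, j - 1))"
  using assms by (simp add: embed_block_def)

lemma det_embed_block:
  fixes A :: "'k::field mat"
  assumes A: "A \<in> carrier_mat M M"
  shows "det (embed_block M a A b) = a * det A * b"
proof -
  let ?C = "four_block_mat A (0\<^sub>m M 1) (0\<^sub>m 1 M) (mat 1 1 (\<lambda>_. b))"
  have "embed_block M a A b = four_block_mat (mat 1 1 (\<lambda>_. a)) (0\<^sub>m 1 (M+1)) (0\<^sub>m (M+1) 1) ?C"
    by (rule eq_matI) (use A in \<open>auto simp: embed_block_def\<close>)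
  moreover have "det (four_block_mat (mat 1 1 (\<lambda>_. a)) (0\<^sub>m 1 (M+1)) (0\<^sub>m (M+1) 1) ?C)
      = det (mat 1 1 (\<lambda>_. a)) * det ?C"
    by (rule det_four_block_mat_lower_left_zero) (use A in auto)
  moreover have "det ?C = det A * det (mat 1 1 (\<lambda>_. b))"
    by (rule det_four_block_mat_lower_left_zero) (use A in auto)
  moreover have "det (mat 1 1 (\<lambda>_. x)) = x" for x :: 'k by (subst det_single) auto
  ultimately show ?thesis by simp
qed

lemma sum_embed_block_column:
  fixes h :: "nat \<Rightarrow> 'k::field"
  assumes "i < M+2"
  shows "(\<Sum>k<M+2. embed_block M a A b $$ (k, i) * h k) =
    (if i = 0 then a * h 0 else if i = Suc M then b * h (Suc M)
     else (\<Sum>k<M. A $$ (k, i - 1) * h (Suc k)))"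
  unfolding sum_lessThan_split_ends using assms by (auto simp: embed_block_index)

text \<open>A similitude of the complement with factor \<open>ab\<close> extends to the whole space by scaling the two
  isotropic lines of the plane by \<open>a\<close> and \<open>b\<close>.\<close>

lemma gram_embed_block:
  fixes Q :: "'k::field mat"
  assumes A: "A \<in> carrier_mat M M" "Q \<in> carrier_mat M M" "Q' \<in> carrier_mat M M"
    and eq: "A\<^sup>T * Q * A = (a * b) \<cdot>\<^sub>m Q'"
  shows "(embed_block M a A b)\<^sup>T * add_plane \<epsilon> M Q * embed_block M a A b = (a * b) \<cdot>\<^sub>m add_plane \<epsilon> M Q'"
proof (rule eq_matI)
  let ?E = "embed_block M a A b"
  fix i j assume "i < dim_row ((a * b) \<cdot>\<^sub>m add_plane \<epsilon> M Q')" "j < dim_col ((a * b) \<cdot>\<^sub>m add_plane \<epsilon> M Q')"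
  then have ij: "i < M+2" "j < M+2" by auto
  have mid: "(\<Sum>k<M. A $$ (k, i - 1) * (\<Sum>l<M. A $$ (l, j - 1) * Q $$ (k, l))) = (a * b) * Q' $$ (i - 1, j - 1)"
    if "0 < i" "i < Suc M" "0 < j" "j < Suc M"
  proof -
    have "(A\<^sup>T * Q * A) $$ (i - 1, j - 1) = (a * b) * Q' $$ (i - 1, j - 1)"
      unfolding eq using that A by auto
    then show ?thesis using gram_index_sum[OF A(1,2), of "i - 1" "j - 1"] that
      by (simp add: sum_distrib_left mult_ac)
  qed
  have "(?E\<^sup>T * add_plane \<epsilon> M Q * ?E) $$ (i, j)
      = (\<Sum>k<M+2. ?E $$ (k, i) * (\<Sum>l<M+2. ?E $$ (l, j) * add_plane \<epsilon> M Q $$ (k, l)))"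
    unfolding gram_index_sum[OF embed_block_carrier add_plane_carrier ij]
    by (simp only: sum_distrib_left mult_ac)
  also have "\<dots> = (a * b) * add_plane \<epsilon> M Q' $$ (i, j)"
    unfolding sum_embed_block_column[OF ij(1)] sum_embed_block_column[OF ij(2)]
    using ij mid by (auto simp: add_plane_index)
  finally show "(?E\<^sup>T * add_plane \<epsilon> M Q * ?E) $$ (i, j) = ((a * b) \<cdot>\<^sub>m add_plane \<epsilon> M Q') $$ (i, j)"
    using ij by simp
qed (auto simp: embed_block_def)

lemma quadratic_spaceD:
  assumes "quadratic_space N Q"
  shows "Q \<in> carrier_mat N N" "det Q \<noteq> 0" "Q\<^sup>T = Q"
  using assms by (auto simp: quadratic_space_def nondegenerate_form_def)


section \<open>Similarity of quadratic spaces with an anisotropic kernel of dimension at most two\<close>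

text \<open>\<open>splits_planes k N Q\<close> bounds the Witt index of \<open>Q\<close> from below by \<open>k\<close>, in a form suited to induction.\<close>

primrec splits_planes :: "nat \<Rightarrow> nat \<Rightarrow> 'f::field mat \<Rightarrow> bool" where
  "splits_planes 0 N Q = True"
| "splits_planes (Suc k) N Q = (\<exists>M P Q'. N = M + 2 \<and> P \<in> carrier_mat N N \<and> det P \<noteq> 0 \<and>
     quadratic_space M Q' \<and> P\<^sup>T * Q * P = add_plane 1 M Q' \<and> splits_planes k M Q')"

definition diag2 :: "'k::field \<Rightarrow> 'k \<Rightarrow> 'k mat" where
  "diag2 a b = mat 2 2 (\<lambda>(i, j). if i = j then if i = 0 then a else b else 0)"

lemma sum_lessThan_2: "(\<Sum>i<(2::nat). f i) = f 0 + (f 1 :: 'k::comm_monoid_add)"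
  by (simp add: numeral_2_eq_2 sum.lessThan_Suc)

lemma det_two:
  fixes A :: "'k::field mat"
  assumes A: "A \<in> carrier_mat 2 2"
  shows "det A = A $$ (0, 0) * A $$ (1, 1) - A $$ (0, 1) * A $$ (1, 0)"
proof -
  have "det A = (\<Sum>i<2. A $$ (i, 0) * cofactor A i 0)"
    by (rule laplace_expansion_column[OF A]) simp
  also have "\<dots> = A $$ (0, 0) * A $$ (1, 1) - A $$ (0, 1) * A $$ (1, 0)"
    unfolding sum_lessThan_2 cofactor_def
    using A by (subst (1 2) det_single) (auto simp: mat_delete_def numeral_2_eq_2)
  finally show ?thesis .
qed

text \<open>A vector \<open>v\<close> with \<open>q(v) = a \<noteq> 0\<close> and a suitable vector orthogonal to it form a basis.\<close>

lemma binary_form_diagonal: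
  fixes Q :: "'k::field_char_0 mat"
  assumes "quadratic_space 2 Q"
  obtains P a where "P \<in> carrier_mat 2 2" "det P \<noteq> 0" "a \<noteq> 0" "P\<^sup>T * Q * P = diag2 a (a * det Q)"
proof -
  note Q = quadratic_spaceD[OF assms]
  define p where "p = Q $$ (0, 0)"
  define q where "q = Q $$ (0, 1)"
  define r where "r = Q $$ (1, 1)"
  have q': "Q $$ (1, 0) = q" using Q unfolding q_def by (metis carrier_matD index_transpose_mat(1) one_less_numeral_iff semiring_norm(76) zero_less_numeral)
  have dQ: "det Q = p * r - q * q" using det_two[OF Q(1)] q' by (simp add: p_def q_def r_def)
  have "\<exists>x y. p * x * x + 2 * q * x * y + r * y * y \<noteq> 0"
  proof (rule ccontr)
    assume "\<not> ?thesis"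
    then have z: "p * x * x + 2 * q * x * y + r * y * y = 0" for x y by blast
    have "p = 0" "r = 0" using z[of 1 0] z[of 0 1] by auto
    moreover then have "q = 0" using z[of 1 1] by simp
    ultimately show False using Q(2) dQ by simp
  qed
  then obtain x y where a0: "p * x * x + 2 * q * x * y + r * y * y \<noteq> 0" by blast
  define a where "a = p * x * x + 2 * q * x * y + r * y * y"
  define P where "P = mat 2 2 (\<lambda>(i, j). if i = 0 then if j = 0 then x else - (q * x + r * y)
     else if j = 0 then y else p * x + q * y)"
  have PC: "P \<in> carrier_mat 2 2" by (simp add: P_def)
  have "det P = a" unfolding det_two[OF PC] by (simp add: P_def a_def algebra_simps)
  moreover have "P\<^sup>T * Q * P = diag2 a (a * det Q)"
  proof (rule eq_matI)
    fix i j assume "i < dim_row (diag2 a (a * det Q))" "j < dim_col (diag2 a (a * det Q))"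
    then have ij: "i < 2" "j < 2" by (auto simp: diag2_def)
    then consider "i = 0" "j = 0" | "i = 0" "j = 1" | "i = 1" "j = 0" | "i = 1" "j = 1" by linarith
    then show "(P\<^sup>T * Q * P) $$ (i, j) = diag2 a (a * det Q) $$ (i, j)"
      unfolding gram_index_sum[OF PC Q(1) ij] sum_lessThan_2 dQ diag2_def a_def q'
        p_def[symmetric] q_def[symmetric] r_def[symmetric]
      by cases (simp_all add: P_def algebra_simps q' p_def[symmetric] q_def[symmetric] r_def[symmetric])
  qed (auto simp: diag2_def P_def)
  ultimately show ?thesis using that PC a0 unfolding a_def by metis
qed

lemma gram_smult_right:
  fixes Q :: "'k::comm_ring_1 mat"
  assumes "P \<in> carrier_mat n n" "Q \<in> carrier_mat n n"
  shows "P\<^sup>T * (c \<cdot>\<^sub>m Q) * P = c \<cdot>\<^sub>m (P\<^sup>T * Q * P)"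
  using assms by (simp add: mult_smult_distrib[of _ n n _ n] mult_smult_assoc_mat[of _ n n _ n])

lemma similar_transfer:
  fixes Q\<^sub>1 Q\<^sub>2 :: "'k::field mat"
  assumes Q: "Q\<^sub>1 \<in> carrier_mat n n" "Q\<^sub>2 \<in> carrier_mat n n"
    and P: "P\<^sub>1 \<in> carrier_mat n n" "det P\<^sub>1 \<noteq> 0" "P\<^sub>2 \<in> carrier_mat n n" "det P\<^sub>2 \<noteq> 0"
    and D: "D \<in> carrier_mat n n" "det D \<noteq> 0"
    and eq: "D\<^sup>T * (P\<^sub>2\<^sup>T * Q\<^sub>2 * P\<^sub>2) * D = c \<cdot>\<^sub>m (P\<^sub>1\<^sup>T * Q\<^sub>1 * P\<^sub>1)"
  obtains h where "h \<in> carrier_mat n n" "det h \<noteq> 0" "h\<^sup>T * Q\<^sub>2 * h = c \<cdot>\<^sub>m Q\<^sub>1"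
proof -
  obtain R where R: "R \<in> carrier_mat n n" "P\<^sub>1 * R = 1\<^sub>m n" "R * P\<^sub>1 = 1\<^sub>m n"
    using obtain_inverse_mat[OF P(1,2)] by blast
  define h where "h = P\<^sub>2 * D * R"
  have C: "P\<^sub>2 * D \<in> carrier_mat n n" "h \<in> carrier_mat n n" using P D R by (auto simp: h_def)
  have "h\<^sup>T * Q\<^sub>2 * h = R\<^sup>T * ((P\<^sub>2 * D)\<^sup>T * Q\<^sub>2 * (P\<^sub>2 * D)) * R"
    unfolding h_def by (rule gram_mult[OF C(1) Q(2) R(1)])
  also have "(P\<^sub>2 * D)\<^sup>T * Q\<^sub>2 * (P\<^sub>2 * D) = c \<cdot>\<^sub>m (P\<^sub>1\<^sup>T * Q\<^sub>1 * P\<^sub>1)"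
    unfolding gram_mult[OF P(3) Q(2) D(1)] by (rule eq)
  also have "R\<^sup>T * (c \<cdot>\<^sub>m (P\<^sub>1\<^sup>T * Q\<^sub>1 * P\<^sub>1)) * R = c \<cdot>\<^sub>m (R\<^sup>T * (P\<^sub>1\<^sup>T * Q\<^sub>1 * P\<^sub>1) * R)"
    by (rule gram_smult_right[OF R(1)]) (use P Q in auto)
  also have "R\<^sup>T * (P\<^sub>1\<^sup>T * Q\<^sub>1 * P\<^sub>1) * R = (P\<^sub>1 * R)\<^sup>T * Q\<^sub>1 * (P\<^sub>1 * R)"
    by (rule gram_mult[OF P(1) Q(1) R(1), symmetric])
  also have "\<dots> = Q\<^sub>1" using R(2) Q(1) by simp
  finally have "h\<^sup>T * Q\<^sub>2 * h = c \<cdot>\<^sub>m Q\<^sub>1" .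
  moreover have "det R \<noteq> 0" using det_nonzero_if_left_inverse[OF R(1) P(1) R(2)] .
  then have "det h \<noteq> 0" unfolding h_def using P D R by (simp add: det_mult[of _ n])
  ultimately show ?thesis using that C by blast
qed

text \<open>Scaling is absorbed by the hyperbolic planes, and a binary form is determined up to scaling
  by its discriminant.\<close>

theorem similar_if_same_disc:
  fixes Q\<^sub>1 Q\<^sub>2 :: "'k::field_char_0 mat"
  assumes "quadratic_space (2*k+2) Q\<^sub>1" "quadratic_space (2*k+2) Q\<^sub>2"
    and "splits_planes k (2*k+2) Q\<^sub>1" "splits_planes k (2*k+2) Q\<^sub>2"
    and "det Q\<^sub>1 * det Q\<^sub>2 = s\<^sup>2"
  shows "\<exists>h c. h \<in> carrier_mat (2*k+2) (2*k+2) \<and> det h \<noteq> 0 \<and> c \<noteq> 0 \<and> h\<^sup>T * Q\<^sub>2 * h = c \<cdot>\<^sub>m Q\<^sub>1"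
  using assms
proof (induction k arbitrary: Q\<^sub>1 Q\<^sub>2 s)
  case 0
  note Q1 = quadratic_spaceD[OF 0(1)] and Q2 = quadratic_spaceD[OF 0(2)]
  obtain P1 a1 where P1: "P1 \<in> carrier_mat 2 2" "det P1 \<noteq> 0" "a1 \<noteq> 0"
    "P1\<^sup>T * Q\<^sub>1 * P1 = diag2 a1 (a1 * det Q\<^sub>1)"
    by (rule binary_form_diagonal[of Q\<^sub>1]) (use 0(1) in \<open>simp_all add: numeral_2_eq_2\<close>)
  obtain P2 a2 where P2: "P2 \<in> carrier_mat 2 2" "det P2 \<noteq> 0" "a2 \<noteq> 0"
    "P2\<^sup>T * Q\<^sub>2 * P2 = diag2 a2 (a2 * det Q\<^sub>2)"
    by (rule binary_form_diagonal[of Q\<^sub>2]) (use 0(2) in \<open>simp_all add: numeral_2_eq_2\<close>)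
  \<comment> \<open>the discriminants differ by the square \<open>t\<^sup>2\<close>, which a diagonal change of basis removes\<close>
  define t where "t = s / det Q\<^sub>2"
  have s0: "s \<noteq> 0" using 0(5) Q1(2) Q2(2) by auto
  have tt: "t * t * det Q\<^sub>2 = det Q\<^sub>1"
    using 0(5) Q2(2) by (simp add: t_def power2_eq_square field_simps)
  have dC: "diag2 1 t \<in> carrier_mat 2 2" "diag2 a2 (a2 * det Q\<^sub>2) \<in> carrier_mat 2 2"
    by (auto simp: diag2_def)
  have dt: "det (diag2 1 t) \<noteq> 0"
    unfolding det_two[OF dC(1)] using s0 Q2(2) by (simp add: diag2_def t_def)
  have "(diag2 1 t)\<^sup>T * (P2\<^sup>T * Q\<^sub>2 * P2) * diag2 1 t = (a2 / a1) \<cdot>\<^sub>m (P1\<^sup>T * Q\<^sub>1 * P1)"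
  proof (rule eq_matI)
    fix i j assume "i < dim_row ((a2 / a1) \<cdot>\<^sub>m (P1\<^sup>T * Q\<^sub>1 * P1))" "j < dim_col ((a2 / a1) \<cdot>\<^sub>m (P1\<^sup>T * Q\<^sub>1 * P1))"
    then have ij: "i < 2" "j < 2" using P1(1) by auto
    then consider "i = 0" "j = 0" | "i = 0" "j = 1" | "i = 1" "j = 0" | "i = 1" "j = 1" by linarith
    then show "((diag2 1 t)\<^sup>T * (P2\<^sup>T * Q\<^sub>2 * P2) * diag2 1 t) $$ (i, j)
        = ((a2 / a1) \<cdot>\<^sub>m (P1\<^sup>T * Q\<^sub>1 * P1)) $$ (i, j)"
      unfolding P1(4) P2(4) gram_index_sum[OF dC ij] sum_lessThan_2
      by cases (use P1(3) tt in \<open>auto simp: diag2_def mult_ac\<close>)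
  qed (use P1 in \<open>auto simp: diag2_def\<close>)
  moreover have "Q\<^sub>1 \<in> carrier_mat 2 2" "Q\<^sub>2 \<in> carrier_mat 2 2" using Q1(1) Q2(1) by (simp_all add: numeral_2_eq_2)
  ultimately obtain h where "h \<in> carrier_mat 2 2" "det h \<noteq> 0" "h\<^sup>T * Q\<^sub>2 * h = (a2 / a1) \<cdot>\<^sub>m Q\<^sub>1"
    using similar_transfer[OF _ _ P1(1,2) P2(1,2) dC(1) dt] by metis
  then show ?case using P1(3) P2(3) by (intro exI[of _ h] exI[of _ "a2 / a1"]) (simp add: numeral_2_eq_2)
next
  case (Suc k)
  let ?M = "2*k+2"
  have N: "2 * Suc k + 2 = ?M + 2" by simp
  note Q1 = quadratic_spaceD[OF Suc.prems(1)] and Q2 = quadratic_spaceD[OF Suc.prems(2)]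
  obtain P1 Q1' where P1: "P1 \<in> carrier_mat (?M+2) (?M+2)" "det P1 \<noteq> 0" "quadratic_space ?M Q1'"
      "P1\<^sup>T * Q\<^sub>1 * P1 = add_plane 1 ?M Q1'" "splits_planes k ?M Q1'"
    using Suc.prems(3) unfolding splits_planes.simps N by auto
  obtain P2 Q2' where P2: "P2 \<in> carrier_mat (?M+2) (?M+2)" "det P2 \<noteq> 0" "quadratic_space ?M Q2'"
      "P2\<^sup>T * Q\<^sub>2 * P2 = add_plane 1 ?M Q2'" "splits_planes k ?M Q2'"
    using Suc.prems(4) unfolding splits_planes.simps N by auto
  note Q1' = quadratic_spaceD[OF P1(3)] and Q2' = quadratic_spaceD[OF P2(3)]
  have "- det Q1' = (det P1)\<^sup>2 * det Q\<^sub>1" "- det Q2' = (det P2)\<^sup>2 * det Q\<^sub>2"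
    using det_gram[OF P1(1), of Q\<^sub>1] det_add_plane[OF Q1'(1), of 1] P1(4) Q1(1)
      det_gram[OF P2(1), of Q\<^sub>2] det_add_plane[OF Q2'(1), of 1] P2(4) Q2(1) by auto
  then have "(- det Q1') * (- det Q2') = (det P1 * det P2)\<^sup>2 * (det Q\<^sub>1 * det Q\<^sub>2)"
    by (simp only: power2_eq_square mult_ac)
  then have "det Q1' * det Q2' = (det P1 * det P2)\<^sup>2 * (det Q\<^sub>1 * det Q\<^sub>2)" by simp
  also have "\<dots> = (det P1 * det P2 * s)\<^sup>2" unfolding Suc.prems(5) by (simp add: power2_eq_square)
  finally obtain h c where h: "h \<in> carrier_mat ?M ?M" "det h \<noteq> 0" "c \<noteq> 0" "h\<^sup>T * Q2' * h = c \<cdot>\<^sub>m Q1'"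
    using Suc.IH[OF P1(3) P2(3) P1(5) P2(5)] by blast
  let ?D = "embed_block ?M c h 1"
  have dD: "det ?D \<noteq> 0" unfolding det_embed_block[OF h(1)] using h by simp
  have "?D\<^sup>T * add_plane 1 ?M Q2' * ?D = c \<cdot>\<^sub>m add_plane 1 ?M Q1'"
    using gram_embed_block[OF h(1) Q2'(1) Q1'(1), of c 1 1] h(4) by simp
  then have "?D\<^sup>T * (P2\<^sup>T * Q\<^sub>2 * P2) * ?D = c \<cdot>\<^sub>m (P1\<^sup>T * Q\<^sub>1 * P1)"
    unfolding P1(4) P2(4) .
  from similar_transfer[OF _ _ P1(1,2) P2(1,2) embed_block_carrier dD this] Q1(1) Q2(1) N
  obtain g where "g \<in> carrier_mat (?M+2) (?M+2)" "det g \<noteq> 0" "g\<^sup>T * Q\<^sub>2 * g = c \<cdot>\<^sub>m Q\<^sub>1" by metis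
  then show ?case using h(3) unfolding N by blast
qed

section \<open>The fixed field of the absolute Galois group\<close>

text \<open>Graphs of embeddings into the algebraic closure of intermediate rings of \<open>K/F\<close>. Describing
  an embedding by its graph makes unions of chains and adjunction of an element uniform.\<close>

definition partial_embedding :: "('f::field alg_closure \<times> 'f alg_closure) set \<Rightarrow> bool" where
  "partial_embedding G \<longleftrightarrow> (\<forall>c. (to_ac c, to_ac c) \<in> G) \<and>
    (\<forall>x x' y y'. (x, x') \<in> G \<longrightarrow> (y, y') \<in> G \<longrightarrow> (x + y, x' + y') \<in> G \<and> (x * y, x' * y') \<in> G) \<and>
    (\<forall>y. (0, y) \<in> G \<longrightarrow> y = 0)"

context
  fixes G :: "('f::field alg_closure \<times> 'f alg_closure) set"
  assumes G: "partial_embedding G"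
begin

lemma pe_const: "(to_ac c, to_ac c) \<in> G" and pe_0: "(0, 0) \<in> G" and pe_1: "(1, 1) \<in> G"
  and pe_add: "(x, x') \<in> G \<Longrightarrow> (y, y') \<in> G \<Longrightarrow> (x + y, x' + y') \<in> G"
  and pe_mult: "(x, x') \<in> G \<Longrightarrow> (y, y') \<in> G \<Longrightarrow> (x * y, x' * y') \<in> G"
  and pe_zero: "(0, y) \<in> G \<Longrightarrow> y = 0"
proof -
  show c: "(to_ac c, to_ac c) \<in> G" for c using G by (simp add: partial_embedding_def)
  show "(0, 0) \<in> G" "(1, 1) \<in> G" using c[of 0] c[of 1] by auto
qed (use G in \<open>auto simp: partial_embedding_def\<close>)

lemma pe_uminus: "(x, x') \<in> G \<Longrightarrow> (- x, - x') \<in> G"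
  using pe_mult[OF pe_const[of "-1"], of x x'] by simp

lemma pe_diff: "(x, x') \<in> G \<Longrightarrow> (y, y') \<in> G \<Longrightarrow> (x - y, x' - y') \<in> G"
  using pe_add[OF _ pe_uminus, of x x' y y'] by simp

lemma pe_functional: "(x, y) \<in> G \<Longrightarrow> (x, y') \<in> G \<Longrightarrow> y = y'"
  using pe_diff[of x y x y'] pe_zero[of "y - y'"] by simp

lemma pe_poly_const:
  assumes "(x, y) \<in> G"
  shows "(poly (map_poly to_ac p) x, poly (map_poly to_ac p) y) \<in> G"
proof (induction p)
  case 0 then show ?case by (simp add: pe_0)
next
  case (pCons a p)
  then show ?case by (simp add: map_poly_pCons pe_add pe_mult pe_const assms)
qed

text \<open>Every ring between \<open>F\<close> and its algebraic closure is a field.\<close>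

lemma pe_inverse:
  assumes "(x, y) \<in> G" "x \<noteq> 0"
  shows "(inverse x, inverse y) \<in> G" "y \<noteq> 0"
proof -
  define P where "P p \<longleftrightarrow> p \<noteq> 0 \<and> poly (map_poly to_ac p) x = 0" for p :: "'f poly"
  obtain p0 where "P p0" using alg_closure_algebraic[of x] unfolding P_def by metis
  then obtain p where p: "P p" and min: "\<And>q. P q \<Longrightarrow> degree p \<le> degree q"
    using ex_has_least_nat[of P p0 degree] by blast
  obtain c s where cs: "p = pCons c s" by (cases p)
  have c0: "c \<noteq> 0"
  proof
    assume "c = 0"
    then have "s \<noteq> 0" "poly (map_poly to_ac s) x = 0"
      using p assms(2) unfolding P_def cs by (auto simp: map_poly_pCons)
    then show False using min[of s] cs by (simp add: P_def)
  qed
  have "to_ac c + x * poly (map_poly to_ac s) x = 0"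
    using p c0 unfolding P_def cs by (simp add: map_poly_pCons)
  then have xs: "x * poly (map_poly to_ac s) x = - to_ac c" by (metis add_eq_0_iff)
  have "map_poly to_ac (smult (- inverse c) s) = smult (- inverse (to_ac c)) (map_poly to_ac s)"
    by (rule poly_eqI) (simp add: coeff_map_poly)
  then have "x * poly (map_poly to_ac (smult (- inverse c) s)) x
      = - inverse (to_ac c) * (x * poly (map_poly to_ac s) x)"
    by (simp only: poly_smult mult_ac)
  also have "\<dots> = 1" unfolding xs using c0 by simp
  finally have "x * poly (map_poly to_ac (smult (- inverse c) s)) x = 1" .
  then have ix: "inverse x = poly (map_poly to_ac (smult (- inverse c) s)) x"
    using inverse_unique by blast
  obtain z where z: "(inverse x, z) \<in> G" unfolding ix using pe_poly_const[OF assms(1)] by blast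
  have "(1, y * z) \<in> G" using pe_mult[OF assms(1) z] assms(2) by simp
  then have "y * z = 1" using pe_functional pe_1 by blast
  then show "y \<noteq> 0" "(inverse x, inverse y) \<in> G" using z inverse_unique by auto
qed

definition poly_pairs :: "('f alg_closure poly \<times> 'f alg_closure poly) set" where
  "poly_pairs = {(p, p'). \<forall>i. (coeff p i, coeff p' i) \<in> G}"

lemma pp_sum:
  "finite A \<Longrightarrow> (\<And>i. i \<in> A \<Longrightarrow> (f i, g i) \<in> G) \<Longrightarrow> (sum f A, sum g A) \<in> G"
  by (induction rule: finite_induct) (auto simp: pe_0 pe_add)

lemma pp_arith:
  assumes "(p, p') \<in> poly_pairs" "(q, q') \<in> poly_pairs"
  shows "(p + q, p' + q') \<in> poly_pairs" "(p * q, p' * q') \<in> poly_pairs" "(p - q, p' - q') \<in> poly_pairs"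
  using assms by (auto simp: poly_pairs_def coeff_mult pe_add pe_diff intro!: pp_sum pe_mult)

lemma pp_monom: "(x, y) \<in> G \<Longrightarrow> (monom x k, monom y k) \<in> poly_pairs"
  by (auto simp: poly_pairs_def pe_0)

lemma pp_degree: "(p, p') \<in> poly_pairs \<Longrightarrow> degree p' = degree p"
proof -
  assume "(p, p') \<in> poly_pairs"
  then have "coeff p i = 0 \<longleftrightarrow> coeff p' i = 0" for i
    unfolding poly_pairs_def using pe_inverse(2) pe_zero by (metis (mono_tags, lifting) case_prodD mem_Collect_eq)
  then show ?thesis unfolding degree_def by simp
qed

lemma pp_zero: "(0, p') \<in> poly_pairs \<Longrightarrow> p' = 0"
  unfolding poly_pairs_def using pe_zero by (auto intro: poly_eqI)

text \<open>Adjoining an element \<open>a\<close>: it may be sent to any root \<open>b\<close> of the image of its minimal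
  polynomial \<open>p\<close>, because every polynomial relation for \<open>a\<close> is a multiple of \<open>p\<close>.\<close>

lemma adjoin:
  assumes p: "(p, p') \<in> poly_pairs" "p \<noteq> 0" "poly p a = 0" "poly p' b = 0"
    and min: "\<forall>q q'. (q, q') \<in> poly_pairs \<longrightarrow> q \<noteq> 0 \<longrightarrow> poly q a = 0 \<longrightarrow> degree p \<le> degree q"
  shows "partial_embedding {(poly q a, poly q' b) | q q'. (q, q') \<in> poly_pairs}" (is "partial_embedding ?H")
    and "G \<subseteq> {(poly q a, poly q' b) | q q'. (q, q') \<in> poly_pairs}"
    and "(a, b) \<in> {(poly q a, poly q' b) | q q'. (q, q') \<in> poly_pairs}"
proof -
  show GH: "G \<subseteq> ?H"
  proof safe
    fix x y assume "(x, y) \<in> G"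
    then have "(monom x 0, monom y 0) \<in> poly_pairs" by (rule pp_monom)
    then show "\<exists>q q'. (x, y) = (poly q a, poly q' b) \<and> (q, q') \<in> poly_pairs"
      by (intro exI[of _ "monom x 0"] exI[of _ "monom y 0"]) (simp add: poly_monom)
  qed
  show "(a, b) \<in> ?H"
    using pp_monom[OF pe_1, of 1] by (auto simp: poly_monom intro!: exI[of _ "monom 1 1"])
  have rel: "poly q' b = 0" if "(q, q') \<in> poly_pairs" "poly q a = 0" for q q'
    using that
  proof (induction "degree q" arbitrary: q q' rule: less_induct)
    case less
    show ?case
    proof (cases "q = 0")
      case True
      then have "q' = 0" using pp_zero less.prems(1) by blast
      then show ?thesis by simp
    next
      case False
      have d: "degree p \<le> degree q" using min less False by blast
      define k where "k = degree q - degree p"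
      define c where "c = lead_coeff q * inverse (lead_coeff p)"
      define c' where "c' = lead_coeff q' * inverse (lead_coeff p')"
      have lc: "(lead_coeff r, lead_coeff r') \<in> G" if "(r, r') \<in> poly_pairs" for r r'
        using that pp_degree[OF that] by (simp add: poly_pairs_def)
      have cG: "(c, c') \<in> G" unfolding c_def c'_def
        by (intro pe_mult pe_inverse(1) lc less p) (use p in auto)
      define q1 where "q1 = q - monom c k * p"
      define q1' where "q1' = q' - monom c' k * p'"
      have q1: "(q1, q1') \<in> poly_pairs" unfolding q1_def q1'_def by (intro pp_arith pp_monom cG less p)
      have c0: "c \<noteq> 0" using False p by (simp add: c_def)
      have dm: "degree (monom c k * p) = degree q"
        using c0 p d by (simp add: degree_mult_eq degree_monom_eq monom_eq_0_iff k_def)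
      have "coeff (monom c k * p) (degree q) = lead_coeff q"
        using p d by (simp add: coeff_monom_mult k_def c_def)
      then have "q1 = 0 \<or> degree q1 < degree q"
        unfolding q1_def using dm by (metis coeff_diff degree_diff_le diff_self eq_zero_or_degree_less leading_coeff_0_iff order_refl)
      moreover have a1: "poly q1 a = 0" using less p by (simp add: q1_def)
      ultimately have "poly q1' b = 0"
      proof (elim disjE)
        assume "q1 = 0"
        then have "q1' = 0" using q1 pp_zero by blast
        then show ?thesis by simp
      qed (use less(1)[OF _ q1] a1 in blast)
      then show ?thesis using p by (simp add: q1'_def)
    qed
  qed
  show "partial_embedding ?H"
    unfolding partial_embedding_def
  proof (intro conjI allI impI ballI)
    show "(to_ac c, to_ac c) \<in> ?H" for c using GH pe_const by blast
    show "y = 0" if "(0, y) \<in> ?H" for y using that rel by auto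
    fix x x' y y' assume "(x, x') \<in> ?H" "(y, y') \<in> ?H"
    then obtain q q' r r' where eq: "x = poly q a" "x' = poly q' b" "y = poly r a" "y' = poly r' b"
      and qr: "(q, q') \<in> poly_pairs" "(r, r') \<in> poly_pairs" by blast
    show "(x + y, x' + y') \<in> ?H"
      using pp_arith(1)[OF qr] unfolding eq poly_add[symmetric] by blast
    show "(x * y, x' * y') \<in> ?H"
      using pp_arith(2)[OF qr] unfolding eq poly_mult[symmetric] by blast
  qed
qed

lemma exists_minimal_relation:
  obtains p p' where "(p, p') \<in> poly_pairs" "p \<noteq> 0" "poly p a = 0"
    "\<forall>q q'. (q, q') \<in> poly_pairs \<longrightarrow> q \<noteq> 0 \<longrightarrow> poly q a = 0 \<longrightarrow> degree p \<le> degree q"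
proof -
  define P where "P p \<longleftrightarrow> (\<exists>p'. (p, p') \<in> poly_pairs) \<and> p \<noteq> 0 \<and> poly p a = 0" for p
  obtain p0 :: "'f poly" where p0: "p0 \<noteq> 0" "poly (map_poly to_ac p0) a = 0"
    by (rule alg_closure_algebraic)
  have "(map_poly to_ac p0, map_poly to_ac p0) \<in> poly_pairs"
    by (auto simp: poly_pairs_def coeff_map_poly pe_const)
  moreover have "map_poly to_ac p0 \<noteq> 0" using p0(1) by (simp add: map_poly_eq_0_iff)
  ultimately have "P (map_poly to_ac p0)" using p0 by (auto simp: P_def)
  then obtain p where "P p" "\<And>q. P q \<Longrightarrow> degree p \<le> degree q"
    using ex_has_least_nat[of P _ degree] by blast
  then show ?thesis using that unfolding P_def by blast
qed

end

text \<open>A maximal extension exists by the lemma of Zorn. It is defined everywhere, since another element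
  could be adjoined otherwise, and it is surjective because it permutes the finitely many roots of
  every polynomial over \<open>F\<close>.\<close>

lemma partial_embedding_extends:
  fixes G :: "('f::field alg_closure \<times> 'f alg_closure) set"
  assumes "partial_embedding G"
  obtains \<sigma> where "\<sigma> \<in> {\<sigma>. bij \<sigma> \<and> (\<forall>a b. \<sigma> (a + b) = \<sigma> a + \<sigma> b) \<and>
    (\<forall>a b. \<sigma> (a * b) = \<sigma> a * \<sigma> b) \<and> (\<forall>c. \<sigma> (to_ac c) = to_ac c)}"
    "\<And>x y. (x, y) \<in> G \<Longrightarrow> \<sigma> x = y"
proof -
  define \<G> where "\<G> = {H. partial_embedding H \<and> G \<subseteq> H}"
  have "\<exists>M\<in>\<G>. \<forall>H\<in>\<G>. M \<subseteq> H \<longrightarrow> H = M"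
  proof (rule subset_Zorn_nonempty)
    show "\<G> \<noteq> {}" using assms by (auto simp: \<G>_def)
    fix C assume C: "C \<noteq> {}" "subset.chain \<G> C"
    have inG: "H \<in> C \<Longrightarrow> partial_embedding H \<and> G \<subseteq> H" for H
      using C by (auto simp: subset.chain_def \<G>_def)
    have common: "\<exists>H\<in>C. u \<in> H \<and> v \<in> H" if "u \<in> \<Union>C" "v \<in> \<Union>C" for u v
      using that C(2) unfolding subset.chain_def by blast
    have "partial_embedding (\<Union>C)"
      unfolding partial_embedding_def
    proof (intro conjI allI impI ballI)
      obtain H where "H \<in> C" using C by blast
      then show "(to_ac c, to_ac c) \<in> \<Union>C" for c using inG pe_const by blast
      show "y = 0" if "(0, y) \<in> \<Union>C" for y using that inG pe_zero by blast
      fix x x' y y' assume "(x, x') \<in> \<Union>C" "(y, y') \<in> \<Union>C"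
      then obtain H where H: "H \<in> C" "(x, x') \<in> H" "(y, y') \<in> H" using common by blast
      then show "(x + y, x' + y') \<in> \<Union>C" "(x * y, x' * y') \<in> \<Union>C"
        using pe_add[of H] pe_mult[of H] inG[OF H(1)] by blast+
    qed
    moreover have "G \<subseteq> \<Union>C" using C(1) inG by blast
    ultimately show "\<Union>C \<in> \<G>" by (simp add: \<G>_def)
  qed
  then obtain M where M: "partial_embedding M" "G \<subseteq> M"
    and max: "\<And>H. partial_embedding H \<Longrightarrow> M \<subseteq> H \<Longrightarrow> H = M"
    unfolding \<G>_def by (metis (mono_tags, lifting) mem_Collect_eq order_trans)
  have total: "\<exists>b. (a, b) \<in> M" for a
  proof -
    obtain p p' where p: "(p, p') \<in> poly_pairs M" "p \<noteq> 0" "poly p a = 0"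
      "\<forall>q q'. (q, q') \<in> poly_pairs M \<longrightarrow> q \<noteq> 0 \<longrightarrow> poly q a = 0 \<longrightarrow> degree p \<le> degree q"
      using exists_minimal_relation[OF M(1)] by blast
    have "degree p > 0" using p(2,3) by (metis degree_0_id gr0I poly_0 poly_const_conv pCons_eq_0_iff degree_eq_zeroE)
    then obtain b where "poly p' b = 0"
      using alg_closed_imp_poly_has_root[of p'] pp_degree[OF M(1) p(1)] by auto
    from adjoin[OF M(1) p(1-3) this p(4)] max show ?thesis by blast
  qed
  define \<sigma> where "\<sigma> a = (THE b. (a, b) \<in> M)" for a
  have \<sigma>: "(a, \<sigma> a) \<in> M" for a
    unfolding \<sigma>_def using total pe_functional[OF M(1)] by (metis theI')
  have eq: "\<sigma> x = y" if "(x, y) \<in> M" for x y using \<sigma> that pe_functional[OF M(1)] by blast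
  have add: "\<sigma> (a + b) = \<sigma> a + \<sigma> b" and mult: "\<sigma> (a * b) = \<sigma> a * \<sigma> b" for a b
    using pe_add[OF M(1) \<sigma> \<sigma>] pe_mult[OF M(1) \<sigma> \<sigma>] eq by blast+
  have const: "\<sigma> (to_ac c) = to_ac c" for c using pe_const[OF M(1)] eq by blast
  have diff: "\<sigma> (a - b) = \<sigma> a - \<sigma> b" for a b using pe_diff[OF M(1) \<sigma> \<sigma>] eq by blast
  have inj: "inj \<sigma>"
  proof (rule injI)
    fix a b assume "\<sigma> a = \<sigma> b"
    then have "(a - b, 0) \<in> M" using \<sigma>[of "a - b"] diff by simp
    then show "a = b" using pe_inverse(2)[OF M(1)] by force
  qed
  have "b \<in> range \<sigma>" for b
  proof -
    obtain p :: "'f poly" where p: "p \<noteq> 0" "poly (map_poly to_ac p) b = 0" by (rule alg_closure_algebraic)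
    define R where "R = {z. poly (map_poly to_ac p) z = 0}"
    have "finite R" unfolding R_def by (rule poly_roots_finite) (use p in \<open>simp add: map_poly_eq_0_iff\<close>)
    moreover have "\<sigma> ` R \<subseteq> R"
    proof safe
      fix z assume "z \<in> R"
      then have "(0, poly (map_poly to_ac p) (\<sigma> z)) \<in> M"
        using pe_poly_const[OF M(1) \<sigma>[of z], of p] by (simp add: R_def)
      then show "\<sigma> z \<in> R" using pe_zero[OF M(1)] by (simp add: R_def)
    qed
    ultimately have "\<sigma> ` R = R" using inj by (meson endo_inj_surj inj_on_subset subset_UNIV)
    then show ?thesis using p by (auto simp: R_def)
  qed
  then have "bij \<sigma>" using inj by (auto simp: bij_def)
  then show ?thesis using that[of \<sigma>] add mult const eq M(2) by blast
qed

text \<open>An element \<open>a\<close> outside \<open>F\<close> has a conjugate \<open>b \<noteq> a\<close>: its minimal polynomial has degree at least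
  two, and a multiple root would also be a root of the derivative. The embedding of \<open>F(a)\<close> that sends
  \<open>a\<close> to \<open>b\<close> extends to an automorphism.\<close>

theorem fixed_by_absolute_galois:
  fixes a :: "'f::field_char_0 alg_closure"
  assumes "\<And>\<sigma>. \<sigma> \<in> absolute_galois \<Longrightarrow> \<sigma> a = a"
  shows "a \<in> range to_ac"
proof (rule ccontr)
  assume na: "a \<notin> range to_ac"
  define D :: "('f alg_closure \<times> 'f alg_closure) set" where "D = range (\<lambda>c. (to_ac c, to_ac c))"
  have D: "partial_embedding D"
    unfolding partial_embedding_def D_def
    by (auto simp flip: to_ac_add to_ac_mult)
  obtain p p' where p: "(p, p') \<in> poly_pairs D" "p \<noteq> 0" "poly p a = 0"
    and min: "\<forall>q q'. (q, q') \<in> poly_pairs D \<longrightarrow> q \<noteq> 0 \<longrightarrow> poly q a = 0 \<longrightarrow> degree p \<le> degree q"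
    using exists_minimal_relation[OF D] by blast
  have p': "p' = p"
  proof (rule poly_eqI)
    fix i have "(coeff p i, coeff p' i) \<in> D" using p(1) by (simp add: poly_pairs_def[OF D])
    then show "coeff p' i = coeff p i" by (auto simp: D_def)
  qed
  obtain q where q: "p = [:-a, 1:] * q" using p(3) poly_eq_0_iff_dvd[of p a] by blast
  have q0: "q \<noteq> 0" using p(2) q by auto
  have dp: "degree p = Suc (degree q)"
    unfolding q by (subst degree_mult_eq) (use q0 in auto)
  have "degree q \<noteq> 0"
  proof
    assume "degree q = 0"
    then obtain c where c: "q = [:c:]" by (rule degree_eq_zeroE)
    then have "p = [:- a * c, c:]" using q by simp
    then have "coeff p 0 = - a * c" "coeff p 1 = c" by auto
    moreover have "coeff p 0 \<in> range to_ac" "coeff p 1 \<in> range to_ac"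
      using p(1) unfolding poly_pairs_def[OF D] by (auto simp: D_def)
    ultimately obtain u w where u: "- a * c = to_ac u" "c = to_ac w" by auto
    moreover have "c \<noteq> 0" using q0 c by auto
    ultimately have w: "to_ac w \<noteq> 0" by auto
    have "a * to_ac w = to_ac (- u)" using u by (metis minus_minus mult_minus_left to_ac_minus)
    then have "a = to_ac (- u / w)" using w by (metis nonzero_eq_divide_eq to_ac_divide)
    then show False using na by blast
  qed
  then obtain b where b: "poly q b = 0" using alg_closed_imp_poly_has_root[of q] by auto
  have "b \<noteq> a"
  proof
    assume "b = a"
    then have "poly (pderiv p) a = 0" using b unfolding q pderiv_mult poly_add poly_mult by simp
    moreover have "(pderiv p, pderiv p) \<in> poly_pairs D"
    proof -
      have "(of_nat (Suc i) * coeff p (Suc i), of_nat (Suc i) * coeff p (Suc i)) \<in> D" for i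
        using pe_mult[OF D pe_const[OF D, of "of_nat (Suc i)"], of "coeff p (Suc i)" "coeff p (Suc i)"] p(1) p'
        by (simp add: poly_pairs_def[OF D])
      then show ?thesis by (simp add: poly_pairs_def[OF D] coeff_pderiv)
    qed
    moreover have "pderiv p \<noteq> 0" using dp by (simp add: pderiv_eq_0_iff)
    ultimately have "degree p \<le> degree (pderiv p)" using min by blast
    then show False using dp by (simp add: degree_pderiv)
  qed
  have "poly p' b = 0" using b p' q by simp
  note H = adjoin[OF D p(1-3) this min]
  obtain \<sigma> where \<sigma>: "\<sigma> \<in> absolute_galois" "\<sigma> a = b"
    using partial_embedding_extends[OF H(1)] H(3) unfolding absolute_galois_def
    by (metis (no_types, lifting))
  then show False using assms \<open>b \<noteq> a\<close> by auto
qed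

section \<open>Zariski topology on the general linear group\<close>

lemma carrier_GL: "g \<in> carrier (GL N) \<longleftrightarrow> g \<in> carrier_mat N N \<and> det g \<noteq> 0"
  by (simp add: GL_def)

lemma mult_GL [simp]: "g \<otimes>\<^bsub>GL N\<^esub> h = g * h" and one_GL [simp]: "\<one>\<^bsub>GL N\<^esub> = 1\<^sub>m N"
  by (simp_all add: GL_def)

lemma group_GL: "Group.group (GL N :: 'k::field mat monoid)"
proof (rule groupI)
  fix x :: "'k mat" assume x: "x \<in> carrier (GL N)"
  then obtain y where y: "y \<in> carrier_mat N N" "x * y = 1\<^sub>m N" "y * x = 1\<^sub>m N"
    using obtain_inverse_mat unfolding carrier_GL by metis
  then show "\<exists>y\<in>carrier (GL N). y \<otimes>\<^bsub>GL N\<^esub> x = \<one>\<^bsub>GL N\<^esub>"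
    using x det_nonzero_if_left_inverse[OF y(1) _ y(2)] by (intro bexI[of _ y]) (auto simp: carrier_GL)
qed (auto simp: carrier_GL det_mult[of _ N] assoc_mult_mat[of _ N N _ N _ N])

lemma inv_GL:
  assumes "g \<in> carrier (GL N)"
  shows "inv\<^bsub>GL N\<^esub> g \<in> carrier (GL N)" "inv\<^bsub>GL N\<^esub> g \<in> carrier_mat N N"
    "g * inv\<^bsub>GL N\<^esub> g = 1\<^sub>m N" "inv\<^bsub>GL N\<^esub> g * g = 1\<^sub>m N"
proof -
  interpret Group.group "GL N" by (rule group_GL)
  show "inv\<^bsub>GL N\<^esub> g \<in> carrier (GL N)" using assms by simp
  then show "inv\<^bsub>GL N\<^esub> g \<in> carrier_mat N N" by (simp add: carrier_GL)
  show "g * inv\<^bsub>GL N\<^esub> g = 1\<^sub>m N" "inv\<^bsub>GL N\<^esub> g * g = 1\<^sub>m N"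
    using r_inv[OF assms] l_inv[OF assms] by simp_all
qed

lemma inv_GL_unique:
  assumes "g \<in> carrier_mat N N" "h \<in> carrier_mat N N" "h * g = 1\<^sub>m N"
  shows "inv\<^bsub>GL N\<^esub> g = h"
proof -
  have g: "g \<in> carrier (GL N)" using assms det_nonzero_if_left_inverse by (auto simp: carrier_GL)
  have "h = h * (g * inv\<^bsub>GL N\<^esub> g)" using assms inv_GL[OF g] by simp
  also have "\<dots> = (h * g) * inv\<^bsub>GL N\<^esub> g"
    using assoc_mult_mat[OF assms(2,1) inv_GL(2)[OF g]] by simp
  also have "\<dots> = inv\<^bsub>GL N\<^esub> g" using assms inv_GL[OF g] by simp
  finally show ?thesis by simp
qed

text \<open>Only the values on \<open>S\<close> matter, so that functions given by different expressions off \<open>S\<close>, or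
  junk values outside \<open>GL N\<close>, can be compared.\<close>

definition regular_on :: "'k::field set \<Rightarrow> nat \<Rightarrow> 'k mat set \<Rightarrow> ('k mat \<Rightarrow> 'k) \<Rightarrow> bool" where
  "regular_on K N S f \<longleftrightarrow> (\<exists>r \<in> regular_functions K N. \<forall>g\<in>S. f g = r g)"

lemma regular_onI: "r \<in> regular_functions K N \<Longrightarrow> regular_on K N S r"
  by (auto simp: regular_on_def)

lemma regular_on_cong:
  "regular_on K N S f \<Longrightarrow> (\<And>g. g \<in> S \<Longrightarrow> f g = f' g) \<Longrightarrow> regular_on K N S f'"
  by (auto simp: regular_on_def)

lemma regular_on_const: "c \<in> K \<Longrightarrow> regular_on K N S (\<lambda>_. c)"
  by (intro regular_onI regular_functions.const)

lemma regular_on_entry: "i < N \<Longrightarrow> j < N \<Longrightarrow> regular_on K N S (\<lambda>A. A $$ (i, j))"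
  by (intro regular_onI regular_functions.entry)

lemma regular_on_inv_det: "regular_on K N S (\<lambda>A. inverse (det A))"
  by (intro regular_onI regular_functions.inv_det)

lemma regular_on_add: "regular_on K N S f \<Longrightarrow> regular_on K N S g \<Longrightarrow> regular_on K N S (\<lambda>A. f A + g A)"
  unfolding regular_on_def
proof (elim bexE)
  fix r s assume "\<forall>A\<in>S. f A = r A" "\<forall>A\<in>S. g A = s A" "r \<in> regular_functions K N" "s \<in> regular_functions K N"
  then show "\<exists>t\<in>regular_functions K N. \<forall>A\<in>S. f A + g A = t A"
    by (intro bexI[of _ "\<lambda>A. r A + s A"] regular_functions.add) auto
qed

lemma regular_on_mult: "regular_on K N S f \<Longrightarrow> regular_on K N S g \<Longrightarrow> regular_on K N S (\<lambda>A. f A * g A)"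
  unfolding regular_on_def
proof (elim bexE)
  fix r s assume "\<forall>A\<in>S. f A = r A" "\<forall>A\<in>S. g A = s A" "r \<in> regular_functions K N" "s \<in> regular_functions K N"
  then show "\<exists>t\<in>regular_functions K N. \<forall>A\<in>S. f A * g A = t A"
    by (intro bexI[of _ "\<lambda>A. r A * s A"] regular_functions.mult) auto
qed

lemma regular_on_sum:
  assumes "finite I" "0 \<in> K" "\<And>i. i \<in> I \<Longrightarrow> regular_on K N S (f i)"
  shows "regular_on K N S (\<lambda>A. \<Sum>i\<in>I. f i A)"
  using assms(1,3) by (induction rule: finite_induct) (auto intro!: regular_on_const regular_on_add assms(2))

lemma regular_on_prod:
  assumes "finite I" "1 \<in> K" "\<And>i. i \<in> I \<Longrightarrow> regular_on K N S (f i)"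
  shows "regular_on K N S (\<lambda>A. \<Prod>i\<in>I. f i A)"
  using assms(1,3) by (induction rule: finite_induct) (auto intro!: regular_on_const regular_on_mult assms(2))

lemma regular_on_mult_entry:
  assumes "0 \<in> K" "i < n" "j < l" "\<And>g. g \<in> S \<Longrightarrow> F g \<in> carrier_mat n m" "\<And>g. g \<in> S \<Longrightarrow> H g \<in> carrier_mat m l"
    and "\<And>k. k < m \<Longrightarrow> regular_on K N S (\<lambda>g. F g $$ (i, k))"
    and "\<And>k. k < m \<Longrightarrow> regular_on K N S (\<lambda>g. H g $$ (k, j))"
  shows "regular_on K N S (\<lambda>g. (F g * H g) $$ (i, j))"
proof (rule regular_on_cong)
  show "regular_on K N S (\<lambda>g. \<Sum>k<m. F g $$ (i, k) * H g $$ (k, j))"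
    using assms by (intro regular_on_sum regular_on_mult) auto
  show "(\<Sum>k<m. F g $$ (i, k) * H g $$ (k, j)) = (F g * H g) $$ (i, j)" if "g \<in> S" for g
    using assms(2,3) assms(4,5)[OF that] by (subst mult_mat_index_sum) auto
qed

lemma regular_on_det:
  fixes F :: "'k::field mat \<Rightarrow> 'k mat"
  assumes "\<And>g. g \<in> S \<Longrightarrow> F g \<in> carrier_mat m m"
    and "\<And>i j. i < m \<Longrightarrow> j < m \<Longrightarrow> regular_on UNIV N S (\<lambda>g. F g $$ (i, j))"
  shows "regular_on UNIV N S (\<lambda>g. det (F g))"
proof (rule regular_on_cong)
  show "regular_on UNIV N S (\<lambda>g. \<Sum>p\<in>{p. p permutes {0..<m}}. signof p * (\<Prod>i = 0..<m. F g $$ (i, p i)))"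
    using assms(2)
    by (intro regular_on_sum regular_on_mult regular_on_prod regular_on_const finite_permutations)
       (auto simp: permutes_def permutes_in_image)
  show "(\<Sum>p\<in>{p. p permutes {0..<m}}. signof p * (\<Prod>i = 0..<m. F g $$ (i, p i))) = det (F g)" if "g \<in> S" for g
    using det_def'[OF assms(1)[OF that]] by simp
qed

text \<open>By Cramer's rule.\<close>

lemma regular_on_inv_entry:
  fixes S :: "'k::field mat set"
  assumes S: "S \<subseteq> carrier (GL N)" and ij: "i < N" "j < N"
  shows "regular_on UNIV N S (\<lambda>g. (inv\<^bsub>GL N\<^esub> g) $$ (i, j))"
proof (rule regular_on_cong)
  have "regular_on UNIV N S (\<lambda>g. det (mat_delete g j i))"
  proof (rule regular_on_det[of _ _ "N - 1"])
    fix k l assume kl: "k < N - 1" "l < N - 1"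
    show "regular_on UNIV N S (\<lambda>g. mat_delete g j i $$ (k, l))"
    proof (rule regular_on_cong)
      show "regular_on UNIV N S (\<lambda>g. g $$ (insert_index j k, insert_index i l))"
        using kl by (intro regular_on_entry) (auto simp: insert_index_def)
      show "g $$ (insert_index j k, insert_index i l) = mat_delete g j i $$ (k, l)" if "g \<in> S" for g
        using that S kl ij mat_delete_index[of g "N - 1" j i k l] by (auto simp: carrier_GL)
    qed
  qed (use S ij mat_delete_carrier in \<open>force simp: carrier_GL\<close>)
  then show "regular_on UNIV N S (\<lambda>g. inverse (det g) * ((-1) ^ (j + i) * det (mat_delete g j i)))"
    by (intro regular_on_mult regular_on_inv_det regular_on_const) auto
  fix g assume "g \<in> S"
  then have g: "g \<in> carrier_mat N N" "det g \<noteq> 0" using S by (auto simp: carrier_GL)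
  have "inv\<^bsub>GL N\<^esub> g = inverse (det g) \<cdot>\<^sub>m adj_mat g"
  proof (rule inv_GL_unique)
    have "inverse (det g) \<cdot>\<^sub>m adj_mat g * g = inverse (det g) \<cdot>\<^sub>m (adj_mat g * g)"
      using adj_mat(1)[OF g(1)] g(1) by (simp add: mult_smult_assoc_mat)
    also have "\<dots> = 1\<^sub>m N" unfolding adj_mat(3)[OF g(1)] using g(2) by auto
    finally show "inverse (det g) \<cdot>\<^sub>m adj_mat g * g = 1\<^sub>m N" .
  qed (use g adj_mat(1)[OF g(1)] in auto)
  then show "inverse (det g) * ((-1) ^ (j + i) * det (mat_delete g j i)) = (inv\<^bsub>GL N\<^esub> g) $$ (i, j)"
    using g ij by (simp add: adj_mat_def cofactor_def)
qed

lemma topspace_zariski [simp]: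
  fixes K :: "'k::field set"
  assumes "1 \<in> K"
  shows "topspace (zariski K N) = carrier (GL N)"
proof
  have "(\<lambda>_. 1) \<in> regular_functions K N" using assms by (rule regular_functions.const)
  then have "carrier (GL N) \<in> (\<lambda>f. {A \<in> carrier (GL N). f A \<noteq> 0}) ` regular_functions K N"
    by (rule rev_image_eqI) simp
  then show "carrier (GL N) \<subseteq> topspace (zariski K N)"
    unfolding zariski_def topology_generated_by_topspace by (rule Union_upper)
qed (auto simp: zariski_def)

lemma openin_zariski_nonzero:
  "r \<in> regular_functions K N \<Longrightarrow> openin (zariski K N) {A \<in> carrier (GL N). r A \<noteq> 0}"
  unfolding zariski_def by (rule topology_generated_by_Basis) auto

lemma closedin_zariski_zero:
  fixes K :: "'k::field set"
  assumes "1 \<in> K" "regular_on K N (carrier (GL N)) f"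
  shows "closedin (zariski K N) {A \<in> carrier (GL N). f A = 0}"
proof -
  obtain r where r: "r \<in> regular_functions K N" "\<And>g. g \<in> carrier (GL N) \<Longrightarrow> f g = r g"
    using assms(2) by (auto simp: regular_on_def)
  have "{A \<in> carrier (GL N). f A = 0} = topspace (zariski K N) - {A \<in> carrier (GL N). r A \<noteq> 0}"
    using r assms(1) by auto
  then show ?thesis
    by (simp only:) (intro closedin_diff closedin_topspace openin_zariski_nonzero r)
qed

lemma regular_on_compose:
  fixes \<phi> :: "'k::field mat \<Rightarrow> 'k mat"
  assumes "r \<in> regular_functions UNIV M"
    and "\<And>i j. i < M \<Longrightarrow> j < M \<Longrightarrow> regular_on UNIV N S (\<lambda>g. \<phi> g $$ (i, j))"
    and "regular_on UNIV N S (\<lambda>g. inverse (det (\<phi> g)))"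
  shows "regular_on UNIV N S (\<lambda>g. r (\<phi> g))"
  using assms(1)
  by induction (auto intro: assms regular_on_const regular_on_add regular_on_mult)

lemma connectedin_regular_image:
  fixes \<phi> :: "'k::field mat \<Rightarrow> 'k mat"
  assumes S: "connectedin (zariski UNIV N) S" and \<phi>: "\<phi> ` S \<subseteq> carrier (GL M)"
    and reg: "\<And>i j. i < M \<Longrightarrow> j < M \<Longrightarrow> regular_on UNIV N S (\<lambda>g. \<phi> g $$ (i, j))"
      "regular_on UNIV N S (\<lambda>g. inverse (det (\<phi> g)))"
  shows "connectedin (zariski UNIV M) (\<phi> ` S)"
proof -
  have SG: "S \<subseteq> carrier (GL N)" using connectedin_subset_topspace[OF S] by simp
  have "continuous_map (subtopology (zariski UNIV N) S) (zariski UNIV M) \<phi>"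
    unfolding zariski_def[of _ M] continuous_on_generated_topo_iff
  proof (intro conjI allI impI)
    fix U :: "'k mat set" assume "U \<in> (\<lambda>f. {A \<in> carrier (GL M). f A \<noteq> 0}) ` regular_functions UNIV M"
    then obtain f where f: "f \<in> regular_functions UNIV M" "U = {A \<in> carrier (GL M). f A \<noteq> 0}" by blast
    obtain r where r: "r \<in> regular_functions UNIV N" "\<forall>g\<in>S. f (\<phi> g) = r g"
      using regular_on_compose[OF f(1) reg] unfolding regular_on_def by blast
    have "\<phi> -` U \<inter> topspace (subtopology (zariski UNIV N) S) = {A \<in> carrier (GL N). r A \<noteq> 0} \<inter> S"
      using r(2) f(2) \<phi> SG by auto
    then show "openin (subtopology (zariski UNIV N) S) (\<phi> -` U \<inter> topspace (subtopology (zariski UNIV N) S))"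
      using openin_zariski_nonzero[OF r(1)] by (auto simp: openin_subtopology)
  next
    have "\<Union> ((\<lambda>f. {A \<in> carrier (GL M). f A \<noteq> 0}) ` regular_functions UNIV M) = carrier (GL M)"
      using topspace_zariski[of UNIV M] by (simp add: zariski_def)
    then show "\<phi> ` topspace (subtopology (zariski UNIV N) S) \<subseteq> \<Union> ((\<lambda>f. {A \<in> carrier (GL M). f A \<noteq> 0}) ` regular_functions UNIV M)"
      using \<phi> by (simp only: topspace_subtopology) blast
  qed
  then show ?thesis
    by (rule connectedin_continuous_map_image) (simp add: connectedin_subtopology S)
qed

text \<open>The remaining sets of the cover form the closed complement.\<close>

lemma connectedin_finite_closed_cover:
  assumes S: "connectedin T S" and I: "finite I" "\<And>i. i \<in> I \<Longrightarrow> closedin T (C i)"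
    and cover: "S \<subseteq> (\<Union>i\<in>I. C i)" and disj: "\<And>i j. i \<in> I \<Longrightarrow> j \<in> I \<Longrightarrow> i \<noteq> j \<Longrightarrow> C i \<inter> C j \<inter> S = {}"
    and s: "s \<in> S" "s \<in> C i" "i \<in> I"
  shows "S \<subseteq> C i"
proof -
  let ?E = "\<Union>j\<in>I - {i}. C j"
  have "closedin T ?E" using I by (intro closedin_Union) auto
  moreover have "closedin T (C i)" using I s by blast
  moreover have "S \<subseteq> C i \<union> ?E" using cover by blast
  moreover have "C i \<inter> ?E \<inter> S = {}" using disj s by blast
  ultimately have "?E \<inter> S = {}"
    using S s unfolding connectedin_closedin by blast
  then show ?thesis using \<open>S \<subseteq> C i \<union> ?E\<close> by blast
qed

text \<open>A ratio of regular functions with finitely many values is constant on a connected set. The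
  vectors \<open>F g\<close> and \<open>H g\<close> are proportional, and the sets on which the factor has a given value are
  closed and disjoint.\<close>

lemma connectedin_constant_ratio:
  fixes F H :: "nat \<Rightarrow> 'k::field mat \<Rightarrow> 'k"
  assumes S: "connectedin (zariski UNIV N) S" and fin: "finite \<Lambda>"
    and val: "\<And>g. g \<in> S \<Longrightarrow> \<exists>c\<in>\<Lambda>. \<forall>i<m. F i g = c * H i g"
    and nz: "\<And>g. g \<in> S \<Longrightarrow> \<exists>i<m. H i g \<noteq> 0"
    and reg: "\<And>i. i < m \<Longrightarrow> regular_on UNIV N (carrier (GL N)) (F i)"
      "\<And>i. i < m \<Longrightarrow> regular_on UNIV N (carrier (GL N)) (H i)"
    and s: "s \<in> S" "\<forall>i<m. F i s = c0 * H i s" and g: "g \<in> S" and i: "i < m"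
  shows "F i g = c0 * H i g"
proof -
  define C where "C c = carrier (GL N) \<inter> (\<Inter>i\<in>{..<m}. {A \<in> carrier (GL N). F i A + (- c) * H i A = 0})" for c
  have SG: "S \<subseteq> carrier (GL N)" using connectedin_subset_topspace[OF S] by simp
  have Ceq: "A \<in> C c \<longleftrightarrow> A \<in> carrier (GL N) \<and> (\<forall>i<m. F i A = c * H i A)" for A c
    by (auto simp: C_def)
  have sC: "s \<in> C c0" using s SG by (auto simp: Ceq)
  have "S \<subseteq> C c0"
  proof (rule connectedin_finite_closed_cover[OF S, of "insert c0 \<Lambda>"])
    fix c :: 'k
    have "closedin (zariski UNIV N) {A \<in> carrier (GL N). F i A + (- c) * H i A = 0}" if "i < m" for i
      using that reg by (intro closedin_zariski_zero regular_on_add regular_on_mult regular_on_const) auto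
    moreover have "closedin (zariski UNIV N) (carrier (GL N))"
      using closedin_topspace[of "zariski UNIV N"] by simp
    ultimately show "closedin (zariski UNIV N) (C c)"
      unfolding C_def by (cases "m = 0") (auto intro!: closedin_Int closedin_INT)
  next
    show "S \<subseteq> (\<Union>c\<in>insert c0 \<Lambda>. C c)" using val SG by (force simp: Ceq)
    fix c d :: 'k assume "c \<noteq> d"
    then show "C c \<inter> C d \<inter> S = {}" using nz by (force simp: Ceq)
  qed (use fin s sC in auto)
  then show ?thesis using g i Ceq by blast
qed

lemma regular_on_mult_vec:
  assumes "F \<in> carrier_mat m N" "w \<in> carrier_vec N" "i < m"
  shows "regular_on UNIV N (carrier (GL N)) (\<lambda>g. (F *\<^sub>v (g *\<^sub>v w)) $ i)"
proof (rule regular_on_cong)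
  show "regular_on UNIV N (carrier (GL N)) (\<lambda>g. \<Sum>k<N. F $$ (i, k) * (\<Sum>j<N. g $$ (k, j) * w $ j))"
    by (intro regular_on_sum regular_on_mult regular_on_const regular_on_entry) auto
  show "(\<Sum>k<N. F $$ (i, k) * (\<Sum>j<N. g $$ (k, j) * w $ j)) = (F *\<^sub>v (g *\<^sub>v w)) $ i"
    if "g \<in> carrier (GL N)" for g
  proof -
    have g: "g \<in> carrier_mat N N" using that by (simp add: carrier_GL)
    then have gk: "(g *\<^sub>v w) $ k = (\<Sum>j<N. g $$ (k, j) * w $ j)" if "k < N" for k
      using that assms(2) mult_mat_vec_index_sum[of k g w] by simp
    have "(F *\<^sub>v (g *\<^sub>v w)) $ i = (\<Sum>k<N. F $$ (i, k) * (g *\<^sub>v w) $ k)"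
      using g assms mult_mat_vec_index_sum[of i F "g *\<^sub>v w"] by simp
    also have "\<dots> = (\<Sum>k<N. F $$ (i, k) * (\<Sum>j<N. g $$ (k, j) * w $ j))"
      by (rule sum.cong) (simp_all only: lessThan_iff gk)
    finally show ?thesis by simp
  qed
qed

section \<open>Common eigenvectors of connected solvable groups\<close>

definition vec_subspace :: "nat \<Rightarrow> 'k::field vec set \<Rightarrow> bool" where
  "vec_subspace N W \<longleftrightarrow> W \<subseteq> carrier_vec N \<and> 0\<^sub>v N \<in> W \<and>
    (\<forall>u\<in>W. \<forall>w\<in>W. u + w \<in> W) \<and> (\<forall>c. \<forall>w\<in>W. c \<cdot>\<^sub>v w \<in> W)"

lemma vec_subspaceD:
  assumes "vec_subspace N W"
  shows "w \<in> W \<Longrightarrow> w \<in> carrier_vec N" "0\<^sub>v N \<in> W" "u \<in> W \<Longrightarrow> w \<in> W \<Longrightarrow> u + w \<in> W"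
    "w \<in> W \<Longrightarrow> c \<cdot>\<^sub>v w \<in> W"
  using assms by (auto simp: vec_subspace_def)

text \<open>The action of a polynomial in \<open>b\<close> on \<open>w\<close>, evaluated by the Horner scheme.\<close>

definition horner :: "'k::field mat \<Rightarrow> 'k vec \<Rightarrow> 'k poly \<Rightarrow> 'k vec" where
  "horner b w p = fold_coeffs (\<lambda>a u. a \<cdot>\<^sub>v w + b *\<^sub>v u) p (0\<^sub>v (dim_vec w))"

context
  fixes N :: nat and b :: "'k::field mat" and w :: "'k vec"
  assumes b: "b \<in> carrier_mat N N" and w: "w \<in> carrier_vec N"
begin

lemma horner_0: "horner b w 0 = 0\<^sub>v N"
  using w by (simp add: horner_def)

lemma horner_pCons: "horner b w (pCons a p) = a \<cdot>\<^sub>v w + b *\<^sub>v horner b w p"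
proof (cases "a = 0 \<and> p = 0")
  case True
  have "b *\<^sub>v 0\<^sub>v N = 0\<^sub>v N" using b by (intro eq_vecI) (auto simp: mult_mat_vec_index_sum)
  then show ?thesis using True w by (auto simp: horner_0)
qed (use w in \<open>auto simp: horner_def\<close>)

lemma horner_carrier: "horner b w p \<in> carrier_vec N"
  by (induction p) (use b w in \<open>auto simp: horner_0 horner_pCons\<close>)

lemma horner_add: "horner b w (p + q) = horner b w p + horner b w q"
proof (induction p q rule: poly_induct2)
  case 0 then show ?case by (simp add: horner_0)
next
  case (pCons a p c q)
  have "horner b w (pCons a p + pCons c q) = (a + c) \<cdot>\<^sub>v w + (b *\<^sub>v horner b w p + b *\<^sub>v horner b w q)"
    using pCons b horner_carrier by (simp add: horner_pCons mult_add_distrib_mat_vec[of _ N N])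
  also have "\<dots> = (a \<cdot>\<^sub>v w + b *\<^sub>v horner b w p) + (c \<cdot>\<^sub>v w + b *\<^sub>v horner b w q)"
    by (rule eq_vecI) (use w b horner_carrier in \<open>auto simp: algebra_simps\<close>)
  finally show ?case by (simp add: horner_pCons)
qed

lemma horner_smult: "horner b w (smult c p) = c \<cdot>\<^sub>v horner b w p"
proof (induction p)
  case 0 show ?case unfolding smult_0_right horner_0 by (rule eq_vecI) auto
next
  case (pCons a p)
  have "horner b w (smult c (pCons a p)) = (c * a) \<cdot>\<^sub>v w + c \<cdot>\<^sub>v (b *\<^sub>v horner b w p)"
    using pCons b horner_carrier by (simp add: horner_pCons mult_mat_vec[of _ N N])
  also have "\<dots> = c \<cdot>\<^sub>v (a \<cdot>\<^sub>v w + b *\<^sub>v horner b w p)"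
    by (rule eq_vecI) (use w b horner_carrier in \<open>auto simp: algebra_simps\<close>)
  finally show ?case by (simp add: horner_pCons)
qed

lemma horner_linear_factor:
  "horner b w ([:- a, 1:] * q) = b *\<^sub>v horner b w q + (- a) \<cdot>\<^sub>v horner b w q"
proof -
  have "[:- a, 1:] * q = pCons 0 q + smult (- a) q" by (simp add: mult_pCons_left)
  then have "horner b w ([:- a, 1:] * q) = (0 \<cdot>\<^sub>v w + b *\<^sub>v horner b w q) + (- a) \<cdot>\<^sub>v horner b w q"
    by (simp only: horner_add horner_smult horner_pCons)
  moreover have "0 \<cdot>\<^sub>v w + b *\<^sub>v horner b w q = b *\<^sub>v horner b w q"
    by (rule eq_vecI) (use w b in auto)
  ultimately show ?thesis by simp
qed

lemma horner_monom: "horner b w (monom a k) = a \<cdot>\<^sub>v ((\<lambda>u. b *\<^sub>v u) ^^ k) w"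
proof (induction k)
  case 0
  have "b *\<^sub>v 0\<^sub>v N = 0\<^sub>v N" using b by (intro eq_vecI) (auto simp: mult_mat_vec_index_sum)
  then show ?case using w by (auto simp: monom_0 horner_pCons horner_0)
next
  case (Suc k)
  have c: "((\<lambda>u. b *\<^sub>v u) ^^ k) w \<in> carrier_vec N" by (induction k) (use b w in auto)
  have "horner b w (monom a (Suc k)) = 0 \<cdot>\<^sub>v w + b *\<^sub>v (a \<cdot>\<^sub>v ((\<lambda>u. b *\<^sub>v u) ^^ k) w)"
    by (simp add: monom_Suc horner_pCons Suc)
  also have "\<dots> = a \<cdot>\<^sub>v (b *\<^sub>v ((\<lambda>u. b *\<^sub>v u) ^^ k) w)"
    using mult_mat_vec[OF b c] by (intro eq_vecI) (use w b c in auto)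
  finally show ?case by simp
qed

lemma horner_sum_index:
  assumes "finite A" "i < N"
  shows "horner b w (\<Sum>k\<in>A. f k) $ i = (\<Sum>k\<in>A. horner b w (f k) $ i)"
  using assms(1)
proof (induction rule: finite_induct)
  case empty then show ?case using assms by (simp add: horner_0)
next
  case (insert x A)
  then show ?case using assms(2) carrier_vecD[OF horner_carrier[of "sum f A"]]
    by (simp add: horner_add)
qed

text \<open>The \<open>N + 1\<close> vectors \<open>w, bw, \<dots>, b\<^sup>N w\<close> are linearly dependent.\<close>

lemma exists_annihilating_poly: "\<exists>p. p \<noteq> 0 \<and> horner b w p = 0\<^sub>v N"
proof -
  define u where "u k = ((\<lambda>u. b *\<^sub>v u) ^^ k) w" for k
  define M where "M = mat (Suc N) (Suc N) (\<lambda>(i, j). if i < N then u j $ i else 0)"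
  have MC: "M \<in> carrier_mat (Suc N) (Suc N)" by (simp add: M_def)
  have "M\<^sup>T *\<^sub>v unit_vec (Suc N) N = 0\<^sub>v (Suc N)"
    by (rule eq_vecI) (auto simp: M_def)
  then have "det M\<^sup>T = 0"
    using MC by (subst det_0_iff_vec_prod_zero_field[of _ "Suc N"]) (auto intro!: exI[of _ "unit_vec (Suc N) N"])
  then have "det M = 0" using det_transpose[OF MC] by simp
  then obtain x where x: "x \<in> carrier_vec (Suc N)" "x \<noteq> 0\<^sub>v (Suc N)" "M *\<^sub>v x = 0\<^sub>v (Suc N)"
    using det_0_iff_vec_prod_zero_field[OF MC] by blast
  define p where "p = (\<Sum>k<Suc N. monom (x $ k) k)"
  have cp: "coeff p k = x $ k" if "k < Suc N" for k
    using that by (simp add: p_def coeff_sum coeff_monom)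
  obtain k where "k < Suc N" "x $ k \<noteq> 0" using x by (metis carrier_vecD eq_vecI index_zero_vec)
  then have "p \<noteq> 0" using cp by force
  moreover have "horner b w p = 0\<^sub>v N"
  proof (rule eq_vecI)
    fix i assume "i < dim_vec (0\<^sub>v N :: 'k vec)"
    then have i: "i < N" by simp
    have uC: "u k \<in> carrier_vec N" for k unfolding u_def by (induction k) (use b w in auto)
    have "horner b w p $ i = (\<Sum>k<Suc N. (x $ k \<cdot>\<^sub>v u k) $ i)"
      unfolding p_def using i by (subst horner_sum_index) (auto simp: horner_monom u_def)
    also have "\<dots> = (\<Sum>k<Suc N. M $$ (i, k) * x $ k)"
      by (rule sum.cong[OF refl]) (use i carrier_vecD[OF uC] in \<open>auto simp: M_def\<close>)
    also have "\<dots> = (M *\<^sub>v x) $ i"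
      using mult_mat_vec_index_sum[of i M x] MC x(1) i by simp
    also have "\<dots> = 0\<^sub>v N $ i" using x(3) i by simp
    finally show "horner b w p $ i = 0\<^sub>v N $ i" .
  qed (use horner_carrier in auto)
  ultimately show ?thesis by blast
qed

end

lemma smult_vec_cancel_eq:
  fixes x y :: "'k::field vec"
  assumes "x \<in> carrier_vec N" "y \<in> carrier_vec N" "x + (- a) \<cdot>\<^sub>v y = 0\<^sub>v N"
  shows "x = a \<cdot>\<^sub>v y"
proof (rule eq_vecI)
  fix i assume "i < dim_vec (a \<cdot>\<^sub>v y)"
  then have i: "i < N" using assms by simp
  then have "(x + (- a) \<cdot>\<^sub>v y) $ i = 0" using assms(3) by simp
  then show "x $ i = (a \<cdot>\<^sub>v y) $ i" using i assms(1,2) by simp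
qed (use assms in auto)

text \<open>Among the linear factors of a polynomial \<open>p\<close> with \<open>p(b) w = 0\<close>, one kills a vector of \<open>W\<close> of the form
  \<open>q(b) w \<noteq> 0\<close>.\<close>

lemma eigenvector_in_stable_subspace:
  fixes b :: "'k::alg_closed_field mat"
  assumes b: "b \<in> carrier_mat N N" and W: "vec_subspace N W" and st: "\<And>w. w \<in> W \<Longrightarrow> b *\<^sub>v w \<in> W"
    and w: "w \<in> W" "w \<noteq> 0\<^sub>v N"
  shows "\<exists>u\<in>W. u \<noteq> 0\<^sub>v N \<and> (\<exists>c. b *\<^sub>v u = c \<cdot>\<^sub>v u)"
proof -
  have wC: "w \<in> carrier_vec N" using vec_subspaceD(1)[OF W w(1)] .
  have hW: "horner b w p \<in> W" for p
    by (induction p) (auto simp: horner_0[OF b wC] horner_pCons[OF b wC] intro!: vec_subspaceD[OF W] st w)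
  have "\<exists>u\<in>W. u \<noteq> 0\<^sub>v N \<and> (\<exists>c. b *\<^sub>v u = c \<cdot>\<^sub>v u)" if "p \<noteq> 0" "horner b w p = 0\<^sub>v N" for p
    using that
  proof (induction "degree p" arbitrary: p)
    case 0
    then obtain c where c: "p = [:c:]" "c \<noteq> 0" by (metis degree_eq_zeroE pCons_eq_0_iff)
    have "b *\<^sub>v 0\<^sub>v N = 0\<^sub>v N" using b by (intro eq_vecI) (auto simp: mult_mat_vec_index_sum)
    then have "c \<cdot>\<^sub>v w = 0\<^sub>v N" using 0 wC unfolding c by (auto simp: horner_pCons[OF b wC] horner_0[OF b wC])
    then have "w = 0\<^sub>v N" using c(2) wC
      by (metis carrier_vecD eq_vecI index_smult_vec(1) index_zero_vec mult_eq_0_iff)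
    then show ?case using w by simp
  next
    case (Suc k)
    then obtain a where "poly p a = 0" using alg_closed_imp_poly_has_root[of p] by auto
    then obtain q where q: "p = [:- a, 1:] * q" using poly_eq_0_iff_dvd[of p a] by blast
    have q0: "q \<noteq> 0" using Suc.prems q by auto
    have dq: "k = degree q" using Suc(2) q0 unfolding q by (subst (asm) degree_mult_eq) auto
    show ?case
    proof (cases "horner b w q = 0\<^sub>v N")
      case True then show ?thesis using Suc(1)[OF dq q0] by blast
    next
      case False
      have "b *\<^sub>v horner b w q = a \<cdot>\<^sub>v horner b w q"
        by (rule smult_vec_cancel_eq[of _ N])
           (use Suc.prems(2) b horner_carrier[OF b wC] in \<open>auto simp: q horner_linear_factor[OF b wC] simp del: mult_pCons_left\<close>)
      then show ?thesis using False hW by blast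
    qed
  qed
  then show ?thesis using exists_annihilating_poly[OF b wC] by blast
qed

text \<open>The positions of the leading entries of the vectors in \<open>W\<close>; their number is the dimension.\<close>

definition pivots :: "nat \<Rightarrow> 'k::field vec set \<Rightarrow> nat set" where
  "pivots N W = {i. i < N \<and> (\<exists>w\<in>W. w $ i \<noteq> 0 \<and> (\<forall>j<i. w $ j = 0))}"

lemma finite_pivots [simp]: "finite (pivots N W)"
  by (simp add: pivots_def)

text \<open>Gaussian elimination: the leading entry of \<open>w \<in> W\<close> can be cancelled by an element of \<open>W0\<close>, which
  moves the first nonzero position further to the right.\<close>

lemma subspace_eq_if_same_pivots:
  fixes W W0 :: "'k::field vec set"
  assumes W: "vec_subspace N W" and W0: "vec_subspace N W0" "W0 \<subseteq> W" and piv: "pivots N W \<subseteq> pivots N W0"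
  shows "W \<subseteq> W0"
proof -
  have "\<forall>w\<in>W. (\<forall>j<k. w $ j = 0) \<longrightarrow> w \<in> W0" if "k \<le> N" for k
    using that
  proof (induction k rule: inc_induct)
    case base
    show ?case
    proof safe
      fix w :: "'k vec" assume "w \<in> W" "\<forall>j<N. w $ j = 0"
      then have "w = 0\<^sub>v N" using vec_subspaceD(1)[OF W] by (intro eq_vecI) auto
      then show "w \<in> W0" using vec_subspaceD(2)[OF W0(1)] by simp
    qed
  next
    case (step k)
    show ?case
    proof safe
      fix w :: "'k vec" assume w: "w \<in> W" "\<forall>j<k. w $ j = 0"
      show "w \<in> W0"
      proof (cases "w $ k = 0")
        case True then show ?thesis using step.IH w less_Suc_eq by auto
      next
        case False
        then have "k \<in> pivots N W0" using w step.hyps piv by (auto simp: pivots_def)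
        then obtain v where v: "v \<in> W0" "v $ k \<noteq> 0" "\<forall>j<k. v $ j = 0" by (auto simp: pivots_def)
        define c where "c = w $ k / v $ k"
        define u where "u = w + (- c) \<cdot>\<^sub>v v"
        have C: "w \<in> carrier_vec N" "v \<in> carrier_vec N" using w v W0 vec_subspaceD(1)[OF W] by auto
        have "u \<in> W" unfolding u_def using w v W0 by (intro vec_subspaceD[OF W]) auto
        moreover have "\<forall>j<Suc k. u $ j = 0"
          using C w v step.hyps by (auto simp: u_def c_def less_Suc_eq)
        ultimately have "u \<in> W0" using step.IH by blast
        then have "u + c \<cdot>\<^sub>v v \<in> W0" by (intro vec_subspaceD[OF W0(1)] v)
        moreover have "u + c \<cdot>\<^sub>v v = w" using C by (intro eq_vecI) (auto simp: u_def)
        ultimately show ?thesis by simp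
      qed
    qed
  qed
  from this[of 0] show ?thesis by auto
qed

text \<open>In a minimal nonzero stable subspace every matrix of \<open>G\<close> acts as a scalar: its eigenspaces are
  stable under the matrices that commute with it.\<close>

lemma commuting_common_eigenvector:
  fixes G :: "'k::alg_closed_field mat set"
  assumes G: "G \<subseteq> carrier_mat N N" and W: "vec_subspace N W" "W \<noteq> {0\<^sub>v N}"
    and st: "\<And>g w. g \<in> G \<Longrightarrow> w \<in> W \<Longrightarrow> g *\<^sub>v w \<in> W"
    and comm: "\<And>a b w. a \<in> G \<Longrightarrow> b \<in> G \<Longrightarrow> w \<in> W \<Longrightarrow> a *\<^sub>v (b *\<^sub>v w) = b *\<^sub>v (a *\<^sub>v w)"
  shows "\<exists>w\<in>W. w \<noteq> 0\<^sub>v N \<and> (\<forall>g\<in>G. \<exists>c. g *\<^sub>v w = c \<cdot>\<^sub>v w)"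
proof -
  define P where "P V \<longleftrightarrow> vec_subspace N V \<and> V \<subseteq> W \<and> V \<noteq> {0\<^sub>v N} \<and> (\<forall>g\<in>G. \<forall>w\<in>V. g *\<^sub>v w \<in> V)" for V
  have "P W" using W st by (auto simp: P_def)
  then obtain V where V: "P V" and min: "\<And>U. P U \<Longrightarrow> card (pivots N V) \<le> card (pivots N U)"
    using ex_has_least_nat[of P W "\<lambda>V. card (pivots N V)"] by blast
  have Vs: "vec_subspace N V" "V \<subseteq> W" using V by (auto simp: P_def)
  obtain w where w: "w \<in> V" "w \<noteq> 0\<^sub>v N" using V vec_subspaceD(2)[OF Vs(1)] by (auto simp: P_def)
  have "\<exists>c. g *\<^sub>v w = c \<cdot>\<^sub>v w" if g: "g \<in> G" for g
  proof -
    have gC: "g \<in> carrier_mat N N" using g G by blast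
    obtain u c where u: "u \<in> V" "u \<noteq> 0\<^sub>v N" "g *\<^sub>v u = c \<cdot>\<^sub>v u"
      using eigenvector_in_stable_subspace[OF gC Vs(1) _ w] V g unfolding P_def by blast
    define U where "U = {x \<in> V. g *\<^sub>v x = c \<cdot>\<^sub>v x}"
    have "vec_subspace N U"
      unfolding vec_subspace_def U_def
      using vec_subspaceD[OF Vs(1)] gC
      by (auto simp: mult_add_distrib_mat_vec[of _ N N] smult_add_distrib_vec[of _ N] mult_mat_vec[of _ N N]
          smult_smult_assoc mult.commute intro!: eq_vecI)
    moreover have "h *\<^sub>v x \<in> U" if "h \<in> G" "x \<in> U" for h x
    proof -
      have x: "x \<in> V" "g *\<^sub>v x = c \<cdot>\<^sub>v x" using that by (auto simp: U_def)
      have "g *\<^sub>v (h *\<^sub>v x) = h *\<^sub>v (g *\<^sub>v x)" using comm g that x Vs by blast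
      also have "\<dots> = c \<cdot>\<^sub>v (h *\<^sub>v x)"
        using x that G vec_subspaceD(1)[OF Vs(1)] by (auto simp: mult_mat_vec[of _ N N])
      finally show ?thesis using V x that by (auto simp: U_def P_def)
    qed
    moreover have "U \<subseteq> V" "u \<in> U" using u by (auto simp: U_def)
    ultimately have PU: "P U" unfolding P_def using Vs u by blast
    have "pivots N U \<subseteq> pivots N V" using \<open>U \<subseteq> V\<close> by (auto simp: pivots_def)
    then have "pivots N U = pivots N V" using min[OF PU] by (intro card_seteq) auto
    then have "V \<subseteq> U" using subspace_eq_if_same_pivots[OF Vs(1) _ \<open>U \<subseteq> V\<close>] PU by (auto simp: P_def)
    then show ?thesis using w by (auto simp: U_def)
  qed
  then show ?thesis using w Vs by blast
qed

lemma mult_mat_zero_vec: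
  fixes A :: "'k::field mat"
  assumes "A \<in> carrier_mat n m"
  shows "A *\<^sub>v 0\<^sub>v m = 0\<^sub>v n"
  using assms by (intro eq_vecI) (auto simp: mult_mat_vec_index_sum)

lemma finite_eigenvalues:
  fixes h :: "'k::field mat"
  assumes "h \<in> carrier_mat N N"
  shows "finite {c. eigenvalue h c}"
proof -
  have "coeff (char_poly h) N = 1" using degree_monic_char_poly[OF assms] by simp
  then have "char_poly h \<noteq> 0" by auto
  then show ?thesis using poly_roots_finite eigenvalue_root_char_poly[OF assms] by simp
qed

lemma eigenvalueI:
  assumes "h \<in> carrier_mat N N" "u \<in> carrier_vec N" "u \<noteq> 0\<^sub>v N" "h *\<^sub>v u = c \<cdot>\<^sub>v u"
  shows "eigenvalue h c"
  using assms unfolding eigenvalue_def eigenvector_def by auto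

lemma GL_mult_vec_nonzero:
  fixes g :: "'k::field mat"
  assumes "g \<in> carrier (GL N)" "u \<in> carrier_vec N" "u \<noteq> 0\<^sub>v N"
  shows "g *\<^sub>v u \<noteq> 0\<^sub>v N"
  using assms det_0_iff_vec_prod_zero_field[of g N] by (auto simp: carrier_GL)

lemma smult_vec_right_cancel:
  fixes u :: "'k::field vec"
  assumes "u \<in> carrier_vec N" "u \<noteq> 0\<^sub>v N" "a \<cdot>\<^sub>v u = c \<cdot>\<^sub>v u"
  shows "a = c"
proof -
  obtain i where "i < N" "u $ i \<noteq> 0" using assms by (metis carrier_vecD eq_vecI index_zero_vec)
  moreover have "(a \<cdot>\<^sub>v u) $ i = (c \<cdot>\<^sub>v u) $ i" using assms(3) by simp
  ultimately show ?thesis using assms(1) by simp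
qed

text \<open>If all \<open>gu\<close>, \<open>g\<close> in a connected group, are eigenvectors of the same matrix, then for the same
  eigenvalue, since a matrix has only finitely many eigenvalues.\<close>

lemma connectedin_same_eigenvalue:
  fixes G :: "'k::field mat set"
  assumes G: "connectedin (zariski UNIV N) G" "1\<^sub>m N \<in> G"
    and h: "h \<in> carrier_mat N N" and u: "u \<in> carrier_vec N" "u \<noteq> 0\<^sub>v N"
    and ev: "\<And>g. g \<in> G \<Longrightarrow> \<exists>c. h *\<^sub>v (g *\<^sub>v u) = c \<cdot>\<^sub>v (g *\<^sub>v u)"
    and c: "h *\<^sub>v u = c \<cdot>\<^sub>v u" and g: "g \<in> G"
  shows "h *\<^sub>v (g *\<^sub>v u) = c \<cdot>\<^sub>v (g *\<^sub>v u)"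
proof -
  have GG: "G \<subseteq> carrier (GL N)" using connectedin_subset_topspace[OF G(1)] by simp
  have guC: "g *\<^sub>v u \<in> carrier_vec N" if "g \<in> G" for g
  proof (rule mult_mat_vec_carrier[OF _ u(1)])
    show "g \<in> carrier_mat N N" using that GG by (auto simp: carrier_GL)
  qed
  have nz: "g *\<^sub>v u \<noteq> 0\<^sub>v N" if "g \<in> G" for g using GL_mult_vec_nonzero u GG that by blast
  have idx: "(c \<cdot>\<^sub>v (g *\<^sub>v u)) $ i = c * (1\<^sub>m N *\<^sub>v (g *\<^sub>v u)) $ i" if "g \<in> G" "i < N" for g i c
    using carrier_vecD[OF guC[OF that(1)]] guC[OF that(1)] that by simp
  have "(h *\<^sub>v (g *\<^sub>v u)) $ i = c * (1\<^sub>m N *\<^sub>v (g *\<^sub>v u)) $ i" if i: "i < N" for i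
  proof (rule connectedin_constant_ratio[where S = G and \<Lambda> = "{c. eigenvalue h c}" and m = N
        and F = "\<lambda>i g. (h *\<^sub>v (g *\<^sub>v u)) $ i" and H = "\<lambda>i g. (1\<^sub>m N *\<^sub>v (g *\<^sub>v u)) $ i" and s = "1\<^sub>m N"])
    show "\<exists>c\<in>{c. eigenvalue h c}. \<forall>i<N. (h *\<^sub>v (g *\<^sub>v u)) $ i = c * (1\<^sub>m N *\<^sub>v (g *\<^sub>v u)) $ i" if g: "g \<in> G" for g
    proof -
      obtain c where c: "h *\<^sub>v (g *\<^sub>v u) = c \<cdot>\<^sub>v (g *\<^sub>v u)" using ev g by blast
      have "eigenvalue h c" using eigenvalueI[OF h guC[OF g] nz[OF g] c] .
      then show ?thesis using c idx[OF g] by auto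
    qed
    show "\<exists>i<N. (1\<^sub>m N *\<^sub>v (g *\<^sub>v u)) $ i \<noteq> 0" if g: "g \<in> G" for g
    proof -
      obtain i where "i < N" "(g *\<^sub>v u) $ i \<noteq> 0"
        using guC[OF g] nz[OF g] by (metis carrier_vecD eq_vecI index_zero_vec)
      moreover have "1\<^sub>m N *\<^sub>v (g *\<^sub>v u) = g *\<^sub>v u" using guC[OF g] by simp
      ultimately show ?thesis by metis
    qed
    have "1\<^sub>m N *\<^sub>v u = u" using u by simp
    then show "\<forall>i<N. (h *\<^sub>v (1\<^sub>m N *\<^sub>v u)) $ i = c * (1\<^sub>m N *\<^sub>v (1\<^sub>m N *\<^sub>v u)) $ i"
      using c u by (simp del: index_mult_mat_vec)
  qed (use G h u g i finite_eigenvalues[OF h] in \<open>auto intro!: regular_on_mult_vec simp del: index_mult_mat_vec\<close>)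
  then show ?thesis
    using idx[OF g] carrier_vecD[OF guC[OF g]] guC[OF g] h by (intro eq_vecI) (auto simp del: index_mult_mat_vec)
qed

text \<open>Every element of the derived group is joined to \<open>1\<close> by a product of connected families
  \<open>z \<mapsto> z y z\<inverse> y\<inverse>\<close>.\<close>

lemma connectedin_derived:
  fixes G :: "'k::field mat set"
  assumes G: "subgroup G (GL N)" "connectedin (zariski UNIV N) G"
  shows "connectedin (zariski UNIV N) (derived (GL N) G)"
proof -
  interpret L: Group.group "GL N :: 'k mat monoid" by (rule group_GL)
  let ?D = "derived (GL N) G"
  let ?Z = "zariski (UNIV :: 'k set) N"
  have GG: "G \<subseteq> carrier (GL N)" using G(1) by (rule subgroup.subset)
  have D: "subgroup ?D (GL N)" using L.derived_is_subgroup[OF GG] .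
  have comm: "\<exists>S. connectedin ?Z S \<and> S \<subseteq> ?D \<and> 1\<^sub>m N \<in> S \<and> h \<in> S"
    if xy: "x \<in> G" "y \<in> G" and h: "h = x * y * inv\<^bsub>GL N\<^esub> x * inv\<^bsub>GL N\<^esub> y" for x y h
  proof (intro exI conjI)
    let ?S = "(\<lambda>z. z * y * inv\<^bsub>GL N\<^esub> z * inv\<^bsub>GL N\<^esub> y) ` G"
    have y: "y \<in> carrier (GL N)" using xy GG by blast
    have yC: "y \<in> carrier_mat N N" "inv\<^bsub>GL N\<^esub> y \<in> carrier_mat N N" using inv_GL[OF y] y by (auto simp: carrier_GL)
    have zC: "z \<in> carrier_mat N N" "inv\<^bsub>GL N\<^esub> z \<in> carrier_mat N N" if "z \<in> G" for z
      using inv_GL(2)[of z] that GG by (auto simp: carrier_GL)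
    show SD: "?S \<subseteq> ?D"
      unfolding derived_def using xy by (auto intro!: generate.incl)
    show "h \<in> ?S" using xy h by blast
    have "1\<^sub>m N * y * inv\<^bsub>GL N\<^esub> (1\<^sub>m N) * inv\<^bsub>GL N\<^esub> y = 1\<^sub>m N"
      using inv_GL(3)[OF y] yC L.inv_one by simp
    moreover have "1\<^sub>m N \<in> G" using subgroup.one_closed[OF G(1)] by simp
    ultimately show "1\<^sub>m N \<in> ?S" by (metis (no_types, lifting) image_eqI)
    show "connectedin ?Z ?S"
    proof (rule connectedin_regular_image[OF G(2)])
      show "?S \<subseteq> carrier (GL N)" using SD subgroup.subset[OF D] by blast
      show "regular_on UNIV N G (\<lambda>g. (g * y * inv\<^bsub>GL N\<^esub> g * inv\<^bsub>GL N\<^esub> y) $$ (i, j))" if "i < N" "j < N" for i j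
        using that yC zC
        by (intro regular_on_mult_entry[where m = N and l = N and n = N] regular_on_entry regular_on_const
            regular_on_inv_entry[OF GG]) (auto intro!: mult_carrier_mat)
      have d1: "det (g * y * inv\<^bsub>GL N\<^esub> g * inv\<^bsub>GL N\<^esub> y) = 1" if g: "g \<in> G" for g
      proof -
        have "det g * det (inv\<^bsub>GL N\<^esub> g) = 1" "det y * det (inv\<^bsub>GL N\<^esub> y) = 1"
          using g GG inv_GL(3)[of g] inv_GL(3)[OF y] det_mult[OF zC[OF g]] det_mult[OF yC] by auto
        then show ?thesis using yC zC[OF g] by (simp add: det_mult[of _ N] mult_ac)
            (metis mult.assoc mult.commute mult_1)
      qed
      show "regular_on UNIV N G (\<lambda>g. inverse (det (g * y * inv\<^bsub>GL N\<^esub> g * inv\<^bsub>GL N\<^esub> y)))"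
        by (rule regular_on_cong[OF regular_on_const[of 1]]) (auto simp: d1)
    qed
  qed
  have path: "\<exists>S. connectedin ?Z S \<and> S \<subseteq> ?D \<and> 1\<^sub>m N \<in> S \<and> h \<in> S" if "h \<in> ?D" for h
    using that unfolding derived_def
  proof (induction rule: generate.induct)
    case one
    have "(1\<^sub>m N :: 'k mat) \<in> carrier (GL N)" "1\<^sub>m N \<in> ?D" using L.one_closed subgroup.one_closed[OF D] by simp_all
    then show ?case unfolding derived_def[symmetric]
      by (intro exI[of _ "{1\<^sub>m N}"]) (auto simp: connectedin_sing)
  next
    case (incl h)
    then obtain x y where "x \<in> G" "y \<in> G" "h = x * y * inv\<^bsub>GL N\<^esub> x * inv\<^bsub>GL N\<^esub> y" by auto
    then show ?case using comm[of x y h] by (simp add: derived_def)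
  next
    case (inv h)
    then obtain x y where xy: "x \<in> G" "y \<in> G" "h = x * y * inv\<^bsub>GL N\<^esub> x * inv\<^bsub>GL N\<^esub> y" by auto
    then have c: "x \<in> carrier (GL N)" "y \<in> carrier (GL N)" using GG by auto
    have "inv\<^bsub>GL N\<^esub> h = y \<otimes>\<^bsub>GL N\<^esub> x \<otimes>\<^bsub>GL N\<^esub> inv\<^bsub>GL N\<^esub> y \<otimes>\<^bsub>GL N\<^esub> inv\<^bsub>GL N\<^esub> x"
      using c unfolding xy(3) mult_GL[symmetric, where N = N]
      by (simp only: L.inv_mult_group L.m_closed L.inv_closed L.inv_inv L.m_assoc)
    then show ?case using comm[of y x "inv\<^bsub>GL N\<^esub> h"] xy by (simp add: derived_def)
  next
    case (eng h1 h2)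
    obtain S1 S2 where S1: "connectedin ?Z S1" "S1 \<subseteq> ?D" "1\<^sub>m N \<in> S1" "h1 \<in> S1"
      and S2: "connectedin ?Z S2" "S2 \<subseteq> ?D" "1\<^sub>m N \<in> S2" "h2 \<in> S2"
      using eng.IH unfolding derived_def by blast
    have h1: "h1 \<in> ?D" "h1 \<in> carrier (GL N)" using S1 subgroup.subset[OF D] by auto
    have DC: "z \<in> carrier_mat N N" if "z \<in> ?D" for z
      using that subgroup.subset[OF D] by (auto simp: carrier_GL)
    let ?T = "(\<lambda>z. h1 * z) ` S2"
    have TD: "?T \<subseteq> ?D" using subgroup.m_closed[OF D h1(1)] S2(2) by auto
    have T: "connectedin ?Z ?T"
    proof (rule connectedin_regular_image[OF S2(1)])
      show "?T \<subseteq> carrier (GL N)" using TD subgroup.subset[OF D] by blast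
      show "regular_on UNIV N S2 (\<lambda>g. (h1 * g) $$ (i, j))" if "i < N" "j < N" for i j
        using that DC S2 h1
        by (intro regular_on_mult_entry[where m = N and l = N and n = N] regular_on_entry regular_on_const) auto
      show "regular_on UNIV N S2 (\<lambda>g. inverse (det (h1 * g)))"
      proof (rule regular_on_cong)
        show "regular_on UNIV N S2 (\<lambda>g. inverse (det h1) * inverse (det g))"
          by (intro regular_on_mult regular_on_const regular_on_inv_det) auto
        show "inverse (det h1) * inverse (det g) = inverse (det (h1 * g))" if "g \<in> S2" for g
          using that DC S2 h1 by (subst det_mult[of _ N]) auto
      qed
    qed
    have "h1 \<in> ?T" using S2(3) DC[OF h1(1)] by (intro image_eqI[of _ _ "1\<^sub>m N"]) auto
    then have "S1 \<inter> ?T \<noteq> {}" using S1(4) by blast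
    then have "connectedin ?Z (S1 \<union> ?T)" by (rule connectedin_Un[OF S1(1) T])
    then show ?case unfolding derived_def[symmetric] using S1 S2 TD by (intro exI[of _ "S1 \<union> ?T"]) auto
  qed
  define \<S> where "\<S> = {S. connectedin ?Z S \<and> S \<subseteq> ?D \<and> 1\<^sub>m N \<in> S}"
  have "?D = \<Union>\<S>" using path unfolding \<S>_def by blast
  moreover have "connectedin ?Z (\<Union>\<S>)"
    by (rule connectedin_Union) (auto simp: \<S>_def)
  ultimately show ?thesis by simp
qed

text \<open>The theorem of Lie and Kolchin, for a stable subspace \<open>W\<close>. By induction the derived group has
  a common eigenvector; its weight space in \<open>W\<close> is stable under the connected group \<open>G\<close>. On the
  weight space a commutator \<open>[a, b]\<close> is a scalar which, as a function of \<open>a\<close>, is a quotient of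
  eigenvalues of \<open>b\<close>, hence constant and equal to \<open>1\<close>. So \<open>G\<close> acts through commuting maps.\<close>

theorem lie_kolchin:
  fixes G :: "'k::alg_closed_field mat set"
  assumes "subgroup G (GL N)" "connectedin (zariski UNIV N) G" "(derived (GL N) ^^ d) G = {1\<^sub>m N}"
    and "vec_subspace N W" "W \<noteq> {0\<^sub>v N}" "\<And>g w. g \<in> G \<Longrightarrow> w \<in> W \<Longrightarrow> g *\<^sub>v w \<in> W"
  shows "\<exists>w\<in>W. w \<noteq> 0\<^sub>v N \<and> (\<forall>g\<in>G. \<exists>c. g *\<^sub>v w = c \<cdot>\<^sub>v w)"
  using assms
proof (induction d arbitrary: G)
  case 0
  note W = 0(4,5)
  obtain w where w: "w \<in> W" "w \<noteq> 0\<^sub>v N" using W vec_subspaceD(2)[OF W(1)] by blast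
  then show ?case using 0(3) vec_subspaceD(1)[OF W(1)] by (intro bexI[of _ w]) (auto intro!: exI[of _ 1])
next
  case (Suc d)
  interpret L: Group.group "GL N :: 'k mat monoid" by (rule group_GL)
  note G = Suc.prems(1,2) and W = Suc.prems(4,5) and st = Suc.prems(6)
  note WC = vec_subspaceD(1)[OF W(1)]
  define D where "D = derived (GL N) G"
  have GG: "G \<subseteq> carrier (GL N)" using G(1) by (rule subgroup.subset)
  have gC: "g \<in> carrier_mat N N" if "g \<in> G" for g using GG that by (auto simp: carrier_GL)
  have oneG: "1\<^sub>m N \<in> G" using subgroup.one_closed[OF G(1)] by simp
  have D: "subgroup D (GL N)" "D \<subseteq> G" "connectedin (zariski UNIV N) D"
    unfolding D_def using L.derived_is_subgroup[OF GG] L.derived_incl[OF subset_refl G(1)] connectedin_derived[OF G] by auto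
  have "(derived (GL N) ^^ d) D = {1\<^sub>m N}" using Suc.prems(3) by (simp add: D_def funpow_swap1)
  then obtain v where v: "v \<in> W" "v \<noteq> 0\<^sub>v N" "\<forall>h\<in>D. \<exists>c. h *\<^sub>v v = c \<cdot>\<^sub>v v"
    using Suc.IH[OF D(1,3) _ W] st D(2) by blast
  then obtain \<chi> where \<chi>: "\<And>h. h \<in> D \<Longrightarrow> h *\<^sub>v v = \<chi> h \<cdot>\<^sub>v v" by metis
  \<comment> \<open>the weight space of the character \<open>\<chi>\<close> of the derived group\<close>
  define V where "V = {w \<in> W. \<forall>h\<in>D. h *\<^sub>v w = \<chi> h \<cdot>\<^sub>v w}"
  have hC: "h \<in> carrier_mat N N" if "h \<in> D" for h using gC D that by blast
  have V: "vec_subspace N V"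
    unfolding vec_subspace_def V_def using vec_subspaceD[OF W(1)] hC
    by (auto simp: mult_add_distrib_mat_vec[of _ N N] smult_add_distrib_vec[of _ N] mult_mat_vec[of _ N N]
          smult_smult_assoc mult.commute mult_mat_zero_vec[of _ N N])
  have vV: "v \<in> V" using v \<chi> by (auto simp: V_def)
  have VW: "V \<subseteq> W" and VC: "V \<subseteq> carrier_vec N" using WC by (auto simp: V_def)
  have conj: "inv\<^bsub>GL N\<^esub> g * h * g \<in> D" if "g \<in> G" "h \<in> D" for g h
  proof -
    have "D \<lhd> (GL N)\<lparr>carrier := G\<rparr>" unfolding D_def by (rule L.derived_subgroup_is_normal[OF G(1)])
    moreover have "inv\<^bsub>GL N\<^esub> g \<in> G" by (rule subgroup.m_inv_closed[OF G(1) that(1)])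
    moreover have "Group.group ((GL N)\<lparr>carrier := G\<rparr>)" using G(1) L.subgroup_imp_group by blast
    ultimately have "inv\<^bsub>GL N\<^esub> g \<otimes>\<^bsub>GL N\<lparr>carrier := G\<rparr>\<^esub> h \<otimes>\<^bsub>GL N\<lparr>carrier := G\<rparr>\<^esub> inv\<^bsub>GL N\<lparr>carrier := G\<rparr>\<^esub> (inv\<^bsub>GL N\<^esub> g) \<in> D"
      using normal.inv_op_closed2[of D "(GL N)\<lparr>carrier := G\<rparr>" "inv\<^bsub>GL N\<^esub> g" h] that by simp
    moreover have "inv\<^bsub>GL N\<lparr>carrier := G\<rparr>\<^esub> (inv\<^bsub>GL N\<^esub> g) = g"
      using L.m_inv_consistent[OF G(1) \<open>inv\<^bsub>GL N\<^esub> g \<in> G\<close>] that GG by auto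
    ultimately show ?thesis by simp
  qed
  \<comment> \<open>all \<open>fw\<close> are eigenvectors of \<open>h\<close>, because \<open>f\<inverse>hf\<close> lies in the derived group; the eigenvalue is the same for all \<open>f\<close>\<close>
  have Vst: "g *\<^sub>v w \<in> V" if g: "g \<in> G" and w: "w \<in> V" for g w
  proof (cases "w = 0\<^sub>v N")
    case True
    have "g *\<^sub>v 0\<^sub>v N = 0\<^sub>v N" using gC[OF g] by (intro eq_vecI) (auto simp: mult_mat_vec_index_sum)
    then show ?thesis using True w by simp
  next
    case False
    have wC: "w \<in> carrier_vec N" using w VC by blast
    have "h *\<^sub>v (g *\<^sub>v w) = \<chi> h \<cdot>\<^sub>v (g *\<^sub>v w)" if h: "h \<in> D" for h
    proof (rule connectedin_same_eigenvalue[OF G(2) oneG hC[OF h] wC False _ _ g])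
      show "h *\<^sub>v w = \<chi> h \<cdot>\<^sub>v w" using w h by (auto simp: V_def)
      fix f assume f: "f \<in> G"
      have fi: "f \<in> carrier (GL N)" using f GG by blast
      let ?h = "inv\<^bsub>GL N\<^esub> f * h * f"
      note C = gC[OF f] inv_GL(2)[OF fi] hC[OF h]
      have "h * f = f * ?h"
      proof -
        have "f * ?h = (f * inv\<^bsub>GL N\<^esub> f) * (h * f)" using C by (simp add: assoc_mult_mat[of _ N N _ N _ N])
        then show ?thesis using C inv_GL(3)[OF fi] by simp
      qed
      then have "h *\<^sub>v (f *\<^sub>v w) = f *\<^sub>v (?h *\<^sub>v w)"
        using C wC assoc_mult_mat_vec[of h N N f N w] assoc_mult_mat_vec[of f N N ?h N w] by auto
      also have "?h *\<^sub>v w = \<chi> ?h \<cdot>\<^sub>v w" using w conj[OF f h] by (auto simp: V_def)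
      also have "f *\<^sub>v (\<chi> ?h \<cdot>\<^sub>v w) = \<chi> ?h \<cdot>\<^sub>v (f *\<^sub>v w)" using C wC by (simp add: mult_mat_vec[of _ N N])
      finally show "\<exists>c. h *\<^sub>v (f *\<^sub>v w) = c \<cdot>\<^sub>v (f *\<^sub>v w)" by blast
    qed
    then show ?thesis using st g w by (auto simp: V_def)
  qed
  have comm: "\<exists>h\<in>D. a * b = h * (b * a)" if a: "a \<in> G" and b: "b \<in> G" for a b
  proof
    have c: "a \<in> carrier (GL N)" "b \<in> carrier (GL N)" using a b GG by auto
    let ?h = "a \<otimes>\<^bsub>GL N\<^esub> b \<otimes>\<^bsub>GL N\<^esub> inv\<^bsub>GL N\<^esub> a \<otimes>\<^bsub>GL N\<^esub> inv\<^bsub>GL N\<^esub> b"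
    show "?h \<in> D" unfolding D_def derived_def using a b by (intro generate.incl) auto
    have "?h \<otimes>\<^bsub>GL N\<^esub> (b \<otimes>\<^bsub>GL N\<^esub> a) = a \<otimes>\<^bsub>GL N\<^esub> b \<otimes>\<^bsub>GL N\<^esub> (inv\<^bsub>GL N\<^esub> a \<otimes>\<^bsub>GL N\<^esub> (inv\<^bsub>GL N\<^esub> b \<otimes>\<^bsub>GL N\<^esub> b \<otimes>\<^bsub>GL N\<^esub> a))"
      using c by (simp only: L.m_assoc L.m_closed L.inv_closed)
    also have "\<dots> = a \<otimes>\<^bsub>GL N\<^esub> b" using c by (simp only: L.l_inv L.l_one L.r_one L.m_closed L.inv_closed)
    finally show "a * b = ?h * (b * a)" by simp
  qed
  \<comment> \<open>by \<open>twist\<close>, an eigenvector \<open>u\<close> of \<open>b\<close> in \<open>V\<close> is moved by \<open>G\<close> to eigenvectors of \<open>b\<close>, of the same eigenvalue\<close>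
  have \<chi>1: "a *\<^sub>v (b *\<^sub>v w) = b *\<^sub>v (a *\<^sub>v w)" if a: "a \<in> G" and b: "b \<in> G" and w: "w \<in> V" for a b w
  proof -
    obtain u c where u: "u \<in> V" "u \<noteq> 0\<^sub>v N" "b *\<^sub>v u = c \<cdot>\<^sub>v u"
      using eigenvector_in_stable_subspace[OF gC[OF b] V Vst[OF b] vV v(2)] by blast
    have uC: "u \<in> carrier_vec N" and wC: "w \<in> carrier_vec N" using u w VC by auto
    have twist: "\<exists>h\<in>D. \<forall>x\<in>V. f *\<^sub>v (b *\<^sub>v x) = \<chi> h \<cdot>\<^sub>v (b *\<^sub>v (f *\<^sub>v x))" if f: "f \<in> G" for f
    proof -
      obtain h where h: "h \<in> D" "f * b = h * (b * f)" using comm[OF f b] by blast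
      have "f *\<^sub>v (b *\<^sub>v x) = \<chi> h \<cdot>\<^sub>v (b *\<^sub>v (f *\<^sub>v x))" if x: "x \<in> V" for x
      proof -
        have xC: "x \<in> carrier_vec N" using x VC by blast
        have "f *\<^sub>v (b *\<^sub>v x) = (f * b) *\<^sub>v x" using gC[OF f] gC[OF b] xC by simp
        also have "\<dots> = h *\<^sub>v (b *\<^sub>v (f *\<^sub>v x))"
          unfolding h(2) using gC[OF f] gC[OF b] hC[OF h(1)] xC by (simp add: assoc_mult_mat_vec[of _ N N _ N])
        also have "\<dots> = \<chi> h \<cdot>\<^sub>v (b *\<^sub>v (f *\<^sub>v x))" using Vst[OF b Vst[OF f x]] h(1) by (auto simp: V_def)
        finally show ?thesis .
      qed
      then show ?thesis using h by blast
    qed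
    have fu: "f *\<^sub>v u \<in> carrier_vec N" "f *\<^sub>v u \<noteq> 0\<^sub>v N" if "f \<in> G" for f
      using that GG uC u(2) GL_mult_vec_nonzero[of f N u] mult_mat_vec_carrier[OF gC[OF that] uC] by auto
    have bau: "b *\<^sub>v (a *\<^sub>v u) = c \<cdot>\<^sub>v (a *\<^sub>v u)"
    proof (rule connectedin_same_eigenvalue[OF G(2) oneG gC[OF b] uC u(2) _ u(3) a])
      fix f assume f: "f \<in> G"
      obtain h where h: "h \<in> D" "f *\<^sub>v (b *\<^sub>v u) = \<chi> h \<cdot>\<^sub>v (b *\<^sub>v (f *\<^sub>v u))" using twist[OF f] u by blast
      have bfu: "b *\<^sub>v (f *\<^sub>v u) \<in> carrier_vec N" using gC[OF b] fu[OF f] by simp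
      have "f *\<^sub>v (b *\<^sub>v u) \<noteq> 0\<^sub>v N"
        using GL_mult_vec_nonzero[of b N u] GL_mult_vec_nonzero[of f N "b *\<^sub>v u"] f b GG uC u(2) gC[OF b] by auto
      moreover have "0 \<cdot>\<^sub>v (b *\<^sub>v (f *\<^sub>v u)) = 0\<^sub>v N"
        using carrier_vecD[OF bfu] by (intro eq_vecI) (auto simp del: index_mult_mat_vec)
      ultimately have \<chi>0: "\<chi> h \<noteq> 0" using h(2) by metis
      have "c \<cdot>\<^sub>v (f *\<^sub>v u) = \<chi> h \<cdot>\<^sub>v (b *\<^sub>v (f *\<^sub>v u))"
        using h(2) u(3) gC[OF f] uC by (simp add: mult_mat_vec[of _ N N])
      then have "inverse (\<chi> h) \<cdot>\<^sub>v (c \<cdot>\<^sub>v (f *\<^sub>v u)) = inverse (\<chi> h) \<cdot>\<^sub>v (\<chi> h \<cdot>\<^sub>v (b *\<^sub>v (f *\<^sub>v u)))" by simp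
      then have "b *\<^sub>v (f *\<^sub>v u) = (inverse (\<chi> h) * c) \<cdot>\<^sub>v (f *\<^sub>v u)"
        using \<chi>0 by (simp add: smult_smult_assoc)
      then show "\<exists>c. b *\<^sub>v (f *\<^sub>v u) = c \<cdot>\<^sub>v (f *\<^sub>v u)" by blast
    qed
    obtain h where h: "h \<in> D" "\<And>x. x \<in> V \<Longrightarrow> a *\<^sub>v (b *\<^sub>v x) = \<chi> h \<cdot>\<^sub>v (b *\<^sub>v (a *\<^sub>v x))"
      using twist[OF a] by blast
    have "\<chi> h \<cdot>\<^sub>v (b *\<^sub>v (a *\<^sub>v u)) = a *\<^sub>v (c \<cdot>\<^sub>v u)" using h(2)[OF u(1)] u(3) by simp
    also have "\<dots> = c \<cdot>\<^sub>v (a *\<^sub>v u)" using gC[OF a] uC by (simp add: mult_mat_vec[of _ N N])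
    also have "\<dots> = 1 \<cdot>\<^sub>v (b *\<^sub>v (a *\<^sub>v u))" using bau by simp
    finally have "\<chi> h \<cdot>\<^sub>v (b *\<^sub>v (a *\<^sub>v u)) = 1 \<cdot>\<^sub>v (b *\<^sub>v (a *\<^sub>v u))" .
    then have "\<chi> h = 1"
      by (rule smult_vec_right_cancel[rotated 2])
         (use GL_mult_vec_nonzero[of b N "a *\<^sub>v u"] fu[OF a] b GG gC[OF b] in auto)
    then show ?thesis using h(2)[OF w] by simp
  qed
  have "\<exists>w\<in>V. w \<noteq> 0\<^sub>v N \<and> (\<forall>g\<in>G. \<exists>c. g *\<^sub>v w = c \<cdot>\<^sub>v w)"
    by (rule commuting_common_eigenvector) (use gC V vV v(2) Vst \<chi>1 in auto)
  then show ?case using VW by blast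
qed

section \<open>Connected solvable subgroups of orthogonal groups are triangular\<close>

lemma form_gram:
  fixes Q :: "'k::field mat"
  assumes "Q \<in> carrier_mat N N" "g \<in> carrier_mat N N" "v \<in> carrier_vec N" "w \<in> carrier_vec N"
  shows "form Q (g *\<^sub>v v) (g *\<^sub>v w) = form (g\<^sup>T * Q * g) v w"
proof -
  have c: "Q *\<^sub>v (g *\<^sub>v w) \<in> carrier_vec N"
    using mult_mat_vec_carrier[OF assms(1) mult_mat_vec_carrier[OF assms(2,4)]] .
  have "(g\<^sup>T * Q * g) *\<^sub>v w = g\<^sup>T *\<^sub>v (Q *\<^sub>v (g *\<^sub>v w))"
    using assms by (simp add: assoc_mult_mat_vec[of _ N N _ N] assoc_mult_mat[of _ N N _ N _ N])
  then have "form (g\<^sup>T * Q * g) v w = (g\<^sup>T *\<^sub>v (Q *\<^sub>v (g *\<^sub>v w))) \<bullet> v"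
    using assms c by (simp add: form_def) (metis comm_scalar_prod mult_mat_vec_carrier transpose_carrier_mat)
  also have "\<dots> = (Q *\<^sub>v (g *\<^sub>v w)) \<bullet> (g *\<^sub>v v)"
    using transpose_vec_mult_scalar[OF assms(2,3) c] .
  also have "\<dots> = form Q (g *\<^sub>v v) (g *\<^sub>v w)"
    unfolding form_def using c mult_mat_vec_carrier[OF assms(2,3)] by (rule comm_scalar_prod)
  finally show ?thesis by simp
qed

lemma form_unit_vec:
  fixes Q :: "'k::field mat"
  assumes "Q \<in> carrier_mat N N" "i < N" "j < N"
  shows "form Q (unit_vec N i) (unit_vec N j) = Q $$ (i, j)"
  using assms by (simp add: form_def)

lemma form_eqI:
  fixes A B :: "'k::field mat"
  assumes "A \<in> carrier_mat N N" "B \<in> carrier_mat N N"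
    and "\<And>v w. v \<in> carrier_vec N \<Longrightarrow> w \<in> carrier_vec N \<Longrightarrow> form A v w = form B v w"
  shows "A = B"
proof (rule eq_matI)
  fix i j assume "i < dim_row B" "j < dim_col B"
  then have "i < N" "j < N" using assms by auto
  then show "A $$ (i, j) = B $$ (i, j)"
    using assms(3)[of "unit_vec N i" "unit_vec N j"] form_unit_vec[OF assms(1)] form_unit_vec[OF assms(2)] by simp
qed (use assms in auto)

lemma Ortho_iff:
  fixes Q :: "'k::field mat"
  assumes Q: "Q \<in> carrier_mat N N"
  shows "g \<in> Ortho N Q \<longleftrightarrow> g \<in> carrier (GL N) \<and> g\<^sup>T * Q * g = Q"
proof
  assume g: "g \<in> Ortho N Q"
  then have gC: "g \<in> carrier (GL N)" "g \<in> carrier_mat N N" by (auto simp: Ortho_def carrier_GL)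
  have "g\<^sup>T * Q * g = Q"
  proof (rule form_eqI[of _ N])
    fix v w :: "'k vec" assume vw: "v \<in> carrier_vec N" "w \<in> carrier_vec N"
    show "form (g\<^sup>T * Q * g) v w = form Q v w"
      unfolding form_gram[OF Q gC(2) vw, symmetric] using g vw by (auto simp: Ortho_def)
  qed (use Q gC in auto)
  then show "g \<in> carrier (GL N) \<and> g\<^sup>T * Q * g = Q" using gC by blast
next
  assume "g \<in> carrier (GL N) \<and> g\<^sup>T * Q * g = Q"
  then show "g \<in> Ortho N Q" using Q by (auto simp: Ortho_def carrier_GL form_gram)
qed

lemma form_add_smult:
  fixes Q :: "'k::field mat"
  assumes "Q \<in> carrier_mat N N" "v \<in> carrier_vec N" "w \<in> carrier_vec N" "u \<in> carrier_vec N"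
  shows "form Q (v + w) u = form Q v u + form Q w u" "form Q u (v + w) = form Q u v + form Q u w"
    "form Q (c \<cdot>\<^sub>v v) u = c * form Q v u" "form Q u (c \<cdot>\<^sub>v v) = c * form Q u v"
proof -
  have C: "Q *\<^sub>v u \<in> carrier_vec N" "Q *\<^sub>v v \<in> carrier_vec N" "Q *\<^sub>v w \<in> carrier_vec N"
    using assms mult_mat_vec_carrier by blast+
  show "form Q (v + w) u = form Q v u + form Q w u" unfolding form_def
    by (rule add_scalar_prod_distrib[of _ N]) (use assms C in auto)
  show "form Q (c \<cdot>\<^sub>v v) u = c * form Q v u" unfolding form_def using assms C by simp
  show "form Q u (v + w) = form Q u v + form Q u w"
    unfolding form_def mult_add_distrib_mat_vec[OF assms(1,2,3)]
    by (rule scalar_prod_add_distrib[of _ N]) (use assms C in auto)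
  show "form Q u (c \<cdot>\<^sub>v v) = c * form Q u v"
    unfolding form_def mult_mat_vec[OF assms(1,2)] using assms C carrier_vecD[OF C(2)] by simp
qed

lemma form_sym:
  fixes Q :: "'k::field mat"
  assumes "Q \<in> carrier_mat N N" "Q\<^sup>T = Q" "v \<in> carrier_vec N" "w \<in> carrier_vec N"
  shows "form Q w v = form Q v w"
proof -
  have "form Q w v = (Q *\<^sub>v v) \<bullet> w" unfolding form_def
    using assms by (intro comm_scalar_prod[of _ N]) (auto intro!: mult_mat_vec_carrier)
  also have "\<dots> = v \<bullet> (Q *\<^sub>v w)" using transpose_vec_mult_scalar[of Q N N w v] assms by simp
  finally show ?thesis by (simp add: form_def)
qed

lemma form_zero:
  fixes Q :: "'k::field mat"
  assumes "Q \<in> carrier_mat N N" "v \<in> carrier_vec N"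
  shows "form Q v (0\<^sub>v N) = 0" "form Q (0\<^sub>v N) v = 0"
proof -
  show "form Q v (0\<^sub>v N) = 0" unfolding form_def mult_mat_zero_vec[OF assms(1)] using assms(2) by simp
  have "Q *\<^sub>v v \<in> carrier_vec N" using assms by (rule mult_mat_vec_carrier)
  then show "form Q (0\<^sub>v N) v = 0" unfolding form_def by simp
qed

text \<open>The eigenvalues on \<open>v\<close> are \<open>\<plusminus>1\<close>, since \<open>form Q v v \<noteq> 0\<close> is preserved, and thus \<open>1\<close> by connectedness.\<close>

lemma anisotropic_eigenvector_fixed:
  fixes Q :: "'k::field mat"
  assumes Q: "Q \<in> carrier_mat N N" and G: "G \<subseteq> Ortho N Q" "connectedin (zariski UNIV N) G" "1\<^sub>m N \<in> G"
    and v: "v \<in> carrier_vec N" "form Q v v \<noteq> 0" and ev: "\<And>g. g \<in> G \<Longrightarrow> \<exists>c. g *\<^sub>v v = c \<cdot>\<^sub>v v" and g: "g \<in> G"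
  shows "g *\<^sub>v v = v"
proof -
  have v0: "v \<noteq> 0\<^sub>v N" using form_zero[OF Q v(1)] v(2) by auto
  have gC: "f \<in> carrier_mat N N" if "f \<in> G" for f using that G by (auto simp: Ortho_def carrier_GL)
  have idx: "(1\<^sub>m N *\<^sub>v (f *\<^sub>v v)) $ i = (f *\<^sub>v v) $ i" if "f \<in> G" for f i
    using mult_mat_vec_carrier[OF gC[OF that] v(1)] by simp
  have eq: "(1\<^sub>m N *\<^sub>v (g *\<^sub>v v)) $ i = 1 * v $ i" if i: "i < N" for i
  proof (rule connectedin_constant_ratio[where S = G and \<Lambda> = "{1, -1}" and m = N
        and F = "\<lambda>i g. (1\<^sub>m N *\<^sub>v (g *\<^sub>v v)) $ i" and H = "\<lambda>i g. v $ i" and s = "1\<^sub>m N"])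
    show "\<exists>c\<in>{1, -1}. \<forall>i<N. (1\<^sub>m N *\<^sub>v (f *\<^sub>v v)) $ i = c * v $ i" if f: "f \<in> G" for f
    proof -
      obtain c where c: "f *\<^sub>v v = c \<cdot>\<^sub>v v" using ev f by blast
      have "form Q v v = form Q (f *\<^sub>v v) (f *\<^sub>v v)" using f G v by (auto simp: Ortho_def)
      also have "\<dots> = c * (c * form Q v v)" unfolding c
        using form_add_smult(3,4)[OF Q] v by simp
      finally have "c * c = 1" using v(2) by (simp add: mult.assoc[symmetric])
      then have "c = 1 \<or> c = -1" by (simp add: square_eq_1_iff)
      moreover have "(1\<^sub>m N *\<^sub>v (f *\<^sub>v v)) $ i = c * v $ i" if "i < N" for i
        unfolding idx[OF f] c using that v(1) by simp
      ultimately show ?thesis by auto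
    qed
    show "\<exists>i<N. v $ i \<noteq> 0" using v(1) v0 by (metis carrier_vecD eq_vecI index_zero_vec)
  qed (use G g i v in \<open>auto intro!: regular_on_mult_vec regular_on_const simp del: index_mult_mat_vec\<close>)
  show ?thesis
    using eq idx[OF g] carrier_vecD[OF mult_mat_vec_carrier[OF gC[OF g] v(1)]] v(1)
    by (intro eq_vecI) (auto simp del: index_mult_mat_vec)
qed

lemma exists_orthogonal_vector:
  fixes f :: "'k::field vec"
  assumes "f \<in> carrier_vec N" "N \<ge> 2"
  obtains w where "w \<in> carrier_vec N" "w \<noteq> 0\<^sub>v N" "w \<bullet> f = 0"
proof (cases "f $ 0 = 0")
  case True
  have "unit_vec N 0 \<noteq> (0\<^sub>v N :: 'k vec)" using assms(2) by (auto simp: unit_vec_def vec_eq_iff)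
  then show ?thesis using that[of "unit_vec N 0"] True assms by (simp add: scalar_prod_left_unit)
next
  case False
  define w where "w = f $ 1 \<cdot>\<^sub>v unit_vec N 0 + (- f $ 0) \<cdot>\<^sub>v (unit_vec N 1 :: 'k vec)"
  have "w \<bullet> f = f $ 1 * f $ 0 + (- f $ 0) * f $ 1"
    unfolding w_def using assms
    by (subst add_scalar_prod_distrib[of _ N]) (auto simp: scalar_prod_left_unit)
  moreover have "w $ 1 \<noteq> 0" using False assms by (simp add: w_def unit_vec_def)
  then have "w \<noteq> 0\<^sub>v N" using assms by auto
  ultimately show ?thesis using that[of w] by (simp add: w_def)
qed

text \<open>If the common eigenvector \<open>v\<close> provided by the theorem of Lie and Kolchin is anisotropic, it is
  fixed, and so its orthogonal complement contains a further common eigenvector \<open>w\<close>. If \<open>w\<close> is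
  anisotropic, too, then the isotropic vectors in the span of \<open>v\<close> and \<open>w\<close> are fixed.\<close>

lemma isotropic_common_eigenvector:
  fixes Q :: "'k::alg_closed_field mat"
  assumes Q: "quadratic_space N Q" "N \<ge> 2" and G: "G \<subseteq> Ortho N Q" "subgroup G (GL N)"
    "connectedin (zariski UNIV N) G" "(derived (GL N) ^^ d) G = {1\<^sub>m N}"
  obtains v where "v \<in> carrier_vec N" "v \<noteq> 0\<^sub>v N" "form Q v v = 0" "\<And>g. g \<in> G \<Longrightarrow> \<exists>c. g *\<^sub>v v = c \<cdot>\<^sub>v v"
proof -
  note QC = quadratic_spaceD[OF Q(1)]
  have one: "1\<^sub>m N \<in> G" using subgroup.one_closed[OF G(2)] by simp
  have gC: "g \<in> carrier_mat N N" if "g \<in> G" for g using that G by (auto simp: Ortho_def carrier_GL)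
  have "vec_subspace N (carrier_vec N :: 'k vec set)" by (auto simp: vec_subspace_def)
  moreover have "carrier_vec N \<noteq> {0\<^sub>v N :: 'k vec}"
  proof
    assume eq: "carrier_vec N = {0\<^sub>v N :: 'k vec}"
    have "(unit_vec N 0 :: 'k vec) \<in> {0\<^sub>v N}" unfolding eq[symmetric] by simp
    then have "unit_vec N 0 $ 0 = (0\<^sub>v N :: 'k vec) $ 0" by simp
    then show False using Q(2) by simp
  qed
  ultimately have "\<exists>w\<in>carrier_vec N. w \<noteq> 0\<^sub>v N \<and> (\<forall>g\<in>G. \<exists>c. g *\<^sub>v w = c \<cdot>\<^sub>v w)"
    by (rule lie_kolchin[OF G(2-4)]) (rule mult_mat_vec_carrier[OF gC])
  then obtain v where v: "v \<in> carrier_vec N" "v \<noteq> 0\<^sub>v N" "\<And>g. g \<in> G \<Longrightarrow> \<exists>c. g *\<^sub>v v = c \<cdot>\<^sub>v v"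
    by blast
  show ?thesis
  proof (cases "form Q v v = 0")
    case True then show ?thesis using that v by blast
  next
    case False
    have fixv: "g *\<^sub>v v = v" if "g \<in> G" for g
      using anisotropic_eigenvector_fixed[OF QC(1) G(1,3) one v(1) False v(3) that] .
    define W where "W = {w \<in> carrier_vec N. form Q w v = 0}"
    have Ws: "vec_subspace N W"
      unfolding vec_subspace_def W_def using form_zero[OF QC(1) v(1)] form_add_smult[OF QC(1)] v(1) by auto
    have "Q *\<^sub>v v \<in> carrier_vec N" using QC(1) v(1) by (rule mult_mat_vec_carrier)
    then obtain w0 where "w0 \<in> carrier_vec N" "w0 \<noteq> 0\<^sub>v N" "w0 \<bullet> (Q *\<^sub>v v) = 0"
      using exists_orthogonal_vector Q(2) by blast
    then have Wn: "W \<noteq> {0\<^sub>v N}" by (auto simp: W_def form_def)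
    have Wst: "g *\<^sub>v w \<in> W" if g: "g \<in> G" and w: "w \<in> W" for g w
    proof -
      have "form Q (g *\<^sub>v w) v = form Q (g *\<^sub>v w) (g *\<^sub>v v)" using fixv[OF g] by simp
      also have "\<dots> = form Q w v" using g G w v by (auto simp: Ortho_def W_def)
      finally show ?thesis using w mult_mat_vec_carrier[OF gC[OF g]] by (auto simp: W_def)
    qed
    obtain w where w: "w \<in> W" "w \<noteq> 0\<^sub>v N" "\<And>g. g \<in> G \<Longrightarrow> \<exists>c. g *\<^sub>v w = c \<cdot>\<^sub>v w"
      using lie_kolchin[OF G(2-4) Ws Wn Wst] by blast
    have wC: "w \<in> carrier_vec N" and wv: "form Q w v = 0" using w by (auto simp: W_def)
    have vw: "form Q v w = 0" using form_sym[OF QC(1,3) wC v(1)] wv by simp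
    show ?thesis
    proof (cases "form Q w w = 0")
      case True then show ?thesis using that w wC by blast
    next
      case F2: False
      have fixw: "g *\<^sub>v w = w" if "g \<in> G" for g
        using anisotropic_eigenvector_fixed[OF QC(1) G(1,3) one wC F2 w(3) that] .
      obtain s where s: "s ^ 2 = - form Q v v / form Q w w"
        using nth_root_exists[of 2 "- form Q v v / form Q w w"] by auto
      define u where "u = v + s \<cdot>\<^sub>v w"
      have uC: "u \<in> carrier_vec N" using v wC by (simp add: u_def)
      have swC: "s \<cdot>\<^sub>v w \<in> carrier_vec N" using wC by simp
      have Qvu: "form Q v u = form Q v v"
        unfolding u_def form_add_smult(2)[OF QC(1) v(1) swC v(1)] form_add_smult(4)[OF QC(1) wC v(1) v(1)] vw by simp
      have Qwu: "form Q w u = s * form Q w w"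
        unfolding u_def form_add_smult(2)[OF QC(1) v(1) swC wC] form_add_smult(4)[OF QC(1) wC v(1) wC] wv by simp
      have "form Q u u = form Q v u + s * form Q w u"
        using form_add_smult(1)[OF QC(1) v(1) swC uC] form_add_smult(3)[OF QC(1) wC v(1) uC] by (simp add: u_def)
      also have "\<dots> = form Q v v + s ^ 2 * form Q w w" unfolding Qvu Qwu by (simp add: power2_eq_square)
      also have "\<dots> = 0" unfolding s using F2 by simp
      finally have "form Q u u = 0" .
      moreover have "u \<noteq> 0\<^sub>v N" using Qvu False form_zero(1)[OF QC(1) v(1)] by auto
      moreover have "g *\<^sub>v u = 1 \<cdot>\<^sub>v u" if "g \<in> G" for g
        unfolding u_def mult_add_distrib_mat_vec[OF gC[OF that] v(1) swC] mult_mat_vec[OF gC[OF that] wC]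
          fixv[OF that] fixw[OF that] by simp
      ultimately show ?thesis using that uC by blast
    qed
  qed
qed

definition antidiag :: "nat \<Rightarrow> 'k::field mat" where
  "antidiag N = mat N N (\<lambda>(i, j). if Suc (i + j) = N then 1 else 0)"

lemma antidiag_carrier [simp]: "antidiag N \<in> carrier_mat N N"
  by (simp add: antidiag_def)

lemma add_plane_antidiag: "add_plane 1 M (antidiag M) = antidiag (M+2)"
  by (rule eq_matI) (auto simp: add_plane_index antidiag_def)

definition middle_block :: "nat \<Rightarrow> 'k mat \<Rightarrow> 'k mat" where
  "middle_block M t = mat M M (\<lambda>(i, j). t $$ (Suc i, Suc j))"

lemma middle_block_carrier [simp]: "middle_block M t \<in> carrier_mat M M"
  by (simp add: middle_block_def)

lemma sum_add_plane_row:
  assumes "k < M+2"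
  shows "(\<Sum>l<M+2. add_plane \<epsilon> M Q $$ (k, l) * x l) =
    (if k = 0 then x (Suc M) else if k = Suc M then \<epsilon> * x 0 else (\<Sum>l<M. Q $$ (k - 1, l) * x (Suc l)))"
  unfolding sum_lessThan_split_ends using assms by (auto simp: add_plane_index)

lemma gram_add_plane_entry:
  fixes t :: "'k::field mat"
  assumes t: "t \<in> carrier_mat (M+2) m" and ij: "i < m" "j < m"
  shows "(t\<^sup>T * add_plane 1 M Q * t) $$ (i, j) = t $$ (0, i) * t $$ (Suc M, j)
      + (\<Sum>k<M. t $$ (Suc k, i) * (\<Sum>l<M. Q $$ (k, l) * t $$ (Suc l, j)))
      + t $$ (Suc M, i) * t $$ (0, j)"
proof -
  have "(t\<^sup>T * add_plane 1 M Q * t) $$ (i, j) = (\<Sum>k<M+2. t $$ (k, i) * (\<Sum>l<M+2. add_plane 1 M Q $$ (k, l) * t $$ (l, j)))"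
    unfolding gram_index_sum[OF t add_plane_carrier ij] by (simp only: sum_distrib_left mult_ac)
  also have "\<dots> = (\<Sum>k<M+2. t $$ (k, i) * (if k = 0 then t $$ (Suc M, j) else if k = Suc M then 1 * t $$ (0, j)
      else (\<Sum>l<M. Q $$ (k - 1, l) * t $$ (Suc l, j))))"
    by (rule sum.cong[OF refl]) (simp only: lessThan_iff sum_add_plane_row)
  finally show ?thesis unfolding sum_lessThan_split_ends by simp
qed

text \<open>An isometry stabilizing the line of the first basis vector stabilizes its orthogonal complement,
  and acts isometrically on the complement modulo the line.\<close>

lemma isometry_fixing_line:
  fixes Q :: "'k::field mat"
  assumes t: "t \<in> carrier_mat (M+2) (M+2)" and iso: "t\<^sup>T * add_plane 1 M Q * t = add_plane 1 M Q"
    and Q: "Q \<in> carrier_mat M M" and line: "\<And>i. 0 < i \<Longrightarrow> i < M+2 \<Longrightarrow> t $$ (i, 0) = 0"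
  shows "\<And>j. j < Suc M \<Longrightarrow> t $$ (Suc M, j) = 0"
    and "(middle_block M t)\<^sup>T * Q * middle_block M t = Q"
proof -
  have ent: "add_plane 1 M Q $$ (i, j) = t $$ (0, i) * t $$ (Suc M, j)
      + (\<Sum>k<M. t $$ (Suc k, i) * (\<Sum>l<M. Q $$ (k, l) * t $$ (Suc l, j)))
      + t $$ (Suc M, i) * t $$ (0, j)" if ij: "i < M+2" "j < M+2" for i j
    using gram_add_plane_entry[OF t ij, of Q] unfolding iso .
  have t0: "t $$ (0, 0) * t $$ (Suc M, j) = add_plane 1 M Q $$ (0, j)" if "j < M+2" for j
    using ent[of 0 j] that line by simp
  have "t $$ (0, 0) \<noteq> 0" using t0[of "Suc M"] by (auto simp: add_plane_index)
  then show last: "t $$ (Suc M, j) = 0" if "j < Suc M" for j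
    using t0[of j] that by (auto simp: add_plane_index)
  show "(middle_block M t)\<^sup>T * Q * middle_block M t = Q"
  proof (rule eq_matI)
    fix i j assume "i < dim_row Q" "j < dim_col Q"
    then have ij: "i < M" "j < M" using Q by auto
    have "((middle_block M t)\<^sup>T * Q * middle_block M t) $$ (i, j)
        = (\<Sum>k<M. t $$ (Suc k, Suc i) * (\<Sum>l<M. Q $$ (k, l) * t $$ (Suc l, Suc j)))"
      unfolding gram_index_sum[OF middle_block_carrier Q ij]
      by (simp add: middle_block_def ij sum_distrib_left mult_ac)
    also have "\<dots> = add_plane 1 M Q $$ (Suc i, Suc j)"
      using ent[of "Suc i" "Suc j"] ij last by simp
    also have "\<dots> = Q $$ (i, j)" using ij by (simp add: add_plane_index)
    finally show "((middle_block M t)\<^sup>T * Q * middle_block M t) $$ (i, j) = Q $$ (i, j)" .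
  qed (use Q in \<open>auto simp: middle_block_def\<close>)
qed

lemma middle_block_mult:
  fixes t s :: "'k::field mat"
  assumes t: "t \<in> carrier_mat (M+2) (M+2)" "s \<in> carrier_mat (M+2) (M+2)"
    and z: "\<And>i. 0 < i \<Longrightarrow> i < Suc M \<Longrightarrow> t $$ (i, 0) = 0" "\<And>j. 0 < j \<Longrightarrow> j < Suc M \<Longrightarrow> s $$ (Suc M, j) = 0"
  shows "middle_block M (t * s) = middle_block M t * middle_block M s"
proof (rule eq_matI)
  fix i j assume "i < dim_row (middle_block M t * middle_block M s)" "j < dim_col (middle_block M t * middle_block M s)"
  then have ij: "i < M" "j < M" by (auto simp: middle_block_def)
  have "middle_block M (t * s) $$ (i, j) = (\<Sum>k<M+2. t $$ (Suc i, k) * s $$ (k, Suc j))"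
    using ij t mult_mat_index_sum[of "Suc i" t "Suc j" s] by (simp add: middle_block_def del: index_mult_mat(1))
  also have "\<dots> = (\<Sum>k<M. t $$ (Suc i, Suc k) * s $$ (Suc k, Suc j))"
    unfolding sum_lessThan_split_ends using z ij by simp
  also have "\<dots> = (middle_block M t * middle_block M s) $$ (i, j)"
    using ij by (subst mult_mat_index_sum) (auto simp: middle_block_def)
  finally show "middle_block M (t * s) $$ (i, j) = (middle_block M t * middle_block M s) $$ (i, j)" .
qed (auto simp: middle_block_def)

lemma exp_of_derived_hom_image:
  assumes "Group.group L" "Group.group L'" "subgroup G L"
    and hom: "\<rho> \<in> hom (L\<lparr>carrier := G\<rparr>) L'"
  shows "(derived L' ^^ n) (\<rho> ` G) = \<rho> ` ((derived L ^^ n) G)" "subgroup (\<rho> ` G) L'"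
proof -
  interpret L: Group.group L by fact
  interpret L': Group.group L' by fact
  interpret G: Group.group "L\<lparr>carrier := G\<rparr>" using L.subgroup_imp_group assms(3) by blast
  interpret h: group_hom "L\<lparr>carrier := G\<rparr>" L' \<rho> using hom by unfold_locales
  have c: "(derived (L\<lparr>carrier := G\<rparr>) ^^ n) G = (derived L ^^ n) G \<and> (derived L ^^ n) G \<subseteq> G" for n
  proof (induction n)
    case (Suc n)
    then show ?case using L.derived_consistent[of "(derived L ^^ n) G" G] L.derived_incl[of "(derived L ^^ n) G" G] assms(3) by simp
  qed simp
  show "(derived L' ^^ n) (\<rho> ` G) = \<rho> ` ((derived L ^^ n) G)"
    using h.exp_of_derived_img[of G n] c by simp
  show "subgroup (\<rho> ` G) L'" using h.img_is_subgroup by simp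
qed

lemma mult_mat_entry:
  assumes "A \<in> carrier_mat n m" "B \<in> carrier_mat m l" "i < n" "j < l"
  shows "(A * B) $$ (i, j) = (\<Sum>k<m. A $$ (i, k) * B $$ (k, j))"
  using assms by (subst mult_mat_index_sum) auto

lemma antidiag_dims [simp]: "dim_row (antidiag N) = N" "dim_col (antidiag N) = N"
  by (simp_all add: antidiag_def)

lemma one_smult_mat [simp]: "(1 :: 'k::field) \<cdot>\<^sub>m A = A"
  by (rule eq_matI) auto

lemma mult_mat_inverse_cancel:
  fixes A :: "'k::field mat"
  assumes "A \<in> carrier_mat n n" "B \<in> carrier_mat n n" "A * B = 1\<^sub>m n" "C \<in> carrier_mat n m"
  shows "A * (B * C) = C"
  using assoc_mult_mat[OF assms(1,2,4)] assms by simp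

lemma embed_block_mult:
  fixes A B :: "'k::field mat"
  assumes "A \<in> carrier_mat M M" "B \<in> carrier_mat M M"
  shows "embed_block M a A b * embed_block M c B d = embed_block M (a * c) (A * B) (b * d)"
proof (rule eq_matI)
  fix i j assume "i < dim_row (embed_block M (a * c) (A * B) (b * d))" "j < dim_col (embed_block M (a * c) (A * B) (b * d))"
  then have ij: "i < M+2" "j < M+2" by (auto simp: embed_block_def)
  have mid: "(\<Sum>k<M. A $$ (i - 1, k) * B $$ (k, j - 1)) = (A * B) $$ (i - 1, j - 1)"
    if "0 < i" "i < Suc M" "0 < j" "j < Suc M"
    using that assms mult_mat_index_sum[of "i - 1" A "j - 1" B] by simp
  have "(embed_block M a A b * embed_block M c B d) $$ (i, j)
      = (\<Sum>k<M+2. embed_block M a A b $$ (i, k) * embed_block M c B d $$ (k, j))"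
    using ij by (subst mult_mat_index_sum) (auto simp: embed_block_def)
  also have "\<dots> = embed_block M (a * c) (A * B) (b * d) $$ (i, j)"
    unfolding sum_lessThan_split_ends using ij mid by (auto simp: embed_block_index)
  finally show "(embed_block M a A b * embed_block M c B d) $$ (i, j) = embed_block M (a * c) (A * B) (b * d) $$ (i, j)" .
qed (auto simp: embed_block_def)

lemma embed_block_one: "embed_block M 1 (1\<^sub>m M) 1 = 1\<^sub>m (M+2)"
  by (rule eq_matI) (auto simp: embed_block_index, auto simp: embed_block_def)

lemma sum_embed_block_row:
  fixes h :: "nat \<Rightarrow> 'k::field"
  assumes "i < M+2"
  shows "(\<Sum>k<M+2. embed_block M a A b $$ (i, k) * h k) =
    (if i = 0 then a * h 0 else if i = Suc M then b * h (Suc M)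
     else (\<Sum>k<M. A $$ (i - 1, k) * h (Suc k)))"
  unfolding sum_lessThan_split_ends using assms by (auto simp: embed_block_index)

lemma embed_block_conj_upper:
  fixes t P R :: "'k::field mat"
  assumes t: "t \<in> carrier_mat (M+2) (M+2)" and PR: "P \<in> carrier_mat M M" "R \<in> carrier_mat M M"
    and z: "\<And>i. 0 < i \<Longrightarrow> i < M+2 \<Longrightarrow> t $$ (i, 0) = 0" "\<And>j. j < Suc M \<Longrightarrow> t $$ (Suc M, j) = 0"
    and up: "upper_triangular (R * middle_block M t * P)"
  shows "upper_triangular (embed_block M 1 R 1 * t * embed_block M 1 P 1)"
  unfolding upper_triangular_def
proof (intro allI impI)
  let ?R = "embed_block M 1 R 1" and ?P = "embed_block M 1 P 1"
  fix i j assume "i < dim_row (?R * t * ?P)" "j < i"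
  then have ij: "i < M+2" "j < M+2" "j < i" by (auto simp: embed_block_def)
  have C: "?R * t \<in> carrier_mat (M+2) (M+2)" using t mult_carrier_mat[OF embed_block_carrier] by blast
  have "(?R * t * ?P) $$ (i, j) = (\<Sum>l<M+2. (?R * t) $$ (i, l) * ?P $$ (l, j))"
    by (rule mult_mat_entry[OF C embed_block_carrier ij(1,2)])
  also have "\<dots> = (\<Sum>l<M+2. (\<Sum>k<M+2. ?R $$ (i, k) * t $$ (k, l)) * ?P $$ (l, j))"
  proof (rule sum.cong[OF refl])
    fix l assume "l \<in> {..<M+2}"
    then have l: "l < M+2" by simp
    show "(?R * t) $$ (i, l) * ?P $$ (l, j) = (\<Sum>k<M+2. ?R $$ (i, k) * t $$ (k, l)) * ?P $$ (l, j)"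
      unfolding mult_mat_entry[OF embed_block_carrier t ij(1) l] ..
  qed
  also have "\<dots> = (\<Sum>l<M+2. ?P $$ (l, j) * (if i = Suc M then 1 * t $$ (Suc M, l)
      else (\<Sum>k<M. R $$ (i - 1, k) * t $$ (Suc k, l))))"
    unfolding sum_embed_block_row[OF ij(1)] using ij(3) by (simp add: mult.commute)
  also have "\<dots> = 0"
  proof -
    have mid: "(\<Sum>l<M. P $$ (l, j - 1) * (\<Sum>k<M. R $$ (i - 1, k) * t $$ (Suc k, Suc l))) = 0"
      if h: "i \<noteq> Suc M" "j \<noteq> 0"
    proof -
      have ij': "i - 1 < M" "j - 1 < M" "j - 1 < i - 1" using h ij by auto
      have "(R * middle_block M t * P) $$ (i - 1, j - 1) = (\<Sum>l<M. (R * middle_block M t) $$ (i - 1, l) * P $$ (l, j - 1))"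
        using ij' PR mult_mat_index_sum[of "i - 1" "R * middle_block M t" "j - 1" P] by (simp add: middle_block_def del: index_mult_mat(1))
      also have "\<dots> = (\<Sum>l<M. (\<Sum>k<M. R $$ (i - 1, k) * t $$ (Suc k, Suc l)) * P $$ (l, j - 1))"
      proof (rule sum.cong[OF refl])
        fix l assume l: "l \<in> {..<M}"
        have "(R * middle_block M t) $$ (i - 1, l) = (\<Sum>k<M. R $$ (i - 1, k) * middle_block M t $$ (k, l))"
          using ij' PR l by (subst mult_mat_index_sum) (auto simp: middle_block_def)
        also have "\<dots> = (\<Sum>k<M. R $$ (i - 1, k) * t $$ (Suc k, Suc l))"
          by (rule sum.cong[OF refl]) (use l in \<open>auto simp: middle_block_def\<close>)
        finally show "(R * middle_block M t) $$ (i - 1, l) * P $$ (l, j - 1)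
           = (\<Sum>k<M. R $$ (i - 1, k) * t $$ (Suc k, Suc l)) * P $$ (l, j - 1)" by simp
      qed
      moreover have "(R * middle_block M t * P) $$ (i - 1, j - 1) = 0"
        using up ij' PR unfolding upper_triangular_def by auto
      ultimately show ?thesis by (simp add: mult.commute)
    qed
    show ?thesis unfolding sum_embed_block_column[OF ij(2)] using ij mid z by auto
  qed
  finally show "(?R * t * ?P) $$ (i, j) = 0" .
qed

text \<open>By induction on the dimension: a stable isotropic line exists by the theorem of Lie and
  Kolchin, and the group acts on the orthogonal complement of that line modulo the line.\<close>

theorem connected_solvable_triangular:
  fixes Q :: "'k::{alg_closed_field, field_char_0} mat"
  assumes "quadratic_space N Q" "G \<subseteq> Ortho N Q" "subgroup G (GL N)"
    "connectedin (zariski UNIV N) G" "(derived (GL N) ^^ d) G = {1\<^sub>m N}"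
  shows "\<exists>P. P \<in> carrier_mat N N \<and> det P \<noteq> 0 \<and> P\<^sup>T * Q * P = antidiag N \<and>
    (\<forall>g\<in>G. \<exists>t \<in> carrier_mat N N. upper_triangular t \<and> g * P = P * t)"
  using assms
proof (induction N arbitrary: Q G rule: less_induct)
  case (less N)
  note Q = less.prems(1) and G = less.prems(2-5)
  note QC = quadratic_spaceD[OF Q]
  have gGL: "g \<in> carrier (GL N)" if "g \<in> G" for g using that G by (auto simp: Ortho_def)
  have gC: "g \<in> carrier_mat N N" if "g \<in> G" for g using gGL[OF that] by (simp add: carrier_GL)
  consider "N = 0" | "N = 1" | M where "N = M+2"
    by (metis One_nat_def add_2_eq_Suc' not0_implies_Suc)
  then show ?case
  proof cases
    case 1
    show ?thesis
    proof (intro exI conjI ballI)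
      show "(1\<^sub>m N)\<^sup>T * Q * 1\<^sub>m N = antidiag N" using 1 QC(1) by (intro eq_matI) auto
      fix g assume "g \<in> G"
      then have "g \<in> carrier_mat N N" by (rule gC)
      then show "\<exists>t\<in>carrier_mat N N. upper_triangular t \<and> g * 1\<^sub>m N = 1\<^sub>m N * t"
        using 1 by (intro bexI[of _ g]) (auto simp: upper_triangular_def)
    qed auto
  next
    case 2
    define q where "q = Q $$ (0, 0)"
    have q0: "q \<noteq> 0" using QC 2 det_single[of Q] by (auto simp: q_def)
    obtain s where s: "s ^ 2 = inverse q" using nth_root_exists[of 2 "inverse q"] by auto
    define P where "P = mat N N (\<lambda>_. s)"
    have PC: "P \<in> carrier_mat N N" by (simp add: P_def)
    have "det P = s" using det_single[of P] 2 by (simp add: P_def)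
    moreover have "s \<noteq> 0" using s q0 by auto
    moreover have "P\<^sup>T * Q * P = antidiag N"
    proof (rule eq_matI)
      fix i j assume "i < dim_row (antidiag N :: 'k mat)" "j < dim_col (antidiag N :: 'k mat)"
      then have ij: "i < N" "j < N" by (auto simp: antidiag_def)
      have "s * q * s = 1" using s q0 by (simp add: power2_eq_square mult_ac)
      then show "(P\<^sup>T * Q * P) $$ (i, j) = antidiag N $$ (i, j)"
        unfolding gram_index_sum[OF PC QC(1) ij] using ij 2 by (simp add: P_def q_def antidiag_def sum.lessThan_Suc)
    qed (auto simp: P_def antidiag_def)
    moreover have "upper_triangular g \<and> g * P = P * g" if "g \<in> G" for g
    proof
      show "upper_triangular g" using gC[OF that] 2 by (auto simp: upper_triangular_def)
      show "g * P = P * g"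
      proof (rule eq_matI)
        fix i j assume "i < dim_row (P * g)" "j < dim_col (P * g)"
        then have "i = 0" "j = 0" using gC[OF that] PC 2 by auto
        then show "(g * P) $$ (i, j) = (P * g) $$ (i, j)"
          using mult_mat_index_sum[of 0 g 0 P] mult_mat_index_sum[of 0 P 0 g] gC[OF that] PC 2
          by (simp add: sum.lessThan_Suc del: index_mult_mat(1))
      qed (use gC[OF that] PC in auto)
    qed
    ultimately show ?thesis using PC gC by (intro exI[of _ P]) auto
  next
    case (3 M)
    obtain v where v: "v \<in> carrier_vec N" "v \<noteq> 0\<^sub>v N" "form Q v v = 0"
      and ev: "\<And>g. g \<in> G \<Longrightarrow> \<exists>c. g *\<^sub>v v = c \<cdot>\<^sub>v v"
      using isotropic_common_eigenvector[OF Q _ G] 3 by (metis le_add2)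
    have QT: "Q\<^sup>T = 1 \<cdot>\<^sub>m Q" using QC(3) by simp
    obtain P1 Q' where P1: "P1 \<in> carrier_mat N N" "det P1 \<noteq> 0" "col P1 0 = v"
      and Q': "Q' \<in> carrier_mat M M" "det Q' \<noteq> 0" "Q'\<^sup>T = 1 \<cdot>\<^sub>m Q'" "P1\<^sup>T * Q * P1 = add_plane 1 M Q'"
      using split_off_plane[OF QC(1)[unfolded 3] QC(2) QT _ v(1,2)[unfolded 3] v(3)] unfolding 3 by blast
    have Q'q: "quadratic_space M Q'" using Q' by (simp add: quadratic_space_def nondegenerate_form_def)
    obtain R1 where R1: "R1 \<in> carrier_mat N N" "P1 * R1 = 1\<^sub>m N" "R1 * P1 = 1\<^sub>m N"
      using obtain_inverse_mat[OF P1(1,2)] by blast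
    \<comment> \<open>the group in the new basis, and \<open>\<rho>\<close> below its action on the complement of the line modulo the line\<close>
    define t where "t g = R1 * g * P1" for g
    have tC: "t g \<in> carrier_mat (M+2) (M+2)" if "g \<in> G" for g using gC[OF that] R1 P1 3 by (auto simp: t_def)
    have gP: "g * P1 = P1 * t g" if "g \<in> G" for g
    proof -
      have "P1 * t g = P1 * (R1 * (g * P1))"
        unfolding t_def using gC[OF that] R1 P1 by (simp add: assoc_mult_mat[of _ N N _ N _ N])
      also have "\<dots> = g * P1"
        by (rule mult_mat_inverse_cancel[OF P1(1) R1(1,2), where m = N]) (use gC[OF that] P1 in auto)
      finally show ?thesis by simp
    qed
    have tiso: "(t g)\<^sup>T * add_plane 1 M Q' * t g = add_plane 1 M Q'" if g: "g \<in> G" for g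
    proof -
      have "(t g)\<^sup>T * (P1\<^sup>T * Q * P1) * t g = (P1 * t g)\<^sup>T * Q * (P1 * t g)"
        using gram_mult[OF P1(1) QC(1), of "t g" N] tC[OF g] 3 by simp
      also have "\<dots> = P1\<^sup>T * (g\<^sup>T * Q * g) * P1"
        unfolding gP[OF g, symmetric] by (rule gram_mult[OF gC[OF g] QC(1) P1(1)])
      also have "g\<^sup>T * Q * g = Q" using g G(1) Ortho_iff[OF QC(1)] by blast
      finally show ?thesis unfolding Q'(4) .
    qed
    have tline: "t g $$ (i, 0) = 0" if g: "g \<in> G" and i: "0 < i" "i < M+2" for g i
    proof -
      obtain c where c: "g *\<^sub>v v = c \<cdot>\<^sub>v v" using ev[OF g] by blast
      have R1v: "R1 *\<^sub>v v = unit_vec N 0"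
      proof -
        have "R1 *\<^sub>v v = col (R1 * P1) 0" using col_mult2[OF R1(1) P1(1), of 0] P1(3) 3 by simp
        then show ?thesis using R1 3 by simp
      qed
      have "col (t g) 0 = (R1 * g) *\<^sub>v col P1 0"
        unfolding t_def by (rule col_mult2[OF mult_carrier_mat[OF R1(1) gC[OF g]] P1(1)]) (use 3 in simp)
      also have "\<dots> = R1 *\<^sub>v (c \<cdot>\<^sub>v v)" unfolding P1(3) c[symmetric]
        using R1 gC[OF g] v by (simp add: assoc_mult_mat_vec[of _ N N _ N])
      also have "\<dots> = c \<cdot>\<^sub>v unit_vec N 0" using R1 v R1v by (simp add: mult_mat_vec[of _ N N])
      finally have "col (t g) 0 $ i = (c \<cdot>\<^sub>v unit_vec N 0) $ i" by simp
      then show ?thesis using tC[OF g] i 3 by simp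
    qed
    note blk = isometry_fixing_line[OF tC tiso Q'(1) tline]
    define \<rho> where "\<rho> g = middle_block M (t g)" for g
    have tmult: "t (g * h) = t g * t h" if "g \<in> G" "h \<in> G" for g h
    proof -
      have "t g * t h = R1 * (g * (P1 * (R1 * (h * P1))))"
        unfolding t_def using gC[OF that(1)] gC[OF that(2)] R1 P1 by (simp add: assoc_mult_mat[of _ N N _ N _ N])
      also have "P1 * (R1 * (h * P1)) = h * P1"
        by (rule mult_mat_inverse_cancel[OF P1(1) R1(1,2), where m = N]) (use gC[OF that(2)] P1 in auto)
      also have "R1 * (g * (h * P1)) = t (g * h)"
        unfolding t_def using gC[OF that(1)] gC[OF that(2)] R1 P1 by (simp add: assoc_mult_mat[of _ N N _ N _ N])
      finally show ?thesis by simp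
    qed
    have \<rho>mult: "\<rho> (g * h) = \<rho> g * \<rho> h" if "g \<in> G" "h \<in> G" for g h
      unfolding \<rho>_def tmult[OF that] by (rule middle_block_mult) (use tC tline blk(1) that in auto)
    have \<rho>iso: "(\<rho> g)\<^sup>T * Q' * \<rho> g = Q'" if "g \<in> G" for g unfolding \<rho>_def by (rule blk(2)[OF that that that])
    have \<rho>det: "det (\<rho> g) * det (\<rho> g) = 1" if "g \<in> G" for g
      using det_gram[of "\<rho> g" M Q'] \<rho>iso[OF that] Q' by (simp add: \<rho>_def power2_eq_square)
    have \<rho>GL: "\<rho> g \<in> carrier (GL M)" if "g \<in> G" for g
      using \<rho>det[OF that] by (auto simp: carrier_GL \<rho>_def)
    have \<rho>O: "\<rho> ` G \<subseteq> Ortho M Q'" using \<rho>GL \<rho>iso Ortho_iff[OF Q'(1)] by blast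
    have "\<rho> \<in> hom ((GL N)\<lparr>carrier := G\<rparr>) (GL M)"
      using \<rho>GL \<rho>mult by (intro homI) auto
    note img = exp_of_derived_hom_image[OF group_GL group_GL G(2) this]
    have "(1\<^sub>m N :: 'k mat) \<in> G" using subgroup.one_closed[OF G(2)] by simp
    have "\<rho> (1\<^sub>m N) = 1\<^sub>m M"
      unfolding \<rho>_def t_def using R1 P1 3 by (intro eq_matI) (auto simp: middle_block_def)
    then have \<rho>sol: "(derived (GL M) ^^ d) (\<rho> ` G) = {1\<^sub>m M}" unfolding img(1) G(4) by simp
    have reg: "regular_on UNIV N G (\<lambda>g. \<rho> g $$ (i, j))" if ij: "i < M" "j < M" for i j
    proof (rule regular_on_cong)
      show "regular_on UNIV N G (\<lambda>g. (R1 * g * P1) $$ (Suc i, Suc j))"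
        using ij R1 P1 gC 3
        by (intro regular_on_mult_entry[where m = N and l = N and n = N] regular_on_entry regular_on_const)
           (auto intro!: mult_carrier_mat)
      show "(R1 * g * P1) $$ (Suc i, Suc j) = \<rho> g $$ (i, j)" if "g \<in> G" for g
        using ij by (simp add: \<rho>_def t_def middle_block_def)
    qed
    have \<rho>con: "connectedin (zariski UNIV M) (\<rho> ` G)"
    proof (rule connectedin_regular_image[OF G(3) _ reg])
      show "regular_on UNIV N G (\<lambda>g. inverse (det (\<rho> g)))"
      proof (rule regular_on_cong)
        show "regular_on UNIV N G (\<lambda>g. det (\<rho> g))"
          by (rule regular_on_det[of _ _ M]) (auto simp: \<rho>_def intro: reg[unfolded \<rho>_def])
        show "det (\<rho> g) = inverse (det (\<rho> g))" if "g \<in> G" for g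
          using \<rho>det[OF that] by (metis inverse_unique)
      qed
    qed (use \<rho>GL in auto)
    obtain P' where P': "P' \<in> carrier_mat M M" "det P' \<noteq> 0" "P'\<^sup>T * Q' * P' = antidiag M"
      and up: "\<And>g. g \<in> G \<Longrightarrow> \<exists>s \<in> carrier_mat M M. upper_triangular s \<and> \<rho> g * P' = P' * s"
      using less.IH[of M Q' "\<rho> ` G", OF _ Q'q \<rho>O img(2) \<rho>con \<rho>sol] 3 by auto
    obtain R' where R': "R' \<in> carrier_mat M M" "P' * R' = 1\<^sub>m M" "R' * P' = 1\<^sub>m M"
      using obtain_inverse_mat[OF P'(1,2)] by blast
    let ?E = "embed_block M 1 P' 1" and ?F = "embed_block M 1 R' 1"
    have EC: "?E \<in> carrier_mat N N" "?F \<in> carrier_mat N N" unfolding 3 by (rule embed_block_carrier)+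
    have EF: "?E * ?F = 1\<^sub>m N" using embed_block_mult[OF P'(1) R'(1)] embed_block_one R' 3 by simp
    show ?thesis
    proof (intro exI conjI ballI)
      show PEC: "P1 * ?E \<in> carrier_mat N N" using P1 EC by simp
      show "det (P1 * ?E) \<noteq> 0"
        using det_mult[OF P1(1) EC(1)] det_embed_block[OF P'(1)] P1 P' by simp
      have "(P1 * ?E)\<^sup>T * Q * (P1 * ?E) = ?E\<^sup>T * add_plane 1 M Q' * ?E"
        unfolding gram_mult[OF P1(1) QC(1) EC(1)] Q'(4) ..
      also have "\<dots> = (1 * 1) \<cdot>\<^sub>m add_plane 1 M (antidiag M)"
        by (rule gram_embed_block) (use P' Q' in auto)
      also have "\<dots> = antidiag N" using add_plane_antidiag[of M] 3 by simp
      finally show "(P1 * ?E)\<^sup>T * Q * (P1 * ?E) = antidiag N" .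
      fix g assume g: "g \<in> G"
      have tN: "t g \<in> carrier_mat N N" using tC[OF g] 3 by simp
      show "\<exists>s\<in>carrier_mat N N. upper_triangular s \<and> g * (P1 * ?E) = P1 * ?E * s"
      proof (intro bexI conjI)
        show "?F * t g * ?E \<in> carrier_mat N N" using EC tN by auto
        obtain s where s: "s \<in> carrier_mat M M" "upper_triangular s" "\<rho> g * P' = P' * s" using up[OF g] by blast
        have "R' * middle_block M (t g) * P' = R' * (\<rho> g * P')"
          unfolding \<rho>_def using R' P' by (intro assoc_mult_mat[of _ M M _ M _ M]) auto
        also have "\<dots> = (R' * P') * s"
          unfolding s(3) using R' P' s by (intro assoc_mult_mat[of _ M M _ M _ M, symmetric]) auto
        also have "\<dots> = s" using R' s by simp
        finally have "upper_triangular (R' * middle_block M (t g) * P')" using s by simp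
        then show "upper_triangular (?F * t g * ?E)"
          by (intro embed_block_conj_upper) (use tC[OF g] P' R' tline[OF g] blk(1)[OF g g g] in auto)
        have "P1 * ?E * (?F * t g * ?E) = P1 * (?E * (?F * (t g * ?E)))"
          using P1(1) EC tN by (simp add: assoc_mult_mat[of _ N N _ N _ N])
        also have "?E * (?F * (t g * ?E)) = t g * ?E"
          by (rule mult_mat_inverse_cancel[OF EC EF, where m = N]) (use EC tN in auto)
        also have "P1 * (t g * ?E) = (P1 * t g) * ?E"
          using P1(1) EC tN by (simp add: assoc_mult_mat[of _ N N _ N _ N])
        also have "\<dots> = g * (P1 * ?E)"
          unfolding gP[OF g, symmetric] using P1(1) EC gC[OF g] by (simp add: assoc_mult_mat[of _ N N _ N _ N])
        finally show "g * (P1 * ?E) = P1 * ?E * (?F * t g * ?E)" by simp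
      qed
    qed
  qed
qed

section \<open>The standard Borel subgroup of an even special orthogonal group\<close>

text \<open>With respect to the antidiagonal form the standard flag is self-dual.\<close>

definition std_borel :: "nat \<Rightarrow> 'k::field mat set" where
  "std_borel N = {g \<in> SO N (antidiag N). upper_triangular g}"

lemma gram_antidiag_entry:
  fixes A :: "'k::field mat"
  assumes A: "A \<in> carrier_mat N N" and ij: "i < N" "j < N"
  shows "(A\<^sup>T * antidiag N * A) $$ (i, j) = (\<Sum>k<N. A $$ (k, i) * A $$ (N - 1 - k, j))"
proof -
  have "(A\<^sup>T * antidiag N * A) $$ (i, j) = (\<Sum>k<N. \<Sum>l<N. A $$ (k, i) * antidiag N $$ (k, l) * A $$ (l, j))"
    by (rule gram_index_sum[OF A antidiag_carrier ij])
  also have "\<dots> = (\<Sum>k<N. \<Sum>l<N. if l = N - 1 - k then A $$ (k, i) * A $$ (N - 1 - k, j) else 0)"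
    by (intro sum.cong refl) (auto simp: antidiag_def)
  also have "\<dots> = (\<Sum>k<N. A $$ (k, i) * A $$ (N - 1 - k, j))"
    by (intro sum.cong refl) auto
  finally show ?thesis .
qed

lemma std_borel_iff:
  fixes g :: "'k::field mat"
  shows "g \<in> std_borel N \<longleftrightarrow> g \<in> carrier_mat N N \<and> g\<^sup>T * antidiag N * g = antidiag N \<and> det g = 1 \<and> upper_triangular g"
  unfolding std_borel_def SO_def by (auto simp: Ortho_iff[OF antidiag_carrier] carrier_GL)

lemma subgroup_Ortho:
  fixes Q :: "'k::field mat"
  assumes Q: "Q \<in> carrier_mat N N"
  shows "subgroup (Ortho N Q) (GL N)"
proof
  interpret L: Group.group "GL N :: 'k mat monoid" by (rule group_GL)
  show "Ortho N Q \<subseteq> carrier (GL N)" by (auto simp: Ortho_def)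
  show "\<one>\<^bsub>GL N\<^esub> \<in> Ortho N Q"
    using L.one_closed Q by (simp add: Ortho_iff[OF Q])
  fix x assume x: "x \<in> Ortho N Q"
  then have xG: "x \<in> carrier (GL N)" and xC: "x \<in> carrier_mat N N" by (auto simp: Ortho_def carrier_GL)
  note i = inv_GL[OF xG]
  show "inv\<^bsub>GL N\<^esub> x \<in> Ortho N Q"
    unfolding Ortho_def
  proof safe
    fix v w :: "'k vec" assume vw: "v \<in> carrier_vec N" "w \<in> carrier_vec N"
    have c: "inv\<^bsub>GL N\<^esub> x *\<^sub>v v \<in> carrier_vec N" "inv\<^bsub>GL N\<^esub> x *\<^sub>v w \<in> carrier_vec N"
      using mult_mat_vec_carrier[OF i(2)] vw by auto
    have "x *\<^sub>v (inv\<^bsub>GL N\<^esub> x *\<^sub>v v) = v" "x *\<^sub>v (inv\<^bsub>GL N\<^esub> x *\<^sub>v w) = w"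
      using vw assoc_mult_mat_vec[OF xC i(2)] i(3) by (metis one_mult_mat_vec)+
    then show "form Q (inv\<^bsub>GL N\<^esub> x *\<^sub>v v) (inv\<^bsub>GL N\<^esub> x *\<^sub>v w) = form Q v w"
      using x c unfolding Ortho_def by (metis (mono_tags, lifting) mem_Collect_eq)
  qed (rule i(1))
  fix y assume y: "y \<in> Ortho N Q"
  then have yG: "y \<in> carrier (GL N)" and yC: "y \<in> carrier_mat N N" by (auto simp: Ortho_def carrier_GL)
  show "x \<otimes>\<^bsub>GL N\<^esub> y \<in> Ortho N Q"
    unfolding Ortho_def
  proof safe
    show "x \<otimes>\<^bsub>GL N\<^esub> y \<in> carrier (GL N)" using xG yG by (rule L.m_closed)
    fix v w :: "'k vec" assume vw: "v \<in> carrier_vec N" "w \<in> carrier_vec N"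
    then show "form Q ((x \<otimes>\<^bsub>GL N\<^esub> y) *\<^sub>v v) ((x \<otimes>\<^bsub>GL N\<^esub> y) *\<^sub>v w) = form Q v w"
      using x y mult_mat_vec_carrier[OF yC] assoc_mult_mat_vec[OF xC yC] by (auto simp: Ortho_def)
  qed
qed

lemma subgroup_SO:
  fixes Q :: "'k::field mat"
  assumes Q: "Q \<in> carrier_mat N N"
  shows "subgroup (SO N Q) (GL N)"
proof
  note O = subgroup_Ortho[OF Q]
  show "SO N Q \<subseteq> carrier (GL N)" using subgroup.subset[OF O] by (auto simp: SO_def)
  show "\<one>\<^bsub>GL N\<^esub> \<in> SO N Q" using subgroup.one_closed[OF O] by (simp add: SO_def)
  fix x assume x: "x \<in> SO N Q"
  then have xG: "x \<in> carrier (GL N)" and xC: "x \<in> carrier_mat N N" by (auto simp: SO_def Ortho_def carrier_GL)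
  have "det x * det (inv\<^bsub>GL N\<^esub> x) = 1" using det_mult[OF xC inv_GL(2)[OF xG]] inv_GL(3)[OF xG] by simp
  then show "inv\<^bsub>GL N\<^esub> x \<in> SO N Q" using x subgroup.m_inv_closed[OF O] by (auto simp: SO_def)
  fix y assume y: "y \<in> SO N Q"
  then have yC: "y \<in> carrier_mat N N" by (auto simp: SO_def Ortho_def carrier_GL)
  show "x \<otimes>\<^bsub>GL N\<^esub> y \<in> SO N Q"
    using x y subgroup.m_closed[OF O, of x y] det_mult[OF xC yC] by (auto simp: SO_def)
qed

subsection \<open>Solvability\<close>

text \<open>The filtration of the upper triangular group by the distance from the diagonal:
  \<open>depth_group N 0\<close> is the upper triangular group and \<open>depth_group N 1\<close> its unipotent part.\<close>

definition depth_group :: "nat \<Rightarrow> nat \<Rightarrow> 'k::field mat set" where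
  "depth_group N k = {a \<in> carrier (GL N). \<forall>i<N. \<forall>j<N. j < i + k \<longrightarrow> a $$ (i, j) = (if i = j then 1 else 0)}"

lemma depth_groupD:
  assumes "a \<in> depth_group N k"
  shows "a \<in> carrier_mat N N" "a \<in> carrier (GL N)"
    "i < N \<Longrightarrow> j < N \<Longrightarrow> j < i + k \<Longrightarrow> a $$ (i, j) = (if i = j then 1 else 0)"
  using assms by (auto simp: depth_group_def carrier_GL)

lemma depth_group_upper: "a \<in> depth_group N k \<Longrightarrow> i < N \<Longrightarrow> j < i \<Longrightarrow> a $$ (i, j) = 0"
  by (simp add: depth_group_def)

lemma depth_group_diag_nonzero:
  assumes "a \<in> depth_group N k" "i < N"
  shows "a $$ (i, i) \<noteq> 0"
proof -
  have "upper_triangular a"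
    using depth_group_upper[OF assms(1)] depth_groupD(1)[OF assms(1)] by (auto simp: upper_triangular_def)
  then have "0 \<notin> set (diag_mat a)"
    using upper_triangular_imp_det_eq_0_iff[OF depth_groupD(1)[OF assms(1)]] depth_groupD(2)[OF assms(1)]
    by (auto simp: carrier_GL)
  then show ?thesis using assms depth_groupD(1)[OF assms(1)] by (force simp: diag_mat_def)
qed

text \<open>If \<open>cy\<close> and \<open>y\<close> agree near the diagonal, then \<open>c\<close> is trivial there: solve
  \<open>(c - 1) y = cy - y\<close> column by column.\<close>

lemma quotient_depth:
  fixes c y :: "'k::field mat"
  assumes c: "c \<in> carrier_mat N N" and y: "y \<in> depth_group N k"
    and agree: "\<And>i j. i < N \<Longrightarrow> j < N \<Longrightarrow> j < i + m \<Longrightarrow> (c * y) $$ (i, j) = y $$ (i, j)"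
    and ij: "i < N" "j < N" "j < i + m"
  shows "c $$ (i, j) = (if i = j then 1 else 0)"
  using ij(2,3)
proof (induction j rule: less_induct)
  case (less j)
  note yC = depth_groupD(1)[OF y]
  have "(\<Sum>l<N. c $$ (i, l) * y $$ (l, j)) = (\<Sum>l<N. (if i = l then 1 else 0) * y $$ (l, j))"
  proof -
    have "(\<Sum>l<N. (if i = l then 1 else 0) * y $$ (l, j)) = (\<Sum>l<N. if l = i then y $$ (i, j) else 0)"
      by (intro sum.cong) auto
    also have "\<dots> = y $$ (i, j)" using ij(1) by simp
    finally show ?thesis using agree[OF ij(1) less.prems] mult_mat_entry[OF c yC ij(1) less.prems(1)] by simp
  qed
  then have "(\<Sum>l<N. (c $$ (i, l) - (if i = l then 1 else 0)) * y $$ (l, j)) = 0"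
    by (simp only: left_diff_distrib sum_subtractf) simp
  also have "(\<Sum>l<N. (c $$ (i, l) - (if i = l then 1 else 0)) * y $$ (l, j))
     = (\<Sum>l<N. if l = j then (c $$ (i, j) - (if i = j then 1 else 0)) * y $$ (j, j) else 0)"
  proof (rule sum.cong[OF refl])
    fix l assume "l \<in> {..<N}"
    then have l: "l < N" by simp
    consider "l < j" | "l = j" | "j < l" by linarith
    then show "(c $$ (i, l) - (if i = l then 1 else 0)) * y $$ (l, j)
       = (if l = j then (c $$ (i, j) - (if i = j then 1 else 0)) * y $$ (j, j) else 0)"
      using less.IH[of l] l less.prems depth_group_upper[OF y l] by cases auto
  qed
  also have "\<dots> = (c $$ (i, j) - (if i = j then 1 else 0)) * y $$ (j, j)" using less.prems by simp
  finally show ?case using depth_group_diag_nonzero[OF y less.prems(1)] by simp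
qed

text \<open>On the diagonal at distance \<open>k\<close>, multiplication is multiplication of diagonal entries for \<open>k = 0\<close> and
  addition for \<open>k > 0\<close>; in particular it is commutative there.\<close>

lemma depth_group_mult_entry:
  fixes a b :: "'k::field mat"
  assumes a: "a \<in> depth_group N k" and b: "b \<in> depth_group N k" and ij: "i < N" "j < N" "j \<le> i + k"
  shows "(a * b) $$ (i, j) = (if j < i + k then (if i = j then 1 else 0)
    else if k = 0 then a $$ (i, i) * b $$ (i, i) else a $$ (i, j) + b $$ (i, j))"
proof -
  have "(a * b) $$ (i, j) = (\<Sum>l<N. a $$ (i, l) * b $$ (l, j))"
    by (rule mult_mat_entry[OF depth_groupD(1)[OF a] depth_groupD(1)[OF b] ij(1,2)])
  also have "\<dots> = (\<Sum>l<N. (if l = i then a $$ (i, i) * b $$ (i, j) else 0) + (if l = j \<and> i \<noteq> j then a $$ (i, j) * b $$ (j, j) else 0))"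
  proof (rule sum.cong[OF refl])
    fix l assume "l \<in> {..<N}"
    then have l: "l < N" by simp
    have "a $$ (i, l) * b $$ (l, j) = 0" if "l \<noteq> i" "l \<noteq> j"
    proof (cases "l < i + k")
      case True then show ?thesis using depth_groupD(3)[OF a ij(1) l] that by simp
    next
      case False
      then have "j < l + k \<and> j < l \<or> j = l" using ij by linarith
      then show ?thesis using depth_group_upper[OF b l] that by auto
    qed
    then show "a $$ (i, l) * b $$ (l, j) = (if l = i then a $$ (i, i) * b $$ (i, j) else 0)
       + (if l = j \<and> i \<noteq> j then a $$ (i, j) * b $$ (j, j) else 0)" by auto
  qed
  also have "\<dots> = a $$ (i, i) * b $$ (i, j) + (if i \<noteq> j then a $$ (i, j) * b $$ (j, j) else 0)"
    using ij by (cases "i = j") (simp_all add: sum.distrib)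
  finally show ?thesis
    using depth_groupD(3)[OF a ij(1,2)] depth_groupD(3)[OF b ij(1,2)]
      depth_groupD(3)[OF a ij(1,1)] depth_groupD(3)[OF b ij(2,2)] ij
    by (cases "k = 0") (auto split: if_splits)
qed

lemma subgroup_depth_group: "subgroup (depth_group N k) (GL N :: 'k::field mat monoid)"
proof
  interpret L: Group.group "GL N :: 'k mat monoid" by (rule group_GL)
  show "depth_group N k \<subseteq> carrier (GL N :: 'k mat monoid)" by (auto simp: depth_group_def)
  show "\<one>\<^bsub>GL N\<^esub> \<in> (depth_group N k :: 'k mat set)"
    using L.one_closed by (auto simp: depth_group_def)
  fix x :: "'k mat" assume x: "x \<in> depth_group N k"
  note xD = depth_groupD[OF x]
  have "(inv\<^bsub>GL N\<^esub> x) $$ (i, j) = (if i = j then 1 else 0)" if "i < N" "j < N" "j < i + k" for i j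
    by (rule quotient_depth[OF inv_GL(2)[OF xD(2)] x _ that]) (use inv_GL(4)[OF xD(2)] xD(3) in auto)
  then show "inv\<^bsub>GL N\<^esub> x \<in> depth_group N k" using inv_GL(1)[OF xD(2)] by (simp add: depth_group_def)
  fix y :: "'k mat" assume y: "y \<in> depth_group N k"
  have "x \<otimes>\<^bsub>GL N\<^esub> y \<in> carrier (GL N)" using xD(2) depth_groupD(2)[OF y] by (rule L.m_closed)
  moreover have "(x * y) $$ (i, j) = (if i = j then 1 else 0)" if "i < N" "j < N" "j < i + k" for i j
    using depth_group_mult_entry[OF x y that(1,2)] that by simp
  ultimately show "x \<otimes>\<^bsub>GL N\<^esub> y \<in> depth_group N k" unfolding mult_GL depth_group_def by blast
qed

text \<open>\<open>ab\<close> and \<open>ba\<close> agree up to distance \<open>k\<close> from the diagonal, so their quotient is trivial up to there.\<close>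

lemma derived_depth_group:
  "derived (GL N) (depth_group N k) \<subseteq> (depth_group N (Suc k) :: 'k::field mat set)"
proof -
  interpret L: Group.group "GL N :: 'k mat monoid" by (rule group_GL)
  have "a * b * inv\<^bsub>GL N\<^esub> a * inv\<^bsub>GL N\<^esub> b \<in> depth_group N (Suc k)"
    if a: "a \<in> depth_group N k" and b: "b \<in> depth_group N k" for a b :: "'k mat"
  proof -
    note aD = depth_groupD[OF a] and bD = depth_groupD[OF b]
    note ia = inv_GL[OF aD(2)] and ib = inv_GL[OF bD(2)]
    let ?c = "a * b * inv\<^bsub>GL N\<^esub> a * inv\<^bsub>GL N\<^esub> b"
    have cG: "?c \<in> carrier (GL N)"
      using L.m_closed[OF L.m_closed[OF L.m_closed[OF aD(2) bD(2)] ia(1)] ib(1)] by simp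
    have ba: "b * a \<in> depth_group N k" using subgroup.m_closed[OF subgroup_depth_group b a] by simp
    have e1: "inv\<^bsub>GL N\<^esub> b * (b * a) = a"
      by (rule mult_mat_inverse_cancel[OF ib(2) bD(1) ib(4) aD(1)])
    have "?c * (b * a) = a * b * inv\<^bsub>GL N\<^esub> a * (inv\<^bsub>GL N\<^esub> b * (b * a))"
      by (rule assoc_mult_mat[of _ N N _ N _ N]) (use aD bD ia ib in \<open>auto intro!: mult_carrier_mat\<close>)
    also have "\<dots> = a * b * (inv\<^bsub>GL N\<^esub> a * a)"
      unfolding e1 by (rule assoc_mult_mat[of _ N N _ N _ N]) (use aD bD ia ib in \<open>auto intro!: mult_carrier_mat\<close>)
    also have "\<dots> = a * b" unfolding ia(4) using aD bD by simp
    finally have cba: "?c * (b * a) = a * b" .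
    have "?c $$ (i, j) = (if i = j then 1 else 0)" if ij: "i < N" "j < N" "j < i + Suc k" for i j
    proof (rule quotient_depth[OF _ ba _ ij])
      show "?c \<in> carrier_mat N N" using cG by (simp add: carrier_GL)
      fix i j assume "i < N" "j < N" "j < i + Suc k"
      then show "(?c * (b * a)) $$ (i, j) = (b * a) $$ (i, j)"
        unfolding cba by (simp only: depth_group_mult_entry[OF a b] depth_group_mult_entry[OF b a] less_Suc_eq_le add_Suc_right) (simp add: ac_simps)
    qed
    then show ?thesis using cG by (simp add: depth_group_def)
  qed
  then show ?thesis
    unfolding derived_def
    by (intro L.generate_subgroup_incl[OF _ subgroup_depth_group]) auto
qed

lemma upper_triangular_solvable:
  fixes H :: "'k::field mat set"
  assumes H: "subgroup H (GL N)" "H \<subseteq> depth_group N 0"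
  shows "(derived (GL N) ^^ N) H = {1\<^sub>m N}"
proof -
  interpret L: Group.group "GL N :: 'k mat monoid" by (rule group_GL)
  have "(derived (GL N) ^^ k) H \<subseteq> depth_group N k" for k
  proof (induction k)
    case 0 then show ?case using H by simp
  next
    case (Suc k)
    then show ?case using L.mono_derived[OF Suc] derived_depth_group by fastforce
  qed
  moreover have "depth_group N N \<subseteq> {1\<^sub>m N :: 'k mat}"
    by (auto simp: depth_group_def carrier_GL intro!: eq_matI)
  moreover have "1\<^sub>m N \<in> (derived (GL N) ^^ N) H"
    using subgroup.one_closed[OF L.exp_of_derived_is_subgroup[OF H(1)]] by simp
  ultimately show ?thesis by blast
qed

lemma std_borel_depth: "std_borel N \<subseteq> (depth_group N 0 :: 'k::field mat set)"
  by (auto simp: std_borel_iff depth_group_def carrier_GL upper_triangular_def)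

lemma subgroup_std_borel: "subgroup (std_borel N) (GL N :: 'k::field mat monoid)"
proof -
  interpret L: Group.group "GL N :: 'k mat monoid" by (rule group_GL)
  have "std_borel N = SO N (antidiag N) \<inter> (depth_group N 0 :: 'k mat set)"
    by (auto simp: std_borel_def depth_group_def SO_def Ortho_def carrier_GL upper_triangular_def)
  then show ?thesis using L.subgroups_Inter_pair[OF subgroup_SO[OF antidiag_carrier] subgroup_depth_group] by simp
qed

subsection \<open>Connectedness\<close>

lemma zariski_open_contains_basic:
  fixes K :: "'k::field set"
  assumes "openin (zariski K N) U" "x \<in> U" "1 \<in> K"
  shows "\<exists>r \<in> regular_functions K N. r x \<noteq> 0 \<and> {A \<in> carrier (GL N). r A \<noteq> 0} \<subseteq> U"
proof -
  have "generate_topology_on ((\<lambda>f. {A \<in> carrier (GL N). f A \<noteq> 0}) ` regular_functions K N) U"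
    using assms(1) unfolding zariski_def by (rule openin_topology_generated_by)
  then show ?thesis using assms(2)
  proof (induction rule: generate_topology_on.induct)
    case Empty then show ?case by simp
  next
    case (Int a b)
    obtain r where r: "r \<in> regular_functions K N" "r x \<noteq> 0" "{A \<in> carrier (GL N). r A \<noteq> 0} \<subseteq> a" using Int by blast
    obtain s where s: "s \<in> regular_functions K N" "s x \<noteq> 0" "{A \<in> carrier (GL N). s A \<noteq> 0} \<subseteq> b" using Int by blast
    show ?case
      by (rule bexI[OF _ regular_functions.mult[OF r(1) s(1)]]) (use r s in auto)
  next
    case (UN \<K>)
    then obtain k where "k \<in> \<K>" "x \<in> k" by blast
    then show ?case using UN.IH[of k] by blast
  next
    case (Basis s)
    then show ?case by auto
  qed
qed

text \<open>The line with finitely many points removed is irreducible, hence so is its image under a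
  rational map.\<close>

lemma connectedin_rational_curve:
  fixes f :: "'k::field_char_0 \<Rightarrow> 'k mat"
  assumes q: "q \<noteq> 0" and fG: "\<And>t. poly q t \<noteq> 0 \<Longrightarrow> f t \<in> carrier_mat N N \<and> det (f t) = 1"
    and ent: "\<And>i j. i < N \<Longrightarrow> j < N \<Longrightarrow> \<exists>p m. \<forall>t. poly q t \<noteq> 0 \<longrightarrow> f t $$ (i, j) * poly q t ^ m = poly p t"
  shows "connectedin (zariski UNIV N) (f ` {t. poly q t \<noteq> 0})"
proof -
  let ?S = "f ` {t. poly q t \<noteq> 0}"
  have SG: "?S \<subseteq> carrier (GL N)" using fG by (auto simp: carrier_GL)
  have reg: "\<exists>p m. \<forall>t. poly q t \<noteq> 0 \<longrightarrow> r (f t) * poly q t ^ m = poly p t"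
    if "r \<in> regular_functions UNIV N" for r
    using that
  proof induction
    case (const c) show ?case by (intro exI[of _ "[:c:]"] exI[of _ 0]) simp
  next
    case (entry i j) then show ?case by (rule ent)
  next
    case inv_det show ?case by (intro exI[of _ 1] exI[of _ 0]) (simp add: fG)
  next
    case (add r s)
    obtain p m where p: "\<forall>t. poly q t \<noteq> 0 \<longrightarrow> r (f t) * poly q t ^ m = poly p t" using add.IH by blast
    obtain p' m' where p': "\<forall>t. poly q t \<noteq> 0 \<longrightarrow> s (f t) * poly q t ^ m' = poly p' t" using add.IH by blast
    show ?case
    proof (intro exI allI impI)
      fix t assume t: "poly q t \<noteq> 0"
      have "(r (f t) + s (f t)) * poly q t ^ (m + m') = (r (f t) * poly q t ^ m) * poly q t ^ m' + (s (f t) * poly q t ^ m') * poly q t ^ m"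
        by (simp add: algebra_simps power_add)
      also have "\<dots> = poly (p * q ^ m' + p' * q ^ m) t" using p p' t by simp
      finally show "(r (f t) + s (f t)) * poly q t ^ (m + m') = poly (p * q ^ m' + p' * q ^ m) t" .
    qed
  next
    case (mult r s)
    obtain p m where p: "\<forall>t. poly q t \<noteq> 0 \<longrightarrow> r (f t) * poly q t ^ m = poly p t" using mult.IH by blast
    obtain p' m' where p': "\<forall>t. poly q t \<noteq> 0 \<longrightarrow> s (f t) * poly q t ^ m' = poly p' t" using mult.IH by blast
    show ?case
    proof (intro exI allI impI)
      fix t assume t: "poly q t \<noteq> 0"
      have "(r (f t) * s (f t)) * poly q t ^ (m + m') = (r (f t) * poly q t ^ m) * (s (f t) * poly q t ^ m')"
        by (simp add: algebra_simps power_add)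
      also have "\<dots> = poly (p * p') t" using p p' t by simp
      finally show "(r (f t) * s (f t)) * poly q t ^ (m + m') = poly (p * p') t" .
    qed
  qed
  have "E1 \<inter> E2 \<inter> ?S \<noteq> {}" if E: "openin (zariski UNIV N) E1" "openin (zariski UNIV N) E2" "E1 \<inter> ?S \<noteq> {}" "E2 \<inter> ?S \<noteq> {}" for E1 E2
  proof -
    obtain t1 t2 where t: "poly q t1 \<noteq> 0" "f t1 \<in> E1" "poly q t2 \<noteq> 0" "f t2 \<in> E2" using E(3,4) by auto
    obtain r1 where r1: "r1 \<in> regular_functions UNIV N" "r1 (f t1) \<noteq> 0" "{A \<in> carrier (GL N). r1 A \<noteq> 0} \<subseteq> E1"
      using zariski_open_contains_basic[OF E(1) t(2)] by auto
    obtain r2 where r2: "r2 \<in> regular_functions UNIV N" "r2 (f t2) \<noteq> 0" "{A \<in> carrier (GL N). r2 A \<noteq> 0} \<subseteq> E2"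
      using zariski_open_contains_basic[OF E(2) t(4)] by auto
    obtain p1 m1 where p1: "\<And>t. poly q t \<noteq> 0 \<Longrightarrow> r1 (f t) * poly q t ^ m1 = poly p1 t" using reg[OF r1(1)] by blast
    obtain p2 m2 where p2: "\<And>t. poly q t \<noteq> 0 \<Longrightarrow> r2 (f t) * poly q t ^ m2 = poly p2 t" using reg[OF r2(1)] by blast
    have "poly p1 t1 \<noteq> 0" "poly p2 t2 \<noteq> 0" using p1[OF t(1)] p2[OF t(3)] r1 r2 t by auto
    then have "p1 * p2 * q \<noteq> 0" using q by auto
    then have "finite {t. poly (p1 * p2 * q) t = 0}" by (rule poly_roots_finite)
    then obtain t0 where "poly (p1 * p2 * q) t0 \<noteq> 0"
      using ex_new_if_finite[OF infinite_UNIV_char_0] by blast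
    then have t0: "poly q t0 \<noteq> 0" "poly p1 t0 \<noteq> 0" "poly p2 t0 \<noteq> 0" by auto
    have "f t0 \<in> E1 \<inter> E2 \<inter> ?S"
      using p1[OF t0(1)] p2[OF t0(1)] t0 r1(3) r2(3) SG by force
    then show ?thesis by blast
  qed
  then show ?thesis using SG unfolding connectedin by auto
qed

lemma std_borel_diag:
  fixes b :: "'k::field mat"
  assumes b: "b \<in> std_borel N"
  shows "i < N \<Longrightarrow> b $$ (i, i) * b $$ (N - 1 - i, N - 1 - i) = 1" "(\<Prod>i<N. b $$ (i, i)) = 1"
proof -
  have bC: "b \<in> carrier_mat N N" and up: "\<And>i j. i < N \<Longrightarrow> j < i \<Longrightarrow> b $$ (i, j) = 0"
    and iso: "b\<^sup>T * antidiag N * b = antidiag N" and d: "det b = 1" "upper_triangular b"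
    using b by (auto simp: std_borel_iff upper_triangular_def)
  show "b $$ (i, i) * b $$ (N - 1 - i, N - 1 - i) = 1" if i: "i < N"
  proof -
    have "1 = (b\<^sup>T * antidiag N * b) $$ (i, N - 1 - i)" unfolding iso using i by (simp add: antidiag_def)
    also have "\<dots> = (\<Sum>k<N. b $$ (k, i) * b $$ (N - 1 - k, N - 1 - i))"
      by (rule gram_antidiag_entry[OF bC]) (use i in auto)
    also have "\<dots> = (\<Sum>k<N. if k = i then b $$ (i, i) * b $$ (N - 1 - i, N - 1 - i) else 0)"
    proof (rule sum.cong[OF refl])
      fix k assume "k \<in> {..<N}"
      then have k: "k < N" by simp
      consider "k = i" | "i < k" | "N - 1 - i < N - 1 - k" using k i by linarith
      then show "b $$ (k, i) * b $$ (N - 1 - k, N - 1 - i) = (if k = i then b $$ (i, i) * b $$ (N - 1 - i, N - 1 - i) else 0)"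
        using k i up[of k i] up[of "N - 1 - k" "N - 1 - i"] by cases auto
    qed
    also have "\<dots> = b $$ (i, i) * b $$ (N - 1 - i, N - 1 - i)" using i by simp
    finally show ?thesis by simp
  qed
  have "det b = prod_list (diag_mat b)" by (rule det_upper_triangular[OF d(2) bC])
  also have "\<dots> = (\<Prod>i<N. b $$ (i, i))"
    using bC by (simp add: prod_list_diag_prod atLeast0LessThan)
  finally show "(\<Prod>i<N. b $$ (i, i)) = 1" using d by simp
qed

text \<open>The family \<open>b\<^sub>i\<^sub>j t\<^sup>j\<^sup>-\<^sup>i\<close> arises for \<open>t \<noteq> 0\<close> by conjugation with a diagonal
  similitude, and degenerates to the diagonal part of \<open>b\<close> at \<open>t = 0\<close>.\<close>

definition contract_to_diag :: "'k::field mat \<Rightarrow> 'k \<Rightarrow> 'k mat" where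
  "contract_to_diag b t = mat (dim_row b) (dim_col b) (\<lambda>(i, j). if j < i then 0 else t ^ (j - i) * b $$ (i, j))"

lemma contract_to_diag_std_borel:
  fixes b :: "'k::field mat"
  assumes b: "b \<in> std_borel N"
  shows "contract_to_diag b t \<in> std_borel N"
proof -
  have bC: "b \<in> carrier_mat N N" and up: "\<And>i j. i < N \<Longrightarrow> j < i \<Longrightarrow> b $$ (i, j) = 0"
    and iso: "b\<^sup>T * antidiag N * b = antidiag N" and d: "det b = 1" "upper_triangular b"
    using b by (auto simp: std_borel_iff upper_triangular_def)
  let ?f = "contract_to_diag b t"
  have fC: "?f \<in> carrier_mat N N" using bC by (auto simp: contract_to_diag_def)
  have fi: "?f $$ (i, j) = (if j < i then 0 else t ^ (j - i) * b $$ (i, j))" if "i < N" "j < N" for i j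
    using that bC by (simp add: contract_to_diag_def)
  have fup: "upper_triangular ?f" using fC by (auto simp: upper_triangular_def fi)
  have "det ?f = prod_list (diag_mat ?f)" by (rule det_upper_triangular[OF fup fC])
  also have "\<dots> = (\<Prod>i<N. b $$ (i, i))"
    using fC by (simp add: prod_list_diag_prod atLeast0LessThan fi)
  finally have "det ?f = 1" using std_borel_diag(2)[OF b] by simp
  moreover have "?f\<^sup>T * antidiag N * ?f = antidiag N"
  proof (rule eq_matI)
    fix i j assume "i < dim_row (antidiag N :: 'k mat)" "j < dim_col (antidiag N :: 'k mat)"
    then have ij: "i < N" "j < N" by auto
    have "(?f\<^sup>T * antidiag N * ?f) $$ (i, j) = (\<Sum>k<N. ?f $$ (k, i) * ?f $$ (N - 1 - k, j))"
      by (rule gram_antidiag_entry[OF fC ij])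
    also have "\<dots> = (\<Sum>k<N. t ^ (i + j + 1 - N) * (b $$ (k, i) * b $$ (N - 1 - k, j)))"
    proof (rule sum.cong[OF refl])
      fix k assume "k \<in> {..<N}"
      then have k: "k < N" by simp
      show "?f $$ (k, i) * ?f $$ (N - 1 - k, j) = t ^ (i + j + 1 - N) * (b $$ (k, i) * b $$ (N - 1 - k, j))"
      proof (cases "k \<le> i \<and> N - 1 - k \<le> j")
        case True
        then have e: "i + j + 1 - N = (i - k) + (j - (N - 1 - k))" using k by linarith
        have "?f $$ (k, i) = t ^ (i - k) * b $$ (k, i)"
          "?f $$ (N - 1 - k, j) = t ^ (j - (N - 1 - k)) * b $$ (N - 1 - k, j)"
          using True k ij fi[of k i] fi[of "N - 1 - k" j] by auto
        then show ?thesis unfolding e power_add by (simp only: mult_ac)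
      next
        case False
        then have "b $$ (k, i) = 0 \<or> b $$ (N - 1 - k, j) = 0"
          using up[of k i] up[of "N - 1 - k" j] k by auto
        then show ?thesis using k ij by (auto simp: fi)
      qed
    qed
    also have "\<dots> = t ^ (i + j + 1 - N) * (b\<^sup>T * antidiag N * b) $$ (i, j)"
      unfolding gram_antidiag_entry[OF bC ij] by (simp add: sum_distrib_left)
    also have "\<dots> = antidiag N $$ (i, j)" unfolding iso using ij by (auto simp: antidiag_def)
    finally show "(?f\<^sup>T * antidiag N * ?f) $$ (i, j) = antidiag N $$ (i, j)" .
  qed (use fC in auto)
  ultimately show ?thesis using fC fup by (simp add: std_borel_iff)
qed

lemma prod_pairs:
  fixes a :: "nat \<Rightarrow> 'k::comm_monoid_mult"
  shows "(\<Prod>i<2*n. a i) = (\<Prod>i<n. a i * a (2*n - 1 - i))"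
proof -
  have "(\<Prod>i<2*n. a i) = (\<Prod>i<n. a i) * (\<Prod>i\<in>{n..<2*n}. a i)"
    by (subst prod.union_disjoint[symmetric]) (auto intro: prod.cong)
  also have "(\<Prod>i\<in>{n..<2*n}. a i) = (\<Prod>i<n. a (2*n - 1 - i))"
    by (rule prod.reindex_bij_witness[of _ "\<lambda>i. 2*n - 1 - i" "\<lambda>i. 2*n - 1 - i"]) auto
  finally show ?thesis by (simp add: prod.distrib)
qed

lemma diagonal_std_borel:
  fixes a :: "nat \<Rightarrow> 'k::field"
  assumes a: "\<And>i. i < 2*n \<Longrightarrow> a i * a (2*n - 1 - i) = 1"
  shows "mat (2*n) (2*n) (\<lambda>(i, j). if i = j then a i else 0) \<in> std_borel (2*n)" (is "?g \<in> _")
proof -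
  let ?N = "2*n"
  have gC: "?g \<in> carrier_mat ?N ?N" by simp
  have gup: "upper_triangular ?g" by (auto simp: upper_triangular_def)
  have "det ?g = prod_list (diag_mat ?g)" by (rule det_upper_triangular[OF gup gC])
  also have "\<dots> = (\<Prod>i<?N. a i)" by (simp add: prod_list_diag_prod atLeast0LessThan)
  also have "\<dots> = 1" unfolding prod_pairs using a by (intro prod.neutral) auto
  finally have "det ?g = 1" .
  moreover have "?g\<^sup>T * antidiag ?N * ?g = antidiag ?N"
  proof (rule eq_matI)
    fix i j assume "i < dim_row (antidiag ?N :: 'k mat)" "j < dim_col (antidiag ?N :: 'k mat)"
    then have ij: "i < ?N" "j < ?N" by auto
    have "(?g\<^sup>T * antidiag ?N * ?g) $$ (i, j) = (\<Sum>k<?N. ?g $$ (k, i) * ?g $$ (?N - 1 - k, j))"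
      by (rule gram_antidiag_entry[OF gC ij])
    also have "\<dots> = (\<Sum>k<?N. if k = i then (if ?N - 1 - i = j then a i * a j else 0) else 0)"
      by (rule sum.cong[OF refl]) (use ij in auto)
    also have "\<dots> = (if ?N - 1 - i = j then a i * a j else 0)" using ij by simp
    also have "\<dots> = antidiag ?N $$ (i, j)" using ij a[of i] by (auto simp: antidiag_def)
    finally show "(?g\<^sup>T * antidiag ?N * ?g) $$ (i, j) = antidiag ?N $$ (i, j)" .
  qed auto
  ultimately show ?thesis using gC gup by (simp add: std_borel_iff)
qed

text \<open>Every element \<open>b\<close> is joined to its diagonal part by the curve \<open>contract_to_diag b\<close>, and that part to
  \<open>1\<close> by a rational curve in the torus.\<close>

lemma connectedin_std_borel:
  "connectedin (zariski UNIV (2*n)) (std_borel (2*n) :: 'k::field_char_0 mat set)"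
proof -
  let ?N = "2*n"
  let ?Z = "zariski (UNIV :: 'k set) ?N"
  let ?B = "std_borel ?N :: 'k mat set"
  have one: "1\<^sub>m ?N \<in> ?B" using subgroup.one_closed[OF subgroup_std_borel] by simp
  have "\<exists>S. connectedin ?Z S \<and> S \<subseteq> ?B \<and> 1\<^sub>m ?N \<in> S \<and> b \<in> S" if b: "b \<in> ?B" for b
  proof -
    have bC: "b \<in> carrier_mat ?N ?N" and up: "upper_triangular b" using b by (auto simp: std_borel_iff)
    let ?S1 = "contract_to_diag b ` {t. poly 1 t \<noteq> 0}"
    have S1B: "?S1 \<subseteq> ?B" using contract_to_diag_std_borel[OF b] by blast
    have "connectedin ?Z ?S1"
    proof (rule connectedin_rational_curve)
      show "contract_to_diag b t \<in> carrier_mat ?N ?N \<and> det (contract_to_diag b t) = 1" for t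
        using contract_to_diag_std_borel[OF b, of t] by (simp add: std_borel_iff)
      fix i j assume "i < ?N" "j < ?N"
      then have "contract_to_diag b t $$ (i, j) * poly 1 t ^ 0 = poly (if j < i then 0 else monom (b $$ (i, j)) (j - i)) t" for t
        using bC by (simp add: contract_to_diag_def poly_monom)
      then show "\<exists>p m. \<forall>t. poly 1 t \<noteq> 0 \<longrightarrow> contract_to_diag b t $$ (i, j) * poly 1 t ^ m = poly p t" by blast
    qed simp
    have b1: "contract_to_diag b 1 = b"
      using bC up by (intro eq_matI) (auto simp: contract_to_diag_def upper_triangular_def)
    have bS: "b \<in> ?S1" by (rule image_eqI[of _ _ 1]) (simp_all add: b1)
    \<comment> \<open>A rational curve in the torus through \<open>1\<close> (at \<open>t = 0\<close>) and the diagonal of \<open>b\<close> (at \<open>t = 1\<close>):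
      the first half of the entries moves linearly, the second half by inversion.\<close>
    define l where "l i = [:1, b $$ (i, i) - 1:]" for i
    define q where "q = (\<Prod>i<n. l i)"
    have q0: "q \<noteq> 0" by (simp add: q_def l_def)
    define a where "a t i = (if i < n then poly (l i) t else inverse (poly (l (?N - 1 - i)) t))" for t i
    define g where "g t = mat ?N ?N (\<lambda>(i, j). if i = j then a t i else 0)" for t
    have lnz: "poly (l i) t \<noteq> 0" if "poly q t \<noteq> 0" "i < n" for t i
      using that by (auto simp: q_def poly_prod)
    have gB: "g t \<in> ?B" if t: "poly q t \<noteq> 0" for t
      unfolding g_def
    proof (rule diagonal_std_borel)
      fix i assume i: "i < ?N"
      show "a t i * a t (?N - 1 - i) = 1"
      proof (cases "i < n")
        case True
        moreover then have "\<not> ?N - 1 - i < n" "?N - 1 - (?N - 1 - i) = i" by auto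
        ultimately show ?thesis using lnz[OF t, of i] by (simp add: a_def)
      next
        case False
        then have "?N - 1 - i < n" using i by auto
        then show ?thesis using False lnz[OF t, of "?N - 1 - i"] by (simp add: a_def)
      qed
    qed
    let ?S2 = "g ` {t. poly q t \<noteq> 0}"
    have S2B: "?S2 \<subseteq> ?B" using gB by blast
    have "connectedin ?Z ?S2"
    proof (rule connectedin_rational_curve[OF q0])
      show "g t \<in> carrier_mat ?N ?N \<and> det (g t) = 1" if "poly q t \<noteq> 0" for t
        using gB[OF that] by (simp add: std_borel_iff)
      fix i j assume ij: "i < ?N" "j < ?N"
      consider "i \<noteq> j" | "i = j" "i < n" | "i = j" "\<not> i < n" by blast
      then show "\<exists>p m. \<forall>t. poly q t \<noteq> 0 \<longrightarrow> g t $$ (i, j) * poly q t ^ m = poly p t"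
      proof cases
        case 1 then show ?thesis using ij by (intro exI[of _ 0]) (simp add: g_def)
      next
        case 2 then show ?thesis using ij by (intro exI[of _ "l i"] exI[of _ 0]) (simp add: g_def a_def)
      next
        case 3
        let ?k = "?N - 1 - i"
        have k: "?k < n" using 3 ij by auto
        have qk: "q = l ?k * (\<Prod>i\<in>{..<n} - {?k}. l i)" unfolding q_def using k by (intro prod.remove) auto
        show ?thesis
        proof (intro exI allI impI)
          fix t assume t: "poly q t \<noteq> 0"
          have "poly q t = poly (l ?k) t * poly (\<Prod>i\<in>{..<n} - {?k}. l i) t" unfolding qk by simp
          then show "g t $$ (i, j) * poly q t ^ 1 = poly (\<Prod>i\<in>{..<n} - {?k}. l i) t"
            using 3 ij lnz[OF t k] by (simp add: g_def a_def)
        qed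
      qed
    qed
    have "g 0 = 1\<^sub>m ?N" by (rule eq_matI) (auto simp: g_def a_def l_def)
    moreover have "poly q 0 \<noteq> 0" by (simp add: q_def poly_prod l_def)
    ultimately have oneS: "1\<^sub>m ?N \<in> ?S2" by (metis (mono_tags, lifting) image_eqI mem_Collect_eq)
    have diag: "b $$ (i, i) \<noteq> 0" "inverse (b $$ (?N - 1 - i, ?N - 1 - i)) = b $$ (i, i)" if "i < ?N" for i
      using std_borel_diag(1)[OF b that] by (auto intro: inverse_unique simp: mult.commute)
    have "g 1 = contract_to_diag b 0"
    proof (rule eq_matI)
      fix i j assume "i < dim_row (contract_to_diag b 0)" "j < dim_col (contract_to_diag b 0)"
      then have "i < ?N" "j < ?N" using bC by (auto simp: contract_to_diag_def)
      then show "g 1 $$ (i, j) = contract_to_diag b 0 $$ (i, j)"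
        using bC diag by (auto simp: g_def a_def l_def contract_to_diag_def)
    qed (use bC in \<open>auto simp: g_def contract_to_diag_def\<close>)
    moreover have "poly q 1 \<noteq> 0" using diag by (auto simp: q_def poly_prod l_def)
    ultimately have "contract_to_diag b 0 \<in> ?S1 \<inter> ?S2" by (metis (mono_tags, lifting) IntI image_eqI mem_Collect_eq poly_1 zero_neq_one)
    then have "connectedin ?Z (?S1 \<union> ?S2)"
      using connectedin_Un[OF \<open>connectedin ?Z ?S1\<close> \<open>connectedin ?Z ?S2\<close>] by blast
    then show ?thesis using bS oneS S1B S2B by (intro exI[of _ "?S1 \<union> ?S2"]) auto
  qed
  then have "?B = \<Union>{S. connectedin ?Z S \<and> S \<subseteq> ?B \<and> 1\<^sub>m ?N \<in> S}" by blast
  moreover have "connectedin ?Z (\<Union>{S. connectedin ?Z S \<and> S \<subseteq> ?B \<and> 1\<^sub>m ?N \<in> S})"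
    by (rule connectedin_Union) auto
  ultimately show ?thesis by simp
qed

subsection \<open>Every Borel subgroup is conjugate to the standard one\<close>

lemma solvable_iff_derived:
  fixes H :: "'k::field mat set"
  assumes H: "subgroup H (GL N)"
  shows "solvable ((GL N)\<lparr>carrier := H\<rparr>) \<longleftrightarrow> (\<exists>d. (derived (GL N) ^^ d) H = {1\<^sub>m N})"
proof -
  interpret L: Group.group "GL N :: 'k mat monoid" by (rule group_GL)
  interpret H: Group.group "(GL N)\<lparr>carrier := H\<rparr>" using L.subgroup_imp_group H by blast
  have "(derived ((GL N)\<lparr>carrier := H\<rparr>) ^^ n) H = (derived (GL N) ^^ n) H \<and> (derived (GL N) ^^ n) H \<subseteq> H" for n
  proof (induction n)
    case (Suc n)
    then show ?case using L.derived_consistent[of "(derived (GL N) ^^ n) H" H] L.derived_incl[of "(derived (GL N) ^^ n) H" H] H by simp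
  qed simp
  then show ?thesis unfolding H.solvable_iff_trivial_derived_seq by simp
qed

context
  fixes Q P R :: "'k::field_char_0 mat" and n :: nat
  assumes Q: "Q \<in> carrier_mat (2*n) (2*n)"
    and P: "P \<in> carrier_mat (2*n) (2*n)" and R: "R \<in> carrier_mat (2*n) (2*n)"
    and PR: "P * R = 1\<^sub>m (2*n)" and RP: "R * P = 1\<^sub>m (2*n)"
    and PQP: "P\<^sup>T * Q * P = antidiag (2*n)"
begin

lemma conj_back: "g \<in> carrier_mat (2*n) (2*n) \<Longrightarrow> P * (R * g * P) * R = g"
proof -
  assume g: "g \<in> carrier_mat (2*n) (2*n)"
  have "P * (R * g * P) * R = P * (R * (g * (P * R)))"
    using g P R by (simp add: assoc_mult_mat[of _ "2*n" "2*n" _ "2*n" _ "2*n"])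
  also have "\<dots> = g * (P * R)" by (rule mult_mat_inverse_cancel[OF P R PR, where m = "2*n"]) (use g P R in auto)
  finally show ?thesis using g PR by simp
qed

lemma conj_forth: "b \<in> carrier_mat (2*n) (2*n) \<Longrightarrow> R * (P * b * R) * P = b"
proof -
  assume b: "b \<in> carrier_mat (2*n) (2*n)"
  have "R * (P * b * R) * P = R * (P * (b * (R * P)))"
    using b P R by (simp add: assoc_mult_mat[of _ "2*n" "2*n" _ "2*n" _ "2*n"])
  also have "\<dots> = b * (R * P)" by (rule mult_mat_inverse_cancel[OF R P RP, where m = "2*n"]) (use b P R in auto)
  finally show ?thesis using b RP by simp
qed

lemma conj_std_borel_iff:
  "g \<in> (\<lambda>b. P * b * R) ` std_borel (2*n) \<longleftrightarrow> g \<in> carrier_mat (2*n) (2*n) \<and> R * g * P \<in> std_borel (2*n)"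
proof
  assume "g \<in> (\<lambda>b. P * b * R) ` std_borel (2*n)"
  then obtain b where b: "b \<in> std_borel (2*n)" "g = P * b * R" by blast
  have bC: "b \<in> carrier_mat (2*n) (2*n)" using b by (simp add: std_borel_iff)
  show "g \<in> carrier_mat (2*n) (2*n) \<and> R * g * P \<in> std_borel (2*n)"
    unfolding b(2) conj_forth[OF bC] using b(1) bC P R by (auto intro!: mult_carrier_mat)
next
  assume "g \<in> carrier_mat (2*n) (2*n) \<and> R * g * P \<in> std_borel (2*n)"
  then show "g \<in> (\<lambda>b. P * b * R) ` std_borel (2*n)"
    using conj_back[of g] by (intro image_eqI[of _ _ "R * g * P"]) auto
qed

lemma conj_std_borel_SO: "(\<lambda>b. P * b * R) ` std_borel (2*n) \<subseteq> SO (2*n) Q"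
proof safe
  fix b :: "'k mat" assume b: "b \<in> std_borel (2*n)"
  then have bC: "b \<in> carrier_mat (2*n) (2*n)" and biso: "b\<^sup>T * antidiag (2*n) * b = antidiag (2*n)" and d: "det b = 1"
    by (auto simp: std_borel_iff)
  let ?g = "P * b * R"
  have gC: "?g \<in> carrier_mat (2*n) (2*n)" using bC P R by auto
  have dPR: "det P * det R = 1" using det_mult[OF P R] PR by simp
  have dg: "det ?g = 1" using bC P R d dPR by (simp add: det_mult[of _ "2*n"])
  have "?g = P * (b * R)" using bC P R by (simp add: assoc_mult_mat[of _ "2*n" "2*n" _ "2*n" _ "2*n"])
  then have "?g\<^sup>T * Q * ?g = (b * R)\<^sup>T * antidiag (2*n) * (b * R)"
    using gram_mult[OF P Q mult_carrier_mat[OF bC R]] PQP by simp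
  also have "\<dots> = R\<^sup>T * (P\<^sup>T * Q * P) * R" unfolding gram_mult[OF bC antidiag_carrier R] biso PQP ..
  also have "\<dots> = (P * R)\<^sup>T * Q * (P * R)" by (rule gram_mult[OF P Q R, symmetric])
  also have "\<dots> = Q" using PR Q by simp
  finally show "?g \<in> SO (2*n) Q" using gC dg by (simp add: SO_def Ortho_iff[OF Q] carrier_GL)
qed

lemma conj_std_borel_closed: "closedin (zariski UNIV (2*n)) ((\<lambda>b. P * b * R) ` std_borel (2*n))"
proof -
  let ?S = "carrier (GL (2*n)) :: 'k mat set"
  let ?F = "\<lambda>g. R * g * P"
  have FC: "?F g \<in> carrier_mat (2*n) (2*n)" if "g \<in> ?S" for g using that P R by (auto simp: carrier_GL)
  have rF: "regular_on UNIV (2*n) ?S (\<lambda>g. ?F g $$ (i, j))" if "i < (2*n)" "j < (2*n)" for i j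
    using that P R
    by (intro regular_on_mult_entry[where m = "2*n" and l = "2*n" and n = "2*n"] regular_on_entry regular_on_const)
       (auto simp: carrier_GL intro!: mult_carrier_mat)
  define A where "A = (\<lambda>(i, j). {g \<in> ?S. (\<Sum>k<2*n. ?F g $$ (k, i) * ?F g $$ ((2*n) - 1 - k, j)) + (- antidiag (2*n) $$ (i, j)) = 0})"
  define U where "U = (\<lambda>(i, j). {g \<in> ?S. (if j < i then 1 else 0) * ?F g $$ (i, j) = 0})"
  define C where "C = {g \<in> ?S. det (?F g) + (-1) = 0}"
  let ?I = "{..<2*n} \<times> {..<2*n}"
  have clC: "closedin (zariski UNIV (2*n)) C"
    unfolding C_def
    by (intro closedin_zariski_zero regular_on_add regular_on_const regular_on_det[of _ _ "2*n"] rF FC) auto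
  have clA: "closedin (zariski UNIV (2*n)) (A (i, j))" if "i < (2*n)" "j < (2*n)" for i j
    unfolding A_def prod.case
    by (intro closedin_zariski_zero regular_on_add regular_on_const regular_on_sum regular_on_mult rF) (use that in auto)
  have clU: "closedin (zariski UNIV (2*n)) (U (i, j))" if "i < (2*n)" "j < (2*n)" for i j
    unfolding U_def prod.case
    by (intro closedin_zariski_zero regular_on_const regular_on_mult rF) (use that in auto)
  have cl: "closedin (zariski UNIV (2*n)) Z" if "Z \<in> insert C (A ` ?I \<union> U ` ?I)" for Z
    using that clC clA clU by blast
  have "closedin (zariski UNIV (2*n)) (\<Inter>(insert C (A ` ?I \<union> U ` ?I)))"
    by (rule closedin_Inter) (use cl in auto)
  moreover have "(\<lambda>b. P * b * R) ` std_borel (2*n) = \<Inter>(insert C (A ` ?I \<union> U ` ?I))"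
  proof (rule Set.set_eqI)
    fix g :: "'k mat"
    have "g \<in> \<Inter>(insert C (A ` ?I \<union> U ` ?I)) \<longleftrightarrow> g \<in> C \<and> (\<forall>i<2*n. \<forall>j<2*n. g \<in> A (i, j)) \<and> (\<forall>i<2*n. \<forall>j<2*n. g \<in> U (i, j))"
      by auto
    also have "\<dots> \<longleftrightarrow> g \<in> ?S \<and> ?F g \<in> std_borel (2*n)"
    proof (cases "g \<in> ?S")
      case True
      note F = FC[OF True]
      have "(\<forall>i<2*n. \<forall>j<2*n. g \<in> A (i, j)) \<longleftrightarrow> (?F g)\<^sup>T * antidiag (2*n) * ?F g = antidiag (2*n)"
      proof
        assume a: "\<forall>i<2*n. \<forall>j<2*n. g \<in> A (i, j)"
        show "(?F g)\<^sup>T * antidiag (2*n) * ?F g = antidiag (2*n)"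
        proof (rule eq_matI)
          fix i j assume "i < dim_row (antidiag (2*n) :: 'k mat)" "j < dim_col (antidiag (2*n) :: 'k mat)"
          then have ij: "i < (2*n)" "j < (2*n)" by auto
          then have "(\<Sum>k<2*n. ?F g $$ (k, i) * ?F g $$ ((2*n) - 1 - k, j)) + (- antidiag (2*n) $$ (i, j)) = 0"
            using a by (simp add: A_def)
          then show "((?F g)\<^sup>T * antidiag (2*n) * ?F g) $$ (i, j) = antidiag (2*n) $$ (i, j)"
            unfolding gram_antidiag_entry[OF F ij] by (simp add: eq_neg_iff_add_eq_0)
        qed (use F in auto)
      next
        assume a: "(?F g)\<^sup>T * antidiag (2*n) * ?F g = antidiag (2*n)"
        show "\<forall>i<2*n. \<forall>j<2*n. g \<in> A (i, j)"
        proof (intro allI impI)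
          fix i j assume ij: "i < (2*n)" "j < (2*n)"
          show "g \<in> A (i, j)"
            unfolding A_def using gram_antidiag_entry[OF F ij] True unfolding a by simp
        qed
      qed
      moreover have "(\<forall>i<2*n. \<forall>j<2*n. g \<in> U (i, j)) \<longleftrightarrow> upper_triangular (?F g)"
        using F True unfolding upper_triangular_def U_def by auto
      moreover have "g \<in> C \<longleftrightarrow> det (?F g) = 1" using True by (simp add: C_def)
      ultimately show ?thesis using F True by (simp add: std_borel_iff) blast
    qed (auto simp: C_def)
    also have "\<dots> \<longleftrightarrow> g \<in> (\<lambda>b. P * b * R) ` std_borel (2*n)"
    proof -
      have "g \<in> ?S" if "g \<in> (\<lambda>b. P * b * R) ` std_borel (2*n)"
        using that conj_std_borel_SO by (auto simp: SO_def Ortho_def)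
      then show ?thesis unfolding conj_std_borel_iff by (auto simp: carrier_GL)
    qed
    finally show "g \<in> (\<lambda>b. P * b * R) ` std_borel (2*n) \<longleftrightarrow> g \<in> \<Inter>(insert C (A ` ?I \<union> U ` ?I))" by simp
  qed
  ultimately show ?thesis by simp
qed

lemma connected_solvable_conj_std_borel: "\<exists>d. subgroup ((\<lambda>b. P * b * R) ` std_borel (2*n)) (GL (2*n)) \<and>
  connectedin (zariski UNIV (2*n)) ((\<lambda>b. P * b * R) ` std_borel (2*n)) \<and>
  (derived (GL (2*n)) ^^ d) ((\<lambda>b. P * b * R) ` std_borel (2*n)) = {1\<^sub>m (2*n)}"
proof -
  let ?\<rho> = "\<lambda>b. P * b * R"
  let ?B = "std_borel (2*n) :: 'k mat set"
  have bC: "b \<in> carrier_mat (2*n) (2*n)" if "b \<in> ?B" for b using that by (simp add: std_borel_iff)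
  have dPR: "det P * det R = 1" using det_mult[OF P R] PR by simp
  have \<rho>GL: "?\<rho> b \<in> carrier (GL (2*n))" if "b \<in> ?B" for b
    using conj_std_borel_SO that by (auto simp: SO_def Ortho_def)
  have \<rho>mult: "?\<rho> (b * c) = ?\<rho> b * ?\<rho> c" if "b \<in> ?B" "c \<in> ?B" for b c
  proof -
    have "?\<rho> b * ?\<rho> c = P * (b * (R * (P * (c * R))))"
      using bC[OF that(1)] bC[OF that(2)] P R by (simp add: assoc_mult_mat[of _ "2*n" "2*n" _ "2*n" _ "2*n"])
    also have "R * (P * (c * R)) = c * R"
      by (rule mult_mat_inverse_cancel[OF R P RP, where m = "2*n"]) (use bC[OF that(2)] R in auto)
    also have "P * (b * (c * R)) = ?\<rho> (b * c)"
      using bC[OF that(1)] bC[OF that(2)] P R by (simp add: assoc_mult_mat[of _ "2*n" "2*n" _ "2*n" _ "2*n"])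
    finally show ?thesis by simp
  qed
  have hom: "?\<rho> \<in> hom ((GL (2*n))\<lparr>carrier := ?B\<rparr>) (GL (2*n))" using \<rho>GL \<rho>mult by (intro homI) auto
  note img = exp_of_derived_hom_image[OF group_GL group_GL subgroup_std_borel hom]
  have "(derived (GL (2*n)) ^^ (2*n)) (?\<rho> ` ?B) = ?\<rho> ` {1\<^sub>m (2*n)}"
    unfolding img(1) upper_triangular_solvable[OF subgroup_std_borel std_borel_depth] ..
  also have "\<dots> = {1\<^sub>m (2*n)}" using P PR by simp
  finally have sol: "(derived (GL (2*n)) ^^ (2*n)) (?\<rho> ` ?B) = {1\<^sub>m (2*n)}" .
  have "connectedin (zariski UNIV (2*n)) (?\<rho> ` ?B)"
  proof (rule connectedin_regular_image[OF connectedin_std_borel])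
    show "?\<rho> ` ?B \<subseteq> carrier (GL (2*n))" using \<rho>GL by blast
    show "regular_on UNIV (2*n) ?B (\<lambda>g. ?\<rho> g $$ (i, j))" if "i < (2*n)" "j < (2*n)" for i j
      using that P R bC
      by (intro regular_on_mult_entry[where m = "2*n" and l = "2*n" and n = "2*n"] regular_on_entry regular_on_const)
         (auto intro!: mult_carrier_mat)
    show "regular_on UNIV (2*n) ?B (\<lambda>g. inverse (det (?\<rho> g)))"
    proof (rule regular_on_cong[OF regular_on_const[of 1]])
      show "1 = inverse (det (?\<rho> g))" if "g \<in> ?B" for g
        using conj_std_borel_SO that by (auto simp: SO_def)
    qed simp
  qed
  then show ?thesis using img(2) sol by blast
qed

end

text \<open>In a suitable basis a Borel subgroup \<open>B\<close> consists of upper triangular isometries, so it is contained in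
  a conjugate of the standard Borel subgroup. This is connected and solvable, so that equality
  holds by maximality.\<close>

theorem borel_subgroup_SO:
  fixes Q :: "'k::{alg_closed_field, field_char_0} mat"
  assumes Q: "quadratic_space (2*n) Q" and B: "borel_subgroup (2*n) (SO (2*n) Q) B"
  obtains P R where "P \<in> carrier_mat (2*n) (2*n)" "R \<in> carrier_mat (2*n) (2*n)"
    "P * R = 1\<^sub>m (2*n)" "R * P = 1\<^sub>m (2*n)" "P\<^sup>T * Q * P = antidiag (2*n)"
    "B = (\<lambda>b. P * b * R) ` std_borel (2*n)"
proof -
  let ?N = "2*n"
  note QC = quadratic_spaceD[OF Q]
  have cs: "connected_solvable ?N B" and BSO: "B \<subseteq> SO ?N Q"
    and max: "\<And>B'. connected_solvable ?N B' \<Longrightarrow> B' \<subseteq> SO ?N Q \<Longrightarrow> B \<subseteq> B' \<Longrightarrow> B' = B"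
    using B by (auto simp: borel_subgroup_def)
  have Bg: "subgroup B (GL ?N)" and Bc: "connectedin (zariski UNIV ?N) B"
    using cs by (auto simp: connected_solvable_def closed_subgroup_def)
  obtain d where d: "(derived (GL ?N) ^^ d) B = {1\<^sub>m ?N}"
    using cs solvable_iff_derived[OF Bg] by (auto simp: connected_solvable_def)
  have BO: "B \<subseteq> Ortho ?N Q" using BSO by (auto simp: SO_def)
  obtain P where P: "P \<in> carrier_mat ?N ?N" "det P \<noteq> 0" "P\<^sup>T * Q * P = antidiag ?N"
    and tri: "\<And>g. g \<in> B \<Longrightarrow> \<exists>t \<in> carrier_mat ?N ?N. upper_triangular t \<and> g * P = P * t"
    using connected_solvable_triangular[OF Q BO Bg Bc d] by blast
  obtain R where R: "R \<in> carrier_mat ?N ?N" "P * R = 1\<^sub>m ?N" "R * P = 1\<^sub>m ?N"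
    using obtain_inverse_mat[OF P(1,2)] by blast
  note a = QC(1) P(1) R(1-3) P(3)
  let ?B0 = "(\<lambda>b. P * b * R) ` std_borel ?N"
  have "connected_solvable ?N ?B0"
    using connected_solvable_conj_std_borel[OF a] conj_std_borel_closed[OF a]
    by (auto simp: connected_solvable_def closed_subgroup_def solvable_iff_derived)
  moreover have "?B0 \<subseteq> SO ?N Q" by (rule conj_std_borel_SO[OF a])
  moreover have "B \<subseteq> ?B0"
  proof
    fix g assume g: "g \<in> B"
    then have gC: "g \<in> carrier_mat ?N ?N" and giso: "g\<^sup>T * Q * g = Q" and dg: "det g = 1"
      using BSO by (auto simp: SO_def Ortho_iff[OF QC(1)] carrier_GL)
    obtain t where t: "t \<in> carrier_mat ?N ?N" "upper_triangular t" "g * P = P * t" using tri[OF g] by blast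
    have "R * g * P = R * (P * t)" using gC P R t by (simp add: assoc_mult_mat[of _ ?N ?N _ ?N _ ?N])
    also have "\<dots> = t" by (rule mult_mat_inverse_cancel[OF R(1) P(1) R(3) t(1)])
    finally have e: "R * g * P = t" .
    have "t\<^sup>T * antidiag ?N * t = (g * P)\<^sup>T * Q * (g * P)"
      unfolding t(3) gram_mult[OF P(1) QC(1) t(1)] P(3) ..
    also have "\<dots> = antidiag ?N" unfolding gram_mult[OF gC QC(1) P(1)] giso P(3) ..
    finally have "t\<^sup>T * antidiag ?N * t = antidiag ?N" .
    moreover have "det t = 1"
      using det_mult[OF P(1) t(1)] det_mult[OF gC P(1)] t(3) dg P(2) by simp
    ultimately show "g \<in> ?B0" unfolding conj_std_borel_iff[OF a] e using gC t by (simp add: std_borel_iff)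
  qed
  ultimately have "B = ?B0" using max by blast
  then show ?thesis using that a by blast
qed

section \<open>The normalizer of the standard Borel subgroup\<close>

text \<open>The unipotent element \<open>1 + E\<^sub>k\<^sub>m - E\<^sub>m\<^sub>'\<^sub>k\<^sub>'\<close> of a root subgroup, where \<open>i' = N - 1 - i\<close>.\<close>

definition root_part :: "nat \<Rightarrow> nat \<Rightarrow> nat \<Rightarrow> 'k::field mat" where
  "root_part N k m = mat N N (\<lambda>(i, j). (if i = k \<and> j = m then 1 else 0)
     - (if i = N - 1 - m \<and> j = N - 1 - k then 1 else 0))"

lemma root_part_carrier [simp]: "root_part N k m \<in> carrier_mat N N"
  by (simp add: root_part_def)

lemma root_part_dims [simp]: "dim_row (root_part N k m) = N" "dim_col (root_part N k m) = N"
  by (simp_all add: root_part_def)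

lemma root_part_index:
  "i < N \<Longrightarrow> j < N \<Longrightarrow> root_part N k m $$ (i, j) = (if i = k \<and> j = m then 1 else 0)
     - (if i = N - 1 - m \<and> j = N - 1 - k then 1 else 0)"
  by (simp add: root_part_def)

context
  fixes n k m :: nat
  assumes km: "k < m" "m < 2*n" and opp: "m \<noteq> 2*n - 1 - k"
begin

lemma root_part_mult_entry:
  fixes C :: "'k::field mat"
  assumes C: "C \<in> carrier_mat (2*n) l" and ij: "i < (2*n)" "j < l"
  shows "(root_part (2*n) k m * C) $$ (i, j) = (if i = k then C $$ (m, j) else 0) - (if i = (2*n) - 1 - m then C $$ ((2*n) - 1 - k, j) else 0)"
proof -
  define N k' m' where d: "N = 2*n" "k' = 2*n - 1 - k" "m' = 2*n - 1 - m"
  have lt: "m < N" "k' < N" using km by (auto simp: d)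
  have "(root_part N k m * C) $$ (i, j) = (\<Sum>r<N. root_part N k m $$ (i, r) * C $$ (r, j))"
    by (rule mult_mat_entry[OF root_part_carrier C[folded d] ij[folded d]])
  also have "\<dots> = (\<Sum>r<N. (if r = m then (if i = k then C $$ (m, j) else 0) else 0)
      - (if r = k' then (if i = m' then C $$ (k', j) else 0) else 0))"
  proof (rule sum.cong[OF refl])
    fix r assume "r \<in> {..<N}"
    then have e: "root_part N k m $$ (i, r) = (if i = k \<and> r = m then 1 else 0 :: 'k) - (if i = m' \<and> r = k' then 1 else 0)"
      using ij root_part_index[of i N r k m] by (simp add: d)
    show "root_part N k m $$ (i, r) * C $$ (r, j) = (if r = m then (if i = k then C $$ (m, j) else 0) else 0)
      - (if r = k' then (if i = m' then C $$ (k', j) else 0) else 0)"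
      unfolding e by (simp add: left_diff_distrib)
  qed
  also have "\<dots> = (if i = k then C $$ (m, j) else 0) - (if i = m' then C $$ (k', j) else 0)"
    unfolding sum_subtractf using lt by simp
  finally show ?thesis unfolding d .
qed

lemma root_part_square: "root_part (2*n) k m * root_part (2*n) k m = (0\<^sub>m (2*n) (2*n) :: 'k::field mat)"
proof (rule eq_matI)
  fix i j assume "i < dim_row (0\<^sub>m (2*n) (2*n) :: 'k mat)" "j < dim_col (0\<^sub>m (2*n) (2*n) :: 'k mat)"
  then have ij: "i < (2*n)" "j < (2*n)" by auto
  have p: "m \<noteq> (2*n) - 1 - m" "k \<noteq> (2*n) - 1 - k" using km by presburger+
  show "(root_part (2*n) k m * root_part (2*n) k m) $$ (i, j) = (0\<^sub>m (2*n) (2*n) :: 'k mat) $$ (i, j)"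
    unfolding root_part_mult_entry[OF root_part_carrier ij] using ij km opp p by (auto simp: root_part_index)
qed auto

lemma root_element_std_borel: "1\<^sub>m (2*n) + root_part (2*n) k m \<in> (std_borel (2*n) :: 'k::field mat set)"
proof -
  define N where N: "N = 2*n"
  define opp' where "opp' i = N - 1 - i" for i
  have op: "opp' i < N" "opp' (opp' i) = i" "opp' i \<noteq> i" if "i < N" for i
  proof -
    show "opp' i < N" "opp' (opp' i) = i" using that by (simp_all add: opp'_def)
    show "opp' i \<noteq> i"
    proof
      assume "opp' i = i"
      then have "2 * n = 2 * i + 1" using that unfolding opp'_def N by linarith
      then show False by presburger
    qed
  qed
  have op_eq: "opp' i = j \<longleftrightarrow> i = opp' j" if "i < N" "j < N" for i j using op(2)[OF that(1)] op(2)[OF that(2)] by auto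
  have kN: "k < N" "m < N" "k \<noteq> m" and mk: "m \<noteq> opp' k" and kk: "opp' m < opp' k"
    using km opp unfolding opp'_def N by linarith+
  let ?u = "1\<^sub>m N + root_part N k m :: 'k mat"
  have uC: "?u \<in> carrier_mat N N" by simp
  have ui: "?u $$ (i, j) = (if i = j then 1 else 0) + ((if i = k \<and> j = m then 1 else 0)
     - (if i = opp' m \<and> j = opp' k then 1 else 0))" if "i < N" "j < N" for i j
    using that by (simp add: root_part_index opp'_def)
  have up: "upper_triangular ?u"
    unfolding upper_triangular_def
  proof (intro allI impI)
    fix i j assume "i < dim_row ?u" and ji: "j < i"
    then have ij: "i < N" "j < N" by simp_all
    have n1: "\<not> (i = k \<and> j = m)" using ji km(1) by linarith
    have n2: "\<not> (i = opp' m \<and> j = opp' k)" using ji kk by linarith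
    show "?u $$ (i, j) = 0" unfolding ui[OF ij] if_not_P[OF n1] if_not_P[OF n2] using ji by auto
  qed
  have ud: "?u $$ (i, i) = 1" if "i < N" for i
  proof -
    have n: "\<not> (i = k \<and> i = m)" "\<not> (i = opp' m \<and> i = opp' k)" using km(1) kk by linarith+
    show ?thesis unfolding ui[OF that that] if_not_P[OF n(1)] if_not_P[OF n(2)] by simp
  qed
  have "det ?u = prod_list (diag_mat ?u)" by (rule det_upper_triangular[OF up uC])
  also have "\<dots> = (\<Prod>i = 0..<N. ?u $$ (i, i))" by (simp add: prod_list_diag_prod)
  also have "\<dots> = 1" using ud by (intro prod.neutral) auto
  finally have "det ?u = 1" .
  moreover have "?u\<^sup>T * antidiag N * ?u = antidiag N"
  proof (rule eq_matI)
    fix i j assume "i < dim_row (antidiag N :: 'k mat)" "j < dim_col (antidiag N :: 'k mat)"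
    then have ij: "i < N" "j < N" by auto
    have "(?u\<^sup>T * antidiag N * ?u) $$ (i, j) = (\<Sum>r<N. ?u $$ (r, i) * ?u $$ (opp' r, j))"
      unfolding opp'_def by (rule gram_antidiag_entry[OF uC ij])
    also have "\<dots> = (\<Sum>r<N. (if r = i then ?u $$ (opp' i, j) else 0)
       + (if r = k then (if i = m then ?u $$ (opp' k, j) else 0) else 0)
       - (if r = opp' m then (if i = opp' k then ?u $$ (opp' (opp' m), j) else 0) else 0))"
    proof (rule sum.cong[OF refl])
      fix r assume "r \<in> {..<N}"
      then have r: "r < N" by simp
      show "?u $$ (r, i) * ?u $$ (opp' r, j) = (if r = i then ?u $$ (opp' i, j) else 0)
       + (if r = k then (if i = m then ?u $$ (opp' k, j) else 0) else 0)
       - (if r = opp' m then (if i = opp' k then ?u $$ (opp' (opp' m), j) else 0) else 0)"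
        unfolding ui[OF r ij(1)] distrib_right left_diff_distrib
        by (cases "r = i"; cases "r = k"; cases "r = opp' m") simp_all
    qed
    also have "\<dots> = ?u $$ (opp' i, j) + (if i = m then ?u $$ (opp' k, j) else 0) - (if i = opp' k then ?u $$ (m, j) else 0)"
      unfolding sum_subtractf sum.distrib using ij kN op(1)[OF kN(2)] op(2)[OF kN(2)] by (simp del: index_add_mat)
    also have "\<dots> = (if opp' i = j then 1 else 0)"
    proof -
      have 1: "?u $$ (opp' i, j) = (if opp' i = j then 1 else 0) + ((if i = opp' k \<and> j = m then 1 else 0)
          - (if i = m \<and> j = opp' k then 1 else 0))"
        unfolding ui[OF op(1)[OF ij(1)] ij(2)]
        using op_eq[OF ij(1) kN(1)] op_eq[OF ij(1) op(1)[OF kN(2)]] op(2)[OF kN(2)] by simp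
      have 2: "?u $$ (opp' k, j) = (if j = opp' k then 1 else 0)"
        unfolding ui[OF op(1)[OF kN(1)] ij(2)] using op(3)[OF kN(1)] kk by auto
      have 3: "?u $$ (m, j) = (if j = m then 1 else 0)"
        unfolding ui[OF kN(2) ij(2)] using op(3)[OF kN(2)] kN(3) by auto
      show ?thesis unfolding 1 2 3 by (cases "i = m"; cases "i = opp' k") (use mk in simp_all)
    qed
    also have "\<dots> = antidiag N $$ (i, j)" using ij by (auto simp: antidiag_def opp'_def)
    finally show "(?u\<^sup>T * antidiag N * ?u) $$ (i, j) = antidiag N $$ (i, j)" .
  qed auto
  ultimately have "?u \<in> std_borel N" using uC up by (simp add: std_borel_iff)
  then show ?thesis unfolding N .
qed

end

text \<open>A matrix \<open>h\<close> normalizing the standard Borel subgroup respects the flag spanned by the first basis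
  vectors, up to dimension \<open>n - 1\<close>; in dimension \<open>n\<close> it may exchange the two maximal isotropic
  subspaces, which is why no more can be said. For a nilpotent \<open>X = E\<^sub>k\<^sub>m - E\<^sub>m\<^sub>'\<^sub>k\<^sub>'\<close> with \<open>k < m\<close>, the
  conjugate \<open>Y = h\<inverse>Xh\<close> is strictly upper triangular. If the columns of \<open>h\<close> before \<open>j\<close> are those of an upper
  triangular matrix, then the column \<open>j\<close> of \<open>hY = Xh\<close> vanishes from position \<open>j\<close> on. Taking \<open>k = j\<close>, \<open>m = i\<close>
  gives \<open>h\<^sub>i\<^sub>j = 0\<close>, except when \<open>i = j'\<close>, for which \<open>X\<close> would vanish; there \<open>k = j + 1\<close> does it, as long
  as \<open>j + 1 < n\<close>.\<close>

lemma std_borel_normalizer: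
  fixes h :: "'k::field mat"
  assumes h: "h \<in> carrier_mat (2*n) (2*n)" "det h \<noteq> 0"
    and norm: "\<And>u. u \<in> std_borel (2*n) \<Longrightarrow> \<exists>b \<in> std_borel (2*n). h * b = u * h"
    and j: "j < n - 1" and i: "j < i" "i < 2*n"
  shows "h $$ (i, j) = 0"
proof -
  let ?N = "2*n"
  have rows: "(root_part ?N k m * h) $$ (r, j) = 0"
    if km: "k < m" "m < ?N" "m \<noteq> ?N - 1 - k" and IH: "\<And>l i. l < j \<Longrightarrow> l < i \<Longrightarrow> i < ?N \<Longrightarrow> h $$ (i, l) = 0"
      and r: "j \<le> r" "r < ?N" and jN: "j < ?N" for k m r j
  proof -
    let ?X = "root_part ?N k m :: 'k mat"
    obtain b where b: "b \<in> std_borel ?N" "h * b = (1\<^sub>m ?N + ?X) * h"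
      using norm[OF root_element_std_borel[OF km]] by blast
    have bC: "b \<in> carrier_mat ?N ?N" and bup: "\<And>i j. i < ?N \<Longrightarrow> j < i \<Longrightarrow> b $$ (i, j) = 0"
      using b(1) by (auto simp: std_borel_iff upper_triangular_def)
    define Y where "Y = b - 1\<^sub>m ?N"
    have YC: "Y \<in> carrier_mat ?N ?N" using bC by (simp add: Y_def minus_carrier_mat)
    have Yi: "Y $$ (i, j) = b $$ (i, j) - (if i = j then 1 else 0)" if "i < ?N" "j < ?N" for i j
      using that bC by (simp add: Y_def)
    have hY: "h * Y = ?X * h"
    proof -
      have "h * Y = h * b - h" unfolding Y_def using h bC by (simp add: mult_minus_distrib_mat[of _ ?N ?N])
      also have "\<dots> = (h + ?X * h) - h" unfolding b(2) using h by (simp add: add_mult_distrib_mat[of _ ?N ?N])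
      also have "\<dots> = ?X * h"
        using h mult_carrier_mat[OF root_part_carrier h(1), of k m] by (intro eq_matI) auto
      finally show ?thesis .
    qed
    have YY: "Y * Y = 0\<^sub>m ?N ?N"
    proof -
      obtain g where g: "g \<in> carrier_mat ?N ?N" "h * g = 1\<^sub>m ?N" "g * h = 1\<^sub>m ?N"
        using obtain_inverse_mat[OF h] by blast
      have "h * (Y * Y) = (h * Y) * Y" by (rule assoc_mult_mat[OF h(1) YC YC, symmetric])
      also have "\<dots> = (?X * h) * Y" by (simp only: hY)
      also have "\<dots> = ?X * (h * Y)" by (rule assoc_mult_mat[OF root_part_carrier h(1) YC])
      also have "\<dots> = ?X * (?X * h)" by (simp only: hY)
      also have "\<dots> = (?X * ?X) * h" by (rule assoc_mult_mat[OF root_part_carrier root_part_carrier h(1), symmetric])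
      also have "\<dots> = 0\<^sub>m ?N ?N" unfolding root_part_square[OF km] using h by simp
      finally have e: "h * (Y * Y) = 0\<^sub>m ?N ?N" .
      have "Y * Y = g * (h * (Y * Y))"
        by (rule mult_mat_inverse_cancel[OF g(1) h(1) g(3), symmetric, where m = ?N]) (use YC in auto)
      then show ?thesis unfolding e using g by simp
    qed
    \<comment> \<open>\<open>Y\<close> is upper triangular with square zero, so its diagonal vanishes\<close>
    have Yd: "Y $$ (l, l) = 0" if l: "l < ?N" for l
    proof -
      have "0 = (Y * Y) $$ (l, l)" unfolding YY using l by simp
      also have "\<dots> = (\<Sum>r<?N. Y $$ (l, r) * Y $$ (r, l))" by (rule mult_mat_entry[OF YC YC l l])
      also have "\<dots> = (\<Sum>r<?N. if r = l then Y $$ (l, l) * Y $$ (l, l) else 0)"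
      proof (rule sum.cong[OF refl])
        fix r assume "r \<in> {..<?N}"
        then show "Y $$ (l, r) * Y $$ (r, l) = (if r = l then Y $$ (l, l) * Y $$ (l, l) else 0)"
          using bup[of l r] bup[of r l] l by (cases r l rule: linorder_cases) (auto simp: Yi)
      qed
      finally show ?thesis using l by simp
    qed
    have "(?X * h) $$ (r, j) = (\<Sum>l<?N. h $$ (r, l) * Y $$ (l, j))"
      unfolding hY[symmetric] by (rule mult_mat_entry[OF h(1) YC r(2) jN])
    also have "\<dots> = 0"
    proof (rule sum.neutral, intro ballI)
      fix l assume l: "l \<in> {..<?N}"
      show "h $$ (r, l) * Y $$ (l, j) = 0"
        using l IH[of l r] r jN Yd[OF jN] bup[of l j] by (cases l j rule: linorder_cases) (auto simp: Yi)
    qed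
    finally show ?thesis .
  qed
  show ?thesis using j i
  proof (induction j arbitrary: i rule: less_induct)
    case (less j)
    have IH: "h $$ (i, l) = 0" if "l < j" "l < i" "i < ?N" for l i
      using less.IH[of l i] that less.prems by simp
    have jN: "j < ?N" using less.prems by linarith
    show ?case
    proof (cases "i = ?N - 1 - j")
      case False
      have km: "j < i" "i < ?N" "i \<noteq> ?N - 1 - j" using less.prems False by auto
      have "j \<noteq> ?N - 1 - i" using km by linarith
      then show ?thesis
        using rows[OF km IH order_refl jN jN] unfolding root_part_mult_entry[OF km h(1) jN jN] by simp
    next
      case True
      have km: "Suc j < ?N - 1 - j" "?N - 1 - j < ?N" "?N - 1 - j \<noteq> ?N - 1 - Suc j" using less.prems by linarith+
      have jS: "Suc j < ?N" "j \<le> Suc j" "Suc j \<noteq> ?N - 1 - (?N - 1 - j)" using less.prems by linarith+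
      show ?thesis
        using rows[OF km IH jS(2,1) jN] jS(3) unfolding root_part_mult_entry[OF km h(1) jS(1) jN] True by simp
    qed
  qed
qed


section \<open>Galois descent\<close>

lemma galois_field_hom:
  assumes "\<sigma> \<in> absolute_galois"
  shows "field_hom \<sigma>"
proof -
  have add: "\<sigma> (a + b) = \<sigma> a + \<sigma> b" and mult: "\<sigma> (a * b) = \<sigma> a * \<sigma> b" and c: "\<sigma> (to_ac r) = to_ac r" for a b r
    using assms by (auto simp: absolute_galois_def)
  show ?thesis by unfold_locales (use add mult c[of 0] c[of 1] in auto)
qed

lemma to_ac_field_hom: "field_hom (to_ac :: 'f::field \<Rightarrow> _)"
  by unfold_locales auto

lemma galois_to_ac: "\<sigma> \<in> absolute_galois \<Longrightarrow> \<sigma> (to_ac c) = to_ac c"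
  by (simp add: absolute_galois_def)

lemma galois_bc: "\<sigma> \<in> absolute_galois \<Longrightarrow> map_mat \<sigma> (bc A) = bc A"
  by (rule eq_matI) (auto simp: galois_to_ac)

lemma regular_function_galois:
  assumes \<sigma>: "\<sigma> \<in> absolute_galois" and r: "r \<in> regular_functions base_field N" and A: "A \<in> carrier_mat N N"
  shows "r (map_mat \<sigma> A) = \<sigma> (r A)"
proof -
  interpret field_hom \<sigma> by (rule galois_field_hom[OF \<sigma>])
  show ?thesis using r
    by induction (use A \<sigma> in \<open>auto simp: galois_to_ac hom_distribs\<close>)
qed

text \<open>For a function \<open>r\<close> with coefficients in \<open>F\<close> one has \<open>r(\<sigma>A) = \<sigma>(rA)\<close>, so \<open>r\<close> vanishes at \<open>\<sigma>A\<close> if and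
  only if it vanishes at \<open>A\<close>.\<close>

lemma closed_over_base_galois:
  assumes \<sigma>: "\<sigma> \<in> absolute_galois" and C: "closedin (zariski base_field N) C" and A: "A \<in> carrier (GL N)"
  shows "map_mat \<sigma> A \<in> C \<longleftrightarrow> A \<in> C"
proof -
  interpret field_hom \<sigma> by (rule galois_field_hom[OF \<sigma>])
  have AC: "A \<in> carrier_mat N N" using A by (simp add: carrier_GL)
  have one: "1 \<in> (base_field :: 'a alg_closure set)" by (metis rangeI to_ac_1)
  have \<sigma>A: "map_mat \<sigma> A \<in> carrier (GL N)" using A by (auto simp: carrier_GL)
  have "map_mat \<sigma> A \<in> U \<longleftrightarrow> A \<in> U" if "openin (zariski base_field N) U" for U
    using openin_topology_generated_by[OF that[unfolded zariski_def]]
  proof (induction rule: generate_topology_on.induct)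
    case (Basis s)
    then obtain f where f: "f \<in> regular_functions base_field N" "s = {A \<in> carrier (GL N). f A \<noteq> 0}" by blast
    show ?case using regular_function_galois[OF \<sigma> f(1) AC] A \<sigma>A f(2) by (simp add: hom_0_iff)
  qed auto
  then show ?thesis using C A \<sigma>A topspace_zariski[OF one, of N] unfolding closedin_def by blast
qed

lemma galois_fixed_vec:
  fixes A :: "'f::field_char_0 alg_closure vec"
  assumes "\<And>\<sigma> i. \<sigma> \<in> absolute_galois \<Longrightarrow> i < dim_vec A \<Longrightarrow> \<sigma> (A $ i) = A $ i"
  obtains w where "dim_vec w = dim_vec A" "map_vec to_ac w = A"
proof -
  have "\<forall>i<dim_vec A. \<exists>c. A $ i = to_ac c"
    using fixed_by_absolute_galois assms by (metis rangeE)
  then obtain c where c: "\<And>i. i < dim_vec A \<Longrightarrow> A $ i = to_ac (c i)" by metis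
  show ?thesis by (rule that[of "vec (dim_vec A) c"]) (auto intro!: eq_vecI simp: c)
qed

text \<open>A line over the algebraic closure that is stable under the Galois group contains a rational
  vector: normalize one coordinate.\<close>

lemma galois_stable_line:
  fixes p :: "'f::field_char_0 alg_closure vec"
  assumes p: "p \<in> carrier_vec N" "p \<noteq> 0\<^sub>v N"
    and st: "\<And>\<sigma>. \<sigma> \<in> absolute_galois \<Longrightarrow> \<exists>c. map_vec \<sigma> p = c \<cdot>\<^sub>v p"
  obtains w a where "w \<in> carrier_vec N" "a \<noteq> 0" "p = a \<cdot>\<^sub>v map_vec to_ac w"
proof -
  obtain i where i: "i < N" "p $ i \<noteq> 0" using p by (metis carrier_vecD eq_vecI index_zero_vec)
  have "\<sigma> ((inverse (p $ i) \<cdot>\<^sub>v p) $ j) = (inverse (p $ i) \<cdot>\<^sub>v p) $ j"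
    if \<sigma>: "\<sigma> \<in> absolute_galois" and "j < dim_vec (inverse (p $ i) \<cdot>\<^sub>v p)" for \<sigma> j
  proof -
    interpret field_hom \<sigma> by (rule galois_field_hom[OF \<sigma>])
    have j: "j < N" using that p by simp
    obtain c where c: "map_vec \<sigma> p = c \<cdot>\<^sub>v p" using st[OF \<sigma>] by blast
    have e: "\<sigma> (p $ l) = c * p $ l" if "l < N" for l
      using arg_cong[OF c, of "\<lambda>z :: 'f alg_closure vec. z $ l"] that p by simp
    have "c \<noteq> 0" using e[OF i(1)] i by auto
    then show ?thesis using e[OF i(1)] e[OF j] i j p by (simp add: hom_distribs field_simps)
  qed
  then obtain w where w: "dim_vec w = dim_vec (inverse (p $ i) \<cdot>\<^sub>v p)" "map_vec to_ac w = inverse (p $ i) \<cdot>\<^sub>v p"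
    using galois_fixed_vec[of "inverse (p $ i) \<cdot>\<^sub>v p"] by blast
  show ?thesis
  proof (rule that[of w "p $ i"])
    show "p = p $ i \<cdot>\<^sub>v map_vec to_ac w" unfolding w(2) using i p by (intro eq_vecI) auto
  qed (use w p i in auto)
qed

lemma form_bc:
  assumes "Q \<in> carrier_mat N N" "v \<in> carrier_vec N" "w \<in> carrier_vec N"
  shows "form (bc Q) (map_vec to_ac v) (map_vec to_ac w) = to_ac (form Q v w)"
proof -
  have "form Q v w = (\<Sum>i<N. v $ i * (\<Sum>j<N. Q $$ (i, j) * w $ j))"
    using assms by (simp add: form_def scalar_prod_def atLeast0LessThan)
  moreover have "form (bc Q) (map_vec to_ac v) (map_vec to_ac w)
     = (\<Sum>i<N. to_ac (v $ i) * (\<Sum>j<N. to_ac (Q $$ (i, j)) * to_ac (w $ j)))"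
    using assms by (simp add: form_def scalar_prod_def atLeast0LessThan)
  ultimately show ?thesis by (simp add: to_ac_sum)
qed

lemma quadratic_space_bc:
  assumes "quadratic_space N Q"
  shows "quadratic_space N (bc Q)"
proof -
  interpret field_hom to_ac by (rule to_ac_field_hom)
  have "(bc Q)\<^sup>T = bc (Q\<^sup>T)" by (rule eq_matI) auto
  then show ?thesis using quadratic_spaceD[OF assms] by (simp add: quadratic_space_def nondegenerate_form_def)
qed

lemma bc_mult: "A \<in> carrier_mat n m \<Longrightarrow> B \<in> carrier_mat m l \<Longrightarrow> bc (A * B) = bc A * bc B"
proof -
  interpret field_hom to_ac by (rule to_ac_field_hom)
  show "A \<in> carrier_mat n m \<Longrightarrow> B \<in> carrier_mat m l \<Longrightarrow> bc (A * B) = bc A * bc B" by (rule mat_hom_mult)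
qed

lemma bc_one: "bc (1\<^sub>m n) = 1\<^sub>m n"
  by (rule eq_matI) auto

text \<open>A Galois-stable isotropic flag of length \<open>k\<close> over the algebraic closure, given by the columns
  of \<open>P\<close>, makes \<open>k\<close> hyperbolic planes split off over \<open>F\<close>: its first line is rational, and after
  splitting off a plane containing this line the rest of the flag lives in the complement. The left
  inverse \<open>L\<close> encodes that the columns are linearly independent.\<close>

lemma splits_planes_if_stable_flag:
  fixes Q :: "'f::field_char_0 mat"
  assumes "quadratic_space N Q" "P \<in> carrier_mat N k" "P\<^sup>T * bc Q * P = 0\<^sub>m k k"
    and "L \<in> carrier_mat k N" "L * P = 1\<^sub>m k"
    and "\<And>\<sigma>. \<sigma> \<in> absolute_galois \<Longrightarrow> \<exists>h \<in> carrier_mat k k. upper_triangular h \<and> map_mat \<sigma> P = P * h"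
  shows "splits_planes k N Q"
  using assms
proof (induction k arbitrary: N Q P L)
  case 0 then show ?case by simp
next
  case (Suc k)
  note Q = quadratic_spaceD[OF Suc.prems(1)] and P = Suc.prems(2,3) and L = Suc.prems(4,5) and st = Suc.prems(6)
  have bQ: "bc Q \<in> carrier_mat N N" using Q by simp
  define p where "p = col P 0"
  have pC: "p \<in> carrier_vec N" using P by (auto simp: p_def)
  have p0: "p \<noteq> 0\<^sub>v N"
  proof
    assume "p = 0\<^sub>v N"
    then have "col (L * P) 0 = L *\<^sub>v 0\<^sub>v N" using col_mult2[OF L(1) P(1), of 0] by (simp add: p_def)
    then have "col (L * P) 0 $ 0 = 0" using mult_mat_zero_vec[OF L(1)] by simp
    then show False unfolding L(2) by simp
  qed
  have pst: "\<exists>c. map_vec \<sigma> p = c \<cdot>\<^sub>v p" if \<sigma>: "\<sigma> \<in> absolute_galois" for \<sigma>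
  proof -
    obtain h where h: "h \<in> carrier_mat (Suc k) (Suc k)" "upper_triangular h" "map_mat \<sigma> P = P * h" using st[OF \<sigma>] by blast
    have "map_vec \<sigma> p = h $$ (0, 0) \<cdot>\<^sub>v p"
    proof (rule eq_vecI)
      fix i assume "i < dim_vec (h $$ (0, 0) \<cdot>\<^sub>v p)"
      then have i: "i < N" using pC by simp
      have "map_vec \<sigma> p $ i = map_mat \<sigma> P $$ (i, 0)" using i P pC by (simp add: p_def)
      also have "\<dots> = (\<Sum>l<Suc k. P $$ (i, l) * h $$ (l, 0))"
        unfolding h(3) by (rule mult_mat_entry[OF P(1) h(1) i]) simp
      also have "\<dots> = (\<Sum>l<Suc k. if l = 0 then P $$ (i, 0) * h $$ (0, 0) else 0)"
        by (rule sum.cong[OF refl]) (use h in \<open>auto simp: upper_triangular_def\<close>)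
      also have "\<dots> = (h $$ (0, 0) \<cdot>\<^sub>v p) $ i" using i P by (simp add: p_def)
      finally show "map_vec \<sigma> p $ i = (h $$ (0, 0) \<cdot>\<^sub>v p) $ i" .
    qed (use pC in auto)
    then show ?thesis by blast
  qed
  obtain w a where w: "w \<in> carrier_vec N" "a \<noteq> 0" "p = a \<cdot>\<^sub>v map_vec to_ac w"
    using galois_stable_line[OF pC p0 pst] by blast
  have bwC: "map_vec to_ac w \<in> carrier_vec N" using w by simp
  have w0: "w \<noteq> 0\<^sub>v N"
  proof
    assume "w = 0\<^sub>v N"
    then have "p = 0\<^sub>v N" unfolding w(3) by (intro eq_vecI) auto
    then show False using p0 by blast
  qed
  have "form (bc Q) p p = 0"
  proof -
    have "0 = (P\<^sup>T * bc Q * P) $$ (0, 0)" unfolding P(2) by simp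
    also have "P\<^sup>T * bc Q * P = P\<^sup>T * (bc Q * P)" by (rule assoc_mult_mat[of _ "Suc k" N _ N _ "Suc k"]) (use P bQ in auto)
    also have "(P\<^sup>T * (bc Q * P)) $$ (0, 0) = row P\<^sup>T 0 \<bullet> col (bc Q * P) 0"
      by (rule index_mult_mat(1)) (use P(1) bQ in auto)
    also have "row P\<^sup>T 0 = col P 0" using P(1) by simp
    also have "col (bc Q * P) 0 = bc Q *\<^sub>v col P 0" by (rule col_mult2[OF bQ P(1)]) simp
    finally show ?thesis by (simp add: form_def p_def)
  qed
  also have "form (bc Q) p p = a * (a * to_ac (form Q w w))"
    unfolding w(3) using form_add_smult(3)[OF bQ bwC bwC, of "a \<cdot>\<^sub>v map_vec to_ac w"] form_add_smult(4)[OF bQ bwC bwC bwC]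
      form_bc[OF Q(1) w(1) w(1)] bwC by simp
  finally have iso: "form Q w w = 0" using w(2) by simp
  have "\<exists>M. N = M + 2"
  proof (rule ccontr)
    assume "\<not> ?thesis"
    then have "N = 0 \<or> N = 1" by presburger
    moreover have "N \<noteq> 0" using w0 w(1) by auto
    ultimately have N: "N = 1" by simp
    then have "w $ 0 * (Q $$ (0, 0) * w $ 0) = 0"
      using iso Q(1) w(1) by (simp add: form_def scalar_prod_def)
    moreover have "Q $$ (0, 0) \<noteq> 0" using Q N det_single[of Q] by auto
    ultimately have "w = 0\<^sub>v N" using N w(1) by (intro eq_vecI) auto
    then show False using w0 by blast
  qed
  then obtain M where N: "N = M + 2" by blast
  obtain P1 Q' where P1: "P1 \<in> carrier_mat N N" "det P1 \<noteq> 0" "col P1 0 = w"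
    and Q': "Q' \<in> carrier_mat M M" "det Q' \<noteq> 0" "Q'\<^sup>T = 1 \<cdot>\<^sub>m Q'" "P1\<^sup>T * Q * P1 = add_plane 1 M Q'"
    using split_off_plane[of Q M 1 w] Q w w0 iso unfolding N by auto
  have Q'q: "quadratic_space M Q'" using Q' by (simp add: quadratic_space_def nondegenerate_form_def)
  obtain R1 where R1: "R1 \<in> carrier_mat N N" "P1 * R1 = 1\<^sub>m N" "R1 * P1 = 1\<^sub>m N"
    using obtain_inverse_mat[OF P1(1,2)] by blast
  have bP1: "bc P1 \<in> carrier_mat N N" and bR1: "bc R1 \<in> carrier_mat N N" using P1 R1 by auto
  have bPR: "bc P1 * bc R1 = 1\<^sub>m N" "bc R1 * bc P1 = 1\<^sub>m N"
    unfolding bc_mult[OF P1(1) R1(1), symmetric] bc_mult[OF R1(1) P1(1), symmetric] R1 bc_one by simp_all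
  have bH: "(bc P1)\<^sup>T * bc Q * bc P1 = add_plane 1 M (bc Q')"
  proof -
    have "(bc P1)\<^sup>T = bc (P1\<^sup>T)" by (rule eq_matI) auto
    then have "(bc P1)\<^sup>T * bc Q * bc P1 = bc (P1\<^sup>T * Q * P1)"
      using bc_mult[of "P1\<^sup>T" N N Q N] bc_mult[of "P1\<^sup>T * Q" N N P1 N] P1 Q by simp
    also have "\<dots> = add_plane 1 M (bc Q')" unfolding Q'(4)
      by (rule eq_matI) (use Q'(1) in \<open>auto simp: add_plane_index\<close>)
    finally show ?thesis .
  qed
  define R where "R = bc R1 * P"
  have RC: "R \<in> carrier_mat (M+2) (Suc k)" using bR1 P N by (auto simp: R_def)
  have PR: "bc P1 * R = P" unfolding R_def by (rule mult_mat_inverse_cancel[OF bP1 bR1 bPR(1) P(1)])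
  have gram: "R\<^sup>T * add_plane 1 M (bc Q') * R = 0\<^sub>m (Suc k) (Suc k)"
    using gram_mult[OF bP1 bQ RC[folded N]] unfolding PR bH P(2) by simp
  have R0: "R $$ (i, 0) = (if i = 0 then a else 0)" if i: "i < M+2" for i
  proof -
    have "col R 0 = bc R1 *\<^sub>v (a \<cdot>\<^sub>v map_vec to_ac w)" unfolding R_def using col_mult2[OF bR1 P(1), of 0] w(3) by (simp add: p_def)
    also have "\<dots> = a \<cdot>\<^sub>v (bc R1 *\<^sub>v map_vec to_ac w)" by (rule mult_mat_vec[OF bR1 bwC])
    also have "map_vec to_ac w = col (bc P1) 0" using P1 N by (intro eq_vecI) auto
    also have "bc R1 *\<^sub>v col (bc P1) 0 = col (bc R1 * bc P1) 0" using col_mult2[OF bR1 bP1, of 0] N by simp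
    finally have "col R 0 $ i = (a \<cdot>\<^sub>v col (1\<^sub>m N) 0) $ i" unfolding bPR by simp
    then show ?thesis using i RC N by simp
  qed
  have Rlast: "R $$ (Suc M, j) = 0" if j: "j < Suc k" for j
  proof -
    have "0 = (R\<^sup>T * add_plane 1 M (bc Q') * R) $$ (0, j)" unfolding gram using j by simp
    also have "\<dots> = a * R $$ (Suc M, j)"
      unfolding gram_add_plane_entry[OF RC zero_less_Suc j] using R0 by simp
    finally show ?thesis using w(2) by simp
  qed
  \<comment> \<open>the flag in the complement of the line modulo the line\<close>
  define R' where "R' = mat M k (\<lambda>(i, j). R $$ (Suc i, Suc j))"
  define L2 where "L2 = L * bc P1"
  have L2C: "L2 \<in> carrier_mat (Suc k) (M+2)" using L bP1 N by (auto simp: L2_def)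
  have L2R: "L2 * R = 1\<^sub>m (Suc k)"
  proof -
    have "L2 * R = L * (bc P1 * R)" unfolding L2_def by (rule assoc_mult_mat[OF L(1) bP1 RC[folded N]])
    then show ?thesis unfolding PR L(2) .
  qed
  have L20: "L2 $$ (Suc i, 0) = 0" if i: "i < k" for i
  proof -
    have "0 = (L2 * R) $$ (Suc i, 0)" unfolding L2R using i by simp
    also have "\<dots> = (\<Sum>r<M+2. L2 $$ (Suc i, r) * R $$ (r, 0))"
      by (rule mult_mat_entry[OF L2C RC]) (use i in auto)
    also have "\<dots> = L2 $$ (Suc i, 0) * a" unfolding sum_lessThan_split_ends by (simp add: R0)
    finally show ?thesis using w(2) by simp
  qed
  define L' where "L' = mat k M (\<lambda>(i, j). L2 $$ (Suc i, Suc j))"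
  have "splits_planes k M Q'"
  proof (rule Suc.IH[OF Q'q])
    show R'C: "R' \<in> carrier_mat M k" and L'C: "L' \<in> carrier_mat k M" by (simp_all add: R'_def L'_def)
    have bQ': "bc Q' \<in> carrier_mat M M" using Q' by simp
    show "R'\<^sup>T * bc Q' * R' = 0\<^sub>m k k"
    proof (rule eq_matI)
      fix i j assume "i < dim_row (0\<^sub>m k k :: 'f alg_closure mat)" "j < dim_col (0\<^sub>m k k :: 'f alg_closure mat)"
      then have ij: "i < k" "j < k" by auto
      have "(R'\<^sup>T * bc Q' * R') $$ (i, j) = (\<Sum>k<M. R $$ (Suc k, Suc i) * (\<Sum>l<M. bc Q' $$ (k, l) * R $$ (Suc l, Suc j)))"
        unfolding gram_index_sum[OF R'C bQ' ij] sum_distrib_left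
        by (intro sum.cong refl) (use ij in \<open>simp add: R'_def mult_ac\<close>)
      also have "\<dots> = (R\<^sup>T * add_plane 1 M (bc Q') * R) $$ (Suc i, Suc j)"
        using gram_add_plane_entry[OF RC, of "Suc i" "Suc j" "bc Q'"] ij Rlast by simp
      finally show "(R'\<^sup>T * bc Q' * R') $$ (i, j) = 0\<^sub>m k k $$ (i, j)" unfolding gram using ij by simp
    qed (use R'C in auto)
    show "L' * R' = 1\<^sub>m k"
    proof (rule eq_matI)
      fix i j assume "i < dim_row (1\<^sub>m k :: 'f alg_closure mat)" "j < dim_col (1\<^sub>m k :: 'f alg_closure mat)"
      then have ij: "i < k" "j < k" by auto
      have "(L' * R') $$ (i, j) = (\<Sum>r<M. L2 $$ (Suc i, Suc r) * R $$ (Suc r, Suc j))"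
        unfolding mult_mat_entry[OF L'C R'C ij] by (intro sum.cong refl) (use ij in \<open>simp add: L'_def R'_def\<close>)
      also have "\<dots> = (\<Sum>r<M+2. L2 $$ (Suc i, r) * R $$ (r, Suc j))"
        unfolding sum_lessThan_split_ends using L20[OF ij(1)] Rlast[of "Suc j"] ij by simp
      also have "\<dots> = (L2 * R) $$ (Suc i, Suc j)"
        by (rule mult_mat_entry[OF L2C RC, symmetric]) (use ij in auto)
      finally show "(L' * R') $$ (i, j) = 1\<^sub>m k $$ (i, j)" unfolding L2R using ij by simp
    qed (use L'C R'C in auto)
    fix \<sigma> :: "'f alg_closure \<Rightarrow> 'f alg_closure" assume \<sigma>: "\<sigma> \<in> absolute_galois"
    interpret \<sigma>: field_hom \<sigma> by (rule galois_field_hom[OF \<sigma>])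
    obtain h where h: "h \<in> carrier_mat (Suc k) (Suc k)" "upper_triangular h" "map_mat \<sigma> P = P * h" using st[OF \<sigma>] by blast
    define h' where "h' = mat k k (\<lambda>(i, j). h $$ (Suc i, Suc j))"
    have h'C: "h' \<in> carrier_mat k k" by (simp add: h'_def)
    have "map_mat \<sigma> R = bc R1 * map_mat \<sigma> P"
      unfolding R_def using \<sigma>.mat_hom_mult[OF bR1 P(1)] galois_bc[OF \<sigma>] by simp
    also have "\<dots> = R * h" unfolding h(3) R_def by (rule assoc_mult_mat[OF bR1 P(1) h(1), symmetric])
    finally have \<sigma>R: "map_mat \<sigma> R = R * h" .
    have "map_mat \<sigma> R' = R' * h'"
    proof (rule eq_matI)
      fix i j assume "i < dim_row (R' * h')" "j < dim_col (R' * h')"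
      then have ij: "i < M" "j < k" by (auto simp: R'_def h'_def)
      have "map_mat \<sigma> R' $$ (i, j) = map_mat \<sigma> R $$ (Suc i, Suc j)" using ij RC by (simp add: R'_def)
      also have "\<dots> = (\<Sum>l<Suc k. R $$ (Suc i, l) * h $$ (l, Suc j))"
        unfolding \<sigma>R by (rule mult_mat_entry[OF RC h(1)]) (use ij in auto)
      also have "\<dots> = (\<Sum>l<k. R $$ (Suc i, Suc l) * h $$ (Suc l, Suc j))"
        unfolding sum.lessThan_Suc_shift using R0[of "Suc i"] ij by simp
      also have "\<dots> = (R' * h') $$ (i, j)"
        unfolding mult_mat_entry[OF R'C h'C ij] by (intro sum.cong refl) (use ij in \<open>simp add: R'_def h'_def\<close>)
      finally show "map_mat \<sigma> R' $$ (i, j) = (R' * h') $$ (i, j)" .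
    qed (auto simp: R'_def h'_def)
    moreover have "upper_triangular h'" using h(1,2) by (auto simp: upper_triangular_def h'_def)
    ultimately show "\<exists>h\<in>carrier_mat k k. upper_triangular h \<and> map_mat \<sigma> R' = R' * h" using h'C by blast
  qed
  then show ?case using N P1 Q'q Q'(4) by auto
qed

lemma std_borel_galois:
  assumes \<sigma>: "\<sigma> \<in> absolute_galois" and b: "b \<in> std_borel N"
  shows "map_mat \<sigma> b \<in> std_borel N"
proof -
  interpret field_hom \<sigma> by (rule galois_field_hom[OF \<sigma>])
  have bC: "b \<in> carrier_mat N N" and iso: "b\<^sup>T * antidiag N * b = antidiag N" and d: "det b = 1" "upper_triangular b"
    using b by (auto simp: std_borel_iff)
  have a: "map_mat \<sigma> (antidiag N) = antidiag N" by (rule eq_matI) (auto simp: antidiag_def)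
  have t: "(map_mat \<sigma> b)\<^sup>T = map_mat \<sigma> (b\<^sup>T)" by (rule eq_matI) auto
  have "(map_mat \<sigma> b)\<^sup>T * antidiag N * map_mat \<sigma> b = map_mat \<sigma> (b\<^sup>T * antidiag N * b)"
    using mat_hom_mult[of "b\<^sup>T" N N "antidiag N" N] mat_hom_mult[of "b\<^sup>T * antidiag N" N N b N] bC a t by simp
  then show ?thesis using bC d by (simp add: std_borel_iff iso a upper_triangular_def)
qed

text \<open>A Galois automorphism \<open>\<sigma>\<close> maps the Borel subgroup, \<open>P BJ P\<inverse>\<close> with \<open>BJ\<close> the standard one, to
  itself. Hence \<open>h = P\<inverse> \<sigma>(P)\<close> normalizes \<open>BJ\<close>, and \<open>\<sigma>(P) = P h\<close> says that the flag given by the first \<open>n - 1\<close>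
  columns of \<open>P\<close> is stable.\<close>

theorem quasisplit_splits_planes:
  fixes Q :: "'f::field_char_0 mat"
  assumes Q: "quadratic_space (2*n) Q" and qs: "quasisplit_SO (2*n) Q"
  shows "splits_planes (n - 1) (2*n) Q"
proof -
  let ?N = "2*n" and ?k = "n - 1"
  obtain B where B: "borel_subgroup ?N (SO ?N (bc Q)) B" "closed_subgroup base_field ?N B"
    using qs by (auto simp: quasisplit_SO_def)
  have bQ: "bc Q \<in> carrier_mat ?N ?N" using quadratic_spaceD(1)[OF Q] by simp
  obtain P R where P: "P \<in> carrier_mat ?N ?N" and R: "R \<in> carrier_mat ?N ?N"
    and PR: "P * R = 1\<^sub>m ?N" and RP: "R * P = 1\<^sub>m ?N" and PQP: "P\<^sup>T * bc Q * P = antidiag ?N"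
    and Beq: "B = (\<lambda>b. P * b * R) ` std_borel ?N"
    using borel_subgroup_SO[OF quadratic_space_bc[OF Q] B(1)] by blast
  note a = bQ P R PR RP PQP
  have Bcl: "closedin (zariski base_field ?N) B" using B(2) by (simp add: closed_subgroup_def)
  define P' where "P' = mat ?N ?k (\<lambda>(i, j). P $$ (i, j))"
  define R' where "R' = mat ?k ?N (\<lambda>(i, j). R $$ (i, j))"
  have P'C: "P' \<in> carrier_mat ?N ?k" and R'C: "R' \<in> carrier_mat ?k ?N" by (simp_all add: P'_def R'_def)
  show ?thesis
  proof (rule splits_planes_if_stable_flag[OF Q P'C _ R'C])
    show "P'\<^sup>T * bc Q * P' = 0\<^sub>m ?k ?k"
    proof (rule eq_matI)
      fix i j assume "i < dim_row (0\<^sub>m ?k ?k :: 'f alg_closure mat)" "j < dim_col (0\<^sub>m ?k ?k :: 'f alg_closure mat)"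
      then have ij: "i < ?k" "j < ?k" by auto
      then have ijN: "i < ?N" "j < ?N" by auto
      have "(P'\<^sup>T * bc Q * P') $$ (i, j) = (P\<^sup>T * bc Q * P) $$ (i, j)"
        unfolding gram_index_sum[OF P'C bQ ij] gram_index_sum[OF P bQ ijN]
        by (intro sum.cong refl) (use ij in \<open>simp add: P'_def\<close>)
      also have "\<dots> = 0" unfolding PQP using ij by (simp add: antidiag_def)
      finally show "(P'\<^sup>T * bc Q * P') $$ (i, j) = 0\<^sub>m ?k ?k $$ (i, j)" using ij by simp
    qed (use P'C in auto)
    show "R' * P' = 1\<^sub>m ?k"
    proof (rule eq_matI)
      fix i j assume "i < dim_row (1\<^sub>m ?k :: 'f alg_closure mat)" "j < dim_col (1\<^sub>m ?k :: 'f alg_closure mat)"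
      then have ij: "i < ?k" "j < ?k" by auto
      then have ijN: "i < ?N" "j < ?N" by auto
      have "(R' * P') $$ (i, j) = (R * P) $$ (i, j)"
        unfolding mult_mat_entry[OF R'C P'C ij] mult_mat_entry[OF R P ijN]
        by (intro sum.cong refl) (use ij in \<open>simp add: P'_def R'_def\<close>)
      then show "(R' * P') $$ (i, j) = 1\<^sub>m ?k $$ (i, j)" unfolding RP using ij ijN by simp
    qed (use P'C R'C in auto)
    fix \<sigma> :: "'f alg_closure \<Rightarrow> 'f alg_closure" assume \<sigma>: "\<sigma> \<in> absolute_galois"
    interpret \<sigma>: field_hom \<sigma> by (rule galois_field_hom[OF \<sigma>])
    have bij: "bij \<sigma>" using \<sigma> by (simp add: absolute_galois_def)
    have \<sigma>P: "map_mat \<sigma> P \<in> carrier_mat ?N ?N" and \<sigma>R: "map_mat \<sigma> R \<in> carrier_mat ?N ?N" using P R by auto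
    have \<sigma>RP: "map_mat \<sigma> R * map_mat \<sigma> P = 1\<^sub>m ?N"
      using \<sigma>.mat_hom_mult[OF R P] RP \<sigma>.mat_hom_one by simp
    define h where "h = R * map_mat \<sigma> P"
    have hC: "h \<in> carrier_mat ?N ?N" using R \<sigma>P by (simp add: h_def)
    have dh: "det h \<noteq> 0"
      unfolding h_def using det_mult[OF R \<sigma>P] det_nonzero_if_left_inverse[OF R P PR] det_nonzero_if_left_inverse[OF \<sigma>P \<sigma>R \<sigma>RP] by simp
    have Ph: "P * h = map_mat \<sigma> P" unfolding h_def by (rule mult_mat_inverse_cancel[OF P R PR \<sigma>P])
    have norm: "\<exists>b\<in>std_borel ?N. h * b = u * h" if u: "u \<in> std_borel ?N" for u
    proof -
      have uC: "u \<in> carrier_mat ?N ?N" using u by (simp add: std_borel_iff)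
      define g where "g = P * u * R"
      have gB: "g \<in> B" unfolding Beq g_def using u by blast
      have gC: "g \<in> carrier_mat ?N ?N" using P uC R by (auto simp: g_def)
      have gG: "g \<in> carrier (GL ?N)"
        using gB conj_std_borel_SO[OF a] unfolding Beq by (auto simp: SO_def Ortho_def)
      define A where "A = map_mat (inv_into UNIV \<sigma>) g"
      have \<sigma>A: "map_mat \<sigma> A = g"
        unfolding A_def using bij by (intro eq_matI) (auto simp: bij_def surj_f_inv_f)
      have AC: "A \<in> carrier_mat ?N ?N" using gC by (simp add: A_def)
      have "\<sigma> (det A) = det g" using \<sigma>A \<sigma>.hom_det[of A] by simp
      then have AG: "A \<in> carrier (GL ?N)" using AC gG by (auto simp: carrier_GL)
      have "A \<in> B" using closed_over_base_galois[OF \<sigma> Bcl AG] gB \<sigma>A by simp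
      then obtain c where c: "c \<in> std_borel ?N" "A = P * c * R" unfolding Beq by blast
      have cC: "c \<in> carrier_mat ?N ?N" using c by (simp add: std_borel_iff)
      let ?b = "map_mat \<sigma> c"
      have bC: "?b \<in> carrier_mat ?N ?N" using cC by simp
      have "map_mat \<sigma> A = map_mat \<sigma> P * ?b * map_mat \<sigma> R"
        unfolding c(2) using \<sigma>.mat_hom_mult[OF mult_carrier_mat[OF P cC] R] \<sigma>.mat_hom_mult[OF P cC] by simp
      then have e: "P * u * R = map_mat \<sigma> P * ?b * map_mat \<sigma> R" using \<sigma>A g_def by simp
      have "u * h = R * (P * u * R) * map_mat \<sigma> P"
      proof -
        have "R * (P * u * R) * map_mat \<sigma> P = R * (P * (u * (R * map_mat \<sigma> P)))"
          using P R uC \<sigma>P by (simp add: assoc_mult_mat[of _ ?N ?N _ ?N _ ?N])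
        also have "\<dots> = u * (R * map_mat \<sigma> P)"
          by (rule mult_mat_inverse_cancel[OF R P RP, where m = ?N]) (use uC R \<sigma>P in auto)
        finally show ?thesis by (simp add: h_def)
      qed
      also have "\<dots> = R * map_mat \<sigma> P * (?b * (map_mat \<sigma> R * map_mat \<sigma> P))"
        unfolding e using R \<sigma>P \<sigma>R bC by (simp add: assoc_mult_mat[of _ ?N ?N _ ?N _ ?N])
      also have "\<dots> = h * ?b" unfolding \<sigma>RP h_def using bC by simp
      finally show ?thesis using std_borel_galois[OF \<sigma> c(1)] by (intro bexI[of _ ?b]) auto
    qed
    define h' where "h' = mat ?k ?k (\<lambda>(i, j). h $$ (i, j))"
    have h'C: "h' \<in> carrier_mat ?k ?k" by (simp add: h'_def)
    have hz: "h $$ (i, j) = 0" if "j < ?k" "j < i" "i < ?N" for i j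
      using std_borel_normalizer[OF hC dh norm that] .
    have "upper_triangular h'" using hz by (auto simp: upper_triangular_def h'_def)
    moreover have "map_mat \<sigma> P' = P' * h'"
    proof (rule eq_matI)
      fix i j assume "i < dim_row (P' * h')" "j < dim_col (P' * h')"
      then have ij: "i < ?N" "j < ?k" by (auto simp: P'_def h'_def)
      then have jN: "j < ?N" by simp
      have "map_mat \<sigma> P' $$ (i, j) = map_mat \<sigma> P $$ (i, j)" using ij jN P by (simp add: P'_def)
      also have "\<dots> = (\<Sum>l<?N. P $$ (i, l) * h $$ (l, j))"
        unfolding Ph[symmetric] by (rule mult_mat_entry[OF P hC ij(1) jN])
      also have "\<dots> = (\<Sum>l<?k. P $$ (i, l) * h $$ (l, j))"
        by (rule sum.mono_neutral_right) (use hz[OF ij(2)] ij in auto)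
      also have "\<dots> = (P' * h') $$ (i, j)"
        unfolding mult_mat_entry[OF P'C h'C ij] by (intro sum.cong refl) (use ij in \<open>simp add: P'_def h'_def\<close>)
      finally show "map_mat \<sigma> P' $$ (i, j) = (P' * h') $$ (i, j)" .
    qed (auto simp: P'_def h'_def)
    ultimately show "\<exists>h\<in>carrier_mat ?k ?k. upper_triangular h \<and> map_mat \<sigma> P' = P' * h" using h'C by blast
  qed
qed

section \<open>Forms and isometries parametrized by etale algebras\<close>

lemma linear_map_matrix:
  fixes T :: "'k::field vec \<Rightarrow> 'k vec"
  assumes T: "\<And>v. v \<in> carrier_vec N \<Longrightarrow> T v \<in> carrier_vec N"
    and add: "\<And>v w. v \<in> carrier_vec N \<Longrightarrow> w \<in> carrier_vec N \<Longrightarrow> T (v + w) = T v + T w"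
    and smult: "\<And>c v. v \<in> carrier_vec N \<Longrightarrow> T (c \<cdot>\<^sub>v v) = c \<cdot>\<^sub>v T v"
  obtains A where "A \<in> carrier_mat N N" "\<And>v. v \<in> carrier_vec N \<Longrightarrow> T v = A *\<^sub>v v"
proof -
  define A where "A = mat N N (\<lambda>(i, j). T (unit_vec N j) $ i)"
  have AC: "A \<in> carrier_mat N N" by (simp add: A_def)
  have key: "T v $ i = (\<Sum>j<k. A $$ (i, j) * v $ j)"
    if "k \<le> N" "v \<in> carrier_vec N" "\<forall>j. k \<le> j \<and> j < N \<longrightarrow> v $ j = 0" "i < N" for k i and v :: "'k vec"
    using that
  proof (induction k arbitrary: v)
    case 0
    then have "v = 0 \<cdot>\<^sub>v v" by (intro eq_vecI) auto
    then have "T v = 0 \<cdot>\<^sub>v T v" using smult[OF 0(2), of 0] by simp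
    then have "T v $ i = (0 \<cdot>\<^sub>v T v) $ i" by simp
    then show ?case using T[OF 0(2)] 0 by simp
  next
    case (Suc k)
    define v' where "v' = vec N (\<lambda>j. if j = k then 0 else v $ j)"
    have v'C: "v' \<in> carrier_vec N" by (simp add: v'_def)
    have "v = v' + v $ k \<cdot>\<^sub>v unit_vec N k" using Suc.prems by (intro eq_vecI) (auto simp: v'_def)
    then have "T v = T v' + v $ k \<cdot>\<^sub>v T (unit_vec N k)"
      using add[OF v'C, of "v $ k \<cdot>\<^sub>v unit_vec N k"] smult[of "unit_vec N k" "v $ k"] by simp
    then have "T v $ i = T v' $ i + v $ k * T (unit_vec N k) $ i"
      using T[OF v'C] T[of "unit_vec N k"] Suc.prems by simp
    also have "T v' $ i = (\<Sum>j<k. A $$ (i, j) * v' $ j)"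
      by (rule Suc.IH) (use Suc.prems v'C in \<open>auto simp: v'_def\<close>)
    also have "\<dots> = (\<Sum>j<k. A $$ (i, j) * v $ j)"
      by (rule sum.cong) (use Suc.prems in \<open>auto simp: v'_def\<close>)
    finally show ?case using Suc.prems by (simp add: A_def sum.lessThan_Suc mult.commute)
  qed
  show ?thesis
  proof (rule that[OF AC])
    fix v :: "'k vec" assume v: "v \<in> carrier_vec N"
    show "T v = A *\<^sub>v v"
    proof (rule eq_vecI)
      fix i assume "i < dim_vec (A *\<^sub>v v)"
      then have i: "i < N" using AC by simp
      have "T v $ i = (\<Sum>j<N. A $$ (i, j) * v $ j)" by (rule key) (use v i in auto)
      then show "T v $ i = (A *\<^sub>v v) $ i"
        using i mult_mat_vec_index_sum[of i A v] AC v by simp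
    qed (use T[OF v] AC in auto)
  qed
qed

lemma mat_eq_if_mult_vec:
  fixes A B :: "'k::field mat"
  assumes "A \<in> carrier_mat N N" "B \<in> carrier_mat N N" "\<And>v. v \<in> carrier_vec N \<Longrightarrow> A *\<^sub>v v = B *\<^sub>v v"
  shows "A = B"
proof (rule eq_matI)
  fix i j assume "i < dim_row B" "j < dim_col B"
  then have ij: "i < N" "j < N" using assms by auto
  have "(A *\<^sub>v unit_vec N j) $ i = (B *\<^sub>v unit_vec N j) $ i" using assms(3) by simp
  then show "A $$ (i, j) = B $$ (i, j)" using assms(1,2) ij by simp
qed (use assms in auto)

context
  fixes N :: nat and L :: "('f::field, 'l) module" and e :: "'f vec \<Rightarrow> 'l"
  assumes alg: "F_algebra L" and e: "lin_iso N L e"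
begin

interpretation A: Module.algebra "ring_of_type_algebra :: 'f ring" L by (rule alg)

lemma lin_iso_closed: "v \<in> carrier_vec N \<Longrightarrow> e v \<in> carrier L"
  using e by (auto simp: lin_iso_def bij_betw_def)

lemma lin_iso_inj: "v \<in> carrier_vec N \<Longrightarrow> w \<in> carrier_vec N \<Longrightarrow> e v = e w \<Longrightarrow> v = w"
  using e by (auto simp: lin_iso_def bij_betw_def inj_on_def)

lemma lin_iso_surj: "a \<in> carrier L \<Longrightarrow> \<exists>v\<in>carrier_vec N. e v = a"
  using e unfolding lin_iso_def bij_betw_def by (metis imageE)

lemma lin_iso_add: "v \<in> carrier_vec N \<Longrightarrow> w \<in> carrier_vec N \<Longrightarrow> e (v + w) = e v \<oplus>\<^bsub>L\<^esub> e w"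
  using e by (auto simp: lin_iso_def)

lemma lin_iso_smult: "v \<in> carrier_vec N \<Longrightarrow> e (c \<cdot>\<^sub>v v) = c \<odot>\<^bsub>L\<^esub> e v"
  using e by (auto simp: lin_iso_def)

lemma lin_iso_zero: "e (0\<^sub>v N) = \<zero>\<^bsub>L\<^esub>"
proof -
  have "e (0\<^sub>v N) \<oplus>\<^bsub>L\<^esub> e (0\<^sub>v N) = e (0\<^sub>v N)" using lin_iso_add[of "0\<^sub>v N" "0\<^sub>v N"] by simp
  then show ?thesis using lin_iso_closed[of "0\<^sub>v N"] by (metis A.M.add.l_cancel_one' zero_carrier_vec)
qed

lemma map_matrix:
  assumes f: "\<And>v. v \<in> carrier_vec N \<Longrightarrow> f v \<in> carrier L"
    and add: "\<And>v w. v \<in> carrier_vec N \<Longrightarrow> w \<in> carrier_vec N \<Longrightarrow> f (v + w) = f v \<oplus>\<^bsub>L\<^esub> f w"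
    and smult: "\<And>c v. v \<in> carrier_vec N \<Longrightarrow> f (c \<cdot>\<^sub>v v) = c \<odot>\<^bsub>L\<^esub> f v"
  obtains A where "A \<in> carrier_mat N N" "\<And>v. v \<in> carrier_vec N \<Longrightarrow> e (A *\<^sub>v v) = f v"
proof -
  define T where "T v = the_inv_into (carrier_vec N) e (f v)" for v
  have bij: "bij_betw e (carrier_vec N) (carrier L)" using e by (simp add: lin_iso_def)
  have TC: "T v \<in> carrier_vec N" and eT: "e (T v) = f v" if "v \<in> carrier_vec N" for v
  proof -
    show "e (T v) = f v" unfolding T_def by (rule f_the_inv_into_f_bij_betw[OF bij]) (use f that in auto)
    show "T v \<in> carrier_vec N" unfolding T_def
      using the_inv_into_into[of e "carrier_vec N" "f v"] bij f[OF that] by (auto simp: bij_betw_def)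
  qed
  have Tadd: "T (v + w) = T v + T w" if "v \<in> carrier_vec N" "w \<in> carrier_vec N" for v w
    by (rule lin_iso_inj) (use that TC eT lin_iso_add add in auto)
  have Tsmult: "T (c \<cdot>\<^sub>v v) = c \<cdot>\<^sub>v T v" if "v \<in> carrier_vec N" for c v
    by (rule lin_iso_inj) (use that TC eT lin_iso_smult smult in auto)
  obtain A where "A \<in> carrier_mat N N" "\<And>v. v \<in> carrier_vec N \<Longrightarrow> T v = A *\<^sub>v v"
    using linear_map_matrix[of N T] TC Tadd Tsmult by blast
  then show ?thesis using that eT by metis
qed

lemma mult_matrix:
  assumes a: "a \<in> carrier L"
  obtains M where "M \<in> carrier_mat N N" "\<And>v. v \<in> carrier_vec N \<Longrightarrow> e (M *\<^sub>v v) = a \<otimes>\<^bsub>L\<^esub> e v"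
proof (rule map_matrix[of "\<lambda>v. a \<otimes>\<^bsub>L\<^esub> e v"])
  show "a \<otimes>\<^bsub>L\<^esub> e (v + w) = a \<otimes>\<^bsub>L\<^esub> e v \<oplus>\<^bsub>L\<^esub> (a \<otimes>\<^bsub>L\<^esub> e w)" if "v \<in> carrier_vec N" "w \<in> carrier_vec N" for v w
    using a that lin_iso_closed by (simp add: lin_iso_add A.r_distr)
  show "a \<otimes>\<^bsub>L\<^esub> e (c \<cdot>\<^sub>v v) = c \<odot>\<^bsub>L\<^esub> (a \<otimes>\<^bsub>L\<^esub> e v)" if "v \<in> carrier_vec N" for c v
    using a that lin_iso_closed A.smult_assoc2[of c "e v" a]
    by (simp add: lin_iso_smult A.m_comm A.smult_closed ring_of_type_algebra_def)
qed (use a lin_iso_closed that in auto)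

lemma alg_trace_matrix:
  assumes "M \<in> carrier_mat N N" "\<And>v. v \<in> carrier_vec N \<Longrightarrow> e (M *\<^sub>v v) = a \<otimes>\<^bsub>L\<^esub> e v"
  shows "alg_trace N L e a = (\<Sum>i<N. M $$ (i, i))"
  unfolding alg_trace_def
proof (rule sum.cong[OF refl])
  fix i assume "i \<in> {..<N}"
  then have i: "i < N" by simp
  have "inj_on e (carrier_vec N)" using e by (simp add: lin_iso_def bij_betw_def)
  then have "the_inv_into (carrier_vec N) e (e (M *\<^sub>v unit_vec N i)) = M *\<^sub>v unit_vec N i"
    using mult_mat_vec_carrier[OF assms(1)] by (intro the_inv_into_f_f) auto
  then show "the_inv_into (carrier_vec N) e (a \<otimes>\<^bsub>L\<^esub> e (unit_vec N i)) $ i = M $$ (i, i)"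
    using assms i by simp
qed

text \<open>Multiplication by \<open>\<tau>(a)\<close> is conjugate to multiplication by \<open>a\<close> under the linear map \<open>\<tau>\<close>.\<close>

lemma alg_trace_involution:
  assumes \<tau>: "\<tau> \<in> alg_hom L L" "\<And>a. a \<in> carrier L \<Longrightarrow> \<tau> (\<tau> a) = a" and a: "a \<in> carrier L"
  shows "alg_trace N L e (\<tau> a) = alg_trace N L e a"
proof -
  have \<tau>h: "\<tau> \<in> Ring.ring_hom L L" "\<And>c b. b \<in> carrier L \<Longrightarrow> \<tau> (c \<odot>\<^bsub>L\<^esub> b) = c \<odot>\<^bsub>L\<^esub> \<tau> b"
    using \<tau> by (auto simp: alg_hom_def)
  note h = ring_hom_closed[OF \<tau>h(1)] ring_hom_mult[OF \<tau>h(1)] ring_hom_add[OF \<tau>h(1)]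
  obtain M where M: "M \<in> carrier_mat N N" "\<And>v. v \<in> carrier_vec N \<Longrightarrow> e (M *\<^sub>v v) = a \<otimes>\<^bsub>L\<^esub> e v"
    using mult_matrix[OF a] by blast
  obtain M' where M': "M' \<in> carrier_mat N N" "\<And>v. v \<in> carrier_vec N \<Longrightarrow> e (M' *\<^sub>v v) = \<tau> a \<otimes>\<^bsub>L\<^esub> e v"
    using mult_matrix[OF h(1)[OF a]] by blast
  obtain S where S: "S \<in> carrier_mat N N" "\<And>v. v \<in> carrier_vec N \<Longrightarrow> e (S *\<^sub>v v) = \<tau> (e v)"
    by (rule map_matrix[of "\<lambda>v. \<tau> (e v)"]) (use lin_iso_closed h \<tau>h lin_iso_add lin_iso_smult in auto)
  have MSC: "M * S \<in> carrier_mat N N" using M S by simp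
  have "S * (M * S) = M'"
  proof (rule mat_eq_if_mult_vec[OF mult_carrier_mat[OF S(1) MSC] M'(1)])
    fix v :: "'f vec" assume v: "v \<in> carrier_vec N"
    have Sv: "S *\<^sub>v v \<in> carrier_vec N" and MSv: "M *\<^sub>v (S *\<^sub>v v) \<in> carrier_vec N" and SMSv: "S *\<^sub>v (M *\<^sub>v (S *\<^sub>v v)) \<in> carrier_vec N"
      using v S(1) M(1) by (metis mult_mat_vec_carrier)+
    have "(S * (M * S)) *\<^sub>v v = S *\<^sub>v (M *\<^sub>v (S *\<^sub>v v))"
      using v S(1) M(1) MSC by (simp add: assoc_mult_mat_vec[of _ N N _ N])
    moreover have "e (S *\<^sub>v (M *\<^sub>v (S *\<^sub>v v))) = e (M' *\<^sub>v v)"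
      using v S(2) M(2) M'(2) Sv MSv h a lin_iso_closed \<tau>(2) by simp
    ultimately show "(S * (M * S)) *\<^sub>v v = M' *\<^sub>v v"
      using lin_iso_inj SMSv mult_mat_vec_carrier[OF M'(1) v] by metis
  qed
  moreover have "S * S = 1\<^sub>m N"
  proof (rule mat_eq_if_mult_vec[OF mult_carrier_mat[OF S(1) S(1)] one_carrier_mat])
    fix v :: "'f vec" assume v: "v \<in> carrier_vec N"
    have Sv: "S *\<^sub>v v \<in> carrier_vec N" "S *\<^sub>v (S *\<^sub>v v) \<in> carrier_vec N" using v S(1) by (metis mult_mat_vec_carrier)+
    have "e (S *\<^sub>v (S *\<^sub>v v)) = e v" using v S(2) Sv lin_iso_closed \<tau>(2) by simp
    then have "S *\<^sub>v (S *\<^sub>v v) = v" using lin_iso_inj Sv v by blast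
    then show "(S * S) *\<^sub>v v = 1\<^sub>m N *\<^sub>v v" using v S(1) by (simp add: assoc_mult_mat_vec[of _ N N _ N])
  qed
  ultimately have MM: "M' = S * (M * S)" and SS: "S * S = 1\<^sub>m N" by auto
  have "(\<Sum>i<N. (S * (M * S)) $$ (i, i)) = (\<Sum>i<N. \<Sum>k<N. S $$ (i, k) * (M * S) $$ (k, i))"
    by (rule sum.cong[OF refl]) (simp only: lessThan_iff mult_mat_entry[OF S(1) MSC])
  also have "\<dots> = (\<Sum>k<N. \<Sum>i<N. (M * S) $$ (k, i) * S $$ (i, k))"
    by (subst sum.swap) (simp only: mult.commute)
  also have "\<dots> = (\<Sum>k<N. ((M * S) * S) $$ (k, k))"
    by (rule sum.cong[OF refl]) (simp only: lessThan_iff mult_mat_entry[OF MSC S(1)])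
  also have "(M * S) * S = M"
    unfolding assoc_mult_mat[OF M(1) S(1) S(1)] SS using M(1) by simp
  finally have "(\<Sum>i<N. M' $$ (i, i)) = (\<Sum>k<N. M $$ (k, k))" unfolding MM .
  moreover have "alg_trace N L e a = (\<Sum>k<N. M $$ (k, k))"
    by (rule alg_trace_matrix[OF M(1)]) (rule M(2))
  moreover have "alg_trace N L e (\<tau> a) = (\<Sum>k<N. M' $$ (k, k))"
    by (rule alg_trace_matrix[OF M'(1)]) (rule M'(2))
  ultimately show ?thesis by (simp only:)
qed

end

text \<open>The element \<open>x/\<tau>(x)\<close> is visible on the form \<open>D\<close> itself: by invariance of the trace under \<open>\<tau>\<close>,
  multiplication by it is the operator \<open>(D\<^sup>T)\<inverse> D\<close>. Hence \<open>D\<close> determines the conjugacy class over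
  \<open>F\<close> of every isometry that corresponds to it.\<close>

lemma corresponds_asymmetry:
  fixes D \<gamma> :: "'f::field_char_0 mat"
  assumes c: "corresponds N Q \<gamma> D" and D: "D \<in> carrier_mat N N" and \<gamma>: "\<gamma> \<in> carrier_mat N N"
  obtains g where "g \<in> carrier_mat N N" "det g \<noteq> 0" "D\<^sup>T * (g * \<gamma>) = - (D * g)"
proof -
  obtain L :: "('f, 'f vec) module" and \<tau> x and L' :: "('f, 'f vec) module" and \<tau>' y c \<phi>
    where fp: "form_param N D L \<tau> x" and sp: "SO_param N Q \<gamma> L' \<tau>' y c"
      and \<phi>: "\<phi> \<in> alg_hom L' L" "bij_betw \<phi> (carrier L') (carrier L)"
      and xy: "x \<otimes>\<^bsub>L\<^esub> inv\<^bsub>L\<^esub> (\<tau> x) = \<ominus>\<^bsub>L\<^esub> (\<phi> y)"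
    using c unfolding corresponds_def by (elim exE conjE) (erule (4) that)
  obtain e where e: "lin_iso N L e"
    and De: "\<And>v w. v \<in> carrier_vec N \<Longrightarrow> w \<in> carrier_vec N \<Longrightarrow>
        form D v w = alg_trace N L e (\<tau> (e v) \<otimes>\<^bsub>L\<^esub> e w \<otimes>\<^bsub>L\<^esub> x)"
    using fp unfolding form_param_def by blast
  obtain e' where e': "lin_iso N L' e'"
    and \<gamma>e: "\<And>v. v \<in> carrier_vec N \<Longrightarrow> e' (\<gamma> *\<^sub>v v) = y \<otimes>\<^bsub>L'\<^esub> e' v"
    using sp unfolding SO_param_def by blast
  have alg: "F_algebra L" and alg': "F_algebra L'" and xU: "x \<in> Units L" and yU: "y \<in> Units L'"
    and \<tau>: "\<tau> \<in> alg_hom L L" "\<And>a. a \<in> carrier L \<Longrightarrow> \<tau> (\<tau> a) = a"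
    using fp sp by (auto simp: form_param_def SO_param_def etale_with_involution_def etale_algebra_def)
  interpret A: Module.algebra "ring_of_type_algebra :: 'f ring" L by (rule alg)
  interpret A': Module.algebra "ring_of_type_algebra :: 'f ring" L' by (rule alg')
  have \<tau>h: "\<tau> \<in> Ring.ring_hom L L" using \<tau> by (simp add: alg_hom_def)
  have \<phi>h: "\<phi> \<in> Ring.ring_hom L' L" "\<And>c b. b \<in> carrier L' \<Longrightarrow> \<phi> (c \<odot>\<^bsub>L'\<^esub> b) = c \<odot>\<^bsub>L\<^esub> \<phi> b"
    using \<phi> by (auto simp: alg_hom_def)
  note eC = lin_iso_closed[OF alg e] and eC' = lin_iso_closed[OF alg' e']
  have xC: "x \<in> carrier L" and yC: "y \<in> carrier L'" using xU yU by auto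
  have \<tau>xU: "\<tau> x \<in> Units L"
  proof -
    have "x \<otimes>\<^bsub>L\<^esub> inv\<^bsub>L\<^esub> x = \<one>\<^bsub>L\<^esub>" "inv\<^bsub>L\<^esub> x \<in> carrier L" using xU by auto
    then have "\<tau> x \<otimes>\<^bsub>L\<^esub> \<tau> (inv\<^bsub>L\<^esub> x) = \<one>\<^bsub>L\<^esub>"
      using ring_hom_mult[OF \<tau>h xC, of "inv\<^bsub>L\<^esub> x"] ring_hom_one[OF \<tau>h] by simp
    moreover have C: "\<tau> x \<in> carrier L" "\<tau> (inv\<^bsub>L\<^esub> x) \<in> carrier L"
      using ring_hom_closed[OF \<tau>h] xC \<open>inv\<^bsub>L\<^esub> x \<in> carrier L\<close> by blast+
    ultimately have "\<tau> (inv\<^bsub>L\<^esub> x) \<otimes>\<^bsub>L\<^esub> \<tau> x = \<one>\<^bsub>L\<^esub>" using A.m_comm[OF C] by simp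
    then show ?thesis using C \<open>\<tau> x \<otimes>\<^bsub>L\<^esub> \<tau> (inv\<^bsub>L\<^esub> x) = \<one>\<^bsub>L\<^esub>\<close> unfolding Units_def by blast
  qed
  define z where "z = x \<otimes>\<^bsub>L\<^esub> inv\<^bsub>L\<^esub> (\<tau> x)"
  have zC: "z \<in> carrier L" using xC \<tau>xU by (simp add: z_def)
  have zx: "z \<otimes>\<^bsub>L\<^esub> \<tau> x = x"
    unfolding z_def using xC \<tau>xU A.m_assoc[of x "inv\<^bsub>L\<^esub> (\<tau> x)" "\<tau> x"] by (simp add: A.Units_closed)
  obtain Z where Z: "Z \<in> carrier_mat N N" "\<And>v. v \<in> carrier_vec N \<Longrightarrow> e (Z *\<^sub>v v) = z \<otimes>\<^bsub>L\<^esub> e v"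
    using mult_matrix[OF alg e zC] by blast
  \<comment> \<open>\<open>D(zw, v) = D(v, w)\<close>: apply \<open>\<tau>\<close> under the trace and use \<open>z \<tau>(x) = x\<close>\<close>
  have DZ: "D\<^sup>T * Z = D"
  proof (rule form_eqI[of _ N])
    fix v w :: "'f vec" assume vw: "v \<in> carrier_vec N" "w \<in> carrier_vec N"
    have Zw: "Z *\<^sub>v w \<in> carrier_vec N" using Z(1) vw(2) by (rule mult_mat_vec_carrier)
    note cl = eC[OF vw(1)] eC[OF vw(2)] eC[OF Zw] ring_hom_closed[OF \<tau>h] xC zC
    have "form (D\<^sup>T * Z) v w = v \<bullet> (D\<^sup>T *\<^sub>v (Z *\<^sub>v w))"
      unfolding form_def using D Z vw by (simp add: assoc_mult_mat_vec[of _ N N _ N])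
    also have "\<dots> = (D\<^sup>T *\<^sub>v (Z *\<^sub>v w)) \<bullet> v"
      using D Zw vw by (intro comm_scalar_prod[of _ N]) (auto intro!: mult_mat_vec_carrier)
    also have "\<dots> = form D (Z *\<^sub>v w) v" unfolding form_def by (rule transpose_vec_mult_scalar[OF D vw(1) Zw])
    also have "\<dots> = alg_trace N L e (\<tau> (z \<otimes>\<^bsub>L\<^esub> e w) \<otimes>\<^bsub>L\<^esub> e v \<otimes>\<^bsub>L\<^esub> x)"
      unfolding De[OF Zw vw(1)] Z(2)[OF vw(2)] ..
    also have "\<dots> = alg_trace N L e (\<tau> (\<tau> (z \<otimes>\<^bsub>L\<^esub> e w) \<otimes>\<^bsub>L\<^esub> e v \<otimes>\<^bsub>L\<^esub> x))"
      by (rule alg_trace_involution[OF alg e \<tau>, symmetric]) (use cl in auto)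
    also have "\<tau> (\<tau> (z \<otimes>\<^bsub>L\<^esub> e w) \<otimes>\<^bsub>L\<^esub> e v \<otimes>\<^bsub>L\<^esub> x) = (z \<otimes>\<^bsub>L\<^esub> e w) \<otimes>\<^bsub>L\<^esub> \<tau> (e v) \<otimes>\<^bsub>L\<^esub> \<tau> x"
      using cl \<tau>(2) ring_hom_mult[OF \<tau>h] by simp
    also have "\<dots> = \<tau> (e v) \<otimes>\<^bsub>L\<^esub> e w \<otimes>\<^bsub>L\<^esub> (z \<otimes>\<^bsub>L\<^esub> \<tau> x)" using cl by (simp add: A.m_ac)
    also have "alg_trace N L e \<dots> = form D v w" unfolding zx De[OF vw] ..
    finally show "form (D\<^sup>T * Z) v w = form D v w" .
  qed (use D Z in auto)
  \<comment> \<open>\<open>\<phi>\<close> in coordinates; it turns \<open>\<gamma>\<close> into multiplication by \<open>\<phi>(y) = - x/\<tau>(x)\<close>, which is \<open>- Z\<close>\<close>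
  obtain g where g: "g \<in> carrier_mat N N" "\<And>v. v \<in> carrier_vec N \<Longrightarrow> e (g *\<^sub>v v) = \<phi> (e' v)"
    by (rule map_matrix[OF alg e, of "\<lambda>v. \<phi> (e' v)"])
       (use eC' ring_hom_closed[OF \<phi>h(1)] ring_hom_add[OF \<phi>h(1)] \<phi>h(2) lin_iso_add[OF alg' e'] lin_iso_smult[OF alg' e'] in auto)
  have "det g \<noteq> 0"
  proof (rule det_nonzero_if_kernel_trivial[OF g(1)])
    fix v assume v: "v \<in> carrier_vec N" "g *\<^sub>v v = 0\<^sub>v N"
    have "\<phi> (e' v) = \<zero>\<^bsub>L\<^esub>" using g(2)[OF v(1)] v(2) lin_iso_zero[OF alg e] by simp
    moreover have "g *\<^sub>v 0\<^sub>v N = 0\<^sub>v N" by (rule mult_mat_zero_vec[OF g(1)])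
    then have "\<phi> (e' (0\<^sub>v N)) = \<zero>\<^bsub>L\<^esub>" using g(2)[of "0\<^sub>v N"] lin_iso_zero[OF alg e] by simp
    ultimately have "e' v = e' (0\<^sub>v N)"
      using \<phi>(2) eC'[OF v(1)] eC'[of "0\<^sub>v N"] by (auto simp: bij_betw_def inj_on_def)
    then show "v = 0\<^sub>v N" using lin_iso_inj[OF alg' e' v(1)] by simp
  qed
  moreover have "D\<^sup>T * (g * \<gamma>) = - (D * g)"
  proof -
    have "Z * g = - (g * \<gamma>)"
    proof (rule mat_eq_if_mult_vec)
      show "Z * g \<in> carrier_mat N N" "- (g * \<gamma>) \<in> carrier_mat N N" using Z g \<gamma> by auto
      fix v :: "'f vec" assume v: "v \<in> carrier_vec N"
      have C: "g *\<^sub>v v \<in> carrier_vec N" "\<gamma> *\<^sub>v v \<in> carrier_vec N" "g *\<^sub>v (\<gamma> *\<^sub>v v) \<in> carrier_vec N" "Z *\<^sub>v (g *\<^sub>v v) \<in> carrier_vec N"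
        using v g(1) \<gamma> Z(1) by (metis mult_mat_vec_carrier)+
      have \<phi>y: "\<phi> y \<in> carrier L" using ring_hom_closed[OF \<phi>h(1) yC] .
      have "e (Z *\<^sub>v (g *\<^sub>v v)) = \<ominus>\<^bsub>L\<^esub> (\<phi> y) \<otimes>\<^bsub>L\<^esub> \<phi> (e' v)"
        using Z(2)[OF C(1)] g(2)[OF v] xy by (simp add: z_def)
      moreover have "e (g *\<^sub>v (\<gamma> *\<^sub>v v)) = \<phi> y \<otimes>\<^bsub>L\<^esub> \<phi> (e' v)"
        using g(2)[OF C(2)] \<gamma>e[OF v] ring_hom_mult[OF \<phi>h(1) yC eC'[OF v]] by simp
      ultimately have "e (Z *\<^sub>v (g *\<^sub>v v) + g *\<^sub>v (\<gamma> *\<^sub>v v)) = \<zero>\<^bsub>L\<^esub>"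
        unfolding lin_iso_add[OF alg e C(4,3)]
        using \<phi>y ring_hom_closed[OF \<phi>h(1) eC'[OF v]] by (simp add: A.l_minus A.M.l_neg)
      then have zero: "Z *\<^sub>v (g *\<^sub>v v) + g *\<^sub>v (\<gamma> *\<^sub>v v) = 0\<^sub>v N"
        using lin_iso_inj[OF alg e] lin_iso_zero[OF alg e] C(3,4) by (metis add_carrier_vec zero_carrier_vec)
      have "Z *\<^sub>v (g *\<^sub>v v) = - (g *\<^sub>v (\<gamma> *\<^sub>v v))"
      proof (rule eq_vecI)
        fix i assume "i < dim_vec (- (g *\<^sub>v (\<gamma> *\<^sub>v v)))"
        then have i: "i < N" using carrier_vecD[OF C(3)] by (simp del: dim_mult_mat_vec)
        have "(Z *\<^sub>v (g *\<^sub>v v) + g *\<^sub>v (\<gamma> *\<^sub>v v)) $ i = 0" using zero i by simp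
        then show "(Z *\<^sub>v (g *\<^sub>v v)) $ i = (- (g *\<^sub>v (\<gamma> *\<^sub>v v))) $ i"
          using i carrier_vecD[OF C(3)] carrier_vecD[OF C(4)]
          by (simp add: eq_neg_iff_add_eq_0 del: dim_mult_mat_vec index_mult_mat_vec)
      qed (use carrier_vecD[OF C(3)] carrier_vecD[OF C(4)] in \<open>simp del: dim_mult_mat_vec\<close>)
      moreover have "(- (g * \<gamma>)) *\<^sub>v v = - (g *\<^sub>v (\<gamma> *\<^sub>v v))"
        using v g(1) \<gamma> by (simp add: uminus_mult_mat_vec[of v "g * \<gamma>"] assoc_mult_mat_vec[of _ N N _ N])
      ultimately show "(Z * g) *\<^sub>v v = (- (g * \<gamma>)) *\<^sub>v v"
        using v g(1) Z(1) by (simp add: assoc_mult_mat_vec[of _ N N _ N])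
    qed
    then have gg: "g * \<gamma> = - (Z * g)" by simp
    have "D\<^sup>T * (g * \<gamma>) = - (D\<^sup>T * (Z * g))"
      unfolding gg using D Z g by simp
    also have "D\<^sup>T * (Z * g) = (D\<^sup>T * Z) * g"
      using D Z g by (intro assoc_mult_mat[of _ N N _ N _ N, symmetric]) auto
    finally show ?thesis unfolding DZ .
  qed
  ultimately show ?thesis using that g(1) by blast
qed

text \<open>Since \<open>y\<close> generates \<open>L\<close>, the vector \<open>u\<close> corresponding to \<open>1\<close> is cyclic for \<open>\<gamma>\<close>: a
  hyperplane containing \<open>u\<close> that is stable under \<open>\<gamma>\<close> would contain all the powers of \<open>y\<close>.\<close>

lemma SO_param_cyclic_vector:
  fixes \<gamma> :: "'f::field_char_0 mat"
  assumes sp: "SO_param N Q \<gamma> L \<tau> y c" and \<gamma>C: "\<gamma> \<in> carrier_mat N N"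
  obtains u where "u \<in> carrier_vec N"
    "\<And>(l :: 'f alg_closure vec) a. l \<in> carrier_vec N \<Longrightarrow>
       (\<And>v. v \<in> carrier_vec N \<Longrightarrow> l \<bullet> map_vec to_ac (\<gamma> *\<^sub>v v) = a * (l \<bullet> map_vec to_ac v)) \<Longrightarrow>
       l \<bullet> map_vec to_ac u = 0 \<Longrightarrow> l = 0\<^sub>v N"
proof -
  interpret ac: field_hom "to_ac :: 'f \<Rightarrow> 'f alg_closure" by (rule to_ac_field_hom)
  obtain e where e: "lin_iso N L e" and \<gamma>e: "\<And>v. v \<in> carrier_vec N \<Longrightarrow> e (\<gamma> *\<^sub>v v) = y \<otimes>\<^bsub>L\<^esub> e v"
    using sp unfolding SO_param_def by blast
  have alg: "F_algebra L" and gen: "generates L y"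
    using sp by (auto simp: SO_param_def etale_with_involution_def etale_algebra_def)
  have yC: "y \<in> carrier L" using gen by (simp add: generates_def)
  interpret A: Module.algebra "ring_of_type_algebra :: 'f ring" L by (rule alg)
  note eC = lin_iso_closed[OF alg e] and eadd = lin_iso_add[OF alg e] and esmult = lin_iso_smult[OF alg e]
  obtain u where u: "u \<in> carrier_vec N" "e u = \<one>\<^bsub>L\<^esub>" using lin_iso_surj[OF alg e A.one_closed] by blast
  show ?thesis
  proof (rule that[OF u(1)])
    fix l :: "'f alg_closure vec" and a
    assume l: "l \<in> carrier_vec N" and lu: "l \<bullet> map_vec to_ac u = 0"
      and l\<gamma>: "\<And>v. v \<in> carrier_vec N \<Longrightarrow> l \<bullet> map_vec to_ac (\<gamma> *\<^sub>v v) = a * (l \<bullet> map_vec to_ac v)"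
    define f where "f v = (\<Sum>i<N. l $ i * to_ac (v $ i))" for v
    have f: "l \<bullet> map_vec to_ac v = f v" if "v \<in> carrier_vec N" for v
      using that by (simp add: scalar_prod_def f_def lessThan_atLeast0)
    have fadd: "f (v + w) = f v + f w" if "v \<in> carrier_vec N" "w \<in> carrier_vec N" for v w
      using that by (simp add: f_def ac.hom_add distrib_left sum.distrib)
    have fsmult: "f (b \<cdot>\<^sub>v v) = to_ac b * f v" if "v \<in> carrier_vec N" for b v
      using that by (simp add: f_def ac.hom_mult sum_distrib_left mult_ac)
    have pow: "\<exists>v \<in> carrier_vec N. f v = 0 \<and> e v = y [^]\<^bsub>L\<^esub> k" for k :: nat
    proof (induction k)
      case 0
      then show ?case using u lu f[OF u(1)] by (intro bexI[of _ u]) auto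
    next
      case (Suc k)
      then obtain v where v: "v \<in> carrier_vec N" "f v = 0" "e v = y [^]\<^bsub>L\<^esub> k" by blast
      have \<gamma>v: "\<gamma> *\<^sub>v v \<in> carrier_vec N" using \<gamma>C v(1) by (rule mult_mat_vec_carrier)
      have "f (\<gamma> *\<^sub>v v) = 0" using l\<gamma>[OF v(1)] f[OF v(1)] f[OF \<gamma>v] v(2) by simp
      moreover have "e (\<gamma> *\<^sub>v v) = y [^]\<^bsub>L\<^esub> Suc k"
        using \<gamma>e[OF v(1)] v(3) yC by (simp add: A.m_comm)
      ultimately show ?case using \<gamma>v by blast
    qed
    have comb: "\<exists>v \<in> carrier_vec N. f v = 0 \<and> e v = (\<Oplus>\<^bsub>L\<^esub>i\<in>{..d}. b i \<odot>\<^bsub>L\<^esub> (y [^]\<^bsub>L\<^esub> i))" for b and d :: nat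
    proof (induction d)
      case 0
      obtain v where v: "v \<in> carrier_vec N" "f v = 0" "e v = y [^]\<^bsub>L\<^esub> (0::nat)" using pow by blast
      have "e (b 0 \<cdot>\<^sub>v v) \<in> carrier L" using v by (intro eC) auto
      then have "e (b 0 \<cdot>\<^sub>v v) = (\<Oplus>\<^bsub>L\<^esub>i\<in>{..0::nat}. b i \<odot>\<^bsub>L\<^esub> (y [^]\<^bsub>L\<^esub> i))"
        using v esmult[OF v(1)] by (subst A.M.finsum_0) auto
      then show ?case using v fsmult[OF v(1)] by (intro bexI[of _ "b 0 \<cdot>\<^sub>v v"]) auto
    next
      case (Suc d)
      obtain v where v: "v \<in> carrier_vec N" "f v = 0" "e v = y [^]\<^bsub>L\<^esub> Suc d" using pow by blast
      obtain w where w: "w \<in> carrier_vec N" "f w = 0" "e w = (\<Oplus>\<^bsub>L\<^esub>i\<in>{..d}. b i \<odot>\<^bsub>L\<^esub> (y [^]\<^bsub>L\<^esub> i))"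
        using Suc by blast
      have bC: "b i \<odot>\<^bsub>L\<^esub> (y [^]\<^bsub>L\<^esub> i) \<in> carrier L" for i
        using A.smult_closed[of "b i" "y [^]\<^bsub>L\<^esub> i"] A.nat_pow_closed[OF yC, of i] by (simp add: ring_of_type_algebra_def)
      have bv: "b (Suc d) \<cdot>\<^sub>v v \<in> carrier_vec N" using v(1) by simp
      have "(\<Oplus>\<^bsub>L\<^esub>i\<in>{..Suc d}. b i \<odot>\<^bsub>L\<^esub> (y [^]\<^bsub>L\<^esub> i))
          = b (Suc d) \<odot>\<^bsub>L\<^esub> (y [^]\<^bsub>L\<^esub> Suc d) \<oplus>\<^bsub>L\<^esub> (\<Oplus>\<^bsub>L\<^esub>i\<in>{..d}. b i \<odot>\<^bsub>L\<^esub> (y [^]\<^bsub>L\<^esub> i))"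
        by (rule A.M.finsum_Suc) (use bC in blast)
      also have "\<dots> = e (b (Suc d) \<cdot>\<^sub>v v + w)"
        unfolding eadd[OF bv w(1)] esmult[OF v(1)] v(3) w(3) ..
      finally have "e (b (Suc d) \<cdot>\<^sub>v v + w) = (\<Oplus>\<^bsub>L\<^esub>i\<in>{..Suc d}. b i \<odot>\<^bsub>L\<^esub> (y [^]\<^bsub>L\<^esub> i))" by (rule sym)
      moreover have "f (b (Suc d) \<cdot>\<^sub>v v + w) = 0" using fadd[OF bv w(1)] fsmult[OF v(1)] v(2) w(2) by simp
      moreover have "b (Suc d) \<cdot>\<^sub>v v + w \<in> carrier_vec N" using bv w(1) by simp
      ultimately show ?case by blast
    qed
    show "l = 0\<^sub>v N"
    proof (rule eq_vecI)
      fix j assume "j < dim_vec (0\<^sub>v N :: 'f alg_closure vec)"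
      then have j: "j < N" by simp
      have uj: "unit_vec N j \<in> carrier_vec N" by simp
      obtain p where p: "e (unit_vec N j) = eval_poly_alg L p y"
        using gen eC[OF uj] unfolding generates_def by blast
      obtain v where v: "v \<in> carrier_vec N" "f v = 0" "e v = eval_poly_alg L p y"
        using comb[of "coeff p" "degree p"] unfolding eval_poly_alg_def by blast
      have "v = unit_vec N j" by (rule lin_iso_inj[OF alg e v(1) uj]) (simp only: v(3) p)
      then have "f (unit_vec N j) = 0" using v(2) by simp
      moreover have "f (unit_vec N j) = (\<Sum>i<N. if i = j then l $ i else 0)"
        unfolding f_def by (rule sum.cong[OF refl]) (use j in auto)
      ultimately show "l $ j = 0\<^sub>v N $ j" using j by simp
    qed (use l in simp)
  qed
qed

text \<open>Two independent eigenfunctionals for one eigenvalue would have a combination that vanishes on a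
  cyclic vector.\<close>

lemma SO_param_distinct_eigenvalues:
  fixes \<gamma> :: "'f::field_char_0 mat" and E R :: "'f alg_closure mat"
  assumes sp: "SO_param N Q \<gamma> L \<tau> y c" and \<gamma>C: "\<gamma> \<in> carrier_mat N N"
    and E: "E \<in> carrier_mat N N" "diagonal_mat E" and R: "R \<in> carrier_mat N N" "det R \<noteq> 0"
    and RE: "bc \<gamma> * R = R * E" and ij: "i < N" "j < N" "i \<noteq> j"
  shows "E $$ (i, i) \<noteq> E $$ (j, j)"
proof
  assume eq: "E $$ (i, i) = E $$ (j, j)"
  interpret ac: field_hom "to_ac :: 'f \<Rightarrow> 'f alg_closure" by (rule to_ac_field_hom)
  obtain S where S: "S \<in> carrier_mat N N" "R * S = 1\<^sub>m N" "S * R = 1\<^sub>m N"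
    using obtain_inverse_mat[OF R] by blast
  have bC: "bc \<gamma> \<in> carrier_mat N N" using \<gamma>C by simp
  have "S * (bc \<gamma> * R) = E" unfolding RE by (rule mult_mat_inverse_cancel[OF S(1) R(1) S(3) E(1)])
  then have "S * (bc \<gamma> * R) * S = E * S" by simp
  moreover have "S * (bc \<gamma> * R) * S = S * bc \<gamma> * (R * S)"
    using S(1) bC R(1) by (simp add: assoc_mult_mat[of _ N N _ N _ N])
  ultimately have SE: "S * bc \<gamma> = E * S" using S bC by simp
  obtain u where u: "u \<in> carrier_vec N"
    and cyc: "\<And>(l :: 'f alg_closure vec) a. l \<in> carrier_vec N \<Longrightarrow>
       (\<And>v. v \<in> carrier_vec N \<Longrightarrow> l \<bullet> map_vec to_ac (\<gamma> *\<^sub>v v) = a * (l \<bullet> map_vec to_ac v)) \<Longrightarrow>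
       l \<bullet> map_vec to_ac u = 0 \<Longrightarrow> l = 0\<^sub>v N"
    using SO_param_cyclic_vector[OF sp \<gamma>C] by blast
  have row: "row S k \<bullet> map_vec to_ac (\<gamma> *\<^sub>v v) = E $$ (k, k) * (row S k \<bullet> map_vec to_ac v)"
    if k: "k < N" and v: "v \<in> carrier_vec N" for k v
  proof -
    have vC: "map_vec to_ac v \<in> carrier_vec N" using v by simp
    have "row S k \<bullet> map_vec to_ac (\<gamma> *\<^sub>v v) = (S *\<^sub>v (bc \<gamma> *\<^sub>v map_vec to_ac v)) $ k"
      using k S(1) ac.mult_mat_vec_hom[OF \<gamma>C v] by simp
    also have "S *\<^sub>v (bc \<gamma> *\<^sub>v map_vec to_ac v) = E *\<^sub>v (S *\<^sub>v map_vec to_ac v)"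
      using assoc_mult_mat_vec[OF S(1) bC vC] assoc_mult_mat_vec[OF E(1) S(1) vC] SE by simp
    also have "\<dots> $ k = (\<Sum>m<N. E $$ (k, m) * (S *\<^sub>v map_vec to_ac v) $ m)"
      using k E(1) S(1) by (subst mult_mat_vec_index_sum) auto
    also have "\<dots> = (\<Sum>m<N. if m = k then E $$ (k, k) * (S *\<^sub>v map_vec to_ac v) $ k else 0)"
      by (rule sum.cong[OF refl]) (use E k in \<open>auto simp: diagonal_mat_def\<close>)
    finally show ?thesis using k S(1) by simp
  qed
  have rowR: "row S k \<bullet> col R m = (if k = m then 1 else 0)" if "k < N" "m < N" for k m
  proof -
    have "row S k \<bullet> col R m = (S * R) $$ (k, m)" using that S(1) R(1) by simp
    then show ?thesis unfolding S(3) using that by simp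
  qed
  have rowC: "row S k \<in> carrier_vec N" for k using S(1) by (intro carrier_vecI) simp
  have colC: "col R m \<in> carrier_vec N" for m using R(1) by (intro carrier_vecI) simp
  have bcC: "map_vec to_ac v \<in> carrier_vec N" if "v \<in> carrier_vec N" for v :: "'f vec" using that by simp
  have \<gamma>vC: "\<gamma> *\<^sub>v v \<in> carrier_vec N" if "v \<in> carrier_vec N" for v using \<gamma>C that by (rule mult_mat_vec_carrier)
  have nz: "row S k \<bullet> map_vec to_ac u \<noteq> 0" if "k < N" for k
  proof
    assume "row S k \<bullet> map_vec to_ac u = 0"
    then have "row S k = 0\<^sub>v N" using cyc[OF rowC] row[OF that] by blast
    then show False using rowR[OF that that] colC[of k] by simp
  qed
  \<comment> \<open>the rows of \<open>S = R\<inverse>\<close> are eigenfunctionals\<close>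
  define a where "a k = row S k \<bullet> map_vec to_ac u" for k
  define l where "l = a j \<cdot>\<^sub>v row S i - a i \<cdot>\<^sub>v row S j"
  have lw: "l \<bullet> w = a j * (row S i \<bullet> w) - a i * (row S j \<bullet> w)" if "w \<in> carrier_vec N" for w
    unfolding l_def using that rowC smult_scalar_prod_distrib[OF rowC that]
    by (simp add: minus_scalar_prod_distrib[of _ N])
  have lC: "l \<in> carrier_vec N" unfolding l_def using rowC by simp
  have "l = 0\<^sub>v N"
  proof (rule cyc[OF lC])
    show "l \<bullet> map_vec to_ac (\<gamma> *\<^sub>v v) = E $$ (j, j) * (l \<bullet> map_vec to_ac v)" if "v \<in> carrier_vec N" for v
      unfolding lw[OF bcC[OF \<gamma>vC[OF that]]] lw[OF bcC[OF that]] row[OF ij(1) that] row[OF ij(2) that] eq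
      by (simp add: algebra_simps)
    show "l \<bullet> map_vec to_ac u = 0" unfolding lw[OF bcC[OF u]] a_def by simp
  qed
  then have "l \<bullet> col R i = 0" using colC[of i] by simp
  then have "a j = 0" using lw[OF colC[of i]] rowR[of i i] rowR[of j i] ij by simp
  then show False using nz[OF ij(2)] by (simp add: a_def)
qed

section \<open>Comparison of the two quadratic spaces\<close>

text \<open>Both isometries are conjugate to \<open>- (D\<^sup>T)\<inverse> D\<close>.\<close>

lemma corresponds_conjugate:
  fixes D \<gamma>\<^sub>1 \<gamma>\<^sub>2 :: "'f::field_char_0 mat"
  assumes c: "corresponds N Q\<^sub>1 \<gamma>\<^sub>1 D" "corresponds N Q\<^sub>2 \<gamma>\<^sub>2 D"
    and D: "D \<in> carrier_mat N N" "det D \<noteq> 0"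
    and \<gamma>: "\<gamma>\<^sub>1 \<in> carrier_mat N N" "\<gamma>\<^sub>2 \<in> carrier_mat N N"
  obtains k where "k \<in> carrier_mat N N" "det k \<noteq> 0" "k * \<gamma>\<^sub>1 = \<gamma>\<^sub>2 * k"
proof -
  obtain g1 where g1: "g1 \<in> carrier_mat N N" "det g1 \<noteq> 0" "D\<^sup>T * (g1 * \<gamma>\<^sub>1) = - (D * g1)"
    using corresponds_asymmetry[OF c(1) D(1) \<gamma>(1)] by blast
  obtain g2 where g2: "g2 \<in> carrier_mat N N" "det g2 \<noteq> 0" "D\<^sup>T * (g2 * \<gamma>\<^sub>2) = - (D * g2)"
    using corresponds_asymmetry[OF c(2) D(1) \<gamma>(2)] by blast
  have DT: "D\<^sup>T \<in> carrier_mat N N" "det (D\<^sup>T) \<noteq> 0" using D det_transpose[OF D(1)] by auto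
  obtain T where T: "T \<in> carrier_mat N N" "T * D\<^sup>T = 1\<^sub>m N" using obtain_inverse_mat[OF DT] by blast
  obtain h where h: "h \<in> carrier_mat N N" "g2 * h = 1\<^sub>m N" "h * g2 = 1\<^sub>m N" using obtain_inverse_mat[OF g2(1,2)] by blast
  define k where "k = h * g1"
  have kC: "k \<in> carrier_mat N N" using h g1 by (simp add: k_def)
  have g2k: "g2 * k = g1" unfolding k_def by (rule mult_mat_inverse_cancel[OF g2(1) h(1,2) g1(1)])
  have detk: "det k \<noteq> 0" using det_mult[OF g2(1) kC] g2k g1(2) by auto
  have C: "g1 * \<gamma>\<^sub>1 \<in> carrier_mat N N" "g2 * (\<gamma>\<^sub>2 * k) \<in> carrier_mat N N" "k * \<gamma>\<^sub>1 \<in> carrier_mat N N" "\<gamma>\<^sub>2 * k \<in> carrier_mat N N"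
    "g2 * \<gamma>\<^sub>2 \<in> carrier_mat N N" "D * g2 \<in> carrier_mat N N"
    using g1 g2 \<gamma> kC D by auto
  have "D\<^sup>T * (g2 * (\<gamma>\<^sub>2 * k)) = (D\<^sup>T * (g2 * \<gamma>\<^sub>2)) * k"
    using assoc_mult_mat[OF g2(1) \<gamma>(2) kC] assoc_mult_mat[OF DT(1) C(5) kC] by simp
  also have "\<dots> = - (D * (g2 * k))"
  proof -
    have "- (D * g2) * k = - (D * g2 * k)" by (rule uminus_mult_left_mat) (use kC g2(1) in simp)
    then show ?thesis unfolding g2(3) assoc_mult_mat[OF D(1) g2(1) kC] .
  qed
  finally have "D\<^sup>T * (g2 * (\<gamma>\<^sub>2 * k)) = D\<^sup>T * (g1 * \<gamma>\<^sub>1)" unfolding g2k g1(3) .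
  then have "T * (D\<^sup>T * (g2 * (\<gamma>\<^sub>2 * k))) = T * (D\<^sup>T * (g1 * \<gamma>\<^sub>1))" by simp
  then have "g2 * (\<gamma>\<^sub>2 * k) = g1 * \<gamma>\<^sub>1"
    unfolding mult_mat_inverse_cancel[OF T(1) DT(1) T(2) C(1)] mult_mat_inverse_cancel[OF T(1) DT(1) T(2) C(2)] .
  also have "g1 * \<gamma>\<^sub>1 = g2 * (k * \<gamma>\<^sub>1)" using assoc_mult_mat[OF g2(1) kC \<gamma>(1)] g2k by simp
  finally have "h * (g2 * (\<gamma>\<^sub>2 * k)) = h * (g2 * (k * \<gamma>\<^sub>1))" by simp
  then have "\<gamma>\<^sub>2 * k = k * \<gamma>\<^sub>1"
    unfolding mult_mat_inverse_cancel[OF h(1) g2(1) h(3) C(3)] mult_mat_inverse_cancel[OF h(1) g2(1) h(3) C(4)] .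
  then show ?thesis using that kC detk by metis
qed

text \<open>The matrix \<open>Q\<gamma> - \<gamma>\<^sup>TQ\<close> is skew, so its determinant is a square; multiplied by \<open>\<gamma>\<close> it
  becomes \<open>Q(\<gamma>\<^sup>2 - 1)\<close>.\<close>

lemma isometry_disc:
  fixes Q \<gamma> :: "'f::field_char_0 mat"
  assumes Q: "Q \<in> carrier_mat N N" "Q\<^sup>T = Q" and \<gamma>: "\<gamma> \<in> carrier_mat N N" "\<gamma>\<^sup>T * Q * \<gamma> = Q" "det \<gamma> = 1"
  shows "\<exists>s. det Q * det (\<gamma> * \<gamma> - 1\<^sub>m N) = s\<^sup>2"
proof -
  define A where "A = Q * \<gamma> - \<gamma>\<^sup>T * Q"
  have C: "Q * \<gamma> \<in> carrier_mat N N" "\<gamma>\<^sup>T * Q \<in> carrier_mat N N" "\<gamma> * \<gamma> \<in> carrier_mat N N" using Q \<gamma> by auto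
  have AC: "A \<in> carrier_mat N N" unfolding A_def by (rule minus_carrier_mat[OF C(2)])
  have "(Q * \<gamma>)\<^sup>T = \<gamma>\<^sup>T * Q" "(\<gamma>\<^sup>T * Q)\<^sup>T = Q * \<gamma>"
    using transpose_mult[OF Q(1) \<gamma>(1)] transpose_mult[of "\<gamma>\<^sup>T" N N Q N] Q \<gamma>(1) by auto
  then have "A\<^sup>T = \<gamma>\<^sup>T * Q - Q * \<gamma>" unfolding A_def using transpose_minus[OF C(1,2)] by simp
  also have "\<dots> = (-1) \<cdot>\<^sub>m A" by (rule eq_matI) (use C in \<open>auto simp: A_def simp del: index_mult_mat\<close>)
  finally obtain s where s: "det A = s\<^sup>2" using det_skew_is_square[OF AC] by blast
  have "A * \<gamma> = Q * \<gamma> * \<gamma> - \<gamma>\<^sup>T * Q * \<gamma>" unfolding A_def by (rule minus_mult_distrib_mat[OF C(1,2) \<gamma>(1)])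
  also have "\<dots> = Q * (\<gamma> * \<gamma>) - Q * 1\<^sub>m N" unfolding \<gamma>(2) using assoc_mult_mat[OF Q(1) \<gamma>(1) \<gamma>(1)] Q(1) by simp
  also have "\<dots> = Q * (\<gamma> * \<gamma> - 1\<^sub>m N)" by (rule mult_minus_distrib_mat[OF Q(1) C(3), symmetric]) simp
  finally have "det A * det \<gamma> = det Q * det (\<gamma> * \<gamma> - 1\<^sub>m N)"
    using det_mult[OF AC \<gamma>(1)] det_mult[OF Q(1) minus_carrier_mat[OF one_carrier_mat], of "\<gamma> * \<gamma>"] by simp
  then show ?thesis using s \<gamma>(3) by (intro exI[of _ s]) simp
qed

lemma vec_eq_if_minus_zero:
  fixes a b :: "'a::ab_group_add vec"
  assumes "a \<in> carrier_vec N" "b \<in> carrier_vec N" "a - b = 0\<^sub>v N"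
  shows "a = b"
proof (rule eq_vecI)
  fix i assume "i < dim_vec b"
  then have i: "i < N" using assms(2) by simp
  have "(a - b) $ i = 0" using assms(3) i by simp
  then show "a $ i = b $ i" using assms(1,2) i by simp
qed (use assms in auto)

lemma vec_eq_if_plus_zero:
  fixes a b :: "'a::ring_1 vec"
  assumes "a \<in> carrier_vec N" "b \<in> carrier_vec N" "a + b = 0\<^sub>v N"
  shows "a = (-1) \<cdot>\<^sub>v b"
proof (rule eq_vecI)
  fix i assume "i < dim_vec ((-1) \<cdot>\<^sub>v b)"
  then have i: "i < N" using assms(2) by simp
  have "(a + b) $ i = 0" using assms(3) i by simp
  then show "a $ i = ((-1) \<cdot>\<^sub>v b) $ i" using assms(1,2) i by (simp add: eq_neg_iff_add_eq_0)
qed (use assms in auto)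

lemma det_square_minus_one_nonzero:
  fixes \<gamma> :: "'f::field_char_0 mat"
  assumes \<gamma>: "\<gamma> \<in> carrier_mat N N" and ev: "\<not> eigenvalue \<gamma> 1" "\<not> eigenvalue \<gamma> (-1)"
  shows "det (\<gamma> * \<gamma> - 1\<^sub>m N) \<noteq> 0"
proof (rule det_nonzero_if_kernel_trivial)
  show "\<gamma> * \<gamma> - 1\<^sub>m N \<in> carrier_mat N N" by (rule minus_carrier_mat) simp
  fix v :: "'f vec" assume v: "v \<in> carrier_vec N" and z: "(\<gamma> * \<gamma> - 1\<^sub>m N) *\<^sub>v v = 0\<^sub>v N"
  have \<gamma>v: "\<gamma> *\<^sub>v v \<in> carrier_vec N" "\<gamma> *\<^sub>v (\<gamma> *\<^sub>v v) \<in> carrier_vec N"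
    using mult_mat_vec_carrier[OF \<gamma>] v by auto
  have "\<gamma> *\<^sub>v (\<gamma> *\<^sub>v v) - v = 0\<^sub>v N"
    using z minus_mult_distrib_mat_vec[of "\<gamma> * \<gamma>" N N "1\<^sub>m N" v] \<gamma> v assoc_mult_mat_vec[OF \<gamma> \<gamma> v] by simp
  then have sq: "\<gamma> *\<^sub>v (\<gamma> *\<^sub>v v) = v" by (rule vec_eq_if_minus_zero[OF \<gamma>v(2) v])
  define w where "w = \<gamma> *\<^sub>v v + v"
  have wC: "w \<in> carrier_vec N" using v \<gamma>v by (simp add: w_def)
  have "\<gamma> *\<^sub>v w = \<gamma> *\<^sub>v (\<gamma> *\<^sub>v v) + \<gamma> *\<^sub>v v" unfolding w_def by (rule mult_add_distrib_mat_vec[OF \<gamma> \<gamma>v(1) v])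
  also have "\<dots> = 1 \<cdot>\<^sub>v w" unfolding sq w_def using v \<gamma>v(1) comm_add_vec[OF v \<gamma>v(1)] by simp
  finally have "w = 0\<^sub>v N" using ev(1) wC \<gamma> unfolding eigenvalue_def eigenvector_def by auto
  then have "\<gamma> *\<^sub>v v = (-1) \<cdot>\<^sub>v v" unfolding w_def by (rule vec_eq_if_plus_zero[OF \<gamma>v(1) v])
  then show "v = 0\<^sub>v N" using ev(2) v \<gamma> unfolding eigenvalue_def eigenvector_def by auto
qed

text \<open>Conjugate matrices have the same \<open>det (\<gamma>\<^sup>2 - 1)\<close>.\<close>

lemma disc_product_square:
  fixes Q\<^sub>1 Q\<^sub>2 \<gamma>\<^sub>1 \<gamma>\<^sub>2 k :: "'f::field_char_0 mat"
  assumes Q1: "quadratic_space N Q\<^sub>1" and Q2: "quadratic_space N Q\<^sub>2"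
    and v1: "\<gamma>\<^sub>1 \<in> SO N Q\<^sub>1" "\<not> eigenvalue \<gamma>\<^sub>1 1" "\<not> eigenvalue \<gamma>\<^sub>1 (-1)" and v2: "\<gamma>\<^sub>2 \<in> SO N Q\<^sub>2"
    and k: "k \<in> carrier_mat N N" "det k \<noteq> 0" "k * \<gamma>\<^sub>1 = \<gamma>\<^sub>2 * k"
  shows "\<exists>s. det Q\<^sub>1 * det Q\<^sub>2 = s\<^sup>2"
proof -
  note q1 = quadratic_spaceD[OF Q1] and q2 = quadratic_spaceD[OF Q2]
  have g1: "\<gamma>\<^sub>1 \<in> carrier_mat N N" "\<gamma>\<^sub>1\<^sup>T * Q\<^sub>1 * \<gamma>\<^sub>1 = Q\<^sub>1" "det \<gamma>\<^sub>1 = 1"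
    using v1(1) Ortho_iff[OF q1(1)] by (auto simp: SO_def carrier_GL)
  have g2: "\<gamma>\<^sub>2 \<in> carrier_mat N N" "\<gamma>\<^sub>2\<^sup>T * Q\<^sub>2 * \<gamma>\<^sub>2 = Q\<^sub>2" "det \<gamma>\<^sub>2 = 1"
    using v2 Ortho_iff[OF q2(1)] by (auto simp: SO_def carrier_GL)
  let ?a = "\<gamma>\<^sub>1 * \<gamma>\<^sub>1" and ?b = "\<gamma>\<^sub>2 * \<gamma>\<^sub>2"
  have C: "?a \<in> carrier_mat N N" "?b \<in> carrier_mat N N" "?a - 1\<^sub>m N \<in> carrier_mat N N" "?b - 1\<^sub>m N \<in> carrier_mat N N"
    using g1(1) g2(1) by (auto intro!: minus_carrier_mat)
  have "k * ?a = \<gamma>\<^sub>2 * k * \<gamma>\<^sub>1" using assoc_mult_mat[OF k(1) g1(1) g1(1)] k(3) by simp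
  also have "\<dots> = \<gamma>\<^sub>2 * (\<gamma>\<^sub>2 * k)" using assoc_mult_mat[OF g2(1) k(1) g1(1)] k(3) by simp
  also have "\<dots> = ?b * k" using assoc_mult_mat[OF g2(1) g2(1) k(1)] by simp
  finally have kk: "k * ?a = ?b * k" .
  have "k * (?a - 1\<^sub>m N) = k * ?a - k * 1\<^sub>m N" by (rule mult_minus_distrib_mat[OF k(1) C(1)]) simp
  also have "\<dots> = ?b * k - 1\<^sub>m N * k" unfolding kk using k(1) by simp
  also have "\<dots> = (?b - 1\<^sub>m N) * k" by (rule minus_mult_distrib_mat[OF C(2) _ k(1), symmetric]) simp
  finally have "det k * det (?a - 1\<^sub>m N) = det (?b - 1\<^sub>m N) * det k"
    unfolding det_mult[OF k(1) C(3), symmetric] det_mult[OF C(4) k(1), symmetric] by (rule arg_cong)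
  then have eq: "det (?b - 1\<^sub>m N) = det (?a - 1\<^sub>m N)" using k(2) by simp
  obtain s where s: "det Q\<^sub>1 * det (?a - 1\<^sub>m N) = s\<^sup>2" using isometry_disc[OF q1(1,3) g1] by blast
  obtain t where t: "det Q\<^sub>2 * det (?a - 1\<^sub>m N) = t\<^sup>2" using isometry_disc[OF q2(1,3) g2] eq by auto
  define d where "d = det (?a - 1\<^sub>m N)"
  have d: "d \<noteq> 0" unfolding d_def by (rule det_square_minus_one_nonzero[OF g1(1) v1(2,3)])
  have "det Q\<^sub>1 * det Q\<^sub>2 * d\<^sup>2 = (s * t)\<^sup>2" unfolding power_mult_distrib s[symmetric] t[symmetric] d_def[symmetric]
    by (simp add: power2_eq_square)
  then have "det Q\<^sub>1 * det Q\<^sub>2 = (s * t / d)\<^sup>2" using d by (simp add: power_divide field_simps)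
  then show ?thesis by blast
qed

lemma row_nonzero_entry:
  fixes A :: "'k::field mat"
  assumes A: "A \<in> carrier_mat N N" "det A \<noteq> 0" and i: "i < N"
  shows "\<exists>j<N. A $$ (i, j) \<noteq> 0"
proof (rule ccontr)
  assume "\<not> ?thesis"
  then have z: "\<And>j. j < N \<Longrightarrow> A $$ (i, j) = 0" by blast
  obtain B where B: "B \<in> carrier_mat N N" "A * B = 1\<^sub>m N" using obtain_inverse_mat[OF A] by blast
  have "(A * B) $$ (i, i) = 0" using z by (subst mult_mat_entry[OF A(1) B(1) i i]) simp
  then show False using B(2) i by simp
qed

lemma mult_diag_right_entry:
  fixes A E :: "'k::field mat"
  assumes "A \<in> carrier_mat N N" "E \<in> carrier_mat N N" "diagonal_mat E" "i < N" "j < N"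
  shows "(A * E) $$ (i, j) = A $$ (i, j) * E $$ (j, j)"
proof -
  have "(A * E) $$ (i, j) = (\<Sum>k<N. A $$ (i, k) * E $$ (k, j))" by (rule mult_mat_entry[OF assms(1,2,4,5)])
  also have "\<dots> = (\<Sum>k<N. if k = j then A $$ (i, j) * E $$ (j, j) else 0)"
    by (rule sum.cong[OF refl]) (use assms in \<open>auto simp: diagonal_mat_def\<close>)
  finally show ?thesis using assms(5) by simp
qed

lemma gram_diag_entry:
  fixes A E :: "'k::field mat"
  assumes "A \<in> carrier_mat N N" "E \<in> carrier_mat N N" "diagonal_mat E" "i < N" "j < N"
  shows "(E\<^sup>T * A * E) $$ (i, j) = E $$ (i, i) * A $$ (i, j) * E $$ (j, j)"
proof -
  have C: "E\<^sup>T \<in> carrier_mat N N" "E\<^sup>T * A \<in> carrier_mat N N" using assms by auto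
  have "(E\<^sup>T * A) $$ (i, j) = (\<Sum>k<N. E\<^sup>T $$ (i, k) * A $$ (k, j))" by (rule mult_mat_entry[OF C(1) assms(1,4,5)])
  also have "\<dots> = (\<Sum>k<N. if k = i then E $$ (i, i) * A $$ (i, j) else 0)"
    by (rule sum.cong[OF refl]) (use assms in \<open>auto simp: diagonal_mat_def\<close>)
  finally show ?thesis using mult_diag_right_entry[OF C(2) assms(2,3,4,5)] assms(4) by simp
qed

text \<open>Two isometries \<open>G\<close>, \<open>G'\<close> that are conjugate by \<open>k\<close> in \<open>GL N\<close> are conjugate by an isometry when
  the eigenvalues of \<open>G\<close> are distinct. In an eigenbasis \<open>R\<close> of \<open>G\<close>, an entry \<open>(i, j)\<close> of
  the Gram matrix of an invariant form vanishes unless the eigenvalues \<open>E\<^sub>i\<close> and \<open>E\<^sub>j\<close> are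
  inverse to each other, so the Gram matrices of \<open>Q\<close> and of its transform under \<open>k\<close> are monomial
  with the same support. They differ by a diagonal matrix whose square root commutes with \<open>G\<close>
  and corrects \<open>k\<close>.\<close>

lemma conjugate_in_Ortho_if_conjugate:
  fixes Q G G' k R E :: "'k::alg_closed_field mat"
  assumes Q: "Q \<in> carrier_mat N N" "Q\<^sup>T = Q" "det Q \<noteq> 0"
    and G: "G \<in> Ortho N Q" and G': "G' \<in> Ortho N Q"
    and k: "k \<in> carrier_mat N N" "det k \<noteq> 0" "k * G = G' * k"
    and R: "R \<in> carrier_mat N N" "det R \<noteq> 0" "G * R = R * E"
    and E: "E \<in> carrier_mat N N" "diagonal_mat E"
    and distinct: "\<And>i j. i < N \<Longrightarrow> j < N \<Longrightarrow> i \<noteq> j \<Longrightarrow> E $$ (i, i) \<noteq> E $$ (j, j)"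
  shows "conjugate_in N (Ortho N Q) G G'"
proof -
  have GC: "G \<in> carrier_mat N N" "G\<^sup>T * Q * G = Q" and G'C: "G' \<in> carrier_mat N N" "G'\<^sup>T * Q * G' = Q"
    using G G' Ortho_iff[OF Q(1)] by (auto simp: carrier_GL)
  define q where "q = R\<^sup>T * Q * R"
  define m where "m = (k * R)\<^sup>T * Q * (k * R)"
  have kR: "k * R \<in> carrier_mat N N" "det (k * R) \<noteq> 0" using k R det_mult[OF k(1) R(1)] by auto
  have qC: "q \<in> carrier_mat N N" and mC: "m \<in> carrier_mat N N" using R Q kR by (auto simp: q_def m_def)
  have detq: "det q \<noteq> 0" and detm: "det m \<noteq> 0"
    unfolding q_def m_def det_gram[OF R(1) Q(1)] det_gram[OF kR(1) Q(1)] using R(2) kR(2) Q(3) by auto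
  have sym: "(P\<^sup>T * Q * P)\<^sup>T = P\<^sup>T * Q * P" if P: "P \<in> carrier_mat N N" for P
  proof -
    have "(P\<^sup>T * Q * P)\<^sup>T = P\<^sup>T * (P\<^sup>T * Q)\<^sup>T" using P Q(1) by (intro transpose_mult[of _ N N _ N]) auto
    also have "(P\<^sup>T * Q)\<^sup>T = Q * P" using P Q transpose_mult[of "P\<^sup>T" N N Q N] by simp
    finally show ?thesis using P Q(1) by (simp add: assoc_mult_mat[of _ N N _ N _ N])
  qed
  have qsym: "q $$ (j, i) = q $$ (i, j)" if "i < N" "j < N" for i j
  proof -
    have "q\<^sup>T $$ (i, j) = q $$ (i, j)" unfolding q_def sym[OF R(1)] ..
    then show ?thesis using that qC by simp
  qed
  have msym: "m $$ (j, i) = m $$ (i, j)" if "i < N" "j < N" for i j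
  proof -
    have "m\<^sup>T $$ (i, j) = m $$ (i, j)" unfolding m_def sym[OF kR(1)] ..
    then show ?thesis using that mC by simp
  qed
  have qE: "E\<^sup>T * q * E = q"
  proof -
    have "E\<^sup>T * q * E = (R * E)\<^sup>T * Q * (R * E)" unfolding q_def by (rule gram_mult[OF R(1) Q(1) E(1), symmetric])
    also have "\<dots> = R\<^sup>T * (G\<^sup>T * Q * G) * R" unfolding R(3)[symmetric] by (rule gram_mult[OF GC(1) Q(1) R(1)])
    finally show ?thesis unfolding GC(2) q_def .
  qed
  have G'kR: "(k * R) * E = G' * (k * R)"
    using assoc_mult_mat[OF k(1) R(1) E(1)] assoc_mult_mat[OF k(1) GC(1) R(1)] assoc_mult_mat[OF G'C(1) k(1) R(1)] R(3) k(3)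
    by simp
  have mE: "E\<^sup>T * m * E = m"
  proof -
    have "E\<^sup>T * m * E = ((k * R) * E)\<^sup>T * Q * ((k * R) * E)" unfolding m_def by (rule gram_mult[OF kR(1) Q(1) E(1), symmetric])
    also have "\<dots> = (k * R)\<^sup>T * (G'\<^sup>T * Q * G') * (k * R)" unfolding G'kR by (rule gram_mult[OF G'C(1) Q(1) kR(1)])
    finally show ?thesis unfolding G'C(2) m_def .
  qed
  define \<epsilon> where "\<epsilon> i = E $$ (i, i)" for i
  have q1: "\<epsilon> i * \<epsilon> j = 1" if "i < N" "j < N" "q $$ (i, j) \<noteq> 0" for i j
    using gram_diag_entry[OF qC E that(1,2)] that(3) unfolding qE \<epsilon>_def by (simp add: mult_ac)
  have m1: "\<epsilon> i * \<epsilon> j = 1" if "i < N" "j < N" "m $$ (i, j) \<noteq> 0" for i j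
    using gram_diag_entry[OF mC E that(1,2)] that(3) unfolding mE \<epsilon>_def by (simp add: mult_ac)
  have uniq: "j = j'" if "i < N" "j < N" "j' < N" "\<epsilon> i * \<epsilon> j = 1" "\<epsilon> i * \<epsilon> j' = 1" for i j j'
  proof -
    have "\<epsilon> i \<noteq> 0" using that(4) by auto
    moreover have "\<epsilon> i * \<epsilon> j = \<epsilon> i * \<epsilon> j'" using that by simp
    ultimately have "\<epsilon> j = \<epsilon> j'" by simp
    then show ?thesis using distinct[OF that(2,3)] unfolding \<epsilon>_def by blast
  qed
  have "\<forall>i<N. \<exists>j<N. q $$ (i, j) \<noteq> 0" using row_nonzero_entry[OF qC detq] by blast
  then obtain p where p: "\<And>i. i < N \<Longrightarrow> p i < N" "\<And>i. i < N \<Longrightarrow> q $$ (i, p i) \<noteq> 0" by metis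
  \<comment> \<open>the diagonal matrix with \<open>m = diag(t) q\<close>\<close>
  define t where "t i = m $$ (i, p i) / q $$ (i, p i)" for i
  have pj: "j = p i" if "i < N" "j < N" "\<epsilon> i * \<epsilon> j = 1" for i j
    using uniq[OF that(1,2) p(1)[OF that(1)] that(3) q1[OF that(1) p(1)[OF that(1)] p(2)[OF that(1)]]] .
  have mt: "m $$ (i, j) = t i * q $$ (i, j)" if "i < N" "j < N" for i j
  proof (cases "j = p i")
    case True then show ?thesis using p(2)[OF that(1)] by (simp add: t_def)
  next
    case False
    then have "m $$ (i, j) = 0" "q $$ (i, j) = 0" using pj[OF that] m1[OF that] q1[OF that] by blast+
    then show ?thesis by simp
  qed
  have tt: "t j = t i" if "i < N" "j < N" "q $$ (i, j) \<noteq> 0" for i j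
    using mt[OF that(1,2)] mt[OF that(2,1)] qsym[OF that(1,2)] msym[OF that(1,2)] that(3) by simp
  have t0: "t i \<noteq> 0" if "i < N" for i
    using row_nonzero_entry[OF mC detm that] mt[OF that] by auto
  define s where "s a = (SOME b. b ^ 2 = a)" for a :: 'k
  have s: "s a ^ 2 = a" for a unfolding s_def by (rule someI_ex) (rule nth_root_exists, simp)
  define r where "r = mat N N (\<lambda>(i, j). if i = j then s (t i) else 0)"
  have rC: "r \<in> carrier_mat N N" "diagonal_mat r" by (auto simp: r_def diagonal_mat_def)
  have rqr: "r\<^sup>T * q * r = m"
  proof (rule eq_matI)
    fix i j assume "i < dim_row m" "j < dim_col m"
    then have ij: "i < N" "j < N" using mC by auto
    have "(r\<^sup>T * q * r) $$ (i, j) = s (t i) * q $$ (i, j) * s (t j)"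
      unfolding gram_diag_entry[OF qC rC ij] using ij by (simp add: r_def)
    also have "\<dots> = (s (t i))\<^sup>2 * q $$ (i, j)" using tt[OF ij] by (cases "q $$ (i, j) = 0") (auto simp: power2_eq_square)
    finally show "(r\<^sup>T * q * r) $$ (i, j) = m $$ (i, j)" unfolding s mt[OF ij] .
  qed (use rC mC qC in auto)
  \<comment> \<open>both \<open>P\<close> and \<open>kR\<close> carry \<open>Q\<close> to \<open>m\<close>, so \<open>kRP\<inverse>\<close> is an isometry\<close>
  define P where "P = R * r"
  have PC: "P \<in> carrier_mat N N" using R rC by (simp add: P_def)
  have Pm: "P\<^sup>T * Q * P = m" unfolding P_def gram_mult[OF R(1) Q(1) rC(1)] q_def[symmetric] by (rule rqr)
  have detP: "det P \<noteq> 0" using detm det_gram[OF PC Q(1)] unfolding Pm by auto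
  obtain S where S: "S \<in> carrier_mat N N" "P * S = 1\<^sub>m N" "S * P = 1\<^sub>m N" using obtain_inverse_mat[OF PC detP] by blast
  define w where "w = (k * R) * S"
  have wC: "w \<in> carrier_mat N N" using kR S by (simp add: w_def)
  have wP: "w * P = k * R" unfolding w_def assoc_mult_mat[OF kR(1) S(1) PC] S(3) by (rule right_mult_one_mat[OF kR(1)])
  have wQ: "w\<^sup>T * Q * w = Q"
  proof -
    have "w\<^sup>T * Q * w = S\<^sup>T * m * S" unfolding w_def m_def by (rule gram_mult[OF kR(1) Q(1) S(1)])
    also have "\<dots> = (P * S)\<^sup>T * Q * (P * S)" unfolding Pm[symmetric] by (rule gram_mult[OF PC Q(1) S(1), symmetric])
    finally show ?thesis unfolding S(2) using Q(1) by simp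
  qed
  have detw: "det w \<noteq> 0" using det_gram[OF wC Q(1)] Q(3) unfolding wQ by auto
  have rE: "r * E = E * r"
  proof (rule eq_matI)
    fix i j assume "i < dim_row (E * r)" "j < dim_col (E * r)"
    then have ij: "i < N" "j < N" using E rC by auto
    show "(r * E) $$ (i, j) = (E * r) $$ (i, j)"
      unfolding mult_diag_right_entry[OF rC(1) E ij] mult_diag_right_entry[OF E(1) rC ij]
      using E rC ij by (cases "i = j") (auto simp: diagonal_mat_def mult.commute)
  qed (use E rC in auto)
  have GP: "G * P = P * E"
    unfolding P_def using assoc_mult_mat[OF GC(1) R(1) rC(1)] assoc_mult_mat[OF R(1) E(1) rC(1)] assoc_mult_mat[OF R(1) rC(1) E(1)]
    by (simp add: R(3) rE)
  have "w * G = G' * w"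
  proof -
    have C: "w * G \<in> carrier_mat N N" "G' * w \<in> carrier_mat N N" using wC GC G'C by auto
    have "(w * G) * P = w * (P * E)" using assoc_mult_mat[OF wC GC(1) PC] GP by simp
    also have "\<dots> = (k * R) * E" using assoc_mult_mat[OF wC PC E(1)] wP by simp
    also have "\<dots> = (G' * w) * P" unfolding G'kR using assoc_mult_mat[OF G'C(1) wC PC] wP by simp
    finally have "(w * G) * P * S = (G' * w) * P * S" by simp
    then show ?thesis unfolding assoc_mult_mat[OF C(1) PC S(1)] assoc_mult_mat[OF C(2) PC S(1)] S(2)
        right_mult_one_mat[OF C(1)] right_mult_one_mat[OF C(2)] .
  qed
  moreover have wGL: "w \<in> carrier (GL N)" using wC detw by (simp add: carrier_GL)
  ultimately have "w * G * inv\<^bsub>GL N\<^esub> w = G'"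
    using assoc_mult_mat[OF G'C(1) wC inv_GL(2)[OF wGL]] inv_GL(3)[OF wGL] G'C(1) by simp
  then show ?thesis unfolding conjugate_in_def using wGL wQ Ortho_iff[OF Q(1)] by blast
qed

section \<open>The isomorphism and the characters\<close>

text \<open>A similitude \<open>h\<close> over \<open>F\<close> conjugates one orthogonal group to the other, because scaling a form
  does not change its isometries.\<close>

lemma conj_in_Ortho:
  fixes Q\<^sub>1 Q\<^sub>2 h :: "'k::field mat"
  assumes Q: "Q\<^sub>1 \<in> carrier_mat N N" "Q\<^sub>2 \<in> carrier_mat N N"
    and h: "h \<in> carrier_mat N N" "h' \<in> carrier_mat N N" "h * h' = 1\<^sub>m N" "h' * h = 1\<^sub>m N"
    and sim: "h\<^sup>T * Q\<^sub>2 * h = c \<cdot>\<^sub>m Q\<^sub>1" and A: "A \<in> Ortho N Q\<^sub>1"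
  shows "h * A * h' \<in> Ortho N Q\<^sub>2"
proof -
  have AC: "A \<in> carrier_mat N N" "det A \<noteq> 0" "A\<^sup>T * Q\<^sub>1 * A = Q\<^sub>1"
    using A Ortho_iff[OF Q(1)] by (auto simp: carrier_GL)
  have hA: "h * A \<in> carrier_mat N N" using h AC by simp
  have B: "h * A * h' \<in> carrier_mat N N" using hA h by simp
  have "(h * A * h')\<^sup>T * Q\<^sub>2 * (h * A * h') = h'\<^sup>T * ((h * A)\<^sup>T * Q\<^sub>2 * (h * A)) * h'"
    by (rule gram_mult[OF hA Q(2) h(2)])
  also have "(h * A)\<^sup>T * Q\<^sub>2 * (h * A) = A\<^sup>T * (h\<^sup>T * Q\<^sub>2 * h) * A" by (rule gram_mult[OF h(1) Q(2) AC(1)])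
  also have "\<dots> = c \<cdot>\<^sub>m Q\<^sub>1" unfolding sim gram_smult_right[OF AC(1) Q(1)] AC(3) ..
  also have "h'\<^sup>T * (c \<cdot>\<^sub>m Q\<^sub>1) * h' = (h * h')\<^sup>T * Q\<^sub>2 * (h * h')"
    unfolding sim[symmetric] by (rule gram_mult[OF h(1) Q(2) h(2), symmetric])
  also have "\<dots> = Q\<^sub>2" unfolding h(3) using Q(2) by simp
  finally have "(h * A * h')\<^sup>T * Q\<^sub>2 * (h * A * h') = Q\<^sub>2" .
  moreover have "det (h * A * h') \<noteq> 0"
    unfolding det_mult[OF hA h(2)] det_mult[OF h(1) AC(1)]
    using AC(2) det_nonzero_if_left_inverse[OF h(1,2,4)] det_nonzero_if_left_inverse[OF h(2,1,3)] by simp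
  ultimately show ?thesis unfolding Ortho_iff[OF Q(2)] carrier_GL using B by blast
qed

lemma conj_in_SO:
  fixes Q\<^sub>1 Q\<^sub>2 h :: "'k::field mat"
  assumes Q: "Q\<^sub>1 \<in> carrier_mat N N" "Q\<^sub>2 \<in> carrier_mat N N"
    and h: "h \<in> carrier_mat N N" "h' \<in> carrier_mat N N" "h * h' = 1\<^sub>m N" "h' * h = 1\<^sub>m N"
    and sim: "h\<^sup>T * Q\<^sub>2 * h = c \<cdot>\<^sub>m Q\<^sub>1" and A: "A \<in> SO N Q\<^sub>1"
  shows "h * A * h' \<in> SO N Q\<^sub>2"
proof -
  have AO: "A \<in> Ortho N Q\<^sub>1" "det A = 1" using A by (auto simp: SO_def)
  have AC: "A \<in> carrier_mat N N" using AO(1) Ortho_iff[OF Q(1)] by (auto simp: carrier_GL)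
  have hA: "h * A \<in> carrier_mat N N" using h AC by simp
  have "det (h * A * h') = det (h * h')"
    unfolding det_mult[OF hA h(2)] det_mult[OF h(1) AC] det_mult[OF h(1,2)] AO(2) by simp
  then show ?thesis using conj_in_Ortho[OF Q h sim AO(1)] h(3) by (simp add: SO_def)
qed

lemma conj_conj_inverse:
  fixes A :: "'k::field mat"
  assumes "A \<in> carrier_mat N N" "h \<in> carrier_mat N N" "h' \<in> carrier_mat N N" "h' * h = 1\<^sub>m N"
  shows "h' * (h * A * h') * h = A"
proof -
  have C: "h * A \<in> carrier_mat N N" "h * A * h' \<in> carrier_mat N N" "A * h' \<in> carrier_mat N N" using assms by auto
  have "h' * (h * A * h') = A * h'"
    unfolding assoc_mult_mat[OF assms(2,1,3)] by (rule mult_mat_inverse_cancel[OF assms(3,2,4) C(3)])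
  then show ?thesis using assoc_mult_mat[OF assms(1,3,2)] assms(1,4) by simp
qed

lemma regular_map_conj:
  fixes h h' :: "'k::field mat"
  assumes h: "h \<in> carrier_mat N N" "h' \<in> carrier_mat N N" and K: "0 \<in> K"
    and hK: "\<And>i j. i < N \<Longrightarrow> j < N \<Longrightarrow> h $$ (i, j) \<in> K" "\<And>i j. i < N \<Longrightarrow> j < N \<Longrightarrow> h' $$ (i, j) \<in> K"
    and S: "S \<subseteq> carrier_mat N N" and f: "\<And>A. A \<in> S \<Longrightarrow> f A = h * A * h'"
  shows "regular_map K N S N f"
  unfolding regular_map_def
proof (intro allI impI)
  fix i j assume ij: "i < N" "j < N"
  have 1: "regular_on K N S (\<lambda>A. (h * A) $$ (i, k))" if k: "k < N" for k
    by (rule regular_on_mult_entry[OF K ij(1) k, where m = N])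
       (use h S hK k ij in \<open>auto intro!: regular_on_const regular_on_entry\<close>)
  have "regular_on K N S (\<lambda>A. (h * A * h') $$ (i, j))"
    by (rule regular_on_mult_entry[OF K ij, where m = N])
       (use h S hK ij 1 in \<open>auto intro!: regular_on_const mult_carrier_mat simp del: index_mult_mat(1)\<close>)
  then show "\<exists>r\<in>regular_functions K N. \<forall>g\<in>S. f g $$ (i, j) = r g"
    unfolding regular_on_def using f by auto
qed

lemma SO_iso_by_similitude:
  fixes Q\<^sub>1 Q\<^sub>2 h :: "'k::field mat"
  assumes Q: "Q\<^sub>1 \<in> carrier_mat N N" "Q\<^sub>2 \<in> carrier_mat N N" and c: "c \<noteq> 0"
    and h: "h \<in> carrier_mat N N" "h' \<in> carrier_mat N N" "h * h' = 1\<^sub>m N" "h' * h = 1\<^sub>m N"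
    and sim: "h\<^sup>T * Q\<^sub>2 * h = c \<cdot>\<^sub>m Q\<^sub>1" and K: "0 \<in> K"
    and hK: "\<And>i j. i < N \<Longrightarrow> j < N \<Longrightarrow> h $$ (i, j) \<in> K" "\<And>i j. i < N \<Longrightarrow> j < N \<Longrightarrow> h' $$ (i, j) \<in> K"
  shows "alg_group_iso K N (SO N Q\<^sub>1) N (SO N Q\<^sub>2) (\<lambda>A. h * A * h')"
proof -
  let ?f = "\<lambda>A. h * A * h'" and ?g = "\<lambda>A. h' * A * h"
  have SC: "SO N P \<subseteq> carrier_mat N N" for P :: "'k mat"
    by (auto simp: SO_def Ortho_def carrier_GL)
  have sim': "h'\<^sup>T * Q\<^sub>1 * h' = inverse c \<cdot>\<^sub>m Q\<^sub>2"
  proof -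
    have "c \<cdot>\<^sub>m (h'\<^sup>T * Q\<^sub>1 * h') = h'\<^sup>T * (h\<^sup>T * Q\<^sub>2 * h) * h'" unfolding sim gram_smult_right[OF h(2) Q(1)] ..
    also have "\<dots> = (h * h')\<^sup>T * Q\<^sub>2 * (h * h')" by (rule gram_mult[OF h(1) Q(2) h(2), symmetric])
    also have "\<dots> = Q\<^sub>2" unfolding h(3) using Q(2) by simp
    finally have "inverse c \<cdot>\<^sub>m (c \<cdot>\<^sub>m (h'\<^sup>T * Q\<^sub>1 * h')) = inverse c \<cdot>\<^sub>m Q\<^sub>2" by simp
    moreover have "inverse c \<cdot>\<^sub>m (c \<cdot>\<^sub>m M) = M" for M :: "'k mat" using c by (intro eq_matI) auto
    ultimately show ?thesis by simp
  qed
  have fS: "?f A \<in> SO N Q\<^sub>2" if "A \<in> SO N Q\<^sub>1" for A by (rule conj_in_SO[OF Q h sim that])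
  have gS: "?g A \<in> SO N Q\<^sub>1" if "A \<in> SO N Q\<^sub>2" for A by (rule conj_in_SO[OF Q(2,1) h(2,1,4,3) sim' that])
  have gf: "?g (?f A) = A" if "A \<in> SO N Q\<^sub>1" for A using conj_conj_inverse[OF _ h(1,2,4)] SC that by blast
  have fg: "?f (?g A) = A" if "A \<in> SO N Q\<^sub>2" for A using conj_conj_inverse[OF _ h(2,1,3)] SC that by blast
  have bij: "bij_betw ?f (SO N Q\<^sub>1) (SO N Q\<^sub>2)" by (rule bij_betwI[where g = ?g]) (use fS gS fg gf in auto)
  have hom: "?f (A * B) = ?f A * ?f B" if "A \<in> SO N Q\<^sub>1" "B \<in> SO N Q\<^sub>1" for A B
  proof -
    have AC: "A \<in> carrier_mat N N" "B \<in> carrier_mat N N" using that SC by auto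
    have C: "h * A \<in> carrier_mat N N" "h * B \<in> carrier_mat N N" "B * h' \<in> carrier_mat N N" "h * (B * h') \<in> carrier_mat N N"
      using h AC by auto
    have "?f A * ?f B = h * A * (h' * (h * (B * h')))"
      unfolding assoc_mult_mat[OF h(1) AC(2) h(2)] by (rule assoc_mult_mat[OF C(1) h(2) C(4)])
    also have "h' * (h * (B * h')) = B * h'" by (rule mult_mat_inverse_cancel[OF h(2,1,4) C(3)])
    also have "h * A * (B * h') = ?f (A * B)"
      unfolding assoc_mult_mat[OF C(1) AC(2) h(2), symmetric] assoc_mult_mat[OF h(1) AC(1,2)] ..
    finally show ?thesis by (rule sym)
  qed
  have iso: "?f \<in> iso ((GL N)\<lparr>carrier := SO N Q\<^sub>1\<rparr>) ((GL N)\<lparr>carrier := SO N Q\<^sub>2\<rparr>)"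
    unfolding iso_def hom_def using bij fS hom by (auto simp: GL_def)
  have inv: "inv_into (SO N Q\<^sub>1) ?f A = h' * A * h" if "A \<in> SO N Q\<^sub>2" for A
    by (rule inv_into_f_eq[OF bij_betw_imp_inj_on[OF bij] gS[OF that] fg[OF that]])
  have "regular_map K N (SO N Q\<^sub>1) N ?f" by (rule regular_map_conj[OF h(1,2) K hK SC refl])
  moreover have "regular_map K N (SO N Q\<^sub>2) N (inv_into (SO N Q\<^sub>1) ?f)"
    by (rule regular_map_conj[OF h(2,1) K hK(2,1) SC inv])
  ultimately show ?thesis unfolding alg_group_iso_def using iso by blast
qed

text \<open>The square roots of \<open>d\<close> and \<open>dt\<^sup>2\<close> differ by the factor \<open>t\<close>, which every \<open>\<sigma>\<close> fixes.\<close>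

lemma quadratic_character_mult_square:
  fixes d t :: "'f::field_char_0"
  assumes "t \<noteq> 0"
  shows "quadratic_character (d * t\<^sup>2) = quadratic_character d"
proof -
  have "(\<forall>s. s\<^sup>2 = to_ac (d * t\<^sup>2) \<longrightarrow> \<sigma> s = s) \<longleftrightarrow> (\<forall>s. s\<^sup>2 = to_ac d \<longrightarrow> \<sigma> s = s)"
    if \<sigma>: "\<sigma> \<in> absolute_galois" for \<sigma> :: "'f alg_closure \<Rightarrow> 'f alg_closure"
  proof -
    interpret ac: field_hom "to_ac :: 'f \<Rightarrow> 'f alg_closure" by (rule to_ac_field_hom)
    have t: "to_ac t \<noteq> 0" using assms by simp
    have \<sigma>t: "\<sigma> (s * to_ac t) = \<sigma> s * to_ac t" for s using \<sigma> by (simp add: absolute_galois_def)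
    have sq: "to_ac (d * t\<^sup>2) = to_ac d * (to_ac t)\<^sup>2" by (simp add: ac.hom_mult ac.hom_power)
    show ?thesis
    proof (intro iffI allI impI)
      fix s assume a: "\<forall>s. s\<^sup>2 = to_ac (d * t\<^sup>2) \<longrightarrow> \<sigma> s = s" and s: "s\<^sup>2 = to_ac d"
      have "(s * to_ac t)\<^sup>2 = to_ac (d * t\<^sup>2)" unfolding sq power_mult_distrib s ..
      then have "\<sigma> s * to_ac t = s * to_ac t" using a \<sigma>t by metis
      then show "\<sigma> s = s" using t by simp
    next
      fix s assume a: "\<forall>s. s\<^sup>2 = to_ac d \<longrightarrow> \<sigma> s = s" and s: "s\<^sup>2 = to_ac (d * t\<^sup>2)"
      define r where "r = s / to_ac t"
      have r: "s = r * to_ac t" using t by (simp add: r_def)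
      have "r\<^sup>2 = to_ac d" using s t unfolding sq r_def by (simp add: power_divide)
      then show "\<sigma> s = s" using a \<sigma>t unfolding r by simp
    qed
  qed
  then show ?thesis unfolding quadratic_character_def by (intro restrict_ext) simp
qed

text \<open>The similitude \<open>h\<close> turns \<open>\<gamma>\<^sub>1\<close> into an isometry of \<open>Q\<^sub>2\<close>, conjugate to \<open>\<gamma>\<^sub>2\<close> under \<open>k h\<inverse>\<close> and still with
  distinct eigenvalues.\<close>

lemma conj_stably_conjugate:
  fixes Q\<^sub>1 Q\<^sub>2 h k \<gamma>\<^sub>1 \<gamma>\<^sub>2 :: "'f::field_char_0 mat"
  assumes Q1: "quadratic_space N Q\<^sub>1" and Q2: "quadratic_space N Q\<^sub>2"
    and h: "h \<in> carrier_mat N N" "h' \<in> carrier_mat N N" "h * h' = 1\<^sub>m N" "h' * h = 1\<^sub>m N"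
    and sim: "h\<^sup>T * Q\<^sub>2 * h = c \<cdot>\<^sub>m Q\<^sub>1"
    and k: "k \<in> carrier_mat N N" "det k \<noteq> 0" "k * \<gamma>\<^sub>1 = \<gamma>\<^sub>2 * k"
    and \<gamma>1: "very_regular_SO N Q\<^sub>1 \<gamma>\<^sub>1" "corresponds N Q\<^sub>1 \<gamma>\<^sub>1 D" and \<gamma>2: "\<gamma>\<^sub>2 \<in> SO N Q\<^sub>2"
  shows "conjugate_in N (Ortho N (bc Q\<^sub>2)) (bc h * bc \<gamma>\<^sub>1 * bc h') (bc \<gamma>\<^sub>2)"
proof -
  interpret ac: field_hom "to_ac :: 'f \<Rightarrow> 'f alg_closure" by (rule to_ac_field_hom)
  note q1 = quadratic_spaceD[OF Q1] and q2 = quadratic_spaceD[OF Q2] and q2' = quadratic_spaceD[OF quadratic_space_bc[OF Q2]]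
  have O1: "\<gamma>\<^sub>1 \<in> Ortho N Q\<^sub>1" and O2: "\<gamma>\<^sub>2 \<in> Ortho N Q\<^sub>2" using \<gamma>1 \<gamma>2 by (auto simp: very_regular_SO_def SO_def)
  have g1: "\<gamma>\<^sub>1 \<in> carrier_mat N N" and g2: "\<gamma>\<^sub>2 \<in> carrier_mat N N"
    using O1 O2 Ortho_iff[OF q1(1)] Ortho_iff[OF q2(1)] by (auto simp: carrier_GL)
  have bcO: "bc A \<in> Ortho N (bc Q\<^sub>2)" if "A \<in> Ortho N Q\<^sub>2" for A
  proof -
    have A: "A \<in> carrier_mat N N" "det A \<noteq> 0" "A\<^sup>T * Q\<^sub>2 * A = Q\<^sub>2" using that Ortho_iff[OF q2(1)] by (auto simp: carrier_GL)
    have AT: "A\<^sup>T \<in> carrier_mat N N" "A\<^sup>T * Q\<^sub>2 \<in> carrier_mat N N" using A q2 by auto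
    have "(bc A)\<^sup>T * bc Q\<^sub>2 * bc A = bc (A\<^sup>T * Q\<^sub>2 * A)"
      unfolding bc_mult[OF AT(2) A(1)] bc_mult[OF AT(1) q2(1)] by (simp add: map_mat_transpose)
    then show ?thesis unfolding Ortho_iff[OF q2'(1)] carrier_GL using A by simp
  qed
  define G where "G = h * \<gamma>\<^sub>1 * h'"
  have hg: "h * \<gamma>\<^sub>1 \<in> carrier_mat N N" using h g1 by simp
  have GC: "G \<in> carrier_mat N N" using hg h by (simp add: G_def)
  have GO: "G \<in> Ortho N Q\<^sub>2" unfolding G_def by (rule conj_in_Ortho[OF q1(1) q2(1) h sim O1])
  have Gh: "G * h = h * \<gamma>\<^sub>1"
    unfolding G_def assoc_mult_mat[OF hg h(2,1)] h(4) by (rule right_mult_one_mat[OF hg])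
  define k' where "k' = k * h'"
  have k'C: "k' \<in> carrier_mat N N" "det k' \<noteq> 0"
    using k h det_mult[OF k(1) h(2)] det_nonzero_if_left_inverse[OF h(2,1,3)] by (auto simp: k'_def)
  have k'G: "k' * G = \<gamma>\<^sub>2 * k'"
  proof -
    have C: "\<gamma>\<^sub>1 * h' \<in> carrier_mat N N" "h * (\<gamma>\<^sub>1 * h') \<in> carrier_mat N N" using h g1 by auto
    have "k' * G = k * (h' * (h * (\<gamma>\<^sub>1 * h')))"
      unfolding k'_def G_def assoc_mult_mat[OF h(1) g1 h(2)] by (rule assoc_mult_mat[OF k(1) h(2) C(2)])
    also have "h' * (h * (\<gamma>\<^sub>1 * h')) = \<gamma>\<^sub>1 * h'" by (rule mult_mat_inverse_cancel[OF h(2,1,4) C(1)])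
    also have "k * (\<gamma>\<^sub>1 * h') = \<gamma>\<^sub>2 * k * h'" using assoc_mult_mat[OF k(1) g1 h(2)] k(3) by simp
    finally show ?thesis unfolding k'_def using assoc_mult_mat[OF g2 k(1) h(2)] by simp
  qed
  obtain E where E: "diagonal_mat E" "similar_mat (bc \<gamma>\<^sub>1) E" using \<gamma>1(1) by (auto simp: very_regular_SO_def)
  obtain R R' where wit: "similar_mat_wit (bc \<gamma>\<^sub>1) E R R'" using E(2) by (auto simp: similar_mat_def)
  have bg1: "bc \<gamma>\<^sub>1 \<in> carrier_mat N N" using g1 by simp
  note W = similar_mat_witD2[OF bg1 wit]
  have detR: "det R \<noteq> 0" by (rule det_nonzero_if_left_inverse[OF W(6,7,2)])
  have RE: "bc \<gamma>\<^sub>1 * R = R * E"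
  proof -
    have RE: "R * E \<in> carrier_mat N N" using W(5,6) by simp
    have "bc \<gamma>\<^sub>1 * R = R * E * (R' * R)" unfolding W(3) by (rule assoc_mult_mat[OF RE W(7,6)])
    then show ?thesis unfolding W(2) right_mult_one_mat[OF RE] .
  qed
  obtain L' :: "('f, 'f vec) module" and \<tau>' y c' where sp: "SO_param N Q\<^sub>1 \<gamma>\<^sub>1 L' \<tau>' y c'"
    using \<gamma>1(2) unfolding corresponds_def by (elim exE conjE) (erule that)
  note distinct = SO_param_distinct_eigenvalues[OF sp g1 W(5) E(1) W(6) detR RE]
  have bh: "bc h \<in> carrier_mat N N" "det (bc h) \<noteq> 0"
    using h det_nonzero_if_left_inverse[OF h(1,2,4)] by (auto simp: ac.hom_det)
  have hR: "bc h * R \<in> carrier_mat N N" "det (bc h * R) \<noteq> 0" using bh W(6) detR det_mult[OF bh(1) W(6)] by auto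
  have "bc G * (bc h * R) = (bc h * R) * E"
  proof -
    have bG: "bc G \<in> carrier_mat N N" using GC by simp
    have "bc G * (bc h * R) = bc (G * h) * R" unfolding bc_mult[OF GC h(1)] using assoc_mult_mat[OF bG bh(1) W(6)] by simp
    also have "\<dots> = bc h * (bc \<gamma>\<^sub>1 * R)" unfolding Gh bc_mult[OF h(1) g1] by (rule assoc_mult_mat[OF bh(1) bg1 W(6)])
    finally show ?thesis unfolding RE using assoc_mult_mat[OF bh(1) W(6,5)] by simp
  qed
  moreover have "bc k' * bc G = bc \<gamma>\<^sub>2 * bc k'"
    unfolding bc_mult[OF k'C(1) GC, symmetric] bc_mult[OF g2 k'C(1), symmetric] k'G ..
  moreover have "bc k' \<in> carrier_mat N N" "det (bc k') \<noteq> 0" using k'C by (auto simp: ac.hom_det)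
  ultimately have "conjugate_in N (Ortho N (bc Q\<^sub>2)) (bc G) (bc \<gamma>\<^sub>2)"
    by (intro conjugate_in_Ortho_if_conjugate[OF q2'(1,3,2) bcO[OF GO] bcO[OF O2] _ _ _ hR _ W(5) E(1) distinct])
  then show ?thesis unfolding G_def bc_mult[OF hg h(2)] bc_mult[OF h(1) g1] .
qed

theorem lemma4p3p1:
  fixes v :: "'f::field_char_0 \<Rightarrow> real" and n :: nat
    and \<delta> Q\<^sub>1 Q\<^sub>2 \<gamma>\<^sub>1 \<gamma>\<^sub>2 :: "'f mat"
  assumes "nonarch_local_field v" and "n \<ge> 1"
    and "very_regular_form (2 * n) \<delta>"
    and "quadratic_space (2 * n) Q\<^sub>1" and "quadratic_space (2 * n) Q\<^sub>2"
    and "quasisplit_SO (2 * n) Q\<^sub>1" and "quasisplit_SO (2 * n) Q\<^sub>2"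
    and "very_regular_SO (2 * n) Q\<^sub>1 \<gamma>\<^sub>1" and "corresponds (2 * n) Q\<^sub>1 \<gamma>\<^sub>1 \<delta>"
    and "very_regular_SO (2 * n) Q\<^sub>2 \<gamma>\<^sub>2" and "corresponds (2 * n) Q\<^sub>2 \<gamma>\<^sub>2 \<delta>"
  shows "(\<exists>\<phi>. SO_iso_over_base (2 * n) Q\<^sub>1 Q\<^sub>2 \<phi> \<and>
            conjugate_in (2 * n) (Ortho (2 * n) (bc Q\<^sub>2)) (\<phi> (bc \<gamma>\<^sub>1)) (bc \<gamma>\<^sub>2)) \<and>
         (\<forall>\<D>\<^sub>1 \<D>\<^sub>2. is_endo_datum_of n Q\<^sub>1 \<D>\<^sub>1 \<and> is_endo_datum_of n Q\<^sub>2 \<D>\<^sub>2 \<longrightarrow>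
            equivalent_endo_data \<D>\<^sub>1 \<D>\<^sub>2)"
proof -
  interpret ac: field_hom "to_ac :: 'f \<Rightarrow> 'f alg_closure" by (rule to_ac_field_hom)
  define N where "N = 2 * n"
  note A = assms(3-11)[folded N_def]
  note q1 = quadratic_spaceD[OF A(2)] and q2 = quadratic_spaceD[OF A(3)]
  have D: "\<delta> \<in> carrier_mat N N" "det \<delta> \<noteq> 0"
    using A(1) by (auto simp: very_regular_form_def strongly_regular_semisimple_form_def nondegenerate_form_def)
  have s1: "\<gamma>\<^sub>1 \<in> SO N Q\<^sub>1" "\<not> eigenvalue \<gamma>\<^sub>1 1" "\<not> eigenvalue \<gamma>\<^sub>1 (-1)" and s2: "\<gamma>\<^sub>2 \<in> SO N Q\<^sub>2"
    using A(6,8) by (auto simp: very_regular_SO_def)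
  have g: "\<gamma>\<^sub>1 \<in> carrier_mat N N" "\<gamma>\<^sub>2 \<in> carrier_mat N N"
    using s1(1) s2 by (auto simp: SO_def Ortho_def carrier_GL)
  obtain k where k: "k \<in> carrier_mat N N" "det k \<noteq> 0" "k * \<gamma>\<^sub>1 = \<gamma>\<^sub>2 * k"
    using corresponds_conjugate[OF A(7,9) D g] by blast
  obtain s where s: "det Q\<^sub>1 * det Q\<^sub>2 = s\<^sup>2"
    using disc_product_square[OF A(2,3) s1 s2 k] by blast
  obtain h c where h: "h \<in> carrier_mat N N" "det h \<noteq> 0" "c \<noteq> 0" "h\<^sup>T * Q\<^sub>2 * h = c \<cdot>\<^sub>m Q\<^sub>1"
  proof -
    have n: "N = 2 * (n - 1) + 2" using assms(2) by (simp add: N_def)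
    have sp: "splits_planes (n - 1) N Q\<^sub>1" "splits_planes (n - 1) N Q\<^sub>2"
      unfolding N_def using quasisplit_splits_planes assms(4-7) by blast+
    show ?thesis using similar_if_same_disc[OF A(2,3)[unfolded n] sp[unfolded n] s] that unfolding n[symmetric] by blast
  qed
  obtain h' where h': "h' \<in> carrier_mat N N" "h * h' = 1\<^sub>m N" "h' * h = 1\<^sub>m N"
    using obtain_inverse_mat[OF h(1,2)] by blast
  let ?\<phi> = "\<lambda>A. bc h * A * bc h'"
  have "conjugate_in N (Ortho N (bc Q\<^sub>2)) (?\<phi> (bc \<gamma>\<^sub>1)) (bc \<gamma>\<^sub>2)"
    by (rule conj_stably_conjugate[OF A(2,3) h(1) h' h(4) k A(6,7) s2])
  moreover have "SO_iso_over_base N Q\<^sub>1 Q\<^sub>2 ?\<phi>"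
    unfolding SO_iso_over_base_def
  proof (rule SO_iso_by_similitude)
    show "to_ac c \<noteq> (0 :: 'f alg_closure)" using h(3) by simp
    show "bc h * bc h' = 1\<^sub>m N" "bc h' * bc h = 1\<^sub>m N"
      unfolding bc_mult[OF h(1) h'(1), symmetric] bc_mult[OF h'(1) h(1), symmetric] h'(2,3) by (rule bc_one)+
    have hT: "h\<^sup>T \<in> carrier_mat N N" "h\<^sup>T * Q\<^sub>2 \<in> carrier_mat N N" using h(1) q2(1) by auto
    have "(bc h)\<^sup>T * bc Q\<^sub>2 * bc h = bc (h\<^sup>T * Q\<^sub>2 * h)"
      unfolding bc_mult[OF hT(2) h(1)] bc_mult[OF hT(1) q2(1)] by (simp add: map_mat_transpose)
    also have "\<dots> = to_ac c \<cdot>\<^sub>m bc Q\<^sub>1" unfolding h(4) by (rule eq_matI) (simp_all add: ac.hom_mult)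
    finally show "(bc h)\<^sup>T * bc Q\<^sub>2 * bc h = to_ac c \<cdot>\<^sub>m bc Q\<^sub>1" .
    show "(0 :: 'f alg_closure) \<in> base_field" by (rule range_eqI[of _ _ 0]) simp
  qed (use h(1) h'(1) q1(1) q2(1) in auto)
  moreover have "quadratic_character (disc_pm n Q\<^sub>1) = quadratic_character (disc_pm n Q\<^sub>2)"
  proof -
    have "disc_pm n Q\<^sub>1 = disc_pm n Q\<^sub>2 * (s / det Q\<^sub>2)\<^sup>2"
      unfolding disc_pm_def power_divide s[symmetric] using q2(2) by (simp add: power2_eq_square)
    moreover have "s / det Q\<^sub>2 \<noteq> 0" using s q1(2) q2(2) by auto
    ultimately show ?thesis using quadratic_character_mult_square by metis
  qed
  ultimately show ?thesis
    unfolding N_def by (auto simp: is_endo_datum_of_def equivalent_endo_data_def)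
qed

end
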